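(* Let $E$ be a graph and let $L_{\mathbb{C}}(E)$ be the associated Leavitt path algebra with coefficients in $\mathbb{C}$. For $a\in L_{\mathbb{C}}(E)$ define $$\|a\|_0:=\sup\{\|\pi(a)\|:\pi\text{ is a non-degenerate }*\text{-representation of }L_{\mathbb{C}}(E)\text{ into }\mathcal{B}(H)\}.$$ Then $\|\cdot\|_0$ is a norm on $L_{\mathbb{C}}(E)$, and $C^*(E)=\overline{L_{\mathbb{C}}(E)}^{\,0}$, where $\overline{L_{\mathbb{C}}(E)}^{\,0}$ denotes the completion of $L_{\mathbb{C}}(E)$ with respect to $\|\cdot\|_0$.
   Context: A graph $E=(E^0,E^1,r,s)$ is a directed graph with countable vertex set $E^0$, countable edge set $E^1$, and range and source maps $r,s:E^1\to E^0$. A vertex $v$ is regular ($v\in E^0_{\mathrm{reg}}$) if $0<|s^{-1}(v)|<\infty$. Paths are sequences $\alpha=e_1\cdots e_n$ with $r(e_i)=s(e_{i+1})$, together with vertices as paths of length $0$; $E^*$ is the set of finite paths; $\alpha^*:=e_n^*\cdots e_1^*$, $v^*:=v$. $L_{\mathbb{C}}(E)$ is the universal $\mathbb{C}$-algebra generated by pairwise orthogonal idempotents $\{v:v\in E^0\}$ and elements $\{e,e^*:e\in E^1\}$ satisfying (1) $s(e)e=er(e)=e$; (2) $r(e)e^*=e^*s(e)=e^*$; (3) $e^*f=\delta_{e,f}r(e)$ for all $e,f\in E^1$; (4) $v=\sum_{s(e)=v}ee^*$ for all $v\in E^0_{\mathrm{reg}}$. It is a $*$-algebra under the conjugate-linear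 involution $\left(\sum_k\lambda_k\alpha_k\beta_k^*\right)^*=\sum_k\overline{\lambda_k}\beta_k\alpha_k^*$. $\mathcal{B}(H)$ denotes the bounded operators on a Hilbert space $H$, and the supremum is over all Hilbert spaces and all such representations. A Cuntz-Krieger $E$-family is a collection of mutually orthogonal projections $\{p_v:v\in E^0\}$ and partial isometries with mutually orthogonal ranges $\{s_e:e\in E^1\}$ in a $C^*$-algebra with $s_e^*s_e=p_{r(e)}$ and $s_es_e^*\le p_{s(e)}$ for all $e\in E^1$, and $p_v=\sum_{s(e)=v}s_es_e^*$ for all $v\in E^0_{\mathrm{reg}}$. The graph $C^*$-algebra $C^*(E)$ is the $C^*$-algebra generated by a universal Cuntz-Krieger $E$-family $\{s_e,p_v\}$: for every Cuntz-Krieger $E$-family $\{t_e,q_v\}$ in a $C^*$-algebra $A$ there is a $*$-homomorphism $C^*(E)\to A$ with $s_e\mapsto t_e$, $p_v\mapsto q_v$. The equality $C^*(E)=\overline{L_{\mathbb{C}}(E)}^{\,0}$ identifies $v,e,e^*$ with $p_v,s_e,s_e^*$. *)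

theory Defs
  imports
    "HOL-Analysis.Analysis"
    "HOL-Library.Poly_Mapping"
    "HOL-Algebra.Module"
    "Graph_Theory.Digraph"
begin

section \<open>Complex \<open>*\<close>-algebras\<close>

text \<open>
  All structures are carrier-based records, because Leavitt path algebras depend on a graph (a term)
  and because the norm below is a supremum over Hilbert spaces.  Algebras need not be unital: the
  field \<^const>\<open>one\<close> inherited from the record \<open>module\<close> plays no role and is never constrained.
\<close>

definition complex_ring :: "complex ring" where
  "complex_ring = \<lparr>carrier = UNIV, monoid.mult = (*), one = 1, ring.zero = 0, add = (+)\<rparr>"

record 'a star_algebra = "(complex, 'a) module" +
  star :: "'a \<Rightarrow> 'a"

record 'a normed_star_algebra = "'a star_algebra" +
  nrm :: "'a \<Rightarrow> real"

locale star_algebra = Module.module complex_ring A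
  for A :: "('a, 'm) star_algebra_scheme" (structure) +
  assumes mult_closed: "\<lbrakk>x \<in> carrier A; y \<in> carrier A\<rbrakk> \<Longrightarrow> x \<otimes> y \<in> carrier A"
    and mult_assoc: "\<lbrakk>x \<in> carrier A; y \<in> carrier A; z \<in> carrier A\<rbrakk>
      \<Longrightarrow> (x \<otimes> y) \<otimes> z = x \<otimes> (y \<otimes> z)"
    and mult_distrib_right: "\<lbrakk>x \<in> carrier A; y \<in> carrier A; z \<in> carrier A\<rbrakk>
      \<Longrightarrow> (x \<oplus> y) \<otimes> z = x \<otimes> z \<oplus> y \<otimes> z"
    and mult_distrib_left: "\<lbrakk>x \<in> carrier A; y \<in> carrier A; z \<in> carrier A\<rbrakk>
      \<Longrightarrow> x \<otimes> (y \<oplus> z) = x \<otimes> y \<oplus> x \<otimes> z"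
    and smult_mult_left: "\<lbrakk>x \<in> carrier A; y \<in> carrier A\<rbrakk> \<Longrightarrow> (c \<odot> x) \<otimes> y = c \<odot> (x \<otimes> y)"
    and smult_mult_right: "\<lbrakk>x \<in> carrier A; y \<in> carrier A\<rbrakk> \<Longrightarrow> x \<otimes> (c \<odot> y) = c \<odot> (x \<otimes> y)"
    and star_closed: "x \<in> carrier A \<Longrightarrow> star A x \<in> carrier A"
    and star_star: "x \<in> carrier A \<Longrightarrow> star A (star A x) = x"
    and star_add: "\<lbrakk>x \<in> carrier A; y \<in> carrier A\<rbrakk> \<Longrightarrow> star A (x \<oplus> y) = star A x \<oplus> star A y"
    and star_smult: "x \<in> carrier A \<Longrightarrow> star A (c \<odot> x) = cnj c \<odot> star A x"
    and star_mult: "\<lbrakk>x \<in> carrier A; y \<in> carrier A\<rbrakk> \<Longrightarrow> star A (x \<otimes> y) = star A y \<otimes> star A x"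

definition star_hom ::
  "('a, 'm) star_algebra_scheme \<Rightarrow> ('b, 'n) star_algebra_scheme \<Rightarrow> ('a \<Rightarrow> 'b) \<Rightarrow> bool" where
  "star_hom A B \<phi> \<longleftrightarrow>
     (\<forall>x\<in>carrier A. \<phi> x \<in> carrier B) \<and>
     (\<forall>x\<in>carrier A. \<forall>y\<in>carrier A. \<phi> (x \<oplus>\<^bsub>A\<^esub> y) = \<phi> x \<oplus>\<^bsub>B\<^esub> \<phi> y) \<and>
     (\<forall>c. \<forall>x\<in>carrier A. \<phi> (c \<odot>\<^bsub>A\<^esub> x) = c \<odot>\<^bsub>B\<^esub> \<phi> x) \<and>
     (\<forall>x\<in>carrier A. \<forall>y\<in>carrier A. \<phi> (x \<otimes>\<^bsub>A\<^esub> y) = \<phi> x \<otimes>\<^bsub>B\<^esub> \<phi> y) \<and>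
     (\<forall>x\<in>carrier A. \<phi> (star A x) = star B (\<phi> x))"


section \<open>Norms\<close>

definition norm_on :: "(complex, 'a, 'm) module_scheme \<Rightarrow> ('a \<Rightarrow> real) \<Rightarrow> bool" where
  "norm_on X N \<longleftrightarrow>
     (\<forall>x\<in>carrier X. 0 \<le> N x) \<and>
     (\<forall>x\<in>carrier X. N x = 0 \<longleftrightarrow> x = \<zero>\<^bsub>X\<^esub>) \<and>
     (\<forall>c. \<forall>x\<in>carrier X. N (c \<odot>\<^bsub>X\<^esub> x) = cmod c * N x) \<and>
     (\<forall>x\<in>carrier X. \<forall>y\<in>carrier X. N (x \<oplus>\<^bsub>X\<^esub> y) \<le> N x + N y)"

text \<open>
  The locale \<^locale>\<open>Metric_space\<close> demands nonnegativity and symmetry of the distance also outside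
  of the carrier, hence the case distinction.
\<close>

definition norm_dist :: "(complex, 'a, 'm) module_scheme \<Rightarrow> ('a \<Rightarrow> real) \<Rightarrow> 'a \<Rightarrow> 'a \<Rightarrow> real" where
  "norm_dist X N x y = (if x \<in> carrier X \<and> y \<in> carrier X then N (x \<ominus>\<^bsub>X\<^esub> y) else 0)"

abbreviation norm_topology :: "(complex, 'a, 'm) module_scheme \<Rightarrow> ('a \<Rightarrow> real) \<Rightarrow> 'a topology" where
  "norm_topology X N \<equiv> Metric_space.mtopology (carrier X) (norm_dist X N)"

abbreviation norm_Cauchy :: "(complex, 'a, 'm) module_scheme \<Rightarrow> ('a \<Rightarrow> real) \<Rightarrow> (nat \<Rightarrow> 'a) \<Rightarrow> bool" where
  "norm_Cauchy X N \<equiv> Metric_space.MCauchy (carrier X) (norm_dist X N)"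

abbreviation norm_complete :: "(complex, 'a, 'm) module_scheme \<Rightarrow> ('a \<Rightarrow> real) \<Rightarrow> bool" where
  "norm_complete X N \<equiv> Metric_space.mcomplete (carrier X) (norm_dist X N)"


section \<open>C*-algebras\<close>

locale cstar_algebra = star_algebra A
  for A :: "('a, 'm) normed_star_algebra_scheme" (structure) +
  assumes norm: "norm_on A (nrm A)"
    and norm_mult: "\<lbrakk>x \<in> carrier A; y \<in> carrier A\<rbrakk> \<Longrightarrow> nrm A (x \<otimes> y) \<le> nrm A x * nrm A y"
    and cstar_identity: "x \<in> carrier A \<Longrightarrow> nrm A (star A x \<otimes> x) = (nrm A x)\<^sup>2"
    and complete: "norm_complete A (nrm A)"

text \<open>The order of a C*-algebra; only used between self-adjoint elements.\<close>

definition cstar_le :: "('a, 'm) star_algebra_scheme \<Rightarrow> 'a \<Rightarrow> 'a \<Rightarrow> bool" where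
  "cstar_le A x y \<longleftrightarrow> (\<exists>z\<in>carrier A. y \<ominus>\<^bsub>A\<^esub> x = star A z \<otimes>\<^bsub>A\<^esub> z)"

definition projection :: "('a, 'm) star_algebra_scheme \<Rightarrow> 'a \<Rightarrow> bool" where
  "projection A p \<longleftrightarrow> p \<in> carrier A \<and> p \<otimes>\<^bsub>A\<^esub> p = p \<and> star A p = p"

definition partial_isometry :: "('a, 'm) star_algebra_scheme \<Rightarrow> 'a \<Rightarrow> bool" where
  "partial_isometry A s \<longleftrightarrow> s \<in> carrier A \<and> s \<otimes>\<^bsub>A\<^esub> star A s \<otimes>\<^bsub>A\<^esub> s = s"

definition star_subalgebra :: "'a set \<Rightarrow> ('a, 'm) star_algebra_scheme \<Rightarrow> bool" where
  "star_subalgebra B A \<longleftrightarrow> submodule B complex_ring A \<and>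
     (\<forall>x\<in>B. \<forall>y\<in>B. x \<otimes>\<^bsub>A\<^esub> y \<in> B) \<and> (\<forall>x\<in>B. star A x \<in> B)"

definition cstar_generated_by :: "('a, 'm) normed_star_algebra_scheme \<Rightarrow> 'a set \<Rightarrow> bool" where
  "cstar_generated_by A S \<longleftrightarrow> S \<subseteq> carrier A \<and>
     (\<forall>B. star_subalgebra B A \<and> closedin (norm_topology A (nrm A)) B \<and> S \<subseteq> B \<longrightarrow> B = carrier A)"


section \<open>Graph C*-algebras\<close>

text \<open>
  A graph is a \<^typ>\<open>('v, 'e) pre_digraph\<close> that satisfies \<^locale>\<open>wf_digraph\<close>; the source and the
  range of an edge are its \<^const>\<open>tail\<close> and \<^const>\<open>head\<close>.
\<close>

definition emitted :: "('v, 'e) pre_digraph \<Rightarrow> 'v \<Rightarrow> 'e set" where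
  "emitted E v = {e \<in> arcs E. tail E e = v}"

definition regular_vertices :: "('v, 'e) pre_digraph \<Rightarrow> 'v set" where
  "regular_vertices E = {v \<in> verts E. emitted E v \<noteq> {} \<and> finite (emitted E v)}"

definition cuntz_krieger_family ::
  "('v, 'e) pre_digraph \<Rightarrow> ('a, 'm) star_algebra_scheme \<Rightarrow> ('v \<Rightarrow> 'a) \<Rightarrow> ('e \<Rightarrow> 'a) \<Rightarrow> bool" where
  "cuntz_krieger_family E A p s \<longleftrightarrow>
     (\<forall>v\<in>verts E. projection A (p v)) \<and>
     (\<forall>v\<in>verts E. \<forall>w\<in>verts E. v \<noteq> w \<longrightarrow> p v \<otimes>\<^bsub>A\<^esub> p w = \<zero>\<^bsub>A\<^esub>) \<and>
     (\<forall>e\<in>arcs E. partial_isometry A (s e)) \<and>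
     (\<forall>e\<in>arcs E. \<forall>f\<in>arcs E. e \<noteq> f \<longrightarrow>
        (s e \<otimes>\<^bsub>A\<^esub> star A (s e)) \<otimes>\<^bsub>A\<^esub> (s f \<otimes>\<^bsub>A\<^esub> star A (s f)) = \<zero>\<^bsub>A\<^esub>) \<and>
     (\<forall>e\<in>arcs E. star A (s e) \<otimes>\<^bsub>A\<^esub> s e = p (head E e)) \<and>
     (\<forall>e\<in>arcs E. cstar_le A (s e \<otimes>\<^bsub>A\<^esub> star A (s e)) (p (tail E e))) \<and>
     (\<forall>v\<in>regular_vertices E. p v = (\<Oplus>\<^bsub>A\<^esub>e\<in>emitted E v. s e \<otimes>\<^bsub>A\<^esub> star A (s e)))"

text \<open>
  \<open>graph_cstar_algebra TYPE('b) E C p s\<close> says that \<open>C\<close> is the graph C*-algebra of \<open>E\<close>, with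
  universal Cuntz-Krieger family \<open>p, s\<close>.  The universal property ranges over the C*-algebras with
  elements in the type \<open>'b\<close>, as HOL cannot quantify over types inside a definition; \<open>'b\<close> should be
  kept as a type variable to obtain the universal property for all C*-algebras.
\<close>

definition graph_cstar_algebra :: "'b itself \<Rightarrow> ('v, 'e) pre_digraph \<Rightarrow>
    'a normed_star_algebra \<Rightarrow> ('v \<Rightarrow> 'a) \<Rightarrow> ('e \<Rightarrow> 'a) \<Rightarrow> bool" where
  "graph_cstar_algebra _ E C p s \<longleftrightarrow>
     cstar_algebra C \<and>
     cuntz_krieger_family E C p s \<and>
     cstar_generated_by C (p ` verts E \<union> s ` arcs E) \<and>
     (\<forall>(A :: 'b normed_star_algebra) q t.
        cstar_algebra A \<and> cuntz_krieger_family E A q t \<longrightarrow>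
        (\<exists>\<phi>. star_hom C A \<phi> \<and> (\<forall>v\<in>verts E. \<phi> (p v) = q v) \<and> (\<forall>e\<in>arcs E. \<phi> (s e) = t e)))"


section \<open>Leavitt path algebras\<close>

text \<open>
  \<open>L(E)\<close> is the quotient of the free non-unital complex algebra on symbols \<open>v, e, e*\<close> by the
  two-sided ideal generated by the defining relations.  The free unital algebra on a set of letters
  is the monoid algebra of the words, \<open>'g free_word \<Rightarrow>\<^sub>0 complex\<close>; its elements without a
  component at the empty word form the free non-unital algebra.
\<close>

datatype ('v, 'e) lpa_gen = Vertex 'v | Edge 'e | Ghost 'e

datatype 'g free_word = Free_Word (letters: "'g list")

instantiation free_word :: (type) monoid_add
begin

definition zero_free_word :: "'a free_word" where
  "0 = Free_Word []"

definition plus_free_word :: "'a free_word \<Rightarrow> 'a free_word \<Rightarrow> 'a free_word" where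
  "v + w = Free_Word (letters v @ letters w)"

instance
  by standard (simp_all add: zero_free_word_def plus_free_word_def)

end

type_synonym ('v, 'e) lpa_free = "('v, 'e) lpa_gen free_word \<Rightarrow>\<^sub>0 complex"

fun gen_in :: "('v, 'e) pre_digraph \<Rightarrow> ('v, 'e) lpa_gen \<Rightarrow> bool" where
  "gen_in E (Vertex v) \<longleftrightarrow> v \<in> verts E"
| "gen_in E (Edge e) \<longleftrightarrow> e \<in> arcs E"
| "gen_in E (Ghost e) \<longleftrightarrow> e \<in> arcs E"

definition free_carrier :: "('v, 'e) pre_digraph \<Rightarrow> ('v, 'e) lpa_free set" where
  "free_carrier E = {x. \<forall>w\<in>Poly_Mapping.keys x. w \<noteq> 0 \<and> (\<forall>g\<in>set (letters w). gen_in E g)}"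

definition free_gen :: "('v, 'e) lpa_gen \<Rightarrow> ('v, 'e) lpa_free" where
  "free_gen g = Poly_Mapping.single (Free_Word [g]) 1"

definition free_smult :: "complex \<Rightarrow> ('v, 'e) lpa_free \<Rightarrow> ('v, 'e) lpa_free" where
  "free_smult c x = Poly_Mapping.map (\<lambda>a. c * a) x"

fun gen_star :: "('v, 'e) lpa_gen \<Rightarrow> ('v, 'e) lpa_gen" where
  "gen_star (Vertex v) = Vertex v"
| "gen_star (Edge e) = Ghost e"
| "gen_star (Ghost e) = Edge e"

definition word_star :: "('v, 'e) lpa_gen free_word \<Rightarrow> ('v, 'e) lpa_gen free_word" where
  "word_star w = Free_Word (rev (map gen_star (letters w)))"

definition free_star :: "('v, 'e) lpa_free \<Rightarrow> ('v, 'e) lpa_free" where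
  "free_star x = (\<Sum>w\<in>Poly_Mapping.keys x.
     Poly_Mapping.single (word_star w) (cnj (Poly_Mapping.lookup x w)))"

text \<open>An element \<open>x\<close> of \<open>lpa_rels E\<close> stands for the relation \<open>x = 0\<close>.\<close>

inductive_set lpa_rels :: "('v, 'e) pre_digraph \<Rightarrow> ('v, 'e) lpa_free set"
  for E :: "('v, 'e) pre_digraph" where
  idem: "v \<in> verts E \<Longrightarrow>
    free_gen (Vertex v) * free_gen (Vertex v) - free_gen (Vertex v) \<in> lpa_rels E"
| orth: "\<lbrakk>v \<in> verts E; w \<in> verts E; v \<noteq> w\<rbrakk> \<Longrightarrow>
    free_gen (Vertex v) * free_gen (Vertex w) \<in> lpa_rels E"
| source_edge: "e \<in> arcs E \<Longrightarrow>
    free_gen (Vertex (tail E e)) * free_gen (Edge e) - free_gen (Edge e) \<in> lpa_rels E"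
| edge_range: "e \<in> arcs E \<Longrightarrow>
    free_gen (Edge e) * free_gen (Vertex (head E e)) - free_gen (Edge e) \<in> lpa_rels E"
| range_ghost: "e \<in> arcs E \<Longrightarrow>
    free_gen (Vertex (head E e)) * free_gen (Ghost e) - free_gen (Ghost e) \<in> lpa_rels E"
| ghost_source: "e \<in> arcs E \<Longrightarrow>
    free_gen (Ghost e) * free_gen (Vertex (tail E e)) - free_gen (Ghost e) \<in> lpa_rels E"
| ghost_edge_same: "e \<in> arcs E \<Longrightarrow>
    free_gen (Ghost e) * free_gen (Edge e) - free_gen (Vertex (head E e)) \<in> lpa_rels E"
| ghost_edge_diff: "\<lbrakk>e \<in> arcs E; f \<in> arcs E; e \<noteq> f\<rbrakk> \<Longrightarrow>
    free_gen (Ghost e) * free_gen (Edge f) \<in> lpa_rels E"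
| regular: "v \<in> regular_vertices E \<Longrightarrow>
    free_gen (Vertex v) - (\<Sum>e\<in>emitted E v. free_gen (Edge e) * free_gen (Ghost e)) \<in> lpa_rels E"

inductive_set lpa_ideal :: "('v, 'e) pre_digraph \<Rightarrow> ('v, 'e) lpa_free set"
  for E :: "('v, 'e) pre_digraph" where
  zero: "0 \<in> lpa_ideal E"
| rel: "x \<in> lpa_rels E \<Longrightarrow> x \<in> lpa_ideal E"
| add: "\<lbrakk>x \<in> lpa_ideal E; y \<in> lpa_ideal E\<rbrakk> \<Longrightarrow> x + y \<in> lpa_ideal E"
| scale: "x \<in> lpa_ideal E \<Longrightarrow> free_smult c x \<in> lpa_ideal E"
| mult_left: "\<lbrakk>x \<in> lpa_ideal E; y \<in> free_carrier E\<rbrakk> \<Longrightarrow> y * x \<in> lpa_ideal E"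
| mult_right: "\<lbrakk>x \<in> lpa_ideal E; y \<in> free_carrier E\<rbrakk> \<Longrightarrow> x * y \<in> lpa_ideal E"

definition lpa_class :: "('v, 'e) pre_digraph \<Rightarrow> ('v, 'e) lpa_free \<Rightarrow> ('v, 'e) lpa_free set" where
  "lpa_class E x = {y \<in> free_carrier E. y - x \<in> lpa_ideal E}"

text \<open>
  Each union below is over representatives, all of which give the same coset.
\<close>

definition leavitt_path_algebra :: "('v, 'e) pre_digraph \<Rightarrow> ('v, 'e) lpa_free set star_algebra" where
  "leavitt_path_algebra E = \<lparr>
     carrier = lpa_class E ` free_carrier E,
     monoid.mult = (\<lambda>X Y. \<Union>x\<in>X. \<Union>y\<in>Y. lpa_class E (x * y)),
     one = undefined,
     ring.zero = lpa_class E 0,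
     add = (\<lambda>X Y. \<Union>x\<in>X. \<Union>y\<in>Y. lpa_class E (x + y)),
     smult = (\<lambda>c X. \<Union>x\<in>X. lpa_class E (free_smult c x)),
     star = (\<lambda>X. \<Union>x\<in>X. lpa_class E (free_star x))\<rparr>"

definition lpa_vertex :: "('v, 'e) pre_digraph \<Rightarrow> 'v \<Rightarrow> ('v, 'e) lpa_free set" where
  "lpa_vertex E v = lpa_class E (free_gen (Vertex v))"

definition lpa_edge :: "('v, 'e) pre_digraph \<Rightarrow> 'e \<Rightarrow> ('v, 'e) lpa_free set" where
  "lpa_edge E e = lpa_class E (free_gen (Edge e))"


section \<open>Hilbert spaces and bounded operators\<close>

record 'h hilbert_space = "(complex, 'h) module" +
  cinner :: "'h \<Rightarrow> 'h \<Rightarrow> complex"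

definition hnorm :: "('h, 'm) hilbert_space_scheme \<Rightarrow> 'h \<Rightarrow> real" where
  "hnorm H x = sqrt (Re (cinner H x x))"

locale hilbert_space = Module.module complex_ring H
  for H :: "('h, 'm) hilbert_space_scheme" (structure) +
  assumes cinner_add: "\<lbrakk>x \<in> carrier H; y \<in> carrier H; z \<in> carrier H\<rbrakk>
      \<Longrightarrow> cinner H (x \<oplus> y) z = cinner H x z + cinner H y z"
    and cinner_smult: "\<lbrakk>x \<in> carrier H; y \<in> carrier H\<rbrakk> \<Longrightarrow> cinner H (c \<odot> x) y = c * cinner H x y"
    and cinner_commute: "\<lbrakk>x \<in> carrier H; y \<in> carrier H\<rbrakk> \<Longrightarrow> cinner H y x = cnj (cinner H x y)"
    and cinner_nonneg: "x \<in> carrier H \<Longrightarrow> 0 \<le> Re (cinner H x x)"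
    and cinner_definite: "\<lbrakk>x \<in> carrier H; cinner H x x = 0\<rbrakk> \<Longrightarrow> x = \<zero>"
    and hilbert_complete: "norm_complete H (hnorm H)"

definition bounded_operators :: "('h, 'm) hilbert_space_scheme \<Rightarrow> ('h \<Rightarrow> 'h) set" where
  "bounded_operators H = {T \<in> carrier H \<rightarrow>\<^sub>E carrier H.
     (\<forall>x\<in>carrier H. \<forall>y\<in>carrier H. T (x \<oplus>\<^bsub>H\<^esub> y) = T x \<oplus>\<^bsub>H\<^esub> T y) \<and>
     (\<forall>c. \<forall>x\<in>carrier H. T (c \<odot>\<^bsub>H\<^esub> x) = c \<odot>\<^bsub>H\<^esub> T x) \<and>
     (\<exists>K. \<forall>x\<in>carrier H. hnorm H (T x) \<le> K * hnorm H x)}"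

text \<open>The C*-algebra \<open>B(H)\<close>.\<close>

definition bounded_ops :: "('h, 'm) hilbert_space_scheme \<Rightarrow> ('h \<Rightarrow> 'h) normed_star_algebra" where
  "bounded_ops H = \<lparr>
     carrier = bounded_operators H,
     monoid.mult = compose (carrier H),
     one = (\<lambda>x\<in>carrier H. x),
     ring.zero = (\<lambda>x\<in>carrier H. \<zero>\<^bsub>H\<^esub>),
     add = (\<lambda>S T. \<lambda>x\<in>carrier H. S x \<oplus>\<^bsub>H\<^esub> T x),
     smult = (\<lambda>c T. \<lambda>x\<in>carrier H. c \<odot>\<^bsub>H\<^esub> T x),
     star = (\<lambda>T. THE S. S \<in> bounded_operators H \<and>
       (\<forall>x\<in>carrier H. \<forall>y\<in>carrier H. cinner H (T x) y = cinner H x (S y))),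
     nrm = (\<lambda>T. Sup {hnorm H (T x) | x. x \<in> carrier H \<and> hnorm H x \<le> 1})\<rparr>"

text \<open>
  Non-degeneracy: the closed linear span of \<open>{\<pi>(a)\<xi>}\<close> is the whole Hilbert space.
\<close>

definition nondegenerate_rep ::
  "('a, 'm) star_algebra_scheme \<Rightarrow> ('h, 'n) hilbert_space_scheme \<Rightarrow> ('a \<Rightarrow> 'h \<Rightarrow> 'h) \<Rightarrow> bool" where
  "nondegenerate_rep A H \<pi> \<longleftrightarrow>
     hilbert_space H \<and>
     star_hom A (bounded_ops H) \<pi> \<and>
     (\<forall>K. submodule K complex_ring H \<and> closedin (norm_topology H (hnorm H)) K \<and>
        (\<forall>a\<in>carrier A. \<forall>x\<in>carrier H. \<pi> a x \<in> K) \<longrightarrow> K = carrier H)"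


section \<open>The norm and the completion\<close>

text \<open>The numbers \<open>\<parallel>\<pi>(a)\<parallel>\<close> for representations on Hilbert spaces whose elements lie in the type \<open>'h\<close>.\<close>

definition rep_norms :: "'h itself \<Rightarrow> ('v, 'e) pre_digraph \<Rightarrow> ('v, 'e) lpa_free set \<Rightarrow> real set" where
  "rep_norms _ E a = {nrm (bounded_ops H) (\<pi> a) | (H :: 'h hilbert_space) \<pi>.
     nondegenerate_rep (leavitt_path_algebra E) H \<pi>}"

text \<open>
  A supremum over the proper class of all Hilbert spaces is not a HOL term, so it is taken over the
  Hilbert spaces with elements in \<^typ>\<open>nat \<Rightarrow> complex\<close>: these comprise, up to isomorphism, all
  Hilbert spaces with at most continuum many elements.  To identify the value with
  the supremum over all Hilbert spaces, one has to bound \<open>rep_norms TYPE('h) E a\<close> by it for an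
  arbitrary type \<open>'h\<close>.
\<close>

definition leavitt_norm :: "('v, 'e) pre_digraph \<Rightarrow> ('v, 'e) lpa_free set \<Rightarrow> real" where
  "leavitt_norm E a = Sup (rep_norms TYPE(nat \<Rightarrow> complex) E a)"

definition normed_leavitt_path_algebra ::
  "('v, 'e) pre_digraph \<Rightarrow> ('v, 'e) lpa_free set normed_star_algebra" where
  "normed_leavitt_path_algebra E =
     star_algebra.extend (leavitt_path_algebra E) (normed_star_algebra.fields (leavitt_norm E))"

text \<open>
  The completion consists of the Cauchy sequences modulo sequences at distance tending to \<open>0\<close>.
\<close>

definition completion_class ::
  "'a normed_star_algebra \<Rightarrow> (nat \<Rightarrow> 'a) \<Rightarrow> (nat \<Rightarrow> 'a) set" where
  "completion_class A x =
     {y. norm_Cauchy A (nrm A) y \<and> (\<lambda>n. norm_dist A (nrm A) (x n) (y n)) \<longlonglongrightarrow> 0}"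

definition norm_completion :: "'a normed_star_algebra \<Rightarrow> (nat \<Rightarrow> 'a) set normed_star_algebra" where
  "norm_completion A = \<lparr>
     carrier = completion_class A ` Collect (norm_Cauchy A (nrm A)),
     monoid.mult = (\<lambda>X Y. \<Union>x\<in>X. \<Union>y\<in>Y. completion_class A (\<lambda>n. x n \<otimes>\<^bsub>A\<^esub> y n)),
     one = undefined,
     ring.zero = completion_class A (\<lambda>n. \<zero>\<^bsub>A\<^esub>),
     add = (\<lambda>X Y. \<Union>x\<in>X. \<Union>y\<in>Y. completion_class A (\<lambda>n. x n \<oplus>\<^bsub>A\<^esub> y n)),
     smult = (\<lambda>c X. \<Union>x\<in>X. completion_class A (\<lambda>n. c \<odot>\<^bsub>A\<^esub> x n)),
     star = (\<lambda>X. \<Union>x\<in>X. completion_class A (\<lambda>n. star A (x n))),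
     nrm = (\<lambda>X. THE l. \<forall>x\<in>X. (\<lambda>n. nrm A (x n)) \<longlonglongrightarrow> l)\<rparr>"

definition completion_embed :: "'a normed_star_algebra \<Rightarrow> 'a \<Rightarrow> (nat \<Rightarrow> 'a) set" where
  "completion_embed A a = completion_class A (\<lambda>n. a)"

end

theory Submission
  imports Defs
begin

text \<open>
  A C*-seminorm on a \<open>*\<close>-algebra is attained at each element by a vector state: minus a sum of squares
  is never a nonzero positive element (the elementary part of Fukamiya's theorem), so Hahn--Banach
  provides states.  Conversely, a positive form on \<open>L(E)\<close> gives a bounded representation, since every
  generator acts as a partial isometry, and GNS realises it on a Hilbert space of sequences because
  \<open>L(E)\<close> has countable dimension over the complex numbers.  Hence every Hilbert space, and likewise every
  Cuntz-Krieger family, induces a seminorm below the one in the theorem; this is the universal property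
  of the completion.  The seminorm is definite because \<open>L(E)\<close> acts faithfully on a branching
  system over \<open>E\<close> whose points carry an integer degree: multiplying an element of the kernel by edges
  from the right removes its ghost edges, and combinations of paths without ghost edges are determined by
  the points to which they move a given point.
\<close>

section \<open>Positivity in C*-seminormed algebras\<close>

text \<open>The norm is a supremum over concrete Hilbert spaces, while the universal property speaks
  of abstract C*-algebras. States are the bridge, and they require that \<open>st b * b\<close> is
  positive. The classical proof uses spectra in a complete unital algebra. Here positivity is the
  norm condition \<open>pos\<close>, and square roots and comparisons of spectra are replaced by
  polynomial estimates, so that a seminorm on a unital ring suffices. This generality is used: a
  C*-algebra on a carrier set may lack a unit, and the seminorm then lives on a free unital algebra
  acting on it. Scalars enter as central elements \<open>sc c\<close>. L(E) has no unit in general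
  either. Finite sums of vertices are local units, and the basic estimate is
  \<open>N a <= ln a * N u\<close> for \<open>u\<close> with \<open>a * u\<close> equal to
  \<open>a\<close> modulo the relations; the vectors of such \<open>u\<close> stand in for a cyclic
  vector. The same inequality removes the dependence on the element type of the Hilbert space,
  because it passes from a vector of any representation to a space of sequences.\<close>

locale cstar_seminorm =
  fixes sc :: "complex \<Rightarrow> 'r::ring_1" and st :: "'r \<Rightarrow> 'r" and p :: "'r \<Rightarrow> real"
  assumes sc_add: "sc (c + d) = sc c + sc d"
    and sc_mult: "sc (c * d) = sc c * sc d"
    and sc_1 [simp]: "sc 1 = 1"
    and sc_comm: "x * sc c = sc c * x"
    and st_add: "st (x + y) = st x + st y"
    and st_mult: "st (x * y) = st y * st x"
    and st_st [simp]: "st (st x) = x"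
    and st_sc [simp]: "st (sc c) = sc (cnj c)"
    and p_triangle: "p (x + y) \<le> p x + p y"
    and p_mult: "p (x * y) \<le> p x * p y"
    and p_sc: "p (sc c * x) = cmod c * p x"
    and p_cstar: "p (st x * x) = (p x)\<^sup>2"
    and p_1 [simp]: "p 1 = 1"
begin

definition rs :: "real \<Rightarrow> 'r" where "rs t = sc (complex_of_real t)"

lemma sc_0 [simp]: "sc 0 = 0"
  using sc_add[of 0 0] by simp

lemma sc_minus: "sc (- c) = - sc c"
  using sc_add[of c "- c"] by (simp add: eq_neg_iff_add_eq_0 add.commute)

lemma rs_0 [simp]: "rs 0 = 0"
  by (simp add: rs_def)

lemma rs_1 [simp]: "rs 1 = 1"
  by (simp add: rs_def)

lemma rs_add: "rs (a + b) = rs a + rs b"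
  by (simp add: rs_def sc_add)

lemma rs_mult: "rs (a * b) = rs a * rs b"
  by (simp add: rs_def sc_mult)

lemma rs_comm: "x * rs t = rs t * x"
  by (simp add: rs_def sc_comm)

lemma rs_half_add: "rs (1/2) * x + rs (1/2) * x = x"
proof -
  have "rs (1/2) + rs (1/2) = 1"
    by (metis rs_1 field_sum_of_halves rs_add)
  then show ?thesis
    by (metis distrib_right mult_1)
qed

lemma sc_left_comm: "x * (sc c * y) = sc c * (x * y)"
  using sc_comm[of "x" c] by (simp flip: mult.assoc)

lemma rs_left_comm: "x * (rs t * y) = rs t * (x * y)"
  by (simp add: rs_def sc_left_comm)

lemma rs_mult_rs_mult: "rs s * x * (rs t * y) = rs (s * t) * (x * y)"
  by (metis mult.assoc rs_left_comm rs_mult)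

lemma st_rs [simp]: "st (rs t) = rs t"
  by (simp add: rs_def)

lemma st_0 [simp]: "st 0 = 0"
  using st_add[of 0 0] by simp

lemma st_1 [simp]: "st 1 = 1"
  using st_sc[of 1] by simp

lemma st_minus: "st (- x) = - st x"
  using st_add[of x "- x"] by (simp add: eq_neg_iff_add_eq_0 add.commute)

lemma st_diff: "st (x - y) = st x - st y"
  using st_add[of x "- y"] by (simp add: st_minus)

lemma st_power: "st (x ^ n) = st x ^ n"
  by (induction n) (auto simp: st_mult power_commutes)

lemmas st_simps = st_add st_mult st_minus st_diff st_power

lemma p_0 [simp]: "p 0 = 0"
  using p_sc[of 0 0] by simp

lemma p_minus [simp]: "p (- x) = p x"
  using p_sc[of "- 1" x] by (simp add: sc_minus)

lemma p_nonneg [simp]: "0 \<le> p x"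
  using p_triangle[of x "- x"] by simp

lemma p_diff: "p (x - y) \<le> p x + p y"
  using p_triangle[of x "- y"] by simp

lemma p_rs_mult: "p (rs t * x) = \<bar>t\<bar> * p x"
  by (simp add: rs_def p_sc)

lemma p_rs: "p (rs t) = \<bar>t\<bar>"
  using p_rs_mult[of t 1] by simp

lemma p_st [simp]: "p (st x) = p x"
proof -
  have le: "p x \<le> p (st x)" for x
  proof (cases "p x = 0")
    case False
    have "(p x)\<^sup>2 \<le> p (st x) * p x"
      using p_cstar[of x] p_mult[of "st x" x] by simp
    with False show ?thesis
      by (simp add: power2_eq_square less_le)
  qed simp
  from le[of x] le[of "st x"] show ?thesis by simp
qed

lemma p_self_adjoint_square: "st h = h \<Longrightarrow> p (h * h) = (p h)\<^sup>2"
  using p_cstar[of h] by simp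

lemma p_power_two_power: "st h = h \<Longrightarrow> p (h ^ (2 ^ n)) = p h ^ (2 ^ n)"
proof (induction n)
  case (Suc n)
  have "h ^ (2 ^ Suc n) = h ^ (2 ^ n) * h ^ (2 ^ n)"
    by (simp add: mult_2 power_add)
  then show ?case
    using p_self_adjoint_square[of "h ^ (2 ^ n)"] Suc
    by (simp add: st_power power2_eq_square mult_2 power_add)
qed simp

lemma p_real_part: "p (c + st c) \<le> 2 * p c"
  using p_triangle[of c "st c"] by simp

text \<open>The element \<open>c = x + i y\<close> is normal with
  \<open>st c * c = x * x + y * y\<close>, and \<open>x\<close> is its real part, so
  \<open>p x <= p c\<close>. This stands in for monotonicity of the norm between commuting
  squares.\<close>

lemma p_le_add_imaginary:
  assumes "st x = x" "st y = y" "x * y = y * x"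
  shows "(p x)\<^sup>2 \<le> p (x * x + y * y)"
proof -
  define c where "c = x + sc \<i> * y"
  have ii: "sc \<i> * (sc \<i> * z) = - z" for z
    by (metis complex_i_mult_minus mult.assoc mult_minus1 sc_1 sc_minus sc_mult mult.right_neutral)
  have stc: "st c = x - sc \<i> * y"
    using assms by (simp add: c_def st_simps sc_minus sc_comm rs_comm)
  have "st c * c = x * x + y * y"
    unfolding stc unfolding c_def using assms(3)
    by (simp add: algebra_simps sc_left_comm[of x] sc_left_comm[of y] ii)
  then have *: "(p c)\<^sup>2 = p (x * x + y * y)"
    using p_cstar[of c] by simp
  have "c + st c = x + x"
    unfolding stc unfolding c_def by simp
  then have "p (x + x) \<le> 2 * p c"
    using p_real_part[of c] by simp
  moreover have "x + x = rs 2 * x"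
    using rs_add[of 1 1] by (simp add: mult_2)
  ultimately have "p x \<le> p c"
    by (simp add: p_rs_mult)
  then show ?thesis
    using * by (metis p_nonneg power_mono)
qed

text \<open>In a C*-algebra a self-adjoint \<open>w\<close> is positive iff some scalar
  \<open>s >= 0\<close> has distance at most \<open>s\<close> from \<open>w\<close>, that is, the
  spectrum lies in \<open>[0, 2 s]\<close>. The slack \<open>\<epsilon>\<close> makes the cone
  closed under \<open>p\<close>-limits without completeness.\<close>

definition pos :: "'r \<Rightarrow> bool" where
  "pos w \<longleftrightarrow> st w = w \<and> (\<forall>\<epsilon>>0. \<exists>s\<ge>0. p (rs s - w) \<le> s + \<epsilon>)"

lemma pos_sa: "pos w \<Longrightarrow> st w = w"
  by (simp add: pos_def)

text \<open>Passing from \<open>s\<close> to a larger number adds at most the difference to the left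
  side of the estimate and exactly the difference to the right side.\<close>

lemma pos_large:
  assumes "pos w" "0 < \<epsilon>"
  obtains s where "s \<ge> M" "s \<ge> 0" "p (rs s - w) \<le> s + \<epsilon>"
proof -
  obtain s where s: "s \<ge> 0" "p (rs s - w) \<le> s + \<epsilon>"
    using assms unfolding pos_def by blast
  define m where "m = max s M"
  have "rs m - w = rs (m - s) + (rs s - w)"
    using rs_add[of "m - s" s] by simp
  then have "p (rs m - w) \<le> \<bar>m - s\<bar> + p (rs s - w)"
    using p_triangle p_rs by metis
  then show ?thesis
    using s that[of m] by (auto simp: m_def)
qed

lemma pos_0: "pos 0"
  unfolding pos_def by (auto intro!: exI[of _ 0])

lemma pos_rs: "0 \<le> t \<Longrightarrow> pos (rs t)"
  unfolding pos_def by (auto intro!: exI[of _ t])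

lemma pos_add:
  assumes "pos v" "pos w" shows "pos (v + w)"
  unfolding pos_def
proof (intro conjI allI impI)
  show "st (v + w) = v + w"
    using assms by (simp add: st_add pos_sa)
  fix \<epsilon> :: real assume "0 < \<epsilon>"
  then obtain s t where *: "s \<ge> 0" "p (rs s - v) \<le> s + \<epsilon>/2" "t \<ge> 0" "p (rs t - w) \<le> t + \<epsilon>/2"
    using assms unfolding pos_def by (meson half_gt_zero)
  have "rs (s + t) - (v + w) = (rs s - v) + (rs t - w)"
    by (simp add: rs_add)
  then have "p (rs (s + t) - (v + w)) \<le> p (rs s - v) + p (rs t - w)"
    using p_triangle by metis
  also have "\<dots> \<le> (s + t) + \<epsilon>"
    using * by linarith
  finally have "p (rs (s + t) - (v + w)) \<le> (s + t) + \<epsilon>" .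
  then show "\<exists>s\<ge>0. p (rs s - (v + w)) \<le> s + \<epsilon>"
    using * by (intro exI[of _ "s + t"]) simp
qed

lemma pos_scale:
  assumes "pos w" "0 \<le> t" shows "pos (rs t * w)"
proof (cases "t = 0")
  case False
  then have t: "t > 0" using assms by simp
  show ?thesis
    unfolding pos_def
  proof (intro conjI allI impI)
    show "st (rs t * w) = rs t * w"
      using assms by (simp add: st_mult pos_sa sc_comm rs_comm)
    fix \<epsilon> :: real assume "0 < \<epsilon>"
    then obtain s where *: "s \<ge> 0" "p (rs s - w) \<le> s + \<epsilon>/t"
      using assms t unfolding pos_def by (meson divide_pos_pos)
    have "rs (t * s) - rs t * w = rs t * (rs s - w)"
      by (simp add: rs_mult right_diff_distrib)
    then have "p (rs (t * s) - rs t * w) \<le> t * (s + \<epsilon>/t)"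
      using * t by (simp add: p_rs_mult mult_left_mono)
    also have "\<dots> = t * s + \<epsilon>"
      using t by (simp add: field_simps)
    finally show "\<exists>s\<ge>0. p (rs s - rs t * w) \<le> s + \<epsilon>"
      using * t by (intro exI[of _ "t * s"]) simp
  qed
qed (simp add: pos_0)

lemma pos_scale_cancel:
  assumes "pos (rs t * w)" "0 < t" shows "pos w"
proof -
  have "rs (1/t) * (rs t * w) = w"
    using assms(2) by (simp flip: mult.assoc rs_mult)
  then show ?thesis
    using pos_scale[OF assms(1), of "1/t"] assms(2) by simp
qed

lemma pos_limit:
  assumes "st w = w" "\<And>\<epsilon>. 0 < \<epsilon> \<Longrightarrow> \<exists>v. pos v \<and> p (w - v) \<le> \<epsilon>"
  shows "pos w"
  unfolding pos_def
proof (intro conjI allI impI)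
  fix \<epsilon> :: real assume "0 < \<epsilon>"
  then obtain v where v: "pos v" "p (w - v) \<le> \<epsilon>/2"
    using assms(2)[of "\<epsilon>/2"] by auto
  then obtain s where s: "s \<ge> 0" "p (rs s - v) \<le> s + \<epsilon>/2"
    using \<open>0 < \<epsilon>\<close> unfolding pos_def by (meson half_gt_zero)
  have "p (rs s - w) \<le> p (rs s - v) + p (w - v)"
    using p_diff[of "rs s - v" "w - v"] by simp
  then show "\<exists>s\<ge>0. p (rs s - w) \<le> s + \<epsilon>"
    using s v by (intro exI[of _ s]) auto
qed (use assms in simp)

lemma pos_limit_rs:
  assumes "\<And>\<epsilon>. 0 < \<epsilon> \<Longrightarrow> pos (rs \<epsilon> + w)" shows "pos w"
proof (rule pos_limit)
  show "st w = w"
    using assms[of 1] pos_sa[of "rs 1 + w"] by (simp add: st_add)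
  fix \<epsilon> :: real assume "0 < \<epsilon>"
  then show "\<exists>v. pos v \<and> p (w - v) \<le> \<epsilon>"
    using assms[of \<epsilon>] p_rs[of \<epsilon>] by (intro exI[of _ "rs \<epsilon> + w"]) simp
qed

lemma pos_norm_diff:
  assumes "st h = h" "p h \<le> t" shows "pos (rs t - h)"
  unfolding pos_def
proof (intro conjI allI impI)
  show "st (rs t - h) = rs t - h" using assms by (simp add: st_diff)
  fix \<epsilon> :: real assume "0 < \<epsilon>"
  have "0 \<le> t" using assms p_nonneg[of h] by linarith
  then show "\<exists>s\<ge>0. p (rs s - (rs t - h)) \<le> s + \<epsilon>"
    using assms \<open>0 < \<epsilon>\<close> by (intro exI[of _ t]) simp
qed

lemma pos_norm_add:
  assumes "st h = h" "p h \<le> t" shows "pos (rs t + h)"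
  using pos_norm_diff[of "- h" t] assms by (simp add: st_minus)

text \<open>The square root of \<open>1 - k\<close> is \<open>1 - r\<close>, where \<open>r\<close> is the limit of the iteration \<open>r \<mapsto> (k + r\<^sup>2) / 2\<close>;
  the same iteration of scalars, with \<open>1\<close> in place of \<open>k\<close>, dominates the increments.\<close>

lemma approx_sqrt_one_minus:
  assumes "st k = k" "p k \<le> 1" "0 < \<delta>"
  obtains q where "st q = q" "\<And>z. z * k = k * z \<Longrightarrow> z * q = q * z" "p ((1 - k) - q * q) \<le> \<delta>"
proof -
  define r where "r = rec_nat 0 (\<lambda>_ x. rs (1/2) * (k + x * x))"
  have r_Suc: "r (Suc n) = rs (1/2) * (k + r n * r n)" and r_0 [simp]: "r 0 = 0" for n
    by (simp_all add: r_def)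
  define \<rho> :: "nat \<Rightarrow> real" where "\<rho> = rec_nat 0 (\<lambda>_ x. (1 + x * x) / 2)"
  have \<rho>_Suc: "\<rho> (Suc n) = (1 + \<rho> n * \<rho> n) / 2" and \<rho>_0 [simp]: "\<rho> 0 = 0" for n
    by (simp_all add: \<rho>_def)
  have \<rho>: "0 \<le> \<rho> n \<and> \<rho> n \<le> 1" for n
    by (induction n) (auto simp: \<rho>_Suc mult_le_one intro: order_trans)
  have comm: "z * r n = r n * z" if "z * k = k * z" for z n
  proof (induction n)
    case (Suc n)
    have "z * (r n * r n) = r n * r n * z"
      by (metis Suc mult.assoc)
    then show ?case
      using that by (simp add: r_Suc sc_left_comm rs_left_comm distrib_left distrib_right mult.assoc)
  qed simp
  have comm2: "r m * r n = r n * r m" for m n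
    using comm comm[of k] by metis
  have sa: "st (r n) = r n" for n
    by (induction n) (auto simp: r_Suc st_simps sc_comm rs_comm assms)
  have pr: "p (r n) \<le> \<rho> n" for n
  proof (induction n)
    case (Suc n)
    have "p (r n * r n) \<le> \<rho> n * \<rho> n"
      using p_mult[of "r n" "r n"] mult_mono[OF Suc Suc] \<rho>[of n] by simp
    then have "p (k + r n * r n) \<le> 1 + \<rho> n * \<rho> n"
      using p_triangle[of k "r n * r n"] assms(2) by linarith
    then show ?case
      by (simp add: r_Suc \<rho>_Suc p_rs_mult)
  qed simp
  have sq: "p (r (Suc n) * r (Suc n) - r n * r n) \<le> 2 * (\<rho> (Suc n) - \<rho> n)"
    if "p (r (Suc n) - r n) \<le> \<rho> (Suc n) - \<rho> n" for n
  proof -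
    have "r (Suc n) * r (Suc n) - r n * r n = (r (Suc n) - r n) * (r (Suc n) + r n)"
      using comm2[of n "Suc n"] by (simp add: algebra_simps)
    then have "p (r (Suc n) * r (Suc n) - r n * r n) \<le> p (r (Suc n) - r n) * p (r (Suc n) + r n)"
      using p_mult by metis
    also have "\<dots> \<le> (\<rho> (Suc n) - \<rho> n) * (\<rho> (Suc n) + \<rho> n)"
      using that p_triangle[of "r (Suc n)" "r n"] pr[of n] pr[of "Suc n"] p_nonneg[of "r (Suc n) - r n"]
      by (intro mult_mono) (linarith | simp)+
    also have "\<dots> \<le> (\<rho> (Suc n) - \<rho> n) * 2"
      using that p_nonneg[of "r (Suc n) - r n"] \<rho>[of n] \<rho>[of "Suc n"]
      by (intro mult_left_mono) linarith+
    finally show ?thesis by simp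
  qed
  have pd: "p (r (Suc n) - r n) \<le> \<rho> (Suc n) - \<rho> n" for n
  proof (induction n)
    case 0
    then show ?case using assms(2) by (simp add: r_Suc \<rho>_Suc p_rs_mult)
  next
    case (Suc n)
    have "r (Suc n) * r (Suc n) - r n * r n = (r (Suc n) - r n) * (r (Suc n) + r n)"
      using comm2[of n "Suc n"] by (simp add: algebra_simps)
    then have "p (r (Suc n) * r (Suc n) - r n * r n) \<le> p (r (Suc n) - r n) * p (r (Suc n) + r n)"
      using p_mult by metis
    also have "\<dots> \<le> (\<rho> (Suc n) - \<rho> n) * (\<rho> (Suc n) + \<rho> n)"
      using Suc p_triangle[of "r (Suc n)" "r n"] pr[of n] pr[of "Suc n"] p_nonneg[of "r (Suc n) - r n"]
      by (intro mult_mono) (linarith | simp)+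
    finally have "p (r (Suc n) * r (Suc n) - r n * r n) \<le> \<rho> (Suc n) * \<rho> (Suc n) - \<rho> n * \<rho> n"
      by (simp add: algebra_simps)
    moreover have "r (Suc (Suc n)) - r (Suc n) = rs (1/2) * (r (Suc n) * r (Suc n) - r n * r n)"
      unfolding r_Suc[of "Suc n"] r_Suc[of n] by (simp add: algebra_simps)
    moreover have "\<rho> (Suc (Suc n)) - \<rho> (Suc n) = (\<rho> (Suc n) * \<rho> (Suc n) - \<rho> n * \<rho> n) / 2"
      unfolding \<rho>_Suc[of "Suc n"] \<rho>_Suc[of n] by (simp add: field_simps)
    ultimately show ?case by (simp add: p_rs_mult)
  qed
  \<comment> \<open>Only one small increment is used: \<open>\<rho>\<close> is monotone and bounded
    by \<open>1\<close>, so its increments tend to \<open>0\<close>. No limit of the iterates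
    \<open>r n\<close> is formed.\<close>
  have "incseq \<rho>"
    using pd p_nonneg by (intro incseq_SucI) (smt (verit) )
  then obtain L where "\<rho> \<longlonglongrightarrow> L"
    using \<rho> incseq_convergent[of \<rho> 1] by blast
  then have "(\<lambda>n. \<rho> (Suc n) - \<rho> n) \<longlonglongrightarrow> L - L"
    using LIMSEQ_Suc tendsto_diff by blast
  then have "\<forall>\<^sub>F n in sequentially. \<rho> (Suc n) - \<rho> n < \<delta>/2"
    using assms(3) by (intro order_tendstoD(2)) auto
  then obtain n where n: "\<rho> (Suc n) - \<rho> n < \<delta>/2"
    by (auto simp: eventually_sequentially)
  define q where "q = 1 - r (Suc n)"
  \<comment> \<open>As \<open>2 r_(n+1) = k + r_n^2\<close>, the error of
    \<open>q = 1 - r_(n+1)\<close> as a root of \<open>1 - k\<close> is, up to sign, exactly the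
    increment \<open>r_(n+1)^2 - r_n^2\<close>.\<close>
  have "r (Suc n) + r (Suc n) = k + r n * r n"
    unfolding r_Suc by (rule rs_half_add)
  then have "k = r (Suc n) + r (Suc n) - r n * r n"
    by (simp add: algebra_simps)
  then have "(1 - k) - q * q = - (r (Suc n) * r (Suc n) - r n * r n)"
    unfolding q_def by (simp add: algebra_simps)
  then have "p ((1 - k) - q * q) \<le> 2 * (\<rho> (Suc n) - \<rho> n)"
    using sq[OF pd[of n]] by (simp only: p_minus)
  also have "\<dots> \<le> \<delta>"
    using n by simp
  finally have "p ((1 - k) - q * q) \<le> \<delta>" .
  moreover have "z * q = q * z" if "z * k = k * z" for z
    using comm[OF that, of "Suc n"] by (simp add: q_def algebra_simps)
  moreover have "st q = q"
    by (simp add: q_def st_diff sa)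
  ultimately show ?thesis using that by blast
qed

text \<open>With \<open>t = s + \<epsilon>/2\<close> and \<open>k = (s - w) / t\<close> one has
  \<open>p k <= 1\<close> and \<open>t (1 - k) = w + \<epsilon>/2\<close>, so the approximate root
  of \<open>1 - k\<close>, scaled by \<open>sqrt t\<close>, serves. The commutation clause records
  that \<open>q\<close> is a polynomial in \<open>w\<close>.\<close>

lemma pos_approx_sqrt:
  assumes "pos w" "0 < \<epsilon>"
  obtains q where "st q = q" "\<And>z. z * w = w * z \<Longrightarrow> z * q = q * z" "p (w - q * q) \<le> \<epsilon>"
proof -
  obtain s where s: "s \<ge> 0" "p (rs s - w) \<le> s + \<epsilon>/2"
    using assms unfolding pos_def by (meson half_gt_zero)
  define t where "t = s + \<epsilon>/2"
  have t: "t > 0" using s assms by (simp add: t_def)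
  define k where "k = rs (1/t) * (rs s - w)"
  have tk: "rs t * k = rs s - w"
    using t unfolding k_def by (simp flip: mult.assoc rs_mult)
  have "st k = k"
    using pos_sa[OF assms(1)] by (simp add: k_def st_simps sc_comm rs_comm)
  moreover have "p k \<le> 1"
    unfolding k_def p_rs_mult using s t by (simp add: t_def field_simps)
  ultimately obtain q where q: "st q = q" "\<And>z. z * k = k * z \<Longrightarrow> z * q = q * z"
      "p ((1 - k) - q * q) \<le> \<epsilon>/2/t"
    using approx_sqrt_one_minus[of k "\<epsilon>/2/t"] assms t by (metis divide_pos_pos half_gt_zero)
  define q' where "q' = rs (sqrt t) * q"
  have "q' * q' = rs t * (q * q)"
    using t by (simp add: q'_def rs_mult_rs_mult)
  then have "w - q' * q' = rs t * ((1 - k) - q * q) - rs (\<epsilon>/2)"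
    using tk rs_add[of s "\<epsilon>/2"] by (simp add: right_diff_distrib t_def algebra_simps)
  then have "p (w - q' * q') \<le> p (rs t * ((1 - k) - q * q)) + \<epsilon>/2"
    using p_diff[of "rs t * ((1 - k) - q * q)" "rs (\<epsilon>/2)"] p_rs[of "\<epsilon>/2"] assms by simp
  also have "\<dots> \<le> \<epsilon>"
    unfolding p_rs_mult using q(3) t by (simp add: field_simps)
  finally have "p (w - q' * q') \<le> \<epsilon>" .
  moreover have "z * q' = q' * z" if "z * w = w * z" for z
  proof -
    have "z * (rs s - w) = (rs s - w) * z"
      using that by (simp add: right_diff_distrib left_diff_distrib rs_comm[of z])
    then have "z * k = k * z"
      by (simp only: k_def rs_left_comm[of z] mult.assoc)
    then show ?thesis
      using q(2)[of z] by (simp add: q'_def rs_left_comm[of z] mult.assoc)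
  qed
  moreover have "st q' = q'"
    by (simp add: q'_def st_mult q(1) rs_comm[of q])
  ultimately show ?thesis using that by blast
qed

text \<open>\<open>s - u\<^sup>2\<close> is the real part of \<open>c = s - u\<^sup>2 + i \<surd>(2s) u\<close>, and \<open>c\<^sup>* c = s\<^sup>2 + u\<^sup>4\<close>.\<close>

lemma pos_square:
  assumes "st u = u" shows "pos (u * u)"
  unfolding pos_def
proof (intro conjI allI impI)
  show "st (u * u) = u * u" using assms by (simp add: st_mult)
  fix \<epsilon> :: real assume "0 < \<epsilon>"
  define M where "M = p (u * u * (u * u))"
  \<comment> \<open>Chosen so that \<open>M <= 2 * \<epsilon> * s\<close>; then
    \<open>s * s + M\<close> stays below \<open>(s + \<epsilon>)^2\<close>.\<close>
  define s where "s = M / (2 * \<epsilon>) + 1"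
  have "M \<ge> 0" by (simp add: M_def)
  then have s: "s > 0" "M \<le> 2 * \<epsilon> * s"
    using \<open>0 < \<epsilon>\<close> by (simp_all add: s_def field_simps add_pos_nonneg)
  define b where "b = sqrt (2 * s)"
  define v where "v = rs s - u * u"
  have "st v = v" "v * (rs b * u) = rs b * u * v"
    using assms by (simp_all add: v_def st_simps left_diff_distrib right_diff_distrib mult.assoc rs_left_comm[of u]
        rs_comm[of u] rs_left_comm[of "rs s" b])
  then have "(p v)\<^sup>2 \<le> p (v * v + rs b * u * (rs b * u))"
    using assms by (intro p_le_add_imaginary) (simp_all add: st_mult sc_comm rs_comm)
  also have "v * v + rs b * u * (rs b * u) = rs (s * s) + u * u * (u * u)"
  proof -
    have "rs b * u * (rs b * u) = rs (b * b) * (u * u)"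
      by (rule rs_mult_rs_mult)
    also have "b * b = s + s" using s by (simp add: b_def)
    also have "rs (s + s) * (u * u) = rs s * (u * u) + rs s * (u * u)"
      unfolding rs_add distrib_right ..
    finally have "rs b * u * (rs b * u) = rs s * (u * u) + rs s * (u * u)" .
    then show ?thesis
      by (simp add: v_def algebra_simps rs_comm[of u] rs_left_comm[of u] rs_mult)
  qed
  also have "p \<dots> \<le> s * s + M"
    using p_triangle[of "rs (s * s)" "u * u * (u * u)"] p_rs[of "s * s"] s by (simp add: M_def)
  also have "\<dots> \<le> (s + \<epsilon>)\<^sup>2"
  proof -
    have "(s + \<epsilon>)\<^sup>2 = s * s + 2 * \<epsilon> * s + \<epsilon> * \<epsilon>"
      by (simp add: power2_eq_square algebra_simps)
    then show ?thesis
      using s zero_le_square[of \<epsilon>] by linarith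
  qed
  finally have "(p v)\<^sup>2 \<le> (s + \<epsilon>)\<^sup>2" .
  then have "p v \<le> s + \<epsilon>"
    using s \<open>0 < \<epsilon>\<close> power2_le_imp_le by force
  then show "\<exists>s\<ge>0. p (rs s - u * u) \<le> s + \<epsilon>"
    using s by (intro exI[of _ s]) (simp add: v_def)
qed

text \<open>Commutation makes \<open>z * q\<close> self-adjoint for an approximate root
  \<open>q\<close> of \<open>w\<close>, so \<open>z * w * z\<close> is a limit of the squares of the
  elements \<open>z * q\<close>.\<close>

lemma pos_conj:
  assumes "pos w" "st z = z" "z * w = w * z" shows "pos (z * w * z)"
proof (rule pos_limit)
  show "st (z * w * z) = z * w * z"
    using assms(2) pos_sa[OF assms(1)] by (simp add: st_mult mult.assoc)
  fix \<epsilon> :: real assume "0 < \<epsilon>"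
  define \<delta> where "\<delta> = \<epsilon> / (p z * p z + 1)"
  have nz: "p z * p z + 1 > 0"
    by (intro add_nonneg_pos) auto
  then have "\<delta> > 0" using \<open>0 < \<epsilon>\<close> by (simp add: \<delta>_def)
  from pos_approx_sqrt[OF assms(1) this] obtain q
    where q: "st q = q" "z * w = w * z \<Longrightarrow> z * q = q * z" "p (w - q * q) \<le> \<delta>"
    by blast
  note zq = q(2)[OF assms(3)]
  have sq: "pos (z * q * (z * q))"
    using q(1) zq assms(2) by (intro pos_square) (simp add: st_mult)
  have "z * q * (z * q) = z * (q * q) * z"
    unfolding mult.assoc by (simp only: zq)
  then have "z * w * z - z * q * (z * q) = z * (w - q * q) * z"
    by (simp add: right_diff_distrib left_diff_distrib)
  then have "p (z * w * z - z * q * (z * q)) \<le> p z * p (w - q * q) * p z"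
    using p_mult[of "z * (w - q * q)" z] mult_right_mono[OF p_mult[of z "w - q * q"] p_nonneg[of z]]
    by simp
  also have "\<dots> \<le> (p z * p z + 1) * \<delta>"
    using q(3) \<open>\<delta> > 0\<close> mult_left_mono[OF q(3), of "p z * p z"] by (simp add: algebra_simps)
  also have "(p z * p z + 1) * \<delta> = \<epsilon>"
    using nz by (simp add: \<delta>_def)
  finally have "p (z * w * z - z * q * (z * q)) \<le> \<epsilon>" .
  with sq show "\<exists>v. pos v \<and> p (z * w * z - v) \<le> \<epsilon>"
    by (intro exI conjI)
qed

text \<open>With \<open>a = \<mu> - h\<close> and \<open>b = \<mu> + h\<close>, the positive element
  \<open>a b a + b a b\<close> equals \<open>2 \<mu> a b\<close>, so
  \<open>a b = \<mu>^2 - h^2\<close> is positive. An approximate root \<open>q\<close> of it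
  commutes with \<open>h\<close>, and \<open>h^2 + q^2\<close> is nearly \<open>\<mu>^2\<close>; now
  \<open>p_le_add_imaginary\<close> bounds \<open>p h\<close>.\<close>

lemma norm_le_of_pos:
  assumes "0 < \<mu>" "pos (rs \<mu> - h)" "pos (rs \<mu> + h)"
  shows "p h \<le> \<mu>"
proof -
  have sa: "st h = h"
    using pos_sa[OF assms(3)] by (simp add: st_add)
  define a where "a = rs \<mu> - h"
  define b where "b = rs \<mu> + h"
  have ab: "a * b = b * a"
    by (simp add: a_def b_def algebra_simps rs_comm[of h])
  have "st a = a" "st b = b" using assms pos_sa by (auto simp: a_def b_def)
  then have "pos (a * b * a + b * a * b)"
    using assms ab by (intro pos_add pos_conj) (auto simp: a_def b_def)
  also have "a * b * a + b * a * b = (a + b) * (a * b)"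
    by (metis ab distrib_right mult.assoc)
  also have "a + b = rs (2 * \<mu>)"
    using rs_add[of \<mu> \<mu>] by (simp add: a_def b_def)
  finally have "pos (a * b)"
    using assms(1) pos_scale_cancel[of "2 * \<mu>"] by simp
  have abe: "a * b = rs (\<mu> * \<mu>) - h * h"
    by (simp add: a_def b_def algebra_simps rs_comm[of h] rs_mult)
  have "(p h)\<^sup>2 \<le> \<mu> * \<mu> + \<epsilon>" if \<epsilon>: "0 < \<epsilon>" for \<epsilon>
  proof -
    from pos_approx_sqrt[OF \<open>pos (a * b)\<close> \<epsilon>] obtain q where q: "st q = q"
      "h * (a * b) = (a * b) * h \<Longrightarrow> h * q = q * h" "p (a * b - q * q) \<le> \<epsilon>"
      by blast
    have "h * q = q * h"
      by (rule q(2)) (simp add: abe algebra_simps rs_comm[of h])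
    then have "(p h)\<^sup>2 \<le> p (h * h + q * q)"
      using sa q by (intro p_le_add_imaginary)
    also have "h * h + q * q = rs (\<mu> * \<mu>) - (a * b - q * q)"
      by (simp add: abe)
    also have "p \<dots> \<le> \<mu> * \<mu> + \<epsilon>"
      using p_diff[of "rs (\<mu> * \<mu>)" "a * b - q * q"] p_rs[of "\<mu> * \<mu>"] q(3) by simp
    finally show ?thesis .
  qed
  then have "(p h)\<^sup>2 \<le> \<mu>\<^sup>2"
    unfolding power2_eq_square by (rule field_le_epsilon)
  then show ?thesis
    using assms(1) power2_le_imp_le by force
qed

end

text \<open>By Bernoulli's inequality \<open>(a / b) ^ (2 ^ Suc n)\<close> is at least the square of
  \<open>1 + 2 ^ n * x\<close>, where \<open>x = a / b - 1\<close>. If \<open>x > 0\<close>, this is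
  quadratic in \<open>2 ^ n\<close> and outgrows the linear bound.\<close>

lemma le_of_two_power_growth:
  fixes a b C :: real
  assumes "0 \<le> a" "0 < b" "0 \<le> C" "\<And>n. a ^ (2 ^ n) \<le> b ^ (2 ^ n) * (1 + C * 2 ^ n)"
  shows "a \<le> b"
proof (rule ccontr)
  assume "\<not> a \<le> b"
  then have r: "1 < a / b" using assms by simp
  define x where "x = a / b - 1"
  have x: "x > 0" using r by (simp add: x_def)
  obtain n where n: "C < x\<^sup>2 / 4 * 2 ^ n"
  proof -
    obtain n where "C / (x\<^sup>2 / 4) < 2 ^ n"
      using real_arch_pow[of 2 "C / (x\<^sup>2 / 4)"] by auto
    then show ?thesis using x that[of n] by (simp add: field_simps)
  qed
  have sq: "(a / b) ^ (2 ^ n) \<le> 1 + C * 2 ^ n" for n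
    using assms(2) assms(4)[of n] by (simp add: power_divide field_simps)
  have bern: "1 + real m * x \<le> (a / b) ^ m" for m
    using Bernoulli_inequality[of x m] x by (simp add: x_def)
  have "(1 + 2 ^ n * x) * (1 + 2 ^ n * x) \<le> (a / b) ^ (2 ^ n) * (a / b) ^ (2 ^ n)"
    using bern[of "2 ^ n"] x by (intro mult_mono) (auto intro: order_trans[rotated])
  also have "\<dots> = (a / b) ^ (2 ^ Suc n)"
    by (simp add: power_add mult_2)
  also have "\<dots> \<le> 1 + C * 2 ^ Suc n"
    by (rule sq)
  also have "C * 2 ^ Suc n \<le> x\<^sup>2 / 4 * 2 ^ n * 2 ^ Suc n"
    using n by (intro mult_right_mono) auto
  finally have "(1 + 2 ^ n * x) * (1 + 2 ^ n * x) \<le> 1 + x\<^sup>2 / 4 * 2 ^ n * 2 ^ Suc n"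
    by simp
  then have "2 * (2 ^ n * x) + (2 ^ n * x)\<^sup>2 \<le> (2 ^ n * x)\<^sup>2 / 2"
    by (simp add: algebra_simps power2_eq_square)
  moreover have "0 < 2 ^ n * x" using x by simp
  moreover have "0 \<le> (2 ^ n * x)\<^sup>2" by simp
  ultimately show False by linarith
qed

lemma mult_numeral_commute: "x * numeral k = numeral k * (x :: 'a::ring_1)"
  by (metis mult_of_nat_commute of_nat_numeral)

lemma mult_numeral_left_commute: "x * (numeral k * y) = numeral k * (x * (y :: 'a::ring_1))"
  by (metis mult.assoc mult_numeral_commute)

section \<open>Positivity of \<open>st b * b\<close> without spectral theory\<close>

context cstar_seminorm begin

text \<open>Replaces the fact that \<open>st c * c\<close> and \<open>c * st c\<close> have the same
  nonzero spectrum. A bound \<open>R\<close> for \<open>\<sigma> + st c * c\<close> bounds the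
  powers of \<open>\<sigma> + c * st c\<close> by \<open>R ^ N\<close> times a factor linear in
  \<open>N\<close>. For \<open>N = 2 ^ n\<close> the norm of a power of a self-adjoint element is
  the power of the norm, and the linear factor disappears on taking roots.\<close>

lemma pos_minus_swap:
  assumes "0 \<le> t" "pos (rs t - st c * c)"
  shows "pos (rs t - c * st c)"
  unfolding pos_def
proof (intro conjI allI impI)
  show "st (rs t - c * st c) = rs t - c * st c"
    by (simp add: st_simps)
  fix \<epsilon> :: real assume \<epsilon>: "0 < \<epsilon>"
  define x y where "x = st c * c" and "y = c * st c"
  \<comment> \<open>The margin \<open>1\<close> gives \<open>\<sigma> = s - t >= 1\<close> and hence
    \<open>R >= 1\<close>, which makes the powers of \<open>R\<close> increase.\<close>
  obtain s where s: "s \<ge> t + 1" "p (rs s - (rs t - x)) \<le> s + \<epsilon>"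
    using pos_large[OF assms(2) \<epsilon>, of "t + 1"] unfolding x_def by blast
  define \<sigma> where "\<sigma> = s - t"
  define R where "R = s + \<epsilon>"
  have \<sigma>: "\<sigma> \<ge> 1" "\<sigma> \<le> R" "R \<ge> 1" using s \<epsilon> assms(1) by (simp_all add: \<sigma>_def R_def)
  have "rs s = rs \<sigma> + rs t" using rs_add[of \<sigma> t] by (simp add: \<sigma>_def)
  then have px: "p (rs \<sigma> + x) \<le> R"
    using s(2) by (simp add: R_def add.commute)
  \<comment> \<open>As \<open>(\<sigma> + y) * c = c * (\<sigma> + x)\<close>, each new factor
    passes through \<open>c\<close>, and the middle element \<open>q\<close> is only multiplied by
    \<open>\<sigma> + x\<close>, whose seminorm is at most \<open>R\<close>.\<close>
  have "\<exists>q. (rs \<sigma> + y) ^ N = rs (\<sigma> ^ N) + c * q * st c \<and> p q \<le> real N * R ^ (N - 1)" for N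
  proof (induction N)
    case 0
    then show ?case by (auto intro: exI[of _ 0])
  next
    case (Suc N)
    then obtain q where q: "(rs \<sigma> + y) ^ N = rs (\<sigma> ^ N) + c * q * st c" "p q \<le> real N * R ^ (N - 1)"
      by blast
    define q' where "q' = rs (\<sigma> ^ N) + (rs \<sigma> + x) * q"
    have "(rs \<sigma> + y) ^ Suc N = (rs \<sigma> + y) * (rs (\<sigma> ^ N) + c * q * st c)"
      using q by simp
    also have "\<dots> = rs \<sigma> * rs (\<sigma> ^ N) + (y * rs (\<sigma> ^ N) + (rs \<sigma> + y) * c * q * st c)"
      by (simp add: distrib_left distrib_right mult.assoc)
    also have "(rs \<sigma> + y) * c = c * (rs \<sigma> + x)"
      by (simp add: x_def y_def distrib_left distrib_right mult.assoc rs_comm[of c])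
    also have "y * rs (\<sigma> ^ N) = c * rs (\<sigma> ^ N) * st c"
      by (simp add: y_def rs_comm[of c] rs_comm[of "st c"] mult.assoc rs_left_comm[of c])
    finally have 1: "(rs \<sigma> + y) ^ Suc N = rs (\<sigma> ^ Suc N) + c * q' * st c"
      unfolding q'_def by (simp add: rs_mult distrib_left distrib_right mult.assoc)
    have "p q' \<le> \<sigma> ^ N + p (rs \<sigma> + x) * p q"
      unfolding q'_def using p_triangle[of "rs (\<sigma> ^ N)" "(rs \<sigma> + x) * q"] p_mult[of "rs \<sigma> + x" q]
        p_rs[of "\<sigma> ^ N"] \<sigma> by simp
    also have "\<dots> \<le> R ^ N + R * (real N * R ^ (N - 1))"
      using \<sigma> px q(2) by (intro add_mono power_mono mult_mono) auto
    also have "\<dots> = real (Suc N) * R ^ N"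
      by (cases N) (auto simp: algebra_simps)
    finally show ?case using 1 by auto
  qed note expand = this
  define S where "S = p (rs \<sigma> + y)"
  define C where "C = p c * p c"
  have sa: "st (rs \<sigma> + y) = rs \<sigma> + y"
    by (simp add: y_def st_simps)
  have "S ^ (2 ^ n) \<le> R ^ (2 ^ n) * (1 + C * 2 ^ n)" for n
  proof -
    define N :: nat where "N = 2 ^ n"
    obtain q where q: "(rs \<sigma> + y) ^ N = rs (\<sigma> ^ N) + c * q * st c" "p q \<le> real N * R ^ (N - 1)"
      using expand by blast
    have "S ^ N = p ((rs \<sigma> + y) ^ N)"
      using p_power_two_power[OF sa] by (simp add: S_def N_def)
    also have "\<dots> \<le> \<sigma> ^ N + p c * p q * p c"
      using q(1) p_triangle[of "rs (\<sigma> ^ N)" "c * q * st c"] p_mult[of "c * q" "st c"]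
        mult_right_mono[OF p_mult[of c q] p_nonneg[of c]] p_rs[of "\<sigma> ^ N"] \<sigma> by simp
    also have "p c * p q * p c = C * p q"
      by (simp add: C_def)
    also have "\<sigma> ^ N + C * p q \<le> R ^ N + C * (real N * R ^ N)"
    proof (intro add_mono power_mono mult_left_mono)
      have "R ^ (N - 1) \<le> R ^ N" using \<sigma> by (intro power_increasing) auto
      then show "p q \<le> real N * R ^ N"
        using q(2) by (meson mult_left_mono of_nat_0_le_iff order_trans)
    qed (use \<sigma> in \<open>auto simp: C_def\<close>)
    finally show ?thesis
      by (simp add: N_def algebra_simps)
  qed
  then have "S \<le> R"
    using \<sigma> by (intro le_of_two_power_growth[of S R C]) (auto simp: S_def C_def)
  then have "p (rs s - (rs t - c * st c)) \<le> s + \<epsilon>"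
    using \<open>rs s = rs \<sigma> + rs t\<close> by (simp add: S_def R_def y_def add.commute)
  then show "\<exists>s\<ge>0. p (rs s - (rs t - c * st c)) \<le> s + \<epsilon>"
    using s assms(1) by (intro exI[of _ s]) simp
qed

text \<open>\<open>b\<^sup>* b + b b\<^sup>*\<close> is a sum of squares of self-adjoint elements.\<close>

lemma pos_one_plus_of_one_minus:
  assumes "pos (1 - st b * b)"
  shows "pos (1 + st b * b)"
proof -
  define u where "u = b + st b"
  define v where "v = sc \<i> * (b - st b)"
  have ii: "sc \<i> * (sc \<i> * z) = - z" for z
    by (metis complex_i_mult_minus mult.assoc mult_minus1 sc_1 sc_minus sc_mult mult.right_neutral)
  have "st u = u" "st v = v"
    by (simp_all add: u_def v_def st_simps sc_minus sc_comm[of "b - st b"] sc_comm[of "st b - b"])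
       (simp add: algebra_simps)
  then have "pos (u * u + v * v)"
    by (intro pos_add pos_square)
  moreover have "v * v = - ((b - st b) * (b - st b))"
    unfolding v_def by (metis ii mult.assoc sc_comm)
  then have "u * u + v * v = rs 2 * (st b * b + b * st b)"
    using rs_add[of 1 1] by (simp add: u_def algebra_simps mult_2)
  ultimately have "pos (st b * b + b * st b)"
    using pos_scale_cancel[of 2] by simp
  moreover have "pos (1 - b * st b)"
    using pos_minus_swap[of 1 b] assms by simp
  ultimately have "pos ((st b * b + b * st b) + (1 - b * st b))"
    by (rule pos_add)
  then show ?thesis by (simp add: add.commute)
qed

text \<open>Passing from \<open>b\<close> to \<open>c = b (3 - x) / 2\<close> with \<open>x = b\<^sup>* b\<close> keeps \<open>c\<^sup>* c \<le> 1\<close> but multiplies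
  a negative spectral value of \<open>x\<close> by more than \<open>9 / 4\<close>.  Iterating this improves the lower bound
  of the previous lemma to \<open>0\<close>.\<close>

lemma pos_star_mult_contraction:
  assumes "pos (1 - st b * b)"
  shows "pos (rs ((4/9) ^ n) + st b * b)"
  using assms
proof (induction n arbitrary: b)
  case 0
  then show ?case using pos_one_plus_of_one_minus by simp
next
  case (Suc n)
  define x where "x = st b * b"
  define w where "w = 1 - x"
  have sax: "st x = x" "st w = w" by (simp_all add: x_def w_def st_simps)
  have pw: "pos w" using Suc.prems by (simp add: w_def x_def)
  have xw: "x = 1 - w" by (simp add: w_def)
  have commute: "x * w = w * x" by (simp add: xw algebra_simps)
  have p3: "pos (w * w * w)" "pos (w * w)"
    using pos_conj[OF pw] pos_square sax by auto
  define c where "c = rs (1/2) * (b * (1 + 1 + w))"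
  have "st (1 + 1 + w) = 1 + 1 + w" unfolding st_add st_1 sax ..
  then have "st c = rs (1/2) * ((1 + 1 + w) * st b)"
    unfolding c_def st_mult st_rs by (simp only: rs_comm[of "(1 + 1 + w) * st b"])
  then have "st c * c = rs (1/2) * ((1 + 1 + w) * st b) * (rs (1/2) * (b * (1 + 1 + w)))"
    unfolding c_def by simp
  also have "\<dots> = rs (1/4) * ((1 + 1 + w) * x * (1 + 1 + w))"
    using rs_mult_rs_mult[of "1/2" "(1 + 1 + w) * st b" "1/2" "b * (1 + 1 + w)"]
    by (simp add: x_def mult.assoc)
  finally have cc: "st c * c = rs (1/4) * ((1 + 1 + w) * x * (1 + 1 + w))" .
  have fours: "rs 4 = 1 + 1 + 1 + 1"
    using rs_add[of 1 1] rs_add[of 2 1] rs_add[of 3 1] by (simp add: algebra_simps)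
  have four: "rs (1/4) * (1 + 1 + 1 + 1) = 1" "rs 4 * rs (1/4) = 1"
    unfolding fours[symmetric] by (simp_all flip: rs_mult)
  \<comment> \<open>With \<open>x = 1 - w\<close> this is the identity
    \<open>4 - (2 + w)^2 (1 - w) = w^3 + 3 w^2\<close>.\<close>
  have "1 - st c * c = rs (1/4) * (w * w * w + (w * w + w * w + w * w))"
  proof -
    have "(1 + 1 + w) * x * (1 + 1 + w) = (1 + 1 + 1 + 1) - (w * w * w + (w * w + w * w + w * w))"
      unfolding xw by (simp add: algebra_simps mult_2 mult_2_right)
    then have "st c * c = rs (1/4) * (1 + 1 + 1 + 1) - rs (1/4) * (w * w * w + (w * w + w * w + w * w))"
      unfolding cc by (simp only: right_diff_distrib)
    then show ?thesis unfolding four by simp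
  qed
  then have "pos (1 - st c * c)"
    using p3 by (auto intro!: pos_scale pos_add)
  from Suc.IH[OF this] have "pos (rs 4 * (rs ((4/9) ^ n) + st c * c))"
    by (intro pos_scale) auto
  \<comment> \<open>The origin of \<open>4/9\<close>: four times \<open>st c * c\<close> is
    \<open>x (3 - x)^2\<close>, and adding \<open>x (w + 5) x = x^2 (6 - x)\<close> gives exactly
    \<open>9 x\<close>.\<close>
  moreover have "pos (x * (w + rs 5) * x)"
    using pos_rs[of 5] pw sax commute
    by (intro pos_conj pos_add) (auto simp: distrib_left distrib_right rs_comm[of x])
  ultimately have "pos (rs 4 * (rs ((4/9) ^ n) + st c * c) + x * (w + rs 5) * x)"
    by (rule pos_add)
  moreover have "rs 4 * (st c * c) = (1 + 1 + w) * x * (1 + 1 + w)"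
    unfolding cc by (simp add: four flip: mult.assoc)
  moreover have "(1 + 1 + w) * x * (1 + 1 + w) + x * (w + rs 5) * x = rs 9 * x"
  proof -
    have five: "rs 5 = 1 + 1 + 1 + 1 + 1"
      using rs_add[of 1 1] rs_add[of 2 1] rs_add[of 3 1] rs_add[of 4 1] by (simp add: algebra_simps)
    have nine: "rs 9 = rs 5 + 1 + 1 + 1 + 1"
      using rs_add[of 5 1] rs_add[of 6 1] rs_add[of 7 1] rs_add[of 8 1] by (simp add: algebra_simps)
    show ?thesis
      unfolding nine five w_def by (simp add: algebra_simps mult_numeral_commute[of x] mult_numeral_left_commute[of x])
         (simp flip: distrib_right)
  qed
  ultimately have "pos (rs 4 * rs ((4/9) ^ n) + rs 9 * x)"
    by (simp add: distrib_left add.assoc)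
  also have "rs 4 * rs ((4/9) ^ n) = rs 9 * rs ((4/9) ^ Suc n)"
    by (simp flip: rs_mult)
  finally have "pos (rs 9 * (rs ((4/9) ^ Suc n) + x))"
    by (simp only: distrib_left)
  then show ?case
    using pos_scale_cancel[of 9] by (simp add: x_def)
qed

text \<open>After scaling to \<open>p c = 1\<close> the element \<open>1 - st c * c\<close> is
  positive by the norm bound, so the contraction lemma makes \<open>\<epsilon> + st c * c\<close>
  positive for every \<open>\<epsilon> > 0\<close>. If \<open>p b = 0\<close>, no scaling is
  possible, but then \<open>p (st b * b) = 0\<close> and the norm bound is enough.\<close>

theorem pos_star_mult: "pos (st b * b)"
proof (cases "p b = 0")
  case True
  then have "p (st b * b) = 0" by (simp add: p_cstar)
  then have "pos (rs \<epsilon> + st b * b)" if "0 < \<epsilon>" for \<epsilon>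
    using that by (intro pos_norm_add) (auto simp: st_mult)
  then show ?thesis by (rule pos_limit_rs)
next
  case False
  then have pb: "p b > 0" using p_nonneg[of b] by linarith
  define c where "c = rs (1 / p b) * b"
  have "st c * c = rs (1 / p b) * st b * (rs (1 / p b) * b)"
    by (simp add: c_def st_mult rs_comm[of "st b"])
  then have cc: "st c * c = rs (1 / (p b * p b)) * (st b * b)"
    by (simp add: rs_mult_rs_mult)
  have "p c = 1" using pb by (simp add: c_def p_rs_mult)
  then have "pos (1 - st c * c)"
    using pos_norm_diff[of "st c * c" 1] by (simp add: st_mult p_cstar)
  note * = pos_star_mult_contraction[OF this]
  have "pos (rs \<epsilon> + st c * c)" if \<epsilon>: "0 < \<epsilon>" for \<epsilon>
  proof -
    obtain n where n: "(4/9) ^ n < \<epsilon>"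
      using real_arch_pow_inv[OF \<epsilon>, of "4/9"] by auto
    then have "pos (rs (\<epsilon> - (4/9) ^ n) + (rs ((4/9) ^ n) + st c * c))"
      by (intro pos_add pos_rs *) simp
    then show ?thesis
      using rs_add[of "\<epsilon> - (4/9) ^ n" "(4/9) ^ n"] by (simp add: add.assoc)
  qed
  then have "pos (rs (1 / (p b * p b)) * (st b * b))"
    unfolding cc[symmetric] by (rule pos_limit_rs)
  then show ?thesis
    using pb by (elim pos_scale_cancel) simp
qed

end

section \<open>The Hahn--Banach theorem and states\<close>

text \<open>The scaling is a parameter because the real action used later is
  \<open>rs t * x\<close>, which is not a type-class instance.\<close>

locale real_scale = vector_space scale
  for scale :: "real \<Rightarrow> 'a::ab_group_add \<Rightarrow> 'a"
begin

definition sublinear :: "('a \<Rightarrow> real) \<Rightarrow> bool" where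
  "sublinear q \<longleftrightarrow> (\<forall>x y. q (x + y) \<le> q x + q y) \<and> (\<forall>t\<ge>0. \<forall>x. q (scale t x) = t * q x)"

lemma sublinear_add: "sublinear q \<Longrightarrow> q (x + y) \<le> q x + q y"
  by (simp add: sublinear_def)

lemma sublinear_scale: "sublinear q \<Longrightarrow> 0 \<le> t \<Longrightarrow> q (scale t x) = t * q x"
  by (simp add: sublinear_def)

lemma sublinear_zero: "sublinear q \<Longrightarrow> q 0 = 0"
  using sublinear_scale[of q 0 0] by simp

lemma sublinear_minus: "sublinear q \<Longrightarrow> - q (- x) \<le> q x"
  using sublinear_add[of q x "- x"] sublinear_zero[of q] by simp

text \<open>The infimal convolution of \<open>q\<close> with a ray along \<open>z\<close>. It is at
  most \<open>q\<close> (take \<open>t = 0\<close>), and at \<open>- z\<close> it is at most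
  \<open>- q z\<close> (take \<open>t = 1\<close>), so every linear functional below it takes the
  value \<open>q z\<close> at \<open>z\<close>.\<close>

definition shrink :: "('a \<Rightarrow> real) \<Rightarrow> 'a \<Rightarrow> 'a \<Rightarrow> real" where
  "shrink q z x = (INF t\<in>{0..}. q (x + scale t z) - t * q z)"

lemma shrink_bound:
  assumes "sublinear q" "0 \<le> t"
  shows "- q (- x) \<le> q (x + scale t z) - t * q z"
  using sublinear_add[OF assms(1), of "x + scale t z" "- x"] sublinear_scale[OF assms, of z] by simp

lemma shrink_le:
  assumes "sublinear q" "0 \<le> t"
  shows "shrink q z x \<le> q (x + scale t z) - t * q z"
  unfolding shrink_def
  by (rule cINF_lower) (use assms shrink_bound in \<open>auto intro!: bdd_belowI\<close>)

lemma shrink_greatest: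
  assumes "\<And>t. 0 \<le> t \<Longrightarrow> c \<le> q (x + scale t z) - t * q z"
  shows "c \<le> shrink q z x"
  unfolding shrink_def by (rule cINF_greatest) (use assms in auto)

lemma sublinear_shrink:
  assumes q: "sublinear q"
  shows "sublinear (shrink q z)"
  unfolding sublinear_def
proof (intro conjI allI impI)
  fix x y
  have "shrink q z (x + y) - (q (x + scale t z) - t * q z) \<le> shrink q z y" if t: "0 \<le> t" for t
  proof (rule shrink_greatest)
    fix s :: real assume s: "0 \<le> s"
    have "shrink q z (x + y) \<le> q (x + y + scale (t + s) z) - (t + s) * q z"
      using s t by (intro shrink_le q) simp
    also have "x + y + scale (t + s) z = (x + scale t z) + (y + scale s z)"
      by (simp add: scale_left_distrib)
    also have "q \<dots> \<le> q (x + scale t z) + q (y + scale s z)"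
      by (rule sublinear_add[OF q])
    finally show "shrink q z (x + y) - (q (x + scale t z) - t * q z) \<le> q (y + scale s z) - s * q z"
      by (simp add: algebra_simps)
  qed
  then have "shrink q z (x + y) - shrink q z y \<le> shrink q z x"
    by (intro shrink_greatest) (simp add: algebra_simps)
  then show "shrink q z (x + y) \<le> shrink q z x + shrink q z y" by simp
next
  have pos: "shrink q z (scale t x) \<le> t * shrink q z x" if t: "0 < t" for t x
  proof -
    have "shrink q z (scale t x) / t \<le> shrink q z x"
    proof (rule shrink_greatest)
      fix s :: real assume s: "0 \<le> s"
      have "shrink q z (scale t x) \<le> q (scale t x + scale (t * s) z) - t * s * q z"
        using s t by (intro shrink_le q) simp
      also have "scale t x + scale (t * s) z = scale t (x + scale s z)"
        by (simp add: scale_right_distrib)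
      also have "q \<dots> = t * q (x + scale s z)"
        using t by (intro sublinear_scale q) simp
      finally show "shrink q z (scale t x) / t \<le> q (x + scale s z) - s * q z"
        using t by (simp add: field_simps)
    qed
    then show ?thesis using t by (simp add: field_simps)
  qed
  fix t :: real and x assume "0 \<le> t"
  show "shrink q z (scale t x) = t * shrink q z x"
  proof (cases "t = 0")
    case True
    have "shrink q z 0 \<le> 0"
      using shrink_le[OF q, of 0 z 0] sublinear_zero[OF q] by simp
    moreover have "0 \<le> shrink q z 0"
      by (rule shrink_greatest) (simp add: sublinear_scale[OF q])
    ultimately show ?thesis using True by simp
  next
    case False
    then have t: "0 < t" using \<open>0 \<le> t\<close> by simp
    have "shrink q z (scale (1/t) (scale t x)) \<le> 1/t * shrink q z (scale t x)"
      using t by (intro pos) simp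
    then have "t * shrink q z x \<le> shrink q z (scale t x)"
      using t by (simp add: field_simps)
    with pos[OF t, of x] show ?thesis by simp
  qed
qed

text \<open>A minimal sublinear functional is linear, because \<^const>\<open>shrink\<close> cannot decrease it.\<close>

theorem hahn_banach:
  assumes q: "sublinear q"
  obtains f where "\<And>x y. f (x + y) = f x + f y" "\<And>t x. f (scale t x) = t * f x"
    "\<And>x. f x \<le> q x" "f z = q z"
proof -
  define A where "A = {g. sublinear g \<and> (\<forall>x. g x \<le> shrink q z x)}"
  define P where "P = (\<lambda>g h :: 'a \<Rightarrow> real. \<forall>x. h x \<le> g x)"
  have sA: "shrink q z \<in> A" by (simp add: A_def sublinear_shrink q)
  have "\<exists>m\<in>A. \<forall>a\<in>A. P m a \<longrightarrow> a = m"
  proof (rule predicate_Zorn)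
    show "partial_order_on A (relation_of P A)"
      by (rule partial_order_on_relation_ofI) (auto simp: P_def fun_eq_iff intro: order_trans antisym)
    fix C assume C: "C \<in> Chains (relation_of P A)"
    show "\<exists>u\<in>A. \<forall>a\<in>C. P a u"
    proof (cases "C = {}")
      case False
      have CA: "C \<subseteq> A" and tot: "\<And>g h. g \<in> C \<Longrightarrow> h \<in> C \<Longrightarrow> P g h \<or> P h g"
        using C by (auto simp: Chains_def relation_of_def)
      define u where "u x = (INF g\<in>C. g x)" for x
      \<comment> \<open>A lower bound common to all members of the chain, so that their pointwise
        infimum is finite.\<close>
      have lowq: "- shrink q z (- x) \<le> g x" if "g \<in> C" for g x
      proof -
        have "sublinear g" "g (- x) \<le> shrink q z (- x)" using that CA by (auto simp: A_def)
        then show ?thesis using sublinear_minus[of g x] by linarith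
      qed
      have u_le: "u x \<le> g x" if "g \<in> C" for g x
        unfolding u_def using lowq by (intro cINF_lower bdd_belowI that) auto
      have u_ge: "c \<le> u x" if "\<And>g. g \<in> C \<Longrightarrow> c \<le> g x" for c x
        unfolding u_def using that False by (intro cINF_greatest) auto
      have "sublinear u"
        unfolding sublinear_def
      proof (intro conjI allI impI)
        fix x y
        have "u (x + y) - h y \<le> u x" if h: "h \<in> C" for h
        proof (rule u_ge)
          fix g assume g: "g \<in> C"
          \<comment> \<open>Subadditivity of the infimum rests on the chain condition: one member
            lies below both \<open>g\<close> and \<open>h\<close>.\<close>
          obtain k where k: "k \<in> C" "\<And>x. k x \<le> g x" "\<And>x. k x \<le> h x"
            using tot[OF g h] g h unfolding P_def by blast
          have "sublinear k" using k CA by (auto simp: A_def)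
          then have "u (x + y) \<le> k x + k y"
            using u_le[OF k(1), of "x + y"] sublinear_add[of k x y] by linarith
          then show "u (x + y) - h y \<le> g x"
            using k(2)[of x] k(3)[of y] by linarith
        qed
        then have "u (x + y) - u x \<le> u y"
          by (intro u_ge) (simp add: algebra_simps)
        then show "u (x + y) \<le> u x + u y" by simp
      next
        fix t :: real and x assume t: "0 \<le> t"
        have gt: "g (scale t x) = t * g x" if "g \<in> C" for g
          using that CA t by (auto simp: A_def sublinear_scale)
        show "u (scale t x) = t * u x"
        proof (cases "t = 0")
          case True
          have "g 0 = 0" if "g \<in> C" for g
            using that CA by (auto simp: A_def sublinear_zero)
          then have "u 0 = 0" using False u_le[of _ 0] u_ge[of 0 0] by (metis all_not_in_conv antisym order_refl)
          then show ?thesis using True by simp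
        next
          case False
          then have t: "0 < t" using t by simp
          have "u (scale t x) / t \<le> u x"
          proof (rule u_ge)
            fix g assume g: "g \<in> C"
            show "u (scale t x) / t \<le> g x"
              using u_le[OF g, of "scale t x"] gt[OF g] t by (simp add: field_simps)
          qed
          moreover have "t * u x \<le> u (scale t x)"
            using t by (intro u_ge) (simp add: gt u_le)
          ultimately show ?thesis using t by (simp add: field_simps)
        qed
      qed
      moreover have "u x \<le> shrink q z x" for x
      proof -
        obtain g where g: "g \<in> C" using False by blast
        then have "g x \<le> shrink q z x" using CA by (auto simp: A_def)
        then show ?thesis using u_le[OF g, of x] by linarith
      qed
      ultimately have "u \<in> A" by (simp add: A_def)
      then show ?thesis using u_le by (auto simp: P_def)
    qed (use sA in blast)
  qed
  then obtain f where f: "f \<in> A" "\<And>g. g \<in> A \<Longrightarrow> P f g \<Longrightarrow> g = f" by blast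
  have sf: "sublinear f" and fq: "\<And>x. f x \<le> shrink q z x" using f by (auto simp: A_def)
  have odd: "f (- x) = - f x" for x
  proof -
    have le: "shrink f x y \<le> f y" for y using shrink_le[OF sf, of 0 x y] by simp
    then have "shrink f x = f"
      using fq by (intro f(2)) (auto simp: A_def P_def sublinear_shrink sf intro: order_trans)
    then have "f (- x) \<le> - f x"
      using shrink_le[OF sf, of 1 x "- x"] sublinear_zero[OF sf] by simp
    then show ?thesis using sublinear_minus[OF sf, of x] by simp
  qed
  have q_le: "shrink q z x \<le> q x" for x using shrink_le[OF q, of 0 z x] by simp
  show ?thesis
  proof
    show "f (x + y) = f x + f y" for x y
      using sublinear_add[OF sf, of x y] sublinear_add[OF sf, of "- x" "- y"] odd[of "x + y"] odd by simp
    show "f (scale t x) = t * f x" for t x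
    proof (cases "0 \<le> t")
      case False
      then have "f (scale (- t) x) = - t * f x" by (intro sublinear_scale sf) simp
      then show ?thesis using odd[of "scale t x"] by simp
    qed (simp add: sublinear_scale sf)
    show "f x \<le> q x" for x using fq[of x] q_le[of x] by linarith
    have "f (- z) \<le> - q z"
      using fq[of "- z"] shrink_le[OF q, of 1 z "- z"] sublinear_zero[OF q] by simp
    then show "f z = q z" using odd[of z] fq[of z] q_le[of z] by simp
  qed
qed

end

section \<open>Numerical range and existence of states\<close>

context cstar_seminorm begin

definition re :: "'r \<Rightarrow> 'r" where "re z = rs (1/2) * (z + st z)"

lemma re_add: "re (x + y) = re x + re y"
  by (simp add: re_def st_add algebra_simps)

lemma re_rs_mult: "re (rs t * x) = rs t * re x"
  by (simp add: re_def st_mult rs_comm[of "st x"] rs_left_comm[of "rs (1/2)" t x]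
      rs_left_comm[of "rs (1/2)" t "st x"] distrib_left)

lemma re_sa: "st x = x \<Longrightarrow> re x = x"
  by (simp add: re_def distrib_left rs_half_add)

lemma st_re [simp]: "st (re x) = re x"
  by (simp add: re_def st_mult st_add add.commute rs_comm[of "x + st x"])

lemma p_re: "p (re x) \<le> p x"
  unfolding re_def p_rs_mult using p_real_part[of x] by simp

lemma pos_rs_iff: "pos (rs t) \<longleftrightarrow> 0 \<le> t"
proof
  assume "pos (rs t)"
  have "- t \<le> 0 + \<epsilon>" if \<epsilon>: "0 < \<epsilon>" for \<epsilon>
  proof -
    obtain s where "p (rs s - rs t) \<le> s + \<epsilon>"
      using pos_large[OF \<open>pos (rs t)\<close> \<epsilon>] by blast
    moreover have "rs s - rs t = rs (s - t)" using rs_add[of "s - t" t] by simp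
    ultimately show ?thesis using p_rs[of "s - t"] by auto
  qed
  then show "0 \<le> t" using field_le_epsilon[of "- t" 0] by simp
qed (rule pos_rs)

text \<open>Classically this is the largest real part of the values of states at \<open>z\<close>.
  It is written through the order so that it makes sense before any state is known to exist.\<close>

definition num :: "'r \<Rightarrow> real" where "num z = Inf {\<mu>. pos (rs \<mu> - re z)}"

lemma num_bound: "pos (rs \<mu> - re z) \<Longrightarrow> - p z \<le> \<mu>"
proof -
  assume a: "pos (rs \<mu> - re z)"
  have "pos (rs (p z) + re z)" by (intro pos_norm_add p_re) simp
  from pos_add[OF a this] have "pos (rs (\<mu> + p z))" by (simp add: rs_add)
  then show ?thesis by (simp add: pos_rs_iff)
qed

lemma num_le: "pos (rs \<mu> - re z) \<Longrightarrow> num z \<le> \<mu>"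
  unfolding num_def by (rule cInf_lower) (auto intro!: bdd_belowI num_bound)

lemma num_ge:
  assumes "\<And>\<mu>. pos (rs \<mu> - re z) \<Longrightarrow> c \<le> \<mu>" shows "c \<le> num z"
  unfolding num_def
proof (rule cInf_greatest)
  have "pos (rs (p z) - re z)" by (intro pos_norm_diff p_re) simp
  then show "{\<mu>. pos (rs \<mu> - re z)} \<noteq> {}" by blast
qed (use assms in auto)

lemma num_le_p: "num z \<le> p z"
  by (intro num_le pos_norm_diff p_re) simp

lemma re_0 [simp]: "re 0 = 0"
  by (simp add: re_def)

lemma real_scale_rs: "real_scale (\<lambda>t x. rs t * x)"
  by unfold_locales (simp_all add: distrib_left distrib_right rs_add rs_mult mult.assoc)

lemma sublinear_num: "real_scale.sublinear (\<lambda>t x. rs t * x) num"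
  unfolding real_scale.sublinear_def[OF real_scale_rs]
proof (intro conjI allI impI)
  fix x y
  have "num (x + y) - \<nu> \<le> num x" if \<nu>: "pos (rs \<nu> - re y)" for \<nu>
  proof (rule num_ge)
    fix \<mu> assume "pos (rs \<mu> - re x)"
    from pos_add[OF this \<nu>] have "pos (rs (\<mu> + \<nu>) - re (x + y))"
      by (simp add: rs_add re_add algebra_simps)
    then show "num (x + y) - \<nu> \<le> \<mu>" using num_le by fastforce
  qed
  then have "num (x + y) - num x \<le> num y"
    by (intro num_ge) (simp add: algebra_simps)
  then show "num (x + y) \<le> num x + num y" by simp
next
  have le: "num (rs t * x) \<le> t * num x" if t: "0 < t" for t x
  proof -
    have "num (rs t * x) / t \<le> num x"
    proof (rule num_ge)
      fix \<mu> assume "pos (rs \<mu> - re x)"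
      then have "pos (rs t * (rs \<mu> - re x))" using t by (intro pos_scale) auto
      then have "pos (rs (t * \<mu>) - re (rs t * x))" by (simp add: rs_mult re_rs_mult right_diff_distrib)
      then show "num (rs t * x) / t \<le> \<mu>" using num_le[of "t * \<mu>"] t by (simp add: field_simps)
    qed
    then show ?thesis using t by (simp add: field_simps)
  qed
  fix t :: real and x assume "0 \<le> t"
  show "num (rs t * x) = t * num x"
  proof (cases "t = 0")
    case True
    have "num 0 \<le> 0" using num_le[of 0 0] pos_0 by simp
    moreover have "0 \<le> num 0" by (rule num_ge) (simp add: pos_rs_iff)
    ultimately show ?thesis using True by simp
  next
    case False
    then have t: "0 < t" using \<open>0 \<le> t\<close> by simp
    have "num (rs (1/t) * (rs t * x)) \<le> 1/t * num (rs t * x)"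
      using t by (intro le) simp
    also have "rs (1/t) * (rs t * x) = x"
      using t by (simp flip: mult.assoc rs_mult)
    finally have "t * num x \<le> num (rs t * x)" using t by (simp add: field_simps)
    with le[OF t, of x] show ?thesis by simp
  qed
qed

text \<open>Here positivity of \<open>st a * a\<close> is decisive: once
  \<open>\<mu> - st a * a\<close> is positive, \<open>\<mu> + st a * a\<close> is positive as well,
  and the two-sided bound \<open>norm_le_of_pos\<close> shows that \<open>p (st a * a)\<close> is at
  most \<open>\<mu>\<close>, up to an arbitrary \<open>\<epsilon>\<close>.\<close>

lemma num_star_mult: "num (st a * a) = (p a)\<^sup>2"
proof (rule antisym)
  show "num (st a * a) \<le> (p a)\<^sup>2" using num_le_p[of "st a * a"] by (simp add: p_cstar)
  have sa: "re (st a * a) = st a * a" by (rule re_sa) (simp add: st_mult)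
  show "(p a)\<^sup>2 \<le> num (st a * a)"
  proof (rule num_ge)
    fix \<mu> assume a: "pos (rs \<mu> - re (st a * a))"
    then have "pos (rs \<mu>)" using pos_add[OF a pos_star_mult[of a]] by (simp add: sa)
    then have \<mu>: "0 \<le> \<mu>" by (simp add: pos_rs_iff)
    show "(p a)\<^sup>2 \<le> \<mu>"
    proof (rule field_le_epsilon)
      fix \<epsilon> :: real assume e: "0 < \<epsilon>"
      have "p (st a * a) \<le> \<mu> + \<epsilon>"
      proof (rule norm_le_of_pos)
        show "pos (rs (\<mu> + \<epsilon>) - st a * a)"
          using pos_add[OF a pos_rs[of \<epsilon>]] e by (simp add: sa rs_add algebra_simps)
        show "pos (rs (\<mu> + \<epsilon>) + st a * a)"
          using \<mu> e by (intro pos_add pos_rs pos_star_mult) simp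
      qed (use \<mu> e in simp)
      then show "(p a)\<^sup>2 \<le> \<mu> + \<epsilon>" by (simp add: p_cstar)
    qed
  qed
qed

text \<open>Hahn--Banach for \<open>num\<close> at \<open>st a * a\<close> gives a real functional
  \<open>g\<close>. Being below \<open>num\<close>, it vanishes where the real part does and is
  nonnegative on every \<open>st x * x\<close>; its complexification is
  \<open>g x - i g (i x)\<close>. The clause on \<open>p x = 0\<close> lets the functional pass to
  the quotient by the null space of the seminorm.\<close>

theorem state_exists:
  obtains f :: "'r \<Rightarrow> complex" where
    "\<And>x y. f (x + y) = f x + f y" "\<And>c x. f (sc c * x) = c * f x" "\<And>x. f (st x) = cnj (f x)"
    "\<And>x. Im (f (st x * x)) = 0" "\<And>x. 0 \<le> Re (f (st x * x))" "\<And>x. Re (f x) \<le> p x"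
    "\<And>x. p x = 0 \<Longrightarrow> f x = 0" "Re (f (st a * a)) = (p a)\<^sup>2"
proof -
  obtain g where g_add: "\<And>x y. g (x + y) = g x + g y" and g_rs: "\<And>t x. g (rs t * x) = t * g x"
    and g_le: "\<And>x. g x \<le> num x" and ga: "g (st a * a) = num (st a * a)"
    using real_scale.hahn_banach[OF real_scale_rs sublinear_num, of "st a * a"] by blast
  have g_0: "g 0 = 0" using g_add[of 0 0] by simp
  have g_minus: "g (- x) = - g x" for x using g_add[of x "- x"] g_0 by simp
  have g_p: "g x \<le> p x" for x using g_le[of x] num_le_p[of x] by simp
  have g_im: "g x = 0" if "re x = 0" for x
  proof -
    have "re (- x) = 0" using re_add[of x "- x"] that by simp
    then have "num x \<le> 0" "num (- x) \<le> 0" using num_le[of 0] pos_0 that by auto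
    then show ?thesis using g_le[of x] g_le[of "- x"] g_minus[of x] by simp
  qed
  have g_st: "g (st x) = g x" for x
  proof -
    have "g (st x - x) = 0" by (rule g_im) (simp add: re_def st_diff)
    then show ?thesis using g_add[of "st x - x" x] by simp
  qed
  define f where "f x = Complex (g x) (- g (sc \<i> * x))" for x
  have ii: "sc \<i> * (sc \<i> * z) = - z" for z
    by (metis complex_i_mult_minus mult.assoc mult_minus1 sc_1 sc_minus sc_mult mult.right_neutral)
  have st_i: "sc \<i> * st x = st (- (sc \<i> * x))" for x
    by (simp add: st_simps sc_minus sc_comm)
  have sc_split: "sc c = rs (Re c) + rs (Im c) * sc \<i>" for c
    by (metis complex_eq mult.commute rs_def sc_add sc_mult)
  show ?thesis
  proof
    show "f (x + y) = f x + f y" for x y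
      by (simp add: f_def complex_eq_iff g_add distrib_left)
    show "f (sc c * x) = c * f x" for c x
    proof -
      have "sc c * x = rs (Re c) * x + rs (Im c) * (sc \<i> * x)"
        unfolding sc_split[of c] by (simp add: distrib_right mult.assoc)
      then have 1: "g (sc c * x) = Re c * g x + Im c * g (sc \<i> * x)"
        by (simp add: g_add g_rs)
      have "sc \<i> * (sc c * x) = rs (Re c) * (sc \<i> * x) + rs (Im c) * (- x)"
        unfolding sc_split[of c] distrib_right distrib_left mult.assoc rs_left_comm[of "sc \<i>"] ii ..
      then have 2: "g (sc \<i> * (sc c * x)) = Re c * g (sc \<i> * x) - Im c * g x"
        by (simp only: g_add g_rs g_minus)
      show ?thesis using 1 2 by (simp add: f_def complex_eq_iff algebra_simps)
    qed
    show "f (st x) = cnj (f x)" for x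
      unfolding f_def st_i g_st g_minus by (simp add: complex_eq_iff g_st)
    show "Im (f (st x * x)) = 0" for x
    proof -
      have "st (sc \<i> * (st x * x)) = - (sc \<i> * (st x * x))"
        by (simp add: st_mult sc_minus sc_comm[of "st x * x"])
      then have "g (sc \<i> * (st x * x)) = 0" by (intro g_im) (simp add: re_def)
      then show ?thesis by (simp add: f_def)
    qed
    show "0 \<le> Re (f (st x * x))" for x
    proof -
      have "re (- (st x * x)) = - (st x * x)" by (rule re_sa) (simp add: st_simps)
      then have "num (- (st x * x)) \<le> 0" using num_le[of 0] pos_star_mult[of x] by simp
      then show ?thesis using g_le[of "- (st x * x)"] g_minus by (simp add: f_def)
    qed
    show "Re (f x) \<le> p x" for x by (simp add: f_def g_p)
    show "f x = 0" if "p x = 0" for x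
    proof -
      have "g y = 0" if "p y = 0" for y
        using g_p[of y] g_p[of "- y"] g_minus[of y] that by simp
      moreover have "p (sc \<i> * x) = 0" using that by (simp add: p_sc)
      ultimately show ?thesis using that by (simp add: f_def complex_eq_iff)
    qed
    show "Re (f (st a * a)) = (p a)\<^sup>2" by (simp add: f_def ga num_star_mult)
  qed
qed

end

section \<open>Normed complex modules\<close>

lemma complex_ring_simps [simp]:
  "carrier complex_ring = UNIV" "x \<otimes>\<^bsub>complex_ring\<^esub> y = x * y" "x \<oplus>\<^bsub>complex_ring\<^esub> y = x + y"
  "\<one>\<^bsub>complex_ring\<^esub> = 1" "\<zero>\<^bsub>complex_ring\<^esub> = 0"
  by (simp_all add: complex_ring_def)

lemma cring_complex_ring: "cring complex_ring"
  by (rule cringI; (rule abelian_groupI comm_monoidI)?)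
     (auto simp: algebra_simps intro: exI[of _ "- x" for x])

locale complex_module = Module.module complex_ring V
  for V :: "(complex, 'a, 'm) module_scheme" (structure)
begin

lemma smult_add_left: "x \<in> carrier V \<Longrightarrow> (c + d) \<odot> x = c \<odot> x \<oplus> d \<odot> x"
  using smult_l_distr[of c d x] by simp

lemma smult_add_right: "x \<in> carrier V \<Longrightarrow> y \<in> carrier V \<Longrightarrow> c \<odot> (x \<oplus> y) = c \<odot> x \<oplus> c \<odot> y"
  using smult_r_distr[of c x y] by simp

lemma smult_smult: "x \<in> carrier V \<Longrightarrow> c \<odot> (d \<odot> x) = (c * d) \<odot> x"
  using smult_assoc1[of c d x] by simp

lemma smult_1 [simp]: "x \<in> carrier V \<Longrightarrow> 1 \<odot> x = x"
  using smult_one[of x] by simp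

lemma smult_0 [simp]: "x \<in> carrier V \<Longrightarrow> 0 \<odot> x = \<zero>"
  using smult_l_null[of x] by simp

lemma smult_zero [simp]: "c \<odot> \<zero> = \<zero>"
  using smult_r_null[of c] by simp

lemma minus_eq_smult: "x \<in> carrier V \<Longrightarrow> \<ominus> x = (- 1) \<odot> x"
  using smult_add_left[of x 1 "- 1"] by (simp add: M.minus_equality M.a_comm)

lemma diff_eq_smult: "x \<in> carrier V \<Longrightarrow> y \<in> carrier V \<Longrightarrow> x \<ominus> y = x \<oplus> (- 1) \<odot> y"
  by (simp add: a_minus_def minus_eq_smult)

lemma diff_add_diff: "\<lbrakk>x \<in> carrier V; y \<in> carrier V; z \<in> carrier V\<rbrakk> \<Longrightarrow> (x \<ominus> y) \<oplus> (y \<ominus> z) = x \<ominus> z"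
  by (simp add: a_minus_def M.a_assoc M.r_neg1)

lemma add_diff_add: "\<lbrakk>x \<in> carrier V; y \<in> carrier V; z \<in> carrier V; w \<in> carrier V\<rbrakk>
    \<Longrightarrow> (x \<oplus> y) \<ominus> (z \<oplus> w) = (x \<ominus> z) \<oplus> (y \<ominus> w)"
  by (simp add: a_minus_def M.minus_add M.a_ac)

lemma smult_diff: "\<lbrakk>x \<in> carrier V; y \<in> carrier V\<rbrakk> \<Longrightarrow> c \<odot> (x \<ominus> y) = c \<odot> x \<ominus> c \<odot> y"
  by (simp add: diff_eq_smult smult_add_right smult_smult mult.commute)

lemma diff_self [simp]: "x \<in> carrier V \<Longrightarrow> x \<ominus> x = \<zero>"
  by (simp add: M.r_neg a_minus_def)

lemma diff_zero [simp]: "x \<in> carrier V \<Longrightarrow> x \<ominus> \<zero> = x"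
  by (simp add: a_minus_def)

lemma diff_eq_zero_iff: "\<lbrakk>x \<in> carrier V; y \<in> carrier V\<rbrakk> \<Longrightarrow> x \<ominus> y = \<zero> \<longleftrightarrow> x = y"
  by (metis M.add.inv_closed M.add.inv_equality M.minus_minus a_minus_def diff_self)

section \<open>Linear extension of maps from words to formal sums\<close>

definition lext :: "('w \<Rightarrow> 'a) \<Rightarrow> ('w \<Rightarrow>\<^sub>0 complex) \<Rightarrow> 'a" where
  "lext \<phi> z = (\<Oplus>w\<in>Poly_Mapping.keys z. Poly_Mapping.lookup z w \<odot> \<phi> w)"

lemma lext_superset:
  assumes "\<And>w. \<phi> w \<in> carrier V" "finite S" "Poly_Mapping.keys z \<subseteq> S"
  shows "lext \<phi> z = (\<Oplus>w\<in>S. Poly_Mapping.lookup z w \<odot> \<phi> w)"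
  unfolding lext_def
  by (rule M.add.finprod_mono_neutral_cong_left) (use assms in \<open>auto simp: in_keys_iff\<close>)

lemma lext_closed [simp]: "(\<And>w. \<phi> w \<in> carrier V) \<Longrightarrow> lext \<phi> z \<in> carrier V"
  unfolding lext_def by (rule M.finsum_closed) auto

lemma lext_0 [simp]: "lext \<phi> 0 = \<zero>"
  by (simp add: lext_def)

lemma lext_single: "(\<And>w. \<phi> w \<in> carrier V) \<Longrightarrow> lext \<phi> (Poly_Mapping.single w c) = c \<odot> \<phi> w"
  by (subst lext_superset[of _ "{w}"]) (auto simp: M.finsum_insert)

lemma lext_add:
  assumes \<phi>: "\<And>w. \<phi> w \<in> carrier V"
  shows "lext \<phi> (y + z) = lext \<phi> y \<oplus> lext \<phi> z"
proof -
  define S where "S = Poly_Mapping.keys y \<union> Poly_Mapping.keys z"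
  have S: "finite S" "Poly_Mapping.keys y \<subseteq> S" "Poly_Mapping.keys z \<subseteq> S" "Poly_Mapping.keys (y + z) \<subseteq> S"
    using Poly_Mapping.keys_add[of y z] by (auto simp: S_def)
  have "lext \<phi> (y + z) = (\<Oplus>w\<in>S. Poly_Mapping.lookup (y + z) w \<odot> \<phi> w)"
    by (rule lext_superset[OF \<phi> S(1) S(4)])
  also have "\<dots> = (\<Oplus>w\<in>S. Poly_Mapping.lookup y w \<odot> \<phi> w \<oplus> Poly_Mapping.lookup z w \<odot> \<phi> w)"
    by (rule M.finsum_cong') (auto simp: \<phi> lookup_add smult_add_left)
  also have "\<dots> = (\<Oplus>w\<in>S. Poly_Mapping.lookup y w \<odot> \<phi> w) \<oplus> (\<Oplus>w\<in>S. Poly_Mapping.lookup z w \<odot> \<phi> w)"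
    by (rule M.finsum_addf) (auto simp: \<phi>)
  also have "\<dots> = lext \<phi> y \<oplus> lext \<phi> z"
    using lext_superset[OF \<phi> S(1) S(2)] lext_superset[OF \<phi> S(1) S(3)] by simp
  finally show ?thesis .
qed

end

lemma poly_mapping_single_induct [case_names zero single add]:
  fixes z :: "'w \<Rightarrow>\<^sub>0 'c::ab_group_add"
  assumes "P 0" "\<And>w c. w \<in> Poly_Mapping.keys z \<Longrightarrow> P (Poly_Mapping.single w c)"
    "\<And>x y. P x \<Longrightarrow> P y \<Longrightarrow> P (x + y)"
  shows "P z"
proof -
  have "P (\<Sum>w\<in>S. Poly_Mapping.single w (Poly_Mapping.lookup z w))"
    if "finite S" "S \<subseteq> Poly_Mapping.keys z" for S
    using that by (induction S rule: finite_induct) (use assms in auto)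
  moreover have "(\<Sum>w\<in>Poly_Mapping.keys z. Poly_Mapping.single w (Poly_Mapping.lookup z w)) = z"
    by (rule poly_mapping_eqI) (auto simp: lookup_sum lookup_single when_def in_keys_iff sum.delta')
  ultimately show ?thesis by (metis finite_keys order_refl)
qed

locale normed_module = complex_module V
  for V :: "(complex, 'a, 'm) module_scheme" (structure) +
  fixes N :: "'a \<Rightarrow> real"
  assumes norm_on: "norm_on V N"
begin

lemma norm_nonneg [simp]: "x \<in> carrier V \<Longrightarrow> 0 \<le> N x"
  and norm_eq_0: "x \<in> carrier V \<Longrightarrow> N x = 0 \<longleftrightarrow> x = \<zero>"
  and norm_smult: "x \<in> carrier V \<Longrightarrow> N (c \<odot> x) = cmod c * N x"
  and norm_add: "x \<in> carrier V \<Longrightarrow> y \<in> carrier V \<Longrightarrow> N (x \<oplus> y) \<le> N x + N y"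
  using norm_on by (auto simp: norm_on_def)

lemma norm_zero [simp]: "N \<zero> = 0"
  by (simp add: norm_eq_0)

lemma norm_diff_commute: "x \<in> carrier V \<Longrightarrow> y \<in> carrier V \<Longrightarrow> N (x \<ominus> y) = N (y \<ominus> x)"
proof -
  assume *: "x \<in> carrier V" "y \<in> carrier V"
  then have "y \<ominus> x = (- 1) \<odot> (x \<ominus> y)"
    by (simp add: diff_eq_smult smult_add_right smult_smult M.a_comm)
  then show ?thesis using * by (simp add: norm_smult)
qed

lemma norm_triangle_diff:
  "\<lbrakk>x \<in> carrier V; y \<in> carrier V; z \<in> carrier V\<rbrakk> \<Longrightarrow> N (x \<ominus> z) \<le> N (x \<ominus> y) + N (y \<ominus> z)"
  using norm_add[of "x \<ominus> y" "y \<ominus> z"] by (simp add: diff_add_diff)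

lemma norm_diff_norm: "\<lbrakk>x \<in> carrier V; y \<in> carrier V\<rbrakk> \<Longrightarrow> \<bar>N x - N y\<bar> \<le> N (x \<ominus> y)"
  using norm_triangle_diff[of x y \<zero>] norm_triangle_diff[of y x \<zero>] norm_diff_commute[of x y] by simp

lemma Metric_space: "Metric_space (carrier V) (norm_dist V N)"
proof
  show "0 \<le> norm_dist V N x y" for x y by (simp add: norm_dist_def)
  show "norm_dist V N x y = norm_dist V N y x" for x y
    by (auto simp: norm_dist_def norm_diff_commute)
  show "norm_dist V N x y = 0 \<longleftrightarrow> x = y" if "x \<in> carrier V" "y \<in> carrier V" for x y
    using that by (simp add: norm_dist_def norm_eq_0 diff_eq_zero_iff)
  show "norm_dist V N x z \<le> norm_dist V N x y + norm_dist V N y z"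
    if "x \<in> carrier V" "y \<in> carrier V" "z \<in> carrier V" for x y z
    using that by (simp add: norm_dist_def norm_triangle_diff)
qed

section \<open>Convergence and completeness in terms of the norm\<close>

definition conv :: "(nat \<Rightarrow> 'a) \<Rightarrow> 'a \<Rightarrow> bool" where
  "conv x l \<longleftrightarrow> (\<forall>n. x n \<in> carrier V) \<and> l \<in> carrier V \<and> (\<lambda>n. N (x n \<ominus> l)) \<longlonglongrightarrow> 0"

lemma conv_carrier: "conv x l \<Longrightarrow> l \<in> carrier V" "conv x l \<Longrightarrow> x n \<in> carrier V"
  by (auto simp: conv_def)

lemma conv_iff_limitin:
  assumes "\<And>n. x n \<in> carrier V"
  shows "conv x l \<longleftrightarrow> limitin (norm_topology V N) x l sequentially"
  unfolding Metric_space.limitin_metric_dist_null[OF Metric_space] conv_def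
  using assms by (auto simp: norm_dist_def)

lemma norm_Cauchy_iff:
  "norm_Cauchy V N x \<longleftrightarrow> (\<forall>n. x n \<in> carrier V) \<and> (\<forall>\<epsilon>>0. \<exists>M. \<forall>m\<ge>M. \<forall>n\<ge>M. N (x m \<ominus> x n) < \<epsilon>)"
proof (cases "\<forall>n. x n \<in> carrier V")
  case True
  then show ?thesis
    unfolding Metric_space.MCauchy_def[OF Metric_space] by (auto simp: norm_dist_def)
qed (auto simp: Metric_space.MCauchy_def[OF Metric_space])

lemma norm_complete_iff: "norm_complete V N \<longleftrightarrow> (\<forall>x. norm_Cauchy V N x \<longrightarrow> (\<exists>l. conv x l))"
  unfolding Metric_space.mcomplete_def[OF Metric_space]
  by (rule all_cong1, rule imp_cong[OF refl], rule ex_cong1)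
     (simp add: norm_Cauchy_iff conv_iff_limitin)

lemma closedin_iff: "closedin (norm_topology V N) S \<longleftrightarrow>
    S \<subseteq> carrier V \<and> (\<forall>x l. (\<forall>n. x n \<in> S) \<and> conv x l \<longrightarrow> l \<in> S)"
  unfolding Metric_space.metric_closedin_iff_sequentially_closed[OF Metric_space]
proof (rule conj_cong[OF refl])
  assume S: "S \<subseteq> carrier V"
  have "range x \<subseteq> S \<and> limitin (norm_topology V N) x l sequentially \<longleftrightarrow> (\<forall>n. x n \<in> S) \<and> conv x l" for x l
  proof (cases "\<forall>n. x n \<in> S")
    case True
    then show ?thesis using S by (subst conv_iff_limitin) auto
  qed auto
  then show "(\<forall>x l. range x \<subseteq> S \<and> limitin (norm_topology V N) x l sequentially \<longrightarrow> l \<in> S) \<longleftrightarrow>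
      (\<forall>x l. (\<forall>n. x n \<in> S) \<and> conv x l \<longrightarrow> l \<in> S)"
    by simp
qed

lemma norm_tendsto_bound:
  assumes "g \<longlonglongrightarrow> 0" "\<And>n. 0 \<le> f n" "\<And>n. f n \<le> (g n :: real)"
  shows "f \<longlonglongrightarrow> 0"
  by (rule tendsto_sandwich[OF _ _ tendsto_const assms(1)]) (use assms in auto)

lemma conv_const: "l \<in> carrier V \<Longrightarrow> conv (\<lambda>n. l) l"
  by (simp add: conv_def)

lemma conv_add:
  assumes "conv x l" "conv y k" shows "conv (\<lambda>n. x n \<oplus> y n) (l \<oplus> k)"
  unfolding conv_def
proof (intro conjI allI)
  have c: "\<And>n. x n \<in> carrier V" "\<And>n. y n \<in> carrier V" "l \<in> carrier V" "k \<in> carrier V"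
    using assms by (auto simp: conv_def)
  show "(\<lambda>n. N (x n \<oplus> y n \<ominus> (l \<oplus> k))) \<longlonglongrightarrow> 0"
  proof (rule norm_tendsto_bound)
    show "(\<lambda>n. N (x n \<ominus> l) + N (y n \<ominus> k)) \<longlonglongrightarrow> 0"
      using assms by (auto simp: conv_def intro: tendsto_add_zero)
  qed (use c norm_add in \<open>auto simp: add_diff_add\<close>)
qed (use assms in \<open>auto simp: conv_def\<close>)

lemma conv_smult:
  assumes "conv x l" shows "conv (\<lambda>n. c \<odot> x n) (c \<odot> l)"
  unfolding conv_def
proof (intro conjI allI)
  have c: "\<And>n. x n \<in> carrier V" "l \<in> carrier V" "(\<lambda>n. N (x n \<ominus> l)) \<longlonglongrightarrow> 0"
    using assms by (auto simp: conv_def)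
  have "N (c \<odot> x n \<ominus> c \<odot> l) = cmod c * N (x n \<ominus> l)" for n
    using c by (simp add: smult_diff[symmetric] norm_smult)
  then show "(\<lambda>n. N (c \<odot> x n \<ominus> c \<odot> l)) \<longlonglongrightarrow> 0"
    using tendsto_mult_right_zero[OF c(3), of "cmod c"] by simp
qed (use assms in \<open>auto simp: conv_def\<close>)

lemma conv_norm:
  assumes "conv x l" shows "(\<lambda>n. N (x n)) \<longlonglongrightarrow> N l"
proof -
  have c: "\<And>n. x n \<in> carrier V" "l \<in> carrier V" "(\<lambda>n. N (x n \<ominus> l)) \<longlonglongrightarrow> 0"
    using assms by (auto simp: conv_def)
  have "(\<lambda>n. dist (N (x n)) (N l)) \<longlonglongrightarrow> 0"
    by (rule norm_tendsto_bound[OF c(3)]) (use c norm_diff_norm in \<open>auto simp: dist_real_def\<close>)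
  then show ?thesis by (rule tendsto_dist_iff[THEN iffD2])
qed

lemma conv_unique:
  assumes "conv x l" "conv x k" shows "l = k"
proof -
  have c: "l \<in> carrier V" "k \<in> carrier V" "\<And>n. x n \<in> carrier V" using assms by (auto simp: conv_def)
  have "(\<lambda>n. N (x n \<ominus> l) + N (x n \<ominus> k)) \<longlonglongrightarrow> 0"
    using assms by (auto simp: conv_def intro: tendsto_add_zero)
  then have "(\<lambda>n. N (l \<ominus> k)) \<longlonglongrightarrow> 0"
  proof (rule norm_tendsto_bound)
    show "N (l \<ominus> k) \<le> N (x n \<ominus> l) + N (x n \<ominus> k)" for n
      using norm_triangle_diff[of l "x n" k] norm_diff_commute[of l "x n"] c by simp
  qed (use c in auto)
  then have "N (l \<ominus> k) = 0" by (simp add: LIMSEQ_const_iff)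
  then show ?thesis using c by (simp add: norm_eq_0 diff_eq_zero_iff)
qed

lemma conv_Cauchy:
  assumes "conv x l" shows "norm_Cauchy V N x"
  unfolding norm_Cauchy_iff
proof (intro conjI allI impI)
  show c: "x n \<in> carrier V" for n using assms by (auto simp: conv_def)
  have l: "l \<in> carrier V" using assms by (auto simp: conv_def)
  fix \<epsilon> :: real assume "0 < \<epsilon>"
  then have "\<forall>\<^sub>F n in sequentially. N (x n \<ominus> l) < \<epsilon>/2"
    using assms unfolding conv_def by (intro order_tendstoD(2)) auto
  then obtain M where M: "\<And>n. n \<ge> M \<Longrightarrow> N (x n \<ominus> l) < \<epsilon>/2"
    by (auto simp: eventually_sequentially)
  have "N (x m \<ominus> x n) < \<epsilon>" if "m \<ge> M" "n \<ge> M" for m n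
    using norm_triangle_diff[of "x m" l "x n"] norm_diff_commute[of l "x n"] M[OF that(1)] M[OF that(2)] c l
    by simp
  then show "\<exists>M. \<forall>m\<ge>M. \<forall>n\<ge>M. N (x m \<ominus> x n) < \<epsilon>" by blast
qed

lemma conv_of_close:
  assumes "conv y l" "\<And>n. x n \<in> carrier V" "(\<lambda>n. N (x n \<ominus> y n)) \<longlonglongrightarrow> 0"
  shows "conv x l"
  unfolding conv_def
proof (intro conjI allI)
  have y: "\<And>n. y n \<in> carrier V" "l \<in> carrier V" "(\<lambda>n. N (y n \<ominus> l)) \<longlonglongrightarrow> 0" using assms(1) by (auto simp: conv_def)
  show "(\<lambda>n. N (x n \<ominus> l)) \<longlonglongrightarrow> 0"
    by (rule norm_tendsto_bound[OF tendsto_add_zero[OF assms(3) y(3)]])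
       (use y assms norm_triangle_diff in auto)
qed (use assms in \<open>auto simp: conv_def\<close>)

text \<open>Each term of a Cauchy sequence is replaced by an element of \<open>D\<close> at distance
  below \<open>1 / (n + 1)\<close>. The GNS space and the completion of a pre-C*-algebra are both
  treated this way, with the image of the original algebra as \<open>D\<close>.\<close>

lemma complete_via_dense:
  assumes D: "D \<subseteq> carrier V" "\<And>x \<epsilon>. x \<in> carrier V \<Longrightarrow> 0 < \<epsilon> \<Longrightarrow> \<exists>d\<in>D. N (x \<ominus> d) < \<epsilon>"
    and lim: "\<And>x. norm_Cauchy V N x \<Longrightarrow> (\<And>n. x n \<in> D) \<Longrightarrow> \<exists>l. conv x l"
  shows "norm_complete V N"
  unfolding norm_complete_iff
proof (intro allI impI)
  fix x assume x: "norm_Cauchy V N x"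
  then have xc: "\<And>n. x n \<in> carrier V" by (simp add: norm_Cauchy_iff)
  have "\<exists>d\<in>D. N (x n \<ominus> d) < 1 / real (Suc n)" for n
    using D(2)[OF xc] by simp
  then obtain d where d: "\<And>n. d n \<in> D" "\<And>n. N (x n \<ominus> d n) < 1 / real (Suc n)" by metis
  have dc: "\<And>n. d n \<in> carrier V" using d D by blast
  have lim0: "(\<lambda>n. N (x n \<ominus> d n)) \<longlonglongrightarrow> 0"
    by (rule norm_tendsto_bound[OF LIMSEQ_Suc[OF lim_1_over_n]]) (use d xc dc in \<open>auto intro: less_imp_le\<close>)
  have "norm_Cauchy V N d"
    unfolding norm_Cauchy_iff
  proof (intro conjI allI impI dc)
    fix \<epsilon> :: real assume e: "0 < \<epsilon>"
    then obtain M1 where M1: "\<And>m n. m \<ge> M1 \<Longrightarrow> n \<ge> M1 \<Longrightarrow> N (x m \<ominus> x n) < \<epsilon>/3"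
      using x unfolding norm_Cauchy_iff by (meson zero_less_divide_iff zero_less_numeral)
    have "\<forall>\<^sub>F n in sequentially. N (x n \<ominus> d n) < \<epsilon>/3"
      using lim0 e by (intro order_tendstoD(2)) auto
    then obtain M2 where M2: "\<And>n. n \<ge> M2 \<Longrightarrow> N (x n \<ominus> d n) < \<epsilon>/3"
      by (auto simp: eventually_sequentially)
    have "N (d m \<ominus> d n) < \<epsilon>" if "m \<ge> max M1 M2" "n \<ge> max M1 M2" for m n
    proof -
      have "N (d m \<ominus> d n) \<le> N (x m \<ominus> d m) + (N (x m \<ominus> x n) + N (x n \<ominus> d n))"
        using norm_triangle_diff[of "d m" "x m" "d n"] norm_triangle_diff[of "x m" "x n" "d n"]
          norm_diff_commute[of "d m" "x m"] xc dc by simp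
      then show ?thesis using that M1[of m n] M2[of m] M2[of n] by simp
    qed
    then show "\<exists>M. \<forall>m\<ge>M. \<forall>n\<ge>M. N (d m \<ominus> d n) < \<epsilon>" by blast
  qed
  then obtain l where "conv d l" using lim d by blast
  then have "conv x l" by (rule conv_of_close) (use xc lim0 in auto)
  then show "\<exists>l. conv x l" ..
qed

end

section \<open>Free algebras and Leavitt path algebras\<close>

lemma free_word_eq_iff: "v = w \<longleftrightarrow> letters v = letters w"
  by (cases v; cases w) auto

lemma letters_plus [simp]: "letters (v + w) = letters v @ letters w"
  by (simp add: plus_free_word_def)

lemma letters_zero [simp]: "letters 0 = []"
  by (simp add: zero_free_word_def)

lemma Free_Word_Nil [simp]: "Free_Word [] = 0"
  by (simp add: zero_free_word_def)

lemma free_word_zero_iff: "w = 0 \<longleftrightarrow> letters w = []"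
  by (simp add: free_word_eq_iff)

abbreviation const :: "complex \<Rightarrow> ('g free_word \<Rightarrow>\<^sub>0 complex)" where
  "const c \<equiv> Poly_Mapping.single 0 c"

lemma const_mult_single [simp]: "const c * Poly_Mapping.single w d = Poly_Mapping.single w (c * d)"
  by (simp add: mult_single)

lemma const_mult_const: "const c * (const d * x) = const (c * d) * x"
  by (simp flip: mult.assoc)

lemma mult_const: "x * const c = const c * x"
proof (induction x rule: poly_mapping_single_induct)
  case (add x y) then show ?case by (simp add: distrib_left distrib_right)
qed (simp_all add: mult_single mult.commute)

lemma mult_const_left: "x * (const c * y) = const c * (x * y)"
  by (metis mult.assoc mult_const)

text \<open>Parametrised by the involution on letters, since it is used with \<open>gen_star\<close>
  for L(E) and with \<open>istar\<close> for the free algebra over a C*-algebra.\<close>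

definition pm_star :: "('g \<Rightarrow> 'g) \<Rightarrow> ('g free_word \<Rightarrow>\<^sub>0 complex) \<Rightarrow> ('g free_word \<Rightarrow>\<^sub>0 complex)" where
  "pm_star \<sigma> x = (\<Sum>w\<in>Poly_Mapping.keys x.
     Poly_Mapping.single (Free_Word (rev (map \<sigma> (letters w)))) (cnj (Poly_Mapping.lookup x w)))"

lemma pm_star_superset:
  assumes "finite S" "Poly_Mapping.keys x \<subseteq> S"
  shows "pm_star \<sigma> x = (\<Sum>w\<in>S.
     Poly_Mapping.single (Free_Word (rev (map \<sigma> (letters w)))) (cnj (Poly_Mapping.lookup x w)))"
  unfolding pm_star_def by (rule sum.mono_neutral_left) (use assms in \<open>auto simp: in_keys_iff\<close>)

lemma pm_star_add: "pm_star \<sigma> (x + y) = pm_star \<sigma> x + pm_star \<sigma> y"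
proof -
  define S where "S = Poly_Mapping.keys x \<union> Poly_Mapping.keys y"
  have S: "finite S" "Poly_Mapping.keys x \<subseteq> S" "Poly_Mapping.keys y \<subseteq> S" "Poly_Mapping.keys (x + y) \<subseteq> S"
    using Poly_Mapping.keys_add[of x y] by (auto simp: S_def)
  show ?thesis
    unfolding pm_star_superset[OF S(1) S(2)] pm_star_superset[OF S(1) S(3)] pm_star_superset[OF S(1) S(4)]
    by (simp add: lookup_add single_add sum.distrib)
qed

lemma pm_star_single [simp]:
  "pm_star \<sigma> (Poly_Mapping.single w c) = Poly_Mapping.single (Free_Word (rev (map \<sigma> (letters w)))) (cnj c)"
  by (subst pm_star_superset[of "{w}"]) auto

lemma pm_star_0 [simp]: "pm_star \<sigma> 0 = 0"
  by (simp add: pm_star_def)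

lemma pm_star_mult: "pm_star \<sigma> (x * y) = pm_star \<sigma> y * pm_star \<sigma> x"
proof (induction x rule: poly_mapping_single_induct)
  case (single v c)
  show ?case
  proof (induction y rule: poly_mapping_single_induct)
    case (add x y)
    then show ?case by (simp add: distrib_left distrib_right pm_star_add)
  qed (simp_all add: mult_single plus_free_word_def mult.commute)
next
  case (add x y)
  then show ?case by (simp add: distrib_left distrib_right pm_star_add)
qed simp

lemma pm_star_star:
  assumes "\<And>g. \<sigma> (\<sigma> g) = g" shows "pm_star \<sigma> (pm_star \<sigma> x) = x"
proof (induction x rule: poly_mapping_single_induct)
  case (single w c)
  then show ?case using assms by (cases w) (simp add: rev_map comp_def)
qed (simp_all add: pm_star_add)

lemma pm_star_const: "pm_star \<sigma> (const c) = const (cnj c)"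
  by simp

lemma gen_star_gen_star [simp]: "gen_star (gen_star g) = g"
  by (cases g) auto

lemma free_star_eq: "free_star = pm_star gen_star"
  by (rule ext) (simp add: free_star_def pm_star_def word_star_def)

lemma free_star_add: "free_star (x + y) = free_star x + free_star y"
  and free_star_mult: "free_star (x * y) = free_star y * free_star x"
  and free_star_star [simp]: "free_star (free_star x) = x"
  and free_star_0 [simp]: "free_star 0 = 0"
  and free_star_const: "free_star (const c) = const (cnj c)"
  by (simp_all add: free_star_eq pm_star_add pm_star_mult pm_star_star pm_star_const)

lemma free_star_single: "free_star (Poly_Mapping.single w c) = Poly_Mapping.single (word_star w) (cnj c)"
  by (simp add: free_star_eq word_star_def)

lemma free_star_minus: "free_star (- x) = - free_star x"
  using free_star_add[of x "- x"] by (simp add: eq_neg_iff_add_eq_0 add.commute)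

lemma free_star_diff: "free_star (x - y) = free_star x - free_star y"
  using free_star_add[of x "- y"] by (simp add: free_star_minus)

lemma free_star_sum: "free_star (\<Sum>i\<in>I. f i) = (\<Sum>i\<in>I. free_star (f i))"
  by (induction I rule: infinite_finite_induct) (auto simp: free_star_add)

lemma free_star_gen [simp]: "free_star (free_gen g) = free_gen (gen_star g)"
  by (simp add: free_gen_def free_star_single word_star_def)

lemma free_smult_eq: "free_smult c x = const c * x"
  unfolding free_smult_def by (rule mult_map_scale_conv_mult)

lemma free_star_smult: "free_star (free_smult c x) = free_smult (cnj c) (free_star x)"
  by (simp add: free_smult_eq free_star_mult free_star_const mult_const)

lemma free_smult_minus_one: "free_smult (- 1) x = - x"
  by (simp add: free_smult_eq single_uminus)

lemma UN_UN_const: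
  assumes "x \<in> X" "y \<in> Y" "\<And>x y. x \<in> X \<Longrightarrow> y \<in> Y \<Longrightarrow> f x y = c"
  shows "(\<Union>x\<in>X. \<Union>y\<in>Y. f x y) = c"
  using assms by blast

lemma UN_const:
  assumes "x \<in> X" "\<And>x. x \<in> X \<Longrightarrow> f x = c" shows "(\<Union>x\<in>X. f x) = c"
  using assms by blast

locale countable_graph = wf_digraph E for E :: "('v, 'e) pre_digraph" +
  assumes countable_verts: "countable (verts E)" and countable_arcs: "countable (arcs E)"
begin

abbreviation F :: "('v, 'e) lpa_free set" where "F \<equiv> free_carrier E"
abbreviation I :: "('v, 'e) lpa_free set" where "I \<equiv> lpa_ideal E"
abbreviation cl :: "('v, 'e) lpa_free \<Rightarrow> ('v, 'e) lpa_free set" where "cl \<equiv> lpa_class E"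
abbreviation L :: "('v, 'e) lpa_free set star_algebra" where "L \<equiv> leavitt_path_algebra E"
abbreviation V :: "'v \<Rightarrow> ('v, 'e) lpa_free" where "V v \<equiv> free_gen (Vertex v)"
abbreviation A :: "'e \<Rightarrow> ('v, 'e) lpa_free" where "A e \<equiv> free_gen (Edge e)"
abbreviation G :: "'e \<Rightarrow> ('v, 'e) lpa_free" where "G e \<equiv> free_gen (Ghost e)"

definition valid_word :: "('v, 'e) lpa_gen free_word \<Rightarrow> bool" where
  "valid_word w \<longleftrightarrow> w \<noteq> 0 \<and> (\<forall>g\<in>set (letters w). gen_in E g)"

lemma F_iff: "x \<in> F \<longleftrightarrow> (\<forall>w\<in>Poly_Mapping.keys x. valid_word w)"
  by (simp add: free_carrier_def valid_word_def)

lemma F_0 [simp, intro]: "0 \<in> F"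
  by (simp add: F_iff)

lemma F_add [simp, intro]: "x \<in> F \<Longrightarrow> y \<in> F \<Longrightarrow> x + y \<in> F"
  using Poly_Mapping.keys_add[of x y] by (auto simp: F_iff)

lemma F_minus [simp, intro]: "x \<in> F \<Longrightarrow> - x \<in> F"
  by (auto simp: F_iff in_keys_iff)

lemma F_diff [simp, intro]: "x \<in> F \<Longrightarrow> y \<in> F \<Longrightarrow> x - y \<in> F"
  using F_add[of x "- y"] by simp

lemma valid_word_add: "valid_word v \<Longrightarrow> valid_word w \<Longrightarrow> valid_word (v + w)"
  by (auto simp: valid_word_def free_word_zero_iff)

lemma F_mult [simp, intro]: "x \<in> F \<Longrightarrow> y \<in> F \<Longrightarrow> x * y \<in> F"
  using Poly_Mapping.keys_mult[of x y] valid_word_add by (fastforce simp: F_iff)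

lemma F_single [simp, intro]: "valid_word w \<Longrightarrow> Poly_Mapping.single w c \<in> F"
  by (auto simp: F_iff)

lemma F_const_mult [simp, intro]: "x \<in> F \<Longrightarrow> const c * x \<in> F"
  using Poly_Mapping.keys_mult[of "const c" x] by (fastforce simp: F_iff split: if_splits)

lemma F_smult [simp, intro]: "x \<in> F \<Longrightarrow> free_smult c x \<in> F"
  by (simp add: free_smult_eq)

lemma F_sum [intro]: "(\<And>i. i \<in> S \<Longrightarrow> f i \<in> F) \<Longrightarrow> (\<Sum>i\<in>S. f i) \<in> F"
  by (induction S rule: infinite_finite_induct) auto

lemma F_gen [simp, intro]: "gen_in E g \<Longrightarrow> free_gen g \<in> F"
  by (auto simp: free_gen_def valid_word_def free_word_zero_iff)

lemma F_induct [consumes 1, case_names zero single add]: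
  assumes "z \<in> F" "P 0" "\<And>w c. valid_word w \<Longrightarrow> P (Poly_Mapping.single w c)"
    "\<And>x y. x \<in> F \<Longrightarrow> y \<in> F \<Longrightarrow> P x \<Longrightarrow> P y \<Longrightarrow> P (x + y)"
  shows "P z"
proof -
  have "z \<in> F \<and> P z"
    by (induction z rule: poly_mapping_single_induct) (use assms in \<open>auto simp: F_iff[of z]\<close>)
  then show ?thesis by simp
qed

lemma gen_in_star [simp]: "gen_in E (gen_star g) = gen_in E g"
  by (cases g) auto

lemma F_star [simp, intro]: "x \<in> F \<Longrightarrow> free_star x \<in> F"
proof (induction rule: F_induct)
  case (single w c)
  then have "valid_word (word_star w)"
    by (auto simp: valid_word_def word_star_def free_word_zero_iff)
  then show ?case by (simp add: free_star_single)
qed (auto simp: free_star_add)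

lemma regular_verticesD: "v \<in> regular_vertices E \<Longrightarrow> v \<in> verts E \<and> finite (emitted E v)"
  by (simp add: regular_vertices_def)

lemma emittedD: "e \<in> emitted E v \<Longrightarrow> e \<in> arcs E \<and> tail E e = v"
  by (simp add: emitted_def)

lemma rels_in_F: "x \<in> lpa_rels E \<Longrightarrow> x \<in> F"
  by (induction rule: lpa_rels.induct)
     (auto simp: regular_vertices_def dest: emittedD intro!: F_sum F_diff F_mult)

lemma I_in_F [intro]: "x \<in> I \<Longrightarrow> x \<in> F"
  by (induction rule: lpa_ideal.induct) (auto simp: rels_in_F)

lemma I_minus: "x \<in> I \<Longrightarrow> - x \<in> I"
  using lpa_ideal.scale[of x E "- 1"] by (simp add: free_smult_minus_one)

lemma I_diff: "x \<in> I \<Longrightarrow> y \<in> I \<Longrightarrow> x - y \<in> I"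
  using lpa_ideal.add[OF _ I_minus] by fastforce

text \<open>The involution exchanges the source and range relations of an edge with those of its
  ghost, swaps the indices in the two orthogonality relations, and fixes the rest. This is why the
  ideal is stable under it.\<close>

lemma I_rel_star: "x \<in> lpa_rels E \<Longrightarrow> free_star x \<in> lpa_rels E"
proof (induction rule: lpa_rels.induct)
  case (orth v w)
  then show ?case using lpa_rels.orth[of w E v] by (simp add: free_star_mult)
next
  case (ghost_edge_diff e f)
  then show ?case using lpa_rels.ghost_edge_diff[of f E e] by (simp add: free_star_mult)
next
  case (regular v)
  then show ?case using lpa_rels.regular[of v E] by (simp add: free_star_mult free_star_diff free_star_sum)
qed (auto simp: free_star_diff free_star_mult intro: lpa_rels.intros)

lemma I_star: "x \<in> I \<Longrightarrow> free_star x \<in> I"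
  by (induction rule: lpa_ideal.induct)
     (auto simp: free_star_add free_star_smult free_star_mult intro: lpa_ideal.intros I_rel_star)

definition eqv :: "('v, 'e) lpa_free \<Rightarrow> ('v, 'e) lpa_free \<Rightarrow> bool" (infix \<open>\<asymp>\<close> 50) where
  "x \<asymp> y \<longleftrightarrow> x - y \<in> I"

lemma eqv_refl [simp]: "x \<asymp> x"
  by (simp add: eqv_def lpa_ideal.zero)

lemma eqv_sym: "x \<asymp> y \<Longrightarrow> y \<asymp> x"
  using I_minus[of "x - y"] by (simp add: eqv_def)

lemma eqv_trans [trans]: "x \<asymp> y \<Longrightarrow> y \<asymp> z \<Longrightarrow> x \<asymp> z"
  using lpa_ideal.add[of "x - y" E "y - z"] by (simp add: eqv_def)

lemma eqv_add: "x \<asymp> x' \<Longrightarrow> y \<asymp> y' \<Longrightarrow> x + y \<asymp> x' + y'"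
  using lpa_ideal.add[of "x - x'" E "y - y'"] by (simp add: eqv_def algebra_simps)

lemma eqv_diff: "x \<asymp> x' \<Longrightarrow> y \<asymp> y' \<Longrightarrow> x - y \<asymp> x' - y'"
  using I_diff[of "x - x'" "y - y'"] by (simp add: eqv_def algebra_simps)

lemma eqv_smult: "x \<asymp> x' \<Longrightarrow> free_smult c x \<asymp> free_smult c x'"
  using lpa_ideal.scale[of "x - x'" E c] by (simp add: eqv_def free_smult_eq algebra_simps)

lemma eqv_mult_left: "x \<asymp> x' \<Longrightarrow> y \<in> F \<Longrightarrow> y * x \<asymp> y * x'"
  using lpa_ideal.mult_left[of "x - x'" E y] by (simp add: eqv_def algebra_simps)

lemma eqv_mult_right: "x \<asymp> x' \<Longrightarrow> y \<in> F \<Longrightarrow> x * y \<asymp> x' * y"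
  using lpa_ideal.mult_right[of "x - x'" E y] by (simp add: eqv_def algebra_simps)

lemma eqv_mult: "x \<asymp> x' \<Longrightarrow> y \<asymp> y' \<Longrightarrow> x \<in> F \<Longrightarrow> y' \<in> F \<Longrightarrow> x * y \<asymp> x' * y'"
  by (meson eqv_mult_left eqv_mult_right eqv_trans)

lemma eqv_star: "x \<asymp> y \<Longrightarrow> free_star x \<asymp> free_star y"
  using I_star[of "x - y"] by (simp add: eqv_def free_star_diff)

lemma eqv_sum: "(\<And>i. i \<in> S \<Longrightarrow> f i \<asymp> g i) \<Longrightarrow> (\<Sum>i\<in>S. f i) \<asymp> (\<Sum>i\<in>S. g i)"
  by (induction S rule: infinite_finite_induct) (auto intro: eqv_add)

lemma eqv_rel: "x - y \<in> lpa_rels E \<Longrightarrow> x \<asymp> y"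
  by (simp add: eqv_def lpa_ideal.rel)

lemma eqv_rel_zero: "x \<in> lpa_rels E \<Longrightarrow> x \<asymp> 0"
  by (simp add: eqv_def lpa_ideal.rel)

lemma eqv_zero: "x \<asymp> 0 \<longleftrightarrow> x \<in> I"
  by (simp add: eqv_def)

lemmas eqv_rels =
  lpa_rels.idem[THEN eqv_rel] lpa_rels.source_edge[THEN eqv_rel] lpa_rels.edge_range[THEN eqv_rel]
  lpa_rels.range_ghost[THEN eqv_rel] lpa_rels.ghost_source[THEN eqv_rel]
  lpa_rels.ghost_edge_same[THEN eqv_rel] lpa_rels.regular[THEN eqv_rel]
  lpa_rels.orth[THEN eqv_rel_zero]
  lpa_rels.ghost_edge_diff[THEN eqv_rel_zero]

lemma cl_mem: "y \<in> cl x \<longleftrightarrow> y \<in> F \<and> y \<asymp> x"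
  by (simp add: lpa_class_def eqv_def)

lemma cl_eq_iff: "x \<in> F \<Longrightarrow> cl x = cl y \<longleftrightarrow> x \<asymp> y"
  by (auto simp: set_eq_iff cl_mem intro: eqv_trans eqv_sym)

lemma cl_eqI: "x \<asymp> y \<Longrightarrow> cl x = cl y"
  by (auto simp: set_eq_iff cl_mem intro: eqv_trans eqv_sym)

lemma cl_self: "x \<in> F \<Longrightarrow> x \<in> cl x"
  by (simp add: cl_mem)

lemma L_carrier: "carrier L = cl ` F"
  by (simp add: leavitt_path_algebra_def)

lemma cl_in_L [simp, intro]: "x \<in> F \<Longrightarrow> cl x \<in> carrier L"
  by (simp add: L_carrier)

lemma L_cases [elim]:
  assumes "X \<in> carrier L" obtains x where "x \<in> F" "X = cl x"
  using assms by (auto simp: L_carrier)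

lemma L_zero: "\<zero>\<^bsub>L\<^esub> = cl 0"
  by (simp add: leavitt_path_algebra_def)

lemma L_add: "x \<in> F \<Longrightarrow> y \<in> F \<Longrightarrow> cl x \<oplus>\<^bsub>L\<^esub> cl y = cl (x + y)"
proof -
  assume *: "x \<in> F" "y \<in> F"
  have h: "cl (x' + y') = cl (x + y)" if "x' \<in> cl x" "y' \<in> cl y" for x' y'
    using that by (intro cl_eqI eqv_add) (auto simp: cl_mem)
  show ?thesis
    by (simp add: leavitt_path_algebra_def) (rule UN_UN_const[OF cl_self[OF *(1)] cl_self[OF *(2)] h])
qed

lemma L_mult: "x \<in> F \<Longrightarrow> y \<in> F \<Longrightarrow> cl x \<otimes>\<^bsub>L\<^esub> cl y = cl (x * y)"
proof -
  assume *: "x \<in> F" "y \<in> F"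
  have h: "cl (x' * y') = cl (x * y)" if "x' \<in> cl x" "y' \<in> cl y" for x' y'
    using that * by (intro cl_eqI eqv_mult) (auto simp: cl_mem)
  show ?thesis
    by (simp add: leavitt_path_algebra_def) (rule UN_UN_const[OF cl_self[OF *(1)] cl_self[OF *(2)] h])
qed

lemma L_smult: "x \<in> F \<Longrightarrow> c \<odot>\<^bsub>L\<^esub> cl x = cl (free_smult c x)"
proof -
  assume *: "x \<in> F"
  have h: "cl (free_smult c x') = cl (free_smult c x)" if "x' \<in> cl x" for x'
    using that by (intro cl_eqI eqv_smult) (auto simp: cl_mem)
  show ?thesis
    by (simp add: leavitt_path_algebra_def) (rule UN_const[OF cl_self[OF *] h])
qed

lemma L_star: "x \<in> F \<Longrightarrow> star L (cl x) = cl (free_star x)"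
proof -
  assume *: "x \<in> F"
  have h: "cl (free_star x') = cl (free_star x)" if "x' \<in> cl x" for x'
    using that by (intro cl_eqI eqv_star) (auto simp: cl_mem)
  show ?thesis
    by (simp add: leavitt_path_algebra_def) (rule UN_const[OF cl_self[OF *] h])
qed

lemmas L_ops = L_zero L_add L_mult L_smult L_star

text \<open>The vertex that fixes a generator from the right. A ghost edge runs backwards, so it
  ends at the source of its edge.\<close>

fun gen_range :: "('v, 'e) lpa_gen \<Rightarrow> 'v" where
  "gen_range (Vertex v) = v"
| "gen_range (Edge e) = head E e"
| "gen_range (Ghost e) = tail E e"

lemma gen_range_in: "gen_in E g \<Longrightarrow> gen_range g \<in> verts E"
  by (cases g) auto

lemma gen_mult_range: "gen_in E g \<Longrightarrow> free_gen g * V (gen_range g) \<asymp> free_gen g"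
  by (cases g) (auto intro: eqv_rels)

lemma gen_mult_vertex:
  assumes "gen_in E g" "v \<in> verts E" "v \<noteq> gen_range g"
  shows "free_gen g * V v \<asymp> 0"
proof -
  have "free_gen g * V v \<asymp> (free_gen g * V (gen_range g)) * V v"
    using assms by (intro eqv_mult_right eqv_sym[OF gen_mult_range]) auto
  also have "\<dots> = free_gen g * (V (gen_range g) * V v)" by (simp add: mult.assoc)
  also have "\<dots> \<asymp> free_gen g * 0"
    using assms gen_range_in by (intro eqv_mult_left eqv_rels(8)) auto
  finally show ?thesis by simp
qed

text \<open>From here on the three kinds of generator can be treated alike: this relation makes each
  of them a contraction for every invariant form.\<close>

lemma gen_partial_isometry:
  assumes "gen_in E g"
  shows "free_gen g * free_gen (gen_star g) * free_gen g \<asymp> free_gen g"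
proof (cases g)
  case (Vertex v)
  then have "V v * V v \<asymp> V v" using assms by (auto intro: eqv_rels)
  then show ?thesis using assms Vertex eqv_mult_right[of "V v * V v" "V v" "V v"]
    by (auto intro: eqv_trans)
next
  case (Edge e)
  then have e: "e \<in> arcs E" using assms by simp
  have "A e * G e * A e \<asymp> A e * V (head E e)"
    unfolding mult.assoc using e by (intro eqv_mult_left eqv_rels) auto
  also have "\<dots> \<asymp> A e" using e by (intro eqv_rels)
  finally show ?thesis using Edge by simp
next
  case (Ghost e)
  then have e: "e \<in> arcs E" using assms by simp
  have "G e * A e * G e \<asymp> V (head E e) * G e"
    using e by (intro eqv_mult_right eqv_rels) auto
  also have "\<dots> \<asymp> G e" using e by (intro eqv_rels)
  finally show ?thesis using Ghost by simp
qed

section \<open>Local units\<close>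

definition unit :: "'v set \<Rightarrow> ('v, 'e) lpa_free" where "unit S = (\<Sum>v\<in>S. V v)"

lemma unit_in_F [intro]: "S \<subseteq> verts E \<Longrightarrow> unit S \<in> F"
  by (auto simp: unit_def intro!: F_sum F_gen)

lemma unit_star [simp]: "free_star (unit S) = unit S"
  by (simp add: unit_def free_star_sum)

lemma gen_mult_unit:
  assumes "gen_in E g" "finite S" "S \<subseteq> verts E" "gen_range g \<in> S"
  shows "free_gen g * unit S \<asymp> free_gen g"
proof -
  have "free_gen g * unit S \<asymp> (\<Sum>v\<in>S. if v = gen_range g then free_gen g else 0)"
    unfolding unit_def sum_distrib_left
    by (rule eqv_sum) (use assms gen_mult_range gen_mult_vertex in auto)
  then show ?thesis using assms by simp
qed

lemma unit_idem: "finite S \<Longrightarrow> S \<subseteq> verts E \<Longrightarrow> unit S * unit S \<asymp> unit S"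
  unfolding unit_def[of S] sum_distrib_right
  by (rule eqv_sum, fold unit_def, rule gen_mult_unit) auto

text \<open>The last letter of a word determines the vertex that is needed. Quantifying over all
  finite supersets \<open>T\<close> allows the sets found for two summands to be united.\<close>

lemma right_unit_exists:
  assumes "z \<in> F"
  shows "\<exists>S. finite S \<and> S \<subseteq> verts E \<and> (\<forall>T. finite T \<longrightarrow> S \<subseteq> T \<longrightarrow> T \<subseteq> verts E \<longrightarrow> z * unit T \<asymp> z)"
  using assms
proof (induction rule: F_induct)
  case (single w c)
  define g where "g = last (letters w)"
  define w' where "w' = Free_Word (butlast (letters w))"
  have g: "gen_in E g" using single by (auto simp: valid_word_def free_word_zero_iff g_def)
  have "w' + Free_Word [g] = w"
    using single by (simp add: valid_word_def free_word_eq_iff w'_def g_def)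
  then have w: "Poly_Mapping.single w c = Poly_Mapping.single w' c * free_gen g"
    by (simp add: free_gen_def mult_single)
  show ?case
  proof (intro exI[of _ "{gen_range g}"] conjI allI impI)
    fix T assume T: "finite T" "{gen_range g} \<subseteq> T" "T \<subseteq> verts E"
    have *: "free_gen g * unit T \<asymp> free_gen g" using T g by (intro gen_mult_unit) auto
    show "Poly_Mapping.single w c * unit T \<asymp> Poly_Mapping.single w c"
    proof (cases "w' = 0")
      case True
      then show ?thesis unfolding w mult.assoc
        using eqv_smult[OF *, of c] by (simp add: free_smult_eq)
    next
      case False
      then have "valid_word w'"
        using single by (auto simp: valid_word_def w'_def dest: in_set_butlastD)
      then show ?thesis unfolding w mult.assoc by (intro eqv_mult_left *) auto
    qed
  qed (use g gen_range_in in auto)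
next
  case (add x y)
  then obtain S T where "finite S" "S \<subseteq> verts E" "\<forall>U. finite U \<longrightarrow> S \<subseteq> U \<longrightarrow> U \<subseteq> verts E \<longrightarrow> x * unit U \<asymp> x"
    "finite T" "T \<subseteq> verts E" "\<forall>U. finite U \<longrightarrow> T \<subseteq> U \<longrightarrow> U \<subseteq> verts E \<longrightarrow> y * unit U \<asymp> y" by blast
  then show ?case
    by (intro exI[of _ "S \<union> T"]) (auto simp: distrib_right intro!: eqv_add)
qed (auto intro: exI[of _ "{}"])

text \<open>The left unit comes from a right unit of \<open>free_star z\<close> by applying the
  involution.\<close>

lemma local_unit:
  assumes "z \<in> F"
  obtains S where "finite S" "S \<subseteq> verts E" "z * unit S \<asymp> z" "unit S * z \<asymp> z"
proof -
  obtain S where S: "finite S" "S \<subseteq> verts E"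
      "\<And>T. finite T \<Longrightarrow> S \<subseteq> T \<Longrightarrow> T \<subseteq> verts E \<Longrightarrow> z * unit T \<asymp> z"
    using right_unit_exists[OF assms] by blast
  obtain S' where S': "finite S'" "S' \<subseteq> verts E"
      "\<And>T. finite T \<Longrightarrow> S' \<subseteq> T \<Longrightarrow> T \<subseteq> verts E \<Longrightarrow> free_star z * unit T \<asymp> free_star z"
    using right_unit_exists[OF F_star[OF assms]] by blast
  have "free_star z * unit (S \<union> S') \<asymp> free_star z" using S S' by auto
  from eqv_star[OF this] have "unit (S \<union> S') * z \<asymp> z" by (simp add: free_star_mult)
  then show ?thesis using S S' that[of "S \<union> S'"] by auto
qed

end

section \<open>Hilbert spaces and adjoints\<close>

text \<open>The core of Cauchy--Schwarz: \<open>b\<close> is the squared modulus of an inner product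
  \<open>c\<close> of \<open>x\<close> and \<open>y\<close>, and the quadratic in \<open>t\<close>
  is the squared length of \<open>x - t c y\<close>. The value \<open>d = 0\<close> needs its own
  argument because the forms on L(E) may be degenerate.\<close>

lemma quadratic_discriminant_bound:
  fixes a b d :: real
  assumes "0 \<le> a" "0 \<le> b" "0 \<le> d" "\<And>t. 0 \<le> a - 2 * t * b + t\<^sup>2 * b * d"
  shows "b \<le> a * d"
proof (cases "d = 0")
  case True
  show ?thesis
  proof (rule ccontr)
    assume "\<not> b \<le> a * d"
    then have "b > 0" using True by simp
    then show False using assms(4)[of "(a + 1) / (2 * b)"] True by (simp add: field_simps)
  qed
next
  case False
  then show ?thesis using assms(3) assms(4)[of "1 / d"] by (simp add: field_simps power2_eq_square)
qed

lemma linear_term_zero: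
  fixes a b :: real
  assumes "0 \<le> a" "\<And>t. 0 \<le> t\<^sup>2 * a + 2 * t * b"
  shows "b = 0"
proof -
  define t where "t = - b / (a + 1)"
  have "a + 1 > 0" using assms(1) by simp
  then have b: "b = - t * (a + 1)" by (simp add: t_def field_simps)
  have "0 \<le> t\<^sup>2 * a + 2 * t * b" by (rule assms(2))
  also have "\<dots> = - (t\<^sup>2 * (a + 2))" by (simp add: b power2_eq_square algebra_simps)
  finally have "t\<^sup>2 * (a + 2) \<le> 0" by simp
  then have "t = 0" using assms(1) by (simp add: mult_le_0_iff)
  then show ?thesis by (simp add: b)
qed

text \<open>Completeness is left out so that these facts apply to the GNS space before it is known
  to be complete.\<close>

locale prehilbert = complex_module H
  for H :: "('h, 'm) hilbert_space_scheme" (structure) +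
  assumes cinner_add_left: "\<lbrakk>x \<in> carrier H; y \<in> carrier H; z \<in> carrier H\<rbrakk>
      \<Longrightarrow> cinner H (x \<oplus> y) z = cinner H x z + cinner H y z"
    and cinner_smult_left: "\<lbrakk>x \<in> carrier H; y \<in> carrier H\<rbrakk> \<Longrightarrow> cinner H (c \<odot> x) y = c * cinner H x y"
    and cinner_sym: "\<lbrakk>x \<in> carrier H; y \<in> carrier H\<rbrakk> \<Longrightarrow> cinner H y x = cnj (cinner H x y)"
    and cinner_pos: "x \<in> carrier H \<Longrightarrow> 0 \<le> Re (cinner H x x)"
    and cinner_def: "\<lbrakk>x \<in> carrier H; cinner H x x = 0\<rbrakk> \<Longrightarrow> x = \<zero>"
begin

abbreviation hn :: "'h \<Rightarrow> real" where "hn \<equiv> hnorm H"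

lemma cinner_add_right: "\<lbrakk>x \<in> carrier H; y \<in> carrier H; z \<in> carrier H\<rbrakk>
    \<Longrightarrow> cinner H x (y \<oplus> z) = cinner H x y + cinner H x z"
  by (simp add: cinner_sym[of _ x] cinner_add_left)

lemma cinner_smult_right: "\<lbrakk>x \<in> carrier H; y \<in> carrier H\<rbrakk> \<Longrightarrow> cinner H x (c \<odot> y) = cnj c * cinner H x y"
  by (simp add: cinner_sym[of _ x] cinner_smult_left)

lemma cinner_zero_left [simp]: "x \<in> carrier H \<Longrightarrow> cinner H \<zero> x = 0"
  using cinner_smult_left[of \<zero> x 0] by simp

lemma cinner_zero_right [simp]: "x \<in> carrier H \<Longrightarrow> cinner H x \<zero> = 0"
  using cinner_smult_right[of x \<zero> 0] by simp

lemma hn_nonneg [simp]: "x \<in> carrier H \<Longrightarrow> 0 \<le> hn x"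
  by (simp add: hnorm_def cinner_pos)

lemma hn_sq: "x \<in> carrier H \<Longrightarrow> (hn x)\<^sup>2 = Re (cinner H x x)"
  by (simp add: hnorm_def cinner_pos)

lemma cinner_self: "x \<in> carrier H \<Longrightarrow> cinner H x x = complex_of_real ((hn x)\<^sup>2)"
  using cinner_sym[of x x] by (simp add: hn_sq complex_eq_iff)

lemma hn_sq_add_smult:
  assumes "x \<in> carrier H" "y \<in> carrier H"
  shows "(hn (x \<oplus> c \<odot> y))\<^sup>2 = (hn x)\<^sup>2 + 2 * Re (cnj c * cinner H x y) + (cmod c)\<^sup>2 * (hn y)\<^sup>2"
proof -
  have "cinner H (x \<oplus> c \<odot> y) (x \<oplus> c \<odot> y) =
      cinner H x x + (cnj c * cinner H x y + cnj (cnj c * cinner H x y)) + c * cnj c * cinner H y y"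
    using assms by (simp add: cinner_add_left cinner_add_right cinner_smult_left cinner_smult_right
        cinner_sym[of x y] algebra_simps)
  also have "c * cnj c = complex_of_real ((cmod c)\<^sup>2)" by (simp only: complex_norm_square)
  finally have "Re (cinner H (x \<oplus> c \<odot> y) (x \<oplus> c \<odot> y)) =
      (hn x)\<^sup>2 + 2 * Re (cnj c * cinner H x y) + (cmod c)\<^sup>2 * (hn y)\<^sup>2"
    using assms by (simp add: cinner_self flip: of_real_power of_real_mult)
  then show ?thesis
    using assms by (simp add: hn_sq[of "x \<oplus> c \<odot> y"])
qed

lemma cauchy_schwarz:
  assumes "x \<in> carrier H" "y \<in> carrier H"
  shows "cmod (cinner H x y) \<le> hn x * hn y"
proof -
  define b where "b = cinner H x y"
  have "(cmod b)\<^sup>2 \<le> (hn x)\<^sup>2 * (hn y)\<^sup>2"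
  proof (rule quadratic_discriminant_bound)
    fix t :: real
    have "cnj (complex_of_real (- t) * b) * b = complex_of_real (- t * (cmod b)\<^sup>2)"
    proof -
      have "cnj b * b = complex_of_real ((cmod b)\<^sup>2)"
        by (metis complex_norm_square mult.commute)
      moreover have "cnj (complex_of_real (- t) * b) * b = complex_of_real (- t) * (cnj b * b)"
        by simp
      ultimately show ?thesis by (simp only: of_real_mult)
    qed
    then have "(hn (x \<oplus> (of_real (- t) * b) \<odot> y))\<^sup>2 =
        (hn x)\<^sup>2 + 2 * (- t * (cmod b)\<^sup>2) + (\<bar>t\<bar> * cmod b)\<^sup>2 * (hn y)\<^sup>2"
      using hn_sq_add_smult[OF assms, of "of_real (- t) * b"]
      by (simp only: b_def[symmetric] Re_complex_of_real norm_mult norm_of_real abs_minus_cancel)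
    moreover have "0 \<le> (hn (x \<oplus> (of_real (- t) * b) \<odot> y))\<^sup>2" by simp
    ultimately show "0 \<le> (hn x)\<^sup>2 - 2 * t * (cmod b)\<^sup>2 + t\<^sup>2 * (cmod b)\<^sup>2 * (hn y)\<^sup>2"
      by (simp add: power_mult_distrib)
  qed auto
  then have "(cmod b)\<^sup>2 \<le> (hn x * hn y)\<^sup>2" by (simp add: power_mult_distrib)
  then show ?thesis unfolding b_def by (rule power2_le_imp_le) (use assms in auto)
qed

lemma norm_on_hn: "norm_on H hn"
  unfolding norm_on_def
proof (intro conjI ballI allI)
  fix x assume x: "x \<in> carrier H"
  show "0 \<le> hn x" using x by simp
  show "hn x = 0 \<longleftrightarrow> x = \<zero>"
  proof
    assume "hn x = 0"
    then show "x = \<zero>" using x cinner_def[OF x] by (simp add: cinner_self)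
  qed (simp add: hnorm_def)
  show "hn (c \<odot> x) = cmod c * hn x" for c
  proof -
    have "(hn (c \<odot> x))\<^sup>2 = (cmod c * hn x)\<^sup>2"
      using hn_sq_add_smult[of \<zero> x c] x by (simp add: power_mult_distrib) (simp add: hnorm_def)
    then show ?thesis using x by (simp add: power2_eq_iff_nonneg)
  qed
  fix y assume y: "y \<in> carrier H"
  have "Re (cinner H x y) \<le> hn x * hn y"
    using cauchy_schwarz[OF x y] complex_Re_le_cmod[of "cinner H x y"] by linarith
  then have "(hn (x \<oplus> y))\<^sup>2 \<le> (hn x + hn y)\<^sup>2"
    using hn_sq_add_smult[OF x y, of 1] x y by (simp add: power2_sum)
  then show "hn (x \<oplus> y) \<le> hn x + hn y"
    by (rule power2_le_imp_le) (use x y in auto)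
qed

sublocale hn: normed_module H "hnorm H"
  by unfold_locales (rule norm_on_hn)

lemma cinner_ext:
  assumes "x \<in> carrier H" "y \<in> carrier H" "\<And>z. z \<in> carrier H \<Longrightarrow> cinner H z x = cinner H z y"
  shows "x = y"
proof -
  have "cinner H (x \<ominus> y) (x \<ominus> y) = 0"
    using assms by (simp add: diff_eq_smult cinner_add_right cinner_smult_right)
  then have "x \<ominus> y = \<zero>" using assms by (intro cinner_def) auto
  then show ?thesis using assms by (simp add: diff_eq_zero_iff)
qed

abbreviation opn :: "('h \<Rightarrow> 'h) \<Rightarrow> real" where "opn \<equiv> nrm (bounded_ops H)"

lemma bounded_opD:
  assumes "T \<in> bounded_operators H"
  shows "x \<in> carrier H \<Longrightarrow> T x \<in> carrier H"
    "\<lbrakk>x \<in> carrier H; y \<in> carrier H\<rbrakk> \<Longrightarrow> T (x \<oplus> y) = T x \<oplus> T y"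
    "x \<in> carrier H \<Longrightarrow> T (c \<odot> x) = c \<odot> T x"
    "\<exists>K\<ge>0. \<forall>x\<in>carrier H. hn (T x) \<le> K * hn x"
    "x \<notin> carrier H \<Longrightarrow> T x = undefined"
proof -
  show "\<exists>K\<ge>0. \<forall>x\<in>carrier H. hn (T x) \<le> K * hn x"
  proof -
    obtain K where "\<forall>x\<in>carrier H. hn (T x) \<le> K * hn x"
      using assms unfolding bounded_operators_def by blast
    then have K: "\<And>x. x \<in> carrier H \<Longrightarrow> hn (T x) \<le> K * hn x" by blast
    have "hn (T x) \<le> \<bar>K\<bar> * hn x" if "x \<in> carrier H" for x
      using K[OF that] mult_right_mono[OF abs_ge_self hn_nonneg[OF that], of K] by linarith
    then show ?thesis by (intro exI[of _ "\<bar>K\<bar>"]) auto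
  qed
qed (use assms in \<open>auto simp: bounded_operators_def PiE_def Pi_def extensional_def\<close>)

lemma opn_eq: "opn T = Sup {hn (T x) | x. x \<in> carrier H \<and> hn x \<le> 1}"
  by (simp add: bounded_ops_def)

lemma opn_le:
  assumes "T \<in> bounded_operators H" "0 \<le> K" "\<And>x. x \<in> carrier H \<Longrightarrow> hn (T x) \<le> K * hn x"
  shows "opn T \<le> K"
  unfolding opn_eq
proof (rule cSup_least)
  show "{hn (T x) | x. x \<in> carrier H \<and> hn x \<le> 1} \<noteq> {}"
    by (auto intro!: exI[of _ \<zero>])
  fix r assume "r \<in> {hn (T x) | x. x \<in> carrier H \<and> hn x \<le> 1}"
  then obtain x where x: "x \<in> carrier H" "hn x \<le> 1" "r = hn (T x)" by auto
  show "r \<le> K" using assms(3)[OF x(1)] mult_left_mono[OF x(2) assms(2)] x(3) by simp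
qed

lemma opn_upper:
  assumes "T \<in> bounded_operators H" "x \<in> carrier H" "hn x \<le> 1"
  shows "hn (T x) \<le> opn T"
  unfolding opn_eq
proof (rule cSup_upper)
  obtain K where K: "K \<ge> 0" "\<And>x. x \<in> carrier H \<Longrightarrow> hn (T x) \<le> K * hn x"
    using bounded_opD(4)[OF assms(1)] by auto
  show "bdd_above {hn (T x) | x. x \<in> carrier H \<and> hn x \<le> 1}"
    unfolding bdd_above_def
  proof (intro exI[of _ K] ballI)
    fix r assume "r \<in> {hn (T x) | x. x \<in> carrier H \<and> hn x \<le> 1}"
    then obtain x where x: "x \<in> carrier H" "hn x \<le> 1" "r = hn (T x)" by auto
    show "r \<le> K" using K(2)[OF x(1)] mult_left_mono[OF x(2) K(1)] x(3) by simp
  qed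
qed (use assms in blast)

lemma opn_nonneg [simp]: "T \<in> bounded_operators H \<Longrightarrow> 0 \<le> opn T"
  by (rule order_trans[OF hn_nonneg opn_upper[of T \<zero>]]) (auto intro: bounded_opD(1))

lemma opn_bound:
  assumes "T \<in> bounded_operators H" "x \<in> carrier H"
  shows "hn (T x) \<le> opn T * hn x"
proof (cases "hn x = 0")
  case True
  then show ?thesis using bounded_opD(4)[OF assms(1)] assms(2) by auto
next
  case False
  then have p: "hn x > 0" using assms by (simp add: less_le)
  have "hn (T (complex_of_real (1 / hn x) \<odot> x)) \<le> opn T"
    using assms p by (intro opn_upper) (auto simp: hn.norm_smult norm_divide)
  then show ?thesis
    using assms p bounded_opD[OF assms(1)] by (simp add: hn.norm_smult norm_divide field_simps)
qed

lemma bounded_ops_simps [simp]: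
  "carrier (bounded_ops H) = bounded_operators H"
  "S \<otimes>\<^bsub>bounded_ops H\<^esub> T = compose (carrier H) S T"
  "S \<oplus>\<^bsub>bounded_ops H\<^esub> T = (\<lambda>x\<in>carrier H. S x \<oplus> T x)"
  "c \<odot>\<^bsub>bounded_ops H\<^esub> T = (\<lambda>x\<in>carrier H. c \<odot> T x)"
  by (simp_all add: bounded_ops_def)

lemma star_bounded_ops_eqI:
  assumes "S \<in> bounded_operators H"
    "\<And>x y. x \<in> carrier H \<Longrightarrow> y \<in> carrier H \<Longrightarrow> cinner H (T x) y = cinner H x (S y)"
  shows "star (bounded_ops H) T = S"
proof -
  have "(THE S. S \<in> bounded_operators H \<and>
      (\<forall>x\<in>carrier H. \<forall>y\<in>carrier H. cinner H (T x) y = cinner H x (S y))) = S"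
  proof (rule the_equality)
    fix S' assume S': "S' \<in> bounded_operators H \<and>
      (\<forall>x\<in>carrier H. \<forall>y\<in>carrier H. cinner H (T x) y = cinner H x (S' y))"
    show "S' = S"
    proof
      fix y
      show "S' y = S y"
      proof (cases "y \<in> carrier H")
        case True
        then show ?thesis
          using S' assms bounded_opD(1)[of S] bounded_opD(1)[of S'] by (intro cinner_ext) auto
      qed (use S' assms(1) bounded_opD(5) in metis)
    qed
  qed (use assms in auto)
  then show ?thesis by (simp add: bounded_ops_def)
qed

end

sublocale hilbert_space \<subseteq> prehilbert H
  by (intro prehilbert.intro prehilbert_axioms.intro complex_module.intro module_axioms)
     (auto simp: cinner_add cinner_smult cinner_nonneg cinner_definite intro: cinner_commute)

section \<open>Riesz representation and adjoints\<close>

context hilbert_space begin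

text \<open>The representing vector is the minimiser of
  \<open>Q x = (hn x)^2 - 2 Re (\<phi> x)\<close>. The parallelogram law makes minimising sequences
  Cauchy, and the first variation of \<open>Q\<close> at the minimiser is the required identity of
  real parts.\<close>

lemma riesz_representation:
  assumes add: "\<And>x y. x \<in> carrier H \<Longrightarrow> y \<in> carrier H \<Longrightarrow> \<phi> (x \<oplus> y) = \<phi> x + \<phi> y"
    and smult: "\<And>c x. x \<in> carrier H \<Longrightarrow> \<phi> (c \<odot> x) = c * \<phi> x"
    and bound: "\<And>x. x \<in> carrier H \<Longrightarrow> cmod (\<phi> x) \<le> K * hn x"
  shows "\<exists>z\<in>carrier H. \<forall>x\<in>carrier H. \<phi> x = cinner H x z"
proof -
  define Q where "Q x = (hn x)\<^sup>2 - 2 * Re (\<phi> x)" for x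
  have Q_lower: "- K\<^sup>2 \<le> Q x" if x: "x \<in> carrier H" for x
  proof -
    have "Re (\<phi> x) \<le> hn x * K"
      using bound[OF x] complex_Re_le_cmod[of "\<phi> x"] by (simp add: mult.commute)
    moreover have "0 \<le> (hn x)\<^sup>2 + K\<^sup>2 - 2 * hn x * K"
      by (simp flip: power2_diff)
    ultimately show ?thesis unfolding Q_def by linarith
  qed
  define m where "m = Inf (Q ` carrier H)"
  have bdd: "bdd_below (Q ` carrier H)" using Q_lower by (intro bdd_belowI[of _ "- K\<^sup>2"]) auto
  have m_le: "m \<le> Q x" if "x \<in> carrier H" for x
    unfolding m_def using bdd that by (intro cInf_lower) auto
  have "\<exists>x\<in>carrier H. Q x < m + 1 / real (Suc n)" for n
  proof -
    have "Q ` carrier H \<noteq> {}" by auto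
    then show ?thesis
      using cInf_lessD[of "Q ` carrier H" "m + 1 / real (Suc n)"] unfolding m_def by auto
  qed
  then obtain x where x: "\<And>n. x n \<in> carrier H" "\<And>n. Q (x n) < m + 1 / real (Suc n)" by metis
  \<comment> \<open>The parallelogram law combined with \<open>m <= Q\<close> at the midpoint of
    \<open>a\<close> and \<open>b\<close>.\<close>
  have para: "(hn (a \<ominus> b))\<^sup>2 \<le> 2 * (Q a + Q b - 2 * m)" if a: "a \<in> carrier H" and b: "b \<in> carrier H" for a b
  proof -
    have "(hn (a \<ominus> b))\<^sup>2 = (hn a)\<^sup>2 - 2 * Re (cinner H a b) + (hn b)\<^sup>2"
      using hn_sq_add_smult[OF a b, of "- 1"] a b by (simp add: diff_eq_smult)
    moreover have "(hn (a \<oplus> b))\<^sup>2 = (hn a)\<^sup>2 + 2 * Re (cinner H a b) + (hn b)\<^sup>2"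
      using hn_sq_add_smult[OF a b, of 1] a b by simp
    moreover have "m \<le> Q ((1/2) \<odot> (a \<oplus> b))" using a b by (intro m_le) auto
    moreover have "Q ((1/2) \<odot> (a \<oplus> b)) = (hn (a \<oplus> b))\<^sup>2 / 4 - Re (\<phi> a) - Re (\<phi> b)"
      using a b by (simp add: Q_def hn.norm_smult smult add power_mult_distrib power2_eq_square field_simps)
    moreover have "A \<le> 2 * (x - 2 * f + (y - 2 * g) - 2 * m)"
      if "A = x - 2 * r + y" "B = x + 2 * r + y" "m \<le> q" "q = B / 4 - f - g"
      for A B x y r q f g :: real
      using that by (simp add: field_simps)
    ultimately show ?thesis unfolding Q_def[of a] Q_def[of b] by blast
  qed
  have "norm_Cauchy H hn x"
    unfolding hn.norm_Cauchy_iff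
  proof (intro conjI allI impI x(1))
    fix \<epsilon> :: real assume e: "0 < \<epsilon>"
    \<comment> \<open>Two values of \<open>Q\<close> within \<open>\<epsilon>^2 / 4\<close> of
      \<open>m\<close> turn the bound of \<open>para\<close> into
      \<open>2 (\<epsilon>^2 / 2) = \<epsilon>^2\<close>.\<close>
    then obtain M where M: "1 / real (Suc M) < \<epsilon>\<^sup>2 / 4"
      using reals_Archimedean[of "\<epsilon>\<^sup>2 / 4"] by (auto simp: divide_simps)
    have small: "Q (x i) < m + \<epsilon>\<^sup>2 / 4" if "i \<ge> M" for i
    proof -
      have "1 / real (Suc i) \<le> 1 / real (Suc M)" using that by (simp add: frac_le)
      from le_less_trans[OF this M] show ?thesis
        using x(2)[of i] by (meson add_strict_left_mono less_trans)
    qed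
    have "hn (x i \<ominus> x j) < \<epsilon>" if "i \<ge> M" "j \<ge> M" for i j
    proof -
      have "(hn (x i \<ominus> x j))\<^sup>2 < \<epsilon>\<^sup>2"
        using para[OF x(1) x(1), of i j] small[OF that(1)] small[OF that(2)] by argo
      then show ?thesis by (rule power2_less_imp_less) (use e in auto)
    qed
    then show "\<exists>M. \<forall>m\<ge>M. \<forall>n\<ge>M. hn (x m \<ominus> x n) < \<epsilon>" by blast
  qed
  then obtain z where z: "hn.conv x z"
    using hilbert_complete hn.norm_complete_iff by blast
  have zc: "z \<in> carrier H" using z by (rule hn.conv_carrier)
  have "(\<lambda>n. cmod (\<phi> (x n) - \<phi> z)) \<longlonglongrightarrow> 0"
  proof (rule hn.norm_tendsto_bound)
    show "(\<lambda>n. K * hn (x n \<ominus> z)) \<longlonglongrightarrow> 0"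
      using z by (intro tendsto_mult_right_zero) (auto simp: hn.conv_def)
    show "cmod (\<phi> (x n) - \<phi> z) \<le> K * hn (x n \<ominus> z)" for n
      using bound[of "x n \<ominus> z"] x(1) zc by (simp add: diff_eq_smult add smult)
  qed simp
  then have "(\<lambda>n. \<phi> (x n)) \<longlonglongrightarrow> \<phi> z"
    by (simp add: tendsto_iff dist_norm)
  then have "(\<lambda>n. Q (x n)) \<longlonglongrightarrow> Q z"
    unfolding Q_def by (intro tendsto_intros hn.conv_norm[OF z])
  moreover have "(\<lambda>n. m + 1 / real (Suc n)) \<longlonglongrightarrow> m + 0"
    by (intro tendsto_intros LIMSEQ_Suc[OF lim_1_over_n])
  ultimately have Qz: "Q z \<le> m"
    using x(2) by (simp add: LIMSEQ_le less_imp_le)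
  have re: "Re (cinner H y z) = Re (\<phi> y)" if y: "y \<in> carrier H" for y
  proof -
    have "Re (cinner H y z) - Re (\<phi> y) = 0"
    proof (rule linear_term_zero[of "(hn y)\<^sup>2"])
      fix t :: real
      have "Q z \<le> Q (z \<oplus> of_real t \<odot> y)" using Qz m_le[of "z \<oplus> of_real t \<odot> y"] zc y by simp
      then show "0 \<le> t\<^sup>2 * (hn y)\<^sup>2 + 2 * t * (Re (cinner H y z) - Re (\<phi> y))"
        using hn_sq_add_smult[OF zc y, of "of_real t"] zc y
        by (simp add: Q_def add smult cinner_sym[of y z] algebra_simps)
    qed simp
    then show ?thesis by simp
  qed
  \<comment> \<open>The imaginary parts are compared through the real parts at
    \<open>i y\<close>.\<close>
  have "\<phi> y = cinner H y z" if y: "y \<in> carrier H" for y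
    using re[OF y] re[of "\<i> \<odot> y"] y zc by (simp add: smult cinner_smult_left complex_eq_iff)
  then show ?thesis using zc by auto
qed

text \<open>The involution of \<open>bounded_ops H\<close> is a definite description; Riesz
  representation, applied for each \<open>y\<close> to \<open>x \<mapsto> cinner H (T x) y\<close>,
  provides the operator it describes.\<close>

lemma adjoint_exists:
  assumes T: "T \<in> bounded_operators H"
  shows "star (bounded_ops H) T \<in> bounded_operators H \<and>
    (\<forall>x\<in>carrier H. \<forall>y\<in>carrier H. cinner H (T x) y = cinner H x (star (bounded_ops H) T y))"
proof -
  have "\<exists>z\<in>carrier H. \<forall>x\<in>carrier H. cinner H (T x) y = cinner H x z" if y: "y \<in> carrier H" for y
  proof (rule riesz_representation)
    fix x assume x: "x \<in> carrier H"
    have "cmod (cinner H (T x) y) \<le> hn (T x) * hn y"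
      using bounded_opD(1)[OF T x] y by (rule cauchy_schwarz)
    also have "\<dots> \<le> opn T * hn x * hn y"
      using opn_bound[OF T x] y by (intro mult_right_mono) auto
    finally show "cmod (cinner H (T x) y) \<le> (opn T * hn y) * hn x" by (simp add: mult_ac)
  qed (use bounded_opD[OF T] y in \<open>simp_all add: cinner_add_left cinner_smult_left\<close>)
  then obtain S0 where S0: "\<And>y. y \<in> carrier H \<Longrightarrow> S0 y \<in> carrier H"
    "\<And>x y. y \<in> carrier H \<Longrightarrow> x \<in> carrier H \<Longrightarrow> cinner H (T x) y = cinner H x (S0 y)" by metis
  define S where "S = restrict S0 (carrier H)"
  have S: "\<And>y. y \<in> carrier H \<Longrightarrow> S y \<in> carrier H"
    "\<And>x y. y \<in> carrier H \<Longrightarrow> x \<in> carrier H \<Longrightarrow> cinner H (T x) y = cinner H x (S y)"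
    using S0 by (auto simp: S_def)
  have "S \<in> bounded_operators H"
    unfolding bounded_operators_def
  proof (intro CollectI conjI ballI allI)
    show "S \<in> carrier H \<rightarrow>\<^sub>E carrier H" using S(1) by (auto simp: S_def)
    show "S (x \<oplus> y) = S x \<oplus> S y" if "x \<in> carrier H" "y \<in> carrier H" for x y
      using that S bounded_opD(1)[OF T]
      by (intro cinner_ext) (auto simp: cinner_add_right simp flip: S(2))
    show "S (c \<odot> x) = c \<odot> S x" if "x \<in> carrier H" for c x
      using that S bounded_opD(1)[OF T]
      by (intro cinner_ext) (auto simp: cinner_smult_right simp flip: S(2))
    have "hn (S y) \<le> opn T * hn y" if y: "y \<in> carrier H" for y
    proof (cases "hn (S y) = 0")
      case False
      have "(hn (S y))\<^sup>2 = cmod (cinner H (T (S y)) y)"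
        using S y by (simp add: cinner_self norm_power)
      also have "\<dots> \<le> hn (T (S y)) * hn y"
        using bounded_opD(1)[OF T] S(1) y by (intro cauchy_schwarz) auto
      also have "\<dots> \<le> opn T * hn (S y) * hn y"
        using opn_bound[OF T] S(1) y by (intro mult_right_mono) auto
      finally have "hn (S y) * hn (S y) \<le> hn (S y) * (opn T * hn y)"
        by (simp add: power2_eq_square mult_ac)
      moreover have "hn (S y) > 0" using False hn_nonneg[OF S(1)[OF y]] by linarith
      ultimately show ?thesis by simp
    qed (use T y in simp)
    then show "\<exists>K. \<forall>x\<in>carrier H. hn (S x) \<le> K * hn x" by blast
  qed
  moreover from this have "star (bounded_ops H) T = S" using S(2) by (intro star_bounded_ops_eqI) auto
  ultimately show ?thesis using S(2) by auto
qed

end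

section \<open>Semi-inner products on Leavitt path algebras\<close>

text \<open>The common shape of the sources of seminorms on L(E): a vector in a Hilbert space
  representation, a vector moved by the branching system, and a state composed with a Cuntz-Krieger
  family. Boundedness of left multiplication is not assumed; it follows from the relations.\<close>

locale lpa_form = countable_graph E for E :: "('v, 'e) pre_digraph" +
  fixes B :: "('v, 'e) lpa_free \<Rightarrow> ('v, 'e) lpa_free \<Rightarrow> complex"
  assumes B_add: "\<lbrakk>x \<in> free_carrier E; y \<in> free_carrier E; z \<in> free_carrier E\<rbrakk> \<Longrightarrow> B (x + y) z = B x z + B y z"
    and B_smult: "\<lbrakk>x \<in> free_carrier E; y \<in> free_carrier E\<rbrakk> \<Longrightarrow> B (free_smult c x) y = c * B x y"
    and B_sym: "\<lbrakk>x \<in> free_carrier E; y \<in> free_carrier E\<rbrakk> \<Longrightarrow> B y x = cnj (B x y)"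
    and B_pos: "x \<in> free_carrier E \<Longrightarrow> 0 \<le> Re (B x x)"
    and B_adj: "\<lbrakk>x \<in> free_carrier E; y \<in> free_carrier E; z \<in> free_carrier E\<rbrakk> \<Longrightarrow> B (z * x) y = B x (free_star z * y)"
    and B_ideal: "\<lbrakk>x \<in> lpa_ideal E; y \<in> free_carrier E\<rbrakk> \<Longrightarrow> B x y = 0"
begin

definition N :: "('v, 'e) lpa_free \<Rightarrow> real" where "N x = sqrt (Re (B x x))"

lemma B_add_right: "\<lbrakk>x \<in> F; y \<in> F; z \<in> F\<rbrakk> \<Longrightarrow> B x (y + z) = B x y + B x z"
  by (simp add: B_sym[of _ x] B_add)

lemma B_smult_right: "\<lbrakk>x \<in> F; y \<in> F\<rbrakk> \<Longrightarrow> B x (free_smult c y) = cnj c * B x y"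
  by (simp add: B_sym[of _ x] B_smult)

lemma B_zero [simp]: "y \<in> F \<Longrightarrow> B 0 y = 0"
  using B_ideal[OF lpa_ideal.zero] by simp

lemma B_diff: "\<lbrakk>x \<in> F; y \<in> F; z \<in> F\<rbrakk> \<Longrightarrow> B (x - y) z = B x z - B y z"
  using B_add[of "x - y" y z] by simp

lemma B_diff_right: "\<lbrakk>x \<in> F; y \<in> F; z \<in> F\<rbrakk> \<Longrightarrow> B x (y - z) = B x y - B x z"
  using B_add_right[of x "y - z" z] by simp

lemma B_eqv: "\<lbrakk>x \<asymp> y; x \<in> F; y \<in> F; z \<in> F\<rbrakk> \<Longrightarrow> B x z = B y z"
  using B_ideal[of "x - y" z] by (simp add: eqv_def B_diff)

lemma B_eqv_right: "\<lbrakk>x \<asymp> y; x \<in> F; y \<in> F; z \<in> F\<rbrakk> \<Longrightarrow> B z x = B z y"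
  by (simp add: B_sym[of _ z] B_eqv)

lemma N_nonneg [simp]: "x \<in> F \<Longrightarrow> 0 \<le> N x"
  by (simp add: N_def B_pos)

lemma N_0 [simp]: "N 0 = 0"
  by (simp add: N_def)

lemma N_sq: "x \<in> F \<Longrightarrow> (N x)\<^sup>2 = Re (B x x)"
  by (simp add: N_def B_pos)

lemma B_self: "x \<in> F \<Longrightarrow> B x x = complex_of_real ((N x)\<^sup>2)"
  using B_sym[of x x] by (simp add: N_sq complex_eq_iff)

lemma N_eqv: "\<lbrakk>x \<asymp> y; x \<in> F; y \<in> F\<rbrakk> \<Longrightarrow> N x = N y"
  by (simp add: N_def B_eqv[of x y] B_eqv_right[of x y])

lemma N_sq_add_smult:
  assumes "x \<in> F" "y \<in> F"
  shows "(N (x + free_smult c y))\<^sup>2 = (N x)\<^sup>2 + 2 * Re (cnj c * B x y) + (cmod c)\<^sup>2 * (N y)\<^sup>2"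
proof -
  have "B (x + free_smult c y) (x + free_smult c y) =
      B x x + (cnj c * B x y + cnj (cnj c * B x y)) + c * cnj c * B y y"
    using assms by (simp add: B_add B_add_right B_smult B_smult_right B_sym[of x y] algebra_simps)
  also have "c * cnj c = complex_of_real ((cmod c)\<^sup>2)" by (simp only: complex_norm_square)
  finally have "Re (B (x + free_smult c y) (x + free_smult c y)) =
      (N x)\<^sup>2 + 2 * Re (cnj c * B x y) + (cmod c)\<^sup>2 * (N y)\<^sup>2"
    using assms by (simp add: B_self flip: of_real_power of_real_mult)
  then show ?thesis
    using assms by (simp add: N_sq[of "x + free_smult c y"])
qed

lemma B_cauchy_schwarz:
  assumes "x \<in> F" "y \<in> F" shows "cmod (B x y) \<le> N x * N y"
proof -
  define b where "b = B x y"
  have "(cmod b)\<^sup>2 \<le> (N x)\<^sup>2 * (N y)\<^sup>2"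
  proof (rule quadratic_discriminant_bound)
    fix t :: real
    have "cnj b * b = complex_of_real ((cmod b)\<^sup>2)"
      by (metis complex_norm_square mult.commute)
    moreover have "cnj (complex_of_real (- t) * b) * b = complex_of_real (- t) * (cnj b * b)"
      by simp
    ultimately have "cnj (complex_of_real (- t) * b) * b = complex_of_real (- t * (cmod b)\<^sup>2)"
      by (simp only: of_real_mult)
    then have "(N (x + free_smult (of_real (- t) * b) y))\<^sup>2 =
        (N x)\<^sup>2 + 2 * (- t * (cmod b)\<^sup>2) + (\<bar>t\<bar> * cmod b)\<^sup>2 * (N y)\<^sup>2"
      using N_sq_add_smult[OF assms, of "of_real (- t) * b"]
      by (simp only: b_def[symmetric] Re_complex_of_real norm_mult norm_of_real abs_minus_cancel)
    moreover have "0 \<le> (N (x + free_smult (of_real (- t) * b) y))\<^sup>2" by simp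
    ultimately show "0 \<le> (N x)\<^sup>2 - 2 * t * (cmod b)\<^sup>2 + t\<^sup>2 * (cmod b)\<^sup>2 * (N y)\<^sup>2"
      by (simp add: power_mult_distrib)
  qed auto
  then have "(cmod b)\<^sup>2 \<le> (N x * N y)\<^sup>2" by (simp add: power_mult_distrib)
  then show ?thesis unfolding b_def by (rule power2_le_imp_le) (use assms in auto)
qed

lemma N_triangle:
  assumes "x \<in> F" "y \<in> F" shows "N (x + y) \<le> N x + N y"
proof -
  have "Re (B x y) \<le> N x * N y"
    using B_cauchy_schwarz[OF assms] complex_Re_le_cmod[of "B x y"] by linarith
  then have "(N (x + y))\<^sup>2 \<le> (N x + N y)\<^sup>2"
    using N_sq_add_smult[OF assms, of 1] by (simp add: power2_sum free_smult_eq)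
  then show ?thesis by (rule power2_le_imp_le) (use assms in auto)
qed

lemma N_smult: "x \<in> F \<Longrightarrow> N (free_smult c x) = cmod c * N x"
proof -
  assume x: "x \<in> F"
  have "(N (free_smult c x))\<^sup>2 = (cmod c * N x)\<^sup>2"
    using N_sq_add_smult[of 0 x c] x by (simp add: power_mult_distrib)
  then show ?thesis using x by (simp add: power2_eq_iff_nonneg)
qed

lemma N_minus: "x \<in> F \<Longrightarrow> N (- x) = N x"
  using N_smult[of x "- 1"] by (simp add: free_smult_minus_one)

lemma N_diff_commute: "\<lbrakk>x \<in> F; y \<in> F\<rbrakk> \<Longrightarrow> N (x - y) = N (y - x)"
  using N_minus[of "x - y"] by simp

lemma N_diff: "\<lbrakk>x \<in> F; y \<in> F\<rbrakk> \<Longrightarrow> \<bar>N x - N y\<bar> \<le> N (x - y)"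
  using N_triangle[of "x - y" y] N_triangle[of "y - x" x] N_diff_commute[of x y] by simp

lemma N_sum: "(\<And>i. i \<in> S \<Longrightarrow> f i \<in> F) \<Longrightarrow> N (\<Sum>i\<in>S. f i) \<le> (\<Sum>i\<in>S. N (f i))"
proof (induction S rule: infinite_finite_induct)
  case (insert i S)
  then show ?case using N_triangle[of "f i" "sum f S"] F_sum[of S f] by simp
qed auto

text \<open>\<open>q = g\<^sup>* g\<close> is a projection, so \<open>N (g x)\<^sup>2 = B x (q x) \<le> N x N (q x)\<close> and \<open>N (q x) = N (g x)\<close>.\<close>

lemma N_gen:
  assumes "gen_in E g" "x \<in> F" shows "N (free_gen g * x) \<le> N x"
proof -
  define y where "y = free_gen (gen_star g) * (free_gen g * x)"
  have yF: "y \<in> F" using assms by (simp add: y_def)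
  have gx: "B (free_gen g * x) (free_gen g * x) = B x y"
    using assms by (simp add: B_adj y_def)
  have "B y y = B (free_gen g * x) (free_gen g * y)"
    using assms B_adj[of "free_gen g * x" y "free_gen (gen_star g)"] by (simp add: y_def)
  also have "\<dots> = B (free_gen g * x) (free_gen g * x)"
  proof (rule B_eqv_right)
    show "free_gen g * y \<asymp> free_gen g * x"
      using eqv_mult_right[OF gen_partial_isometry[OF assms(1)] assms(2)]
      by (simp add: y_def mult.assoc)
  qed (use assms yF in auto)
  finally have yy: "N y = N (free_gen g * x)" by (simp add: N_def)
  have "(N (free_gen g * x))\<^sup>2 = Re (B x y)" using assms by (simp add: N_sq gx)
  also have "\<dots> \<le> N x * N (free_gen g * x)"
    unfolding yy[symmetric]
    using B_cauchy_schwarz[OF assms(2) yF] complex_Re_le_cmod[of "B x y"] by linarith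
  finally have le: "N (free_gen g * x) * N (free_gen g * x) \<le> N x * N (free_gen g * x)"
    by (simp add: power2_eq_square)
  show ?thesis
  proof (cases "N (free_gen g * x) = 0")
    case False
    then have "N (free_gen g * x) > 0" using assms N_nonneg[of "free_gen g * x"] by (simp add: less_le)
    then show ?thesis using le by simp
  qed (use assms in simp)
qed

text \<open>Stated for lists of letters so that the induction can start at the empty word, which
  does not belong to \<open>F\<close>.\<close>

lemma N_word:
  assumes "\<forall>g\<in>set gs. gen_in E g" "x \<in> F"
  shows "Poly_Mapping.single (Free_Word gs) c * x \<in> F \<and>
    N (Poly_Mapping.single (Free_Word gs) c * x) \<le> cmod c * N x"
  using assms(1)
proof (induction gs)
  case Nil
  then show ?case using assms(2) N_smult[of x c] by (simp add: free_smult_eq)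
next
  case (Cons g gs)
  have "Poly_Mapping.single (Free_Word (g # gs)) c * x =
      free_gen g * (Poly_Mapping.single (Free_Word gs) c * x)"
    by (simp add: free_gen_def mult_single plus_free_word_def flip: mult.assoc)
  then show ?case using Cons N_gen[of g "Poly_Mapping.single (Free_Word gs) c * x"] by auto
qed

end

text \<open>The l1 norm of the coefficients. Since words act as contractions, it bounds every
  representation at once, which makes the supremum defining the norm finite.\<close>

definition coeff_norm :: "('w \<Rightarrow>\<^sub>0 complex) \<Rightarrow> real" where
  "coeff_norm z = (\<Sum>w\<in>Poly_Mapping.keys z. cmod (Poly_Mapping.lookup z w))"

lemma coeff_norm_nonneg [simp]: "0 \<le> coeff_norm z"
  by (simp add: coeff_norm_def sum_nonneg)

lemma sum_single_lookup: "(\<Sum>w\<in>Poly_Mapping.keys z. Poly_Mapping.single w (Poly_Mapping.lookup z w)) = z"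
  by (rule poly_mapping_eqI) (auto simp: lookup_sum lookup_single when_def in_keys_iff sum.delta')

context lpa_form begin

lemma N_mult:
  assumes "z \<in> F" "x \<in> F" shows "N (z * x) \<le> coeff_norm z * N x"
proof -
  let ?f = "\<lambda>w. Poly_Mapping.single w (Poly_Mapping.lookup z w) * x"
  have w: "?f w \<in> F \<and> N (?f w) \<le> cmod (Poly_Mapping.lookup z w) * N x" if "w \<in> Poly_Mapping.keys z" for w
    using that assms N_word[of "letters w" x "Poly_Mapping.lookup z w"]
    by (auto simp: F_iff valid_word_def)
  have "z * x = (\<Sum>w\<in>Poly_Mapping.keys z. ?f w)"
    by (metis sum_single_lookup sum_distrib_right)
  then have "N (z * x) \<le> (\<Sum>w\<in>Poly_Mapping.keys z. N (?f w))"
    using N_sum[of "Poly_Mapping.keys z" ?f] w by simp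
  also have "\<dots> \<le> (\<Sum>w\<in>Poly_Mapping.keys z. cmod (Poly_Mapping.lookup z w) * N x)"
    by (rule sum_mono) (use w in auto)
  finally show ?thesis by (simp add: coeff_norm_def sum_distrib_right)
qed

section \<open>The GNS construction\<close>

text \<open>The element \<open>0\<close> is included so that the set is nonempty and can be
  enumerated even if the graph has no vertices.\<close>

definition basis :: "('v, 'e) lpa_free set" where
  "basis = insert 0 ((\<lambda>w. Poly_Mapping.single w 1) ` {w. valid_word w})"

definition d :: "nat \<Rightarrow> ('v, 'e) lpa_free" where "d = from_nat_into basis"

lemma range_d: "range d = basis"
proof -
  define S where "S = Vertex ` verts E \<union> Edge ` arcs E \<union> Ghost ` arcs E"
  have "g \<in> S" if "gen_in E g" for g using that by (cases g) (auto simp: S_def)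
  then have "{w. valid_word w} \<subseteq> Free_Word ` lists S"
    by (auto simp: valid_word_def in_lists_conv_set intro!: image_eqI[of _ _ "letters _"])
  moreover have "countable (Free_Word ` lists S)"
    using countable_verts countable_arcs by (auto simp: S_def)
  ultimately have "countable {w. valid_word w}" by (rule countable_subset)
  then show ?thesis unfolding d_def basis_def by (intro range_from_nat_into) auto
qed

lemma d_in_F [simp]: "d k \<in> F"
proof -
  have "basis \<subseteq> F" by (auto simp: basis_def)
  then show ?thesis using range_d by blast
qed

definition cau :: "(nat \<Rightarrow> ('v, 'e) lpa_free) \<Rightarrow> bool" where
  "cau x \<longleftrightarrow> (\<forall>n. x n \<in> F) \<and> (\<forall>\<epsilon>>0. \<exists>M. \<forall>m\<ge>M. \<forall>n\<ge>M. N (x m - x n) < \<epsilon>)"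

lemma cau_F: "cau x \<Longrightarrow> x n \<in> F"
  by (simp add: cau_def)

lemma cau_const: "z \<in> F \<Longrightarrow> cau (\<lambda>n. z)"
  by (simp add: cau_def)

lemma cau_dominated:
  assumes "cau x" "\<And>n. y n \<in> F" "0 \<le> K" "\<And>m n. N (y m - y n) \<le> K * N (x m - x n)"
  shows "cau y"
  unfolding cau_def
proof (intro conjI allI impI assms(2))
  fix \<epsilon> :: real assume e: "0 < \<epsilon>"
  then have "0 < \<epsilon> / (K + 1)" using assms(3) by simp
  then obtain M where M: "\<And>m n. m \<ge> M \<Longrightarrow> n \<ge> M \<Longrightarrow> N (x m - x n) < \<epsilon> / (K + 1)"
    using assms(1) unfolding cau_def by blast
  have "N (y m - y n) < \<epsilon>" if "m \<ge> M" "n \<ge> M" for m n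
  proof -
    have "0 \<le> N (x m - x n)" using cau_F[OF assms(1)] by (intro N_nonneg) auto
    then have "N (y m - y n) \<le> (K + 1) * N (x m - x n)"
      using assms(4)[of m n] by (simp add: distrib_right)
    also have "\<dots> < (K + 1) * (\<epsilon> / (K + 1))"
      using M[OF that] assms(3) by (intro mult_strict_left_mono) auto
    also have "\<dots> = \<epsilon>" using assms(3) by simp
    finally show ?thesis .
  qed
  then show "\<exists>M. \<forall>m\<ge>M. \<forall>n\<ge>M. N (y m - y n) < \<epsilon>" by blast
qed

lemma cau_mult: "cau x \<Longrightarrow> a \<in> F \<Longrightarrow> cau (\<lambda>n. a * x n)"
  by (rule cau_dominated[of x _ "coeff_norm a"])
     (auto simp: cau_F right_diff_distrib[symmetric] intro!: N_mult)

lemma cau_smult: "cau x \<Longrightarrow> cau (\<lambda>n. free_smult c (x n))"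
proof (rule cau_dominated[of x _ "cmod c"])
  assume x: "cau x"
  show "N (free_smult c (x m) - free_smult c (x n)) \<le> cmod c * N (x m - x n)" for m n
    using N_smult[of "x m - x n" c] cau_F[OF x] by (simp add: free_smult_eq right_diff_distrib)
qed (auto simp: cau_F)

lemma cau_add:
  assumes "cau x" "cau y" shows "cau (\<lambda>n. x n + y n)"
  unfolding cau_def
proof (intro conjI allI impI)
  show "x n + y n \<in> F" for n using assms by (simp add: cau_F)
  fix \<epsilon> :: real assume "0 < \<epsilon>"
  then have "0 < \<epsilon>/2" by simp
  then obtain M1 M2 where
    M: "\<And>m n. m \<ge> M1 \<Longrightarrow> n \<ge> M1 \<Longrightarrow> N (x m - x n) < \<epsilon>/2" "\<And>m n. m \<ge> M2 \<Longrightarrow> n \<ge> M2 \<Longrightarrow> N (y m - y n) < \<epsilon>/2"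
    using assms unfolding cau_def by metis
  have "N (x m + y m - (x n + y n)) < \<epsilon>" if "m \<ge> max M1 M2" "n \<ge> max M1 M2" for m n
  proof -
    have eq: "x m + y m - (x n + y n) = (x m - x n) + (y m - y n)" by simp
    have "N (x m + y m - (x n + y n)) \<le> N (x m - x n) + N (y m - y n)"
      unfolding eq using assms by (intro N_triangle) (simp_all add: cau_F)
    also have "\<dots> < \<epsilon>/2 + \<epsilon>/2" using that by (intro add_strict_mono M) auto
    finally show ?thesis by simp
  qed
  then show "\<exists>M. \<forall>m\<ge>M. \<forall>n\<ge>M. N (x m + y m - (x n + y n)) < \<epsilon>" by blast
qed

lemma cau_bounded: "cau x \<Longrightarrow> \<exists>K>0. \<forall>n. N (x n) \<le> K"
proof -
  assume x: "cau x"
  have "Cauchy (\<lambda>n. N (x n))"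
    unfolding Cauchy_def
  proof (intro allI impI)
    fix e :: real assume "0 < e"
    then obtain M where "\<forall>m\<ge>M. \<forall>n\<ge>M. N (x m - x n) < e" using x unfolding cau_def by blast
    then show "\<exists>M. \<forall>m\<ge>M. \<forall>n\<ge>M. dist (N (x m)) (N (x n)) < e"
      using N_diff cau_F[OF x] unfolding dist_real_def by (meson le_less_trans)
  qed
  then have "Bseq (\<lambda>n. N (x n))" by (rule Cauchy_Bseq)
  then obtain K where "K > 0" "\<And>n. norm (N (x n)) \<le> K" by (auto elim: BseqE)
  then show ?thesis using cau_F[OF x] by (intro exI[of _ K]) auto
qed

lemma B_diff_bound:
  assumes "x \<in> F" "y \<in> F" "x' \<in> F" "y' \<in> F" "N y \<le> K" "N x' \<le> K"
  shows "cmod (B x y - B x' y') \<le> K * (N (x - x') + N (y - y'))"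
proof -
  have "B x y - B x' y' = B (x - x') y + B x' (y - y')"
    using assms by (simp add: B_diff B_diff_right)
  then have "cmod (B x y - B x' y') \<le> cmod (B (x - x') y) + cmod (B x' (y - y'))"
    by (simp add: norm_triangle_ineq)
  also have "\<dots> \<le> N (x - x') * N y + N x' * N (y - y')"
    using assms by (intro add_mono B_cauchy_schwarz) auto
  also have "\<dots> \<le> N (x - x') * K + K * N (y - y')"
    using assms by (intro add_mono mult_left_mono mult_right_mono) auto
  finally show ?thesis by (simp add: algebra_simps)
qed

lemma B_convergent:
  assumes x: "cau x" and y: "cau y" shows "convergent (\<lambda>n. B (x n) (y n))"
proof (rule Cauchy_convergent, unfold Cauchy_def, intro allI impI)
  fix e :: real assume e: "0 < e"
  obtain K1 K2 where "K1 > 0" "\<And>n. N (x n) \<le> K1" "K2 > 0" "\<And>n. N (y n) \<le> K2"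
    using cau_bounded[OF x] cau_bounded[OF y] by blast
  then obtain K where K: "K > 0" "\<And>n. N (x n) \<le> K" "\<And>n. N (y n) \<le> K"
    by (metis max.coboundedI1 max.coboundedI2 less_max_iff_disj)
  have "0 < e / (2 * K)" using e K by simp
  then obtain M1 M2 where M: "\<And>m n. m \<ge> M1 \<Longrightarrow> n \<ge> M1 \<Longrightarrow> N (x m - x n) < e / (2 * K)"
      "\<And>m n. m \<ge> M2 \<Longrightarrow> n \<ge> M2 \<Longrightarrow> N (y m - y n) < e / (2 * K)"
    using x y unfolding cau_def by metis
  have "dist (B (x m) (y m)) (B (x n) (y n)) < e" if "m \<ge> max M1 M2" "n \<ge> max M1 M2" for m n
  proof -
    have "dist (B (x m) (y m)) (B (x n) (y n)) \<le> K * (N (x m - x n) + N (y m - y n))"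
      unfolding dist_norm using K x y by (intro B_diff_bound) (auto simp: cau_F)
    also have "\<dots> < K * (e / (2 * K) + e / (2 * K))"
      using that K by (intro mult_strict_left_mono add_strict_mono M) auto
    finally show ?thesis using K by simp
  qed
  then show "\<exists>M. \<forall>m\<ge>M. \<forall>n\<ge>M. dist (B (x m) (y m)) (B (x n) (y n)) < e" by blast
qed

text \<open>The vector represented by a Cauchy sequence \<open>x\<close> is encoded by its inner
  products \<open>g k\<close> with the countable family \<open>d\<close>. Vectors thus become
  elements of \<open>nat \<Rightarrow> complex\<close>, the type over which
  \<open>leavitt_norm\<close> takes its supremum.\<close>

definition lims :: "(nat \<Rightarrow> ('v, 'e) lpa_free) \<Rightarrow> (nat \<Rightarrow> complex) \<Rightarrow> bool" where
  "lims x g \<longleftrightarrow> cau x \<and> (\<forall>k. (\<lambda>n. B (x n) (d k)) \<longlonglongrightarrow> g k)"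

lemma lims_cau: "lims x g \<Longrightarrow> cau x"
  by (simp add: lims_def)

lemma lims_exists: "cau x \<Longrightarrow> \<exists>g. lims x g"
proof -
  assume x: "cau x"
  have "\<forall>k. \<exists>l. (\<lambda>n. B (x n) (d k)) \<longlonglongrightarrow> l"
    using B_convergent[OF x cau_const[OF d_in_F]] by (simp add: convergent_def)
  then show ?thesis using x unfolding lims_def by metis
qed

lemma lims_add: "lims x g \<Longrightarrow> lims y h \<Longrightarrow> lims (\<lambda>n. x n + y n) (\<lambda>k. g k + h k)"
  unfolding lims_def by (auto simp: cau_add B_add cau_F intro!: tendsto_add)

lemma lims_smult: "lims x g \<Longrightarrow> lims (\<lambda>n. free_smult c (x n)) (\<lambda>k. c * g k)"
  unfolding lims_def by (auto simp: cau_smult B_smult cau_F intro!: tendsto_mult)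

lemma lims_diff: "lims x g \<Longrightarrow> lims y h \<Longrightarrow> lims (\<lambda>n. x n - y n) (\<lambda>k. g k - h k)"
  using lims_add[of x g "\<lambda>n. free_smult (- 1) (y n)" "\<lambda>k. - 1 * h k"] lims_smult[of y h "- 1"]
  by (simp add: free_smult_minus_one)

text \<open>The coordinates of an element of the completion against the countable family \<^const>\<open>d\<close>
  determine it.\<close>

lemma lims_zero_imp_null:
  assumes "lims x (\<lambda>k. 0)" shows "(\<lambda>n. N (x n)) \<longlonglongrightarrow> 0"
proof -
  have x: "cau x" using assms by (simp add: lims_def)
  have Bz: "(\<lambda>n. B (x n) z) \<longlonglongrightarrow> 0" if "z \<in> F" for z
    using that
  proof (induction rule: F_induct)
    case (single w c)
    then have "Poly_Mapping.single w 1 \<in> range d" unfolding range_d basis_def by auto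
    then obtain k where "d k = Poly_Mapping.single w 1" by auto
    then have "Poly_Mapping.single w c = free_smult c (d k)" by (simp add: free_smult_eq)
    then show ?case
      using assms x by (auto simp: lims_def B_smult_right cau_F intro!: tendsto_mult_right_zero)
  next
    case (add y z)
    then show ?case using x tendsto_add_zero by (fastforce simp: B_add_right cau_F)
  next
    case zero
    then show ?case using x by (simp add: B_sym[of 0] B_sym[of _ 0] cau_F)
  qed
  obtain K where K: "K > 0" "\<And>n. N (x n) \<le> K" using cau_bounded[OF x] by blast
  \<comment> \<open>\<open>B (x n) (x n)\<close> is split at a fixed late index \<open>M\<close>:
    the part against \<open>x n - x M\<close> is small by the Cauchy property, and the part against
    the fixed vector \<open>x M\<close> tends to \<open>0\<close> by \<open>Bz\<close>.\<close>
  have "(\<lambda>n. (N (x n))\<^sup>2) \<longlonglongrightarrow> 0"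
  proof (rule LIMSEQ_I)
    fix e :: real assume e: "0 < e"
    then have "0 < e / (2 * K)" using K by simp
    then obtain M where M: "\<And>m n. m \<ge> M \<Longrightarrow> n \<ge> M \<Longrightarrow> N (x m - x n) < e / (2 * K)"
      using x unfolding cau_def by blast
    have "x M \<in> F" using x by (rule cau_F)
    then obtain M' where M': "\<And>n. n \<ge> M' \<Longrightarrow> cmod (B (x n) (x M)) < e / 2"
      using LIMSEQ_D[OF Bz[OF \<open>x M \<in> F\<close>], of "e / 2"] e by auto
    have "norm ((N (x n))\<^sup>2 - 0) < e" if n: "n \<ge> max M M'" for n
    proof -
      have xF: "x n \<in> F" "x M \<in> F" using x by (auto simp: cau_F)
      have "(N (x n))\<^sup>2 = cmod (B (x n) (x n))"
        using xF by (simp add: B_self norm_power)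
      also have "B (x n) (x n) = B (x n) (x n - x M) + B (x n) (x M)"
        using xF by (simp add: B_diff_right)
      also have "cmod \<dots> \<le> cmod (B (x n) (x n - x M)) + cmod (B (x n) (x M))"
        by (rule norm_triangle_ineq)
      also have "\<dots> < K * (e / (2 * K)) + e / 2"
      proof (rule add_le_less_mono)
        have "cmod (B (x n) (x n - x M)) \<le> N (x n) * N (x n - x M)"
          using xF by (intro B_cauchy_schwarz) auto
        also have "\<dots> \<le> K * (e / (2 * K))"
          using K M[of n M] n xF by (intro mult_mono) auto
        finally show "cmod (B (x n) (x n - x M)) \<le> K * (e / (2 * K))" .
      qed (use M' n in auto)
      finally show ?thesis using K by simp
    qed
    then show "\<exists>M. \<forall>n\<ge>M. norm ((N (x n))\<^sup>2 - 0) < e" by blast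
  qed
  from tendsto_real_sqrt[OF this] show ?thesis using x by (simp add: cau_F)
qed

definition pick :: "(nat \<Rightarrow> complex) \<Rightarrow> nat \<Rightarrow> ('v, 'e) lpa_free" where
  "pick g = (SOME x. lims x g)"

definition ip :: "(nat \<Rightarrow> complex) \<Rightarrow> (nat \<Rightarrow> complex) \<Rightarrow> complex" where
  "ip g h = lim (\<lambda>n. B (pick g n) (pick h n))"

lemma lims_pick: "lims x g \<Longrightarrow> lims (pick g) g"
  unfolding pick_def by (rule someI[where P = "\<lambda>x. lims x g"])

lemma lims_pick_null: "lims x g \<Longrightarrow> (\<lambda>n. N (x n - pick g n)) \<longlonglongrightarrow> 0"
  using lims_zero_imp_null lims_diff[OF _ lims_pick, of x g] by fastforce

text \<open>Independence of the choice made by \<open>pick\<close>: two sequences with the same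
  coordinates differ by a null sequence, and the form is continuous on bounded sequences.\<close>

lemma lims_ip:
  assumes x: "lims x g" and y: "lims y h" shows "(\<lambda>n. B (x n) (y n)) \<longlonglongrightarrow> ip g h"
proof -
  note c = lims_cau[OF x] lims_cau[OF y] lims_cau[OF lims_pick[OF x]] lims_cau[OF lims_pick[OF y]]
  have "(\<lambda>n. B (pick g n) (pick h n)) \<longlonglongrightarrow> ip g h"
    unfolding ip_def using B_convergent[OF c(3,4)] by (simp add: convergent_LIMSEQ_iff)
  moreover have "(\<lambda>n. B (x n) (y n) - B (pick g n) (pick h n)) \<longlonglongrightarrow> 0"
  proof -
    obtain K1 K2 where "K1 > 0" "\<And>n. N (y n) \<le> K1" "K2 > 0" "\<And>n. N (pick g n) \<le> K2"
      using cau_bounded[OF c(2)] cau_bounded[OF c(3)] by blast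
    then obtain K where K: "K > 0" "\<And>n. N (y n) \<le> K" "\<And>n. N (pick g n) \<le> K"
      by (metis max.coboundedI1 max.coboundedI2 less_max_iff_disj)
    have "(\<lambda>n. K * (N (x n - pick g n) + N (y n - pick h n))) \<longlonglongrightarrow> 0"
      by (intro tendsto_mult_right_zero tendsto_add_zero lims_pick_null x y)
    then show ?thesis
      by (rule Lim_null_comparison[rotated])
         (use K c in \<open>auto intro!: always_eventually B_diff_bound simp: cau_F\<close>)
  qed
  ultimately show ?thesis by (rule Lim_transform)
qed

definition Hc :: "(nat \<Rightarrow> complex) set" where "Hc = {g. \<exists>x. lims x g}"

definition Hs :: "(nat \<Rightarrow> complex) hilbert_space" where
  "Hs = \<lparr>carrier = Hc, monoid.mult = undefined, one = undefined, ring.zero = (\<lambda>k. 0),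
     add = (\<lambda>g h k. g k + h k), smult = (\<lambda>c g k. c * g k), cinner = ip\<rparr>"

lemma Hs_simps [simp]:
  "carrier Hs = Hc" "\<zero>\<^bsub>Hs\<^esub> = (\<lambda>k. 0)" "g \<oplus>\<^bsub>Hs\<^esub> h = (\<lambda>k. g k + h k)"
  "c \<odot>\<^bsub>Hs\<^esub> g = (\<lambda>k. c * g k)" "cinner Hs = ip"
  by (simp_all add: Hs_def)

lemma HcI: "lims x g \<Longrightarrow> g \<in> Hc"
  by (auto simp: Hc_def)

lemma HcE [elim]: "g \<in> Hc \<Longrightarrow> (\<And>x. lims x g \<Longrightarrow> thesis) \<Longrightarrow> thesis"
  by (auto simp: Hc_def)

lemma lims_0: "lims (\<lambda>n. 0) (\<lambda>k. 0)"
  by (simp add: lims_def cau_const)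

lemma Hc_smult: "g \<in> Hc \<Longrightarrow> (\<lambda>k. c * g k) \<in> Hc"
  by (auto intro: HcI lims_smult)

lemma Hc_add: "g \<in> Hc \<Longrightarrow> h \<in> Hc \<Longrightarrow> (\<lambda>k. g k + h k) \<in> Hc"
  unfolding Hc_def using lims_add by blast

lemma complex_module_Hs: "complex_module Hs"
proof (rule complex_module.intro, rule moduleI)
  show "abelian_group Hs"
  proof (rule abelian_groupI)
    fix g assume "g \<in> carrier Hs"
    then have "(\<lambda>k. - 1 * g k) \<in> carrier Hs" using Hc_smult[of g "- 1"] by simp
    then show "\<exists>h\<in>carrier Hs. h \<oplus>\<^bsub>Hs\<^esub> g = \<zero>\<^bsub>Hs\<^esub>"
      by (intro bexI[of _ "\<lambda>k. - 1 * g k"]) auto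
  qed (auto intro: Hc_add HcI lims_0 simp: add_ac)
qed (auto simp: cring_complex_ring algebra_simps intro: Hc_smult)

lemma ip_eqI: "lims x g \<Longrightarrow> lims y h \<Longrightarrow> (\<lambda>n. B (x n) (y n)) \<longlonglongrightarrow> l \<Longrightarrow> ip g h = l"
  using lims_ip LIMSEQ_unique by blast

lemma prehilbert_Hs: "prehilbert Hs"
proof (intro prehilbert.intro prehilbert_axioms.intro complex_module_Hs)
  fix g h assume "g \<in> carrier Hs" "h \<in> carrier Hs"
  then obtain x y where x: "lims x g" and y: "lims y h" by (auto simp: Hc_def)
  show "cinner Hs (g \<oplus>\<^bsub>Hs\<^esub> k) h = cinner Hs g h + cinner Hs k h" if k: "k \<in> carrier Hs" for k
  proof -
    obtain z where z: "lims z k" using k by (auto simp: Hc_def)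
    have "(\<lambda>n. B (x n + z n) (y n)) = (\<lambda>n. B (x n) (y n) + B (z n) (y n))"
      using x y z by (simp add: B_add cau_F lims_cau)
    then have "(\<lambda>n. B (x n + z n) (y n)) \<longlonglongrightarrow> ip g h + ip k h"
      using x y z by (simp add: tendsto_add lims_ip)
    from ip_eqI[OF lims_add[OF x z] y this] show ?thesis by simp
  qed
  show "cinner Hs (c \<odot>\<^bsub>Hs\<^esub> g) h = c * cinner Hs g h" for c
  proof -
    have "(\<lambda>n. B (free_smult c (x n)) (y n)) = (\<lambda>n. c * B (x n) (y n))"
      using x y by (simp add: B_smult cau_F lims_cau)
    then have "(\<lambda>n. B (free_smult c (x n)) (y n)) \<longlonglongrightarrow> c * ip g h"
      using x y by (simp add: tendsto_mult lims_ip)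
    from ip_eqI[OF lims_smult[OF x] y this] show ?thesis by simp
  qed
  show "cinner Hs h g = cnj (cinner Hs g h)"
  proof -
    have "(\<lambda>n. B (y n) (x n)) = (\<lambda>n. cnj (B (x n) (y n)))"
      using x y by (intro ext B_sym) (auto simp: cau_F lims_cau)
    then have "(\<lambda>n. B (y n) (x n)) \<longlonglongrightarrow> cnj (ip g h)"
      using x y by (simp add: tendsto_cnj lims_ip)
    from ip_eqI[OF y x this] show ?thesis by simp
  qed
next
  fix g assume "g \<in> carrier Hs"
  then obtain x where x: "lims x g" by (auto simp: Hc_def)
  have lim: "(\<lambda>n. Re (B (x n) (x n))) \<longlonglongrightarrow> Re (ip g g)"
    by (intro tendsto_Re lims_ip x)
  show "0 \<le> Re (cinner Hs g g)"
    using LIMSEQ_le_const[OF lim, of 0] x by (auto simp: B_pos cau_F lims_cau)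
  assume "cinner Hs g g = 0"
  then have "(\<lambda>n. N (x n)) \<longlonglongrightarrow> 0"
    using tendsto_real_sqrt[OF lim] by (simp add: N_def)
  then have 0: "(\<lambda>n. N (x n) * N (d k)) \<longlonglongrightarrow> 0" for k
    by (rule tendsto_mult_left_zero)
  have "(\<lambda>n. B (x n) (d k)) \<longlonglongrightarrow> 0" for k
    by (rule Lim_null_comparison[OF _ 0])
       (use x in \<open>auto intro!: always_eventually B_cauchy_schwarz simp: cau_F lims_cau\<close>)
  then have "g k = 0" for k
    using x LIMSEQ_unique unfolding lims_def by blast
  then show "g = \<zero>\<^bsub>Hs\<^esub>" by auto
qed

sublocale Hp: prehilbert Hs
  by (rule prehilbert_Hs)

lemma hnorm_lim: "lims x g \<Longrightarrow> (\<lambda>n. N (x n)) \<longlonglongrightarrow> hnorm Hs g"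
  unfolding N_def hnorm_def by (auto intro!: tendsto_intros lims_ip)

lemma Hs_diff: "g \<in> Hc \<Longrightarrow> h \<in> Hc \<Longrightarrow> g \<ominus>\<^bsub>Hs\<^esub> h = (\<lambda>k. g k - h k)"
  using Hp.diff_eq_smult[of g h] by simp

definition J :: "('v, 'e) lpa_free \<Rightarrow> nat \<Rightarrow> complex" where "J z = (\<lambda>k. B z (d k))"

lemma lims_J: "z \<in> F \<Longrightarrow> lims (\<lambda>n. z) (J z)"
  by (simp add: lims_def J_def cau_const)

lemma J_in_Hc [simp]: "z \<in> F \<Longrightarrow> J z \<in> Hc"
  using lims_J HcI by blast

lemma hnorm_J: "z \<in> F \<Longrightarrow> hnorm Hs (J z) = N z"
  using hnorm_lim[OF lims_J] LIMSEQ_unique by (metis tendsto_const)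

lemma J_diff: "y \<in> F \<Longrightarrow> z \<in> F \<Longrightarrow> J y \<ominus>\<^bsub>Hs\<^esub> J z = J (y - z)"
  by (simp add: Hs_diff) (simp add: J_def B_diff)

lemma lims_conv_J:
  assumes x: "lims x g" shows "Hp.hn.conv (\<lambda>n. J (x n)) g"
proof -
  have xF: "x n \<in> F" for n using x by (auto simp: cau_F lims_cau)
  have g: "g \<in> Hc" using x by (rule HcI)
  have "(\<lambda>n. hnorm Hs (J (x n) \<ominus>\<^bsub>Hs\<^esub> g)) \<longlonglongrightarrow> 0"
  proof (rule LIMSEQ_I)
    fix e :: real assume e: "0 < e"
    then obtain M where M: "\<And>m n. m \<ge> M \<Longrightarrow> n \<ge> M \<Longrightarrow> N (x m - x n) < e/2"
      using lims_cau[OF x] unfolding cau_def by (meson half_gt_zero)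
    have "norm (hnorm Hs (J (x m) \<ominus>\<^bsub>Hs\<^esub> g) - 0) < e" if m: "m \<ge> M" for m
    proof -
      have "(\<lambda>n. N (x m - x n)) \<longlonglongrightarrow> hnorm Hs (J (x m) \<ominus>\<^bsub>Hs\<^esub> g)"
        using hnorm_lim[OF lims_diff[OF lims_J[OF xF] x]] xF g by (simp add: Hs_diff)
      then have "hnorm Hs (J (x m) \<ominus>\<^bsub>Hs\<^esub> g) \<le> e/2"
        by (rule LIMSEQ_le_const2) (use M m in \<open>auto intro!: exI[of _ M] less_imp_le\<close>)
      moreover have "0 \<le> hnorm Hs (J (x m) \<ominus>\<^bsub>Hs\<^esub> g)"
        using xF g by (intro Hp.hn_nonneg Hp.M.minus_closed) auto
      ultimately show ?thesis using e by simp
    qed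
    then show "\<exists>M. \<forall>n\<ge>M. norm (hnorm Hs (J (x n) \<ominus>\<^bsub>Hs\<^esub> g) - 0) < e" by blast
  qed
  then show ?thesis using xF g by (simp add: Hp.hn.conv_def)
qed

lemma hilbert_space_Hs: "hilbert_space Hs"
proof (intro hilbert_space.intro hilbert_space_axioms.intro)
  show "norm_complete Hs (hnorm Hs)"
  proof (rule Hp.hn.complete_via_dense[of "J ` F"])
    fix g :: "nat \<Rightarrow> complex" and \<epsilon> :: real assume g: "g \<in> carrier Hs" and e: "0 < \<epsilon>"
    then obtain x where x: "lims x g" by (auto simp: Hc_def)
    have "(\<lambda>n. hnorm Hs (J (x n) \<ominus>\<^bsub>Hs\<^esub> g)) \<longlonglongrightarrow> 0"
      using lims_conv_J[OF x] by (simp add: Hp.hn.conv_def)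
    then have "\<forall>\<^sub>F n in sequentially. hnorm Hs (J (x n) \<ominus>\<^bsub>Hs\<^esub> g) < \<epsilon>"
      using e by (rule order_tendstoD(2))
    then obtain n where "hnorm Hs (J (x n) \<ominus>\<^bsub>Hs\<^esub> g) < \<epsilon>"
      by (auto simp: eventually_sequentially)
    moreover have "x n \<in> F" using x by (auto simp: cau_F lims_cau)
    ultimately show "\<exists>h\<in>J ` F. hnorm Hs (g \<ominus>\<^bsub>Hs\<^esub> h) < \<epsilon>"
      using g Hp.hn.norm_diff_commute[of g "J (x n)"] by (intro bexI[of _ "J (x n)"]) auto
  next
    fix y assume y: "norm_Cauchy Hs (hnorm Hs) y" "\<And>n. y n \<in> J ` F"
    have "\<forall>n. \<exists>z. z \<in> F \<and> y n = J z" using y(2) by (auto simp: image_iff)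
    from choice[OF this] obtain x where x: "\<And>n. x n \<in> F" "\<And>n. y n = J (x n)" by blast
    have "hnorm Hs (y m \<ominus>\<^bsub>Hs\<^esub> y n) = N (x m - x n)" for m n
      by (simp only: x(2) J_diff x(1) hnorm_J F_diff)
    then have "cau x"
      using y(1) x(1) unfolding cau_def Hp.hn.norm_Cauchy_iff by simp
    then obtain g where "lims x g" using lims_exists by blast
    from lims_conv_J[OF this] have "Hp.hn.conv y g" by (simp add: x(2)[abs_def])
    then show "\<exists>l. Hp.hn.conv y l" by blast
  qed auto
qed (fact Hp.module_axioms Hp.cinner_add_left Hp.cinner_smult_left Hp.cinner_sym Hp.cinner_pos Hp.cinner_def)+

section \<open>The representation by left multiplication\<close>

definition op :: "('v, 'e) lpa_free \<Rightarrow> (nat \<Rightarrow> complex) \<Rightarrow> (nat \<Rightarrow> complex)" where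
  "op a = (\<lambda>g\<in>Hc. SOME h. lims (\<lambda>n. a * pick g n) h)"

lemma lims_unique_null:
  assumes "lims x g" "lims y h" "(\<lambda>n. N (x n - y n)) \<longlonglongrightarrow> 0" shows "g = h"
proof -
  have F: "x n \<in> F" "y n \<in> F" for n using assms by (auto simp: cau_F lims_cau)
  have 0: "(\<lambda>n. N (x n - y n) * N (d k)) \<longlonglongrightarrow> 0" for k
    by (rule tendsto_mult_left_zero[OF assms(3)])
  have "(\<lambda>n. B (x n - y n) (d k)) \<longlonglongrightarrow> 0" for k
    by (rule Lim_null_comparison[OF _ 0])
       (use F in \<open>auto intro!: always_eventually B_cauchy_schwarz\<close>)
  moreover have "(\<lambda>n. B (x n - y n) (d k)) \<longlonglongrightarrow> g k - h k" for k
    using lims_diff[OF assms(1,2)] by (simp add: lims_def)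
  ultimately have "g k - h k = 0" for k using LIMSEQ_unique by blast
  then show ?thesis by auto
qed

lemma lims_op:
  assumes x: "lims x g" and a: "a \<in> F" shows "lims (\<lambda>n. a * x n) (op a g)"
proof -
  have g: "g \<in> Hc" using x by (rule HcI)
  obtain h where h: "lims (\<lambda>n. a * x n) h"
    using lims_exists[OF cau_mult[OF lims_cau[OF x] a]] by blast
  obtain h' where "lims (\<lambda>n. a * pick g n) h'"
    using lims_exists[OF cau_mult[OF lims_cau[OF lims_pick[OF x]] a]] by blast
  then have op: "lims (\<lambda>n. a * pick g n) (op a g)"
    using g by (simp add: op_def) (rule someI[where P = "\<lambda>h. lims (\<lambda>n. a * pick g n) h"])
  have F: "x n \<in> F" "pick g n \<in> F" for n using x lims_pick[OF x] by (auto simp: cau_F lims_cau)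
  have "(\<lambda>n. coeff_norm a * N (x n - pick g n)) \<longlonglongrightarrow> 0"
    by (intro tendsto_mult_right_zero lims_pick_null x)
  then have "(\<lambda>n. N (a * x n - a * pick g n)) \<longlonglongrightarrow> 0"
    by (rule Hp.hn.norm_tendsto_bound) (use F a in \<open>auto simp: right_diff_distrib[symmetric] intro: N_mult\<close>)
  then show ?thesis using h lims_unique_null[OF h op] by simp
qed

lemma op_eqI: "lims x g \<Longrightarrow> a \<in> F \<Longrightarrow> lims (\<lambda>n. a * x n) h \<Longrightarrow> op a g = h"
  using lims_unique_null[OF lims_op, of x g a "\<lambda>n. a * x n" h] by simp

lemma op_eqv:
  assumes "a \<asymp> b" "a \<in> F" "b \<in> F" shows "op a = op b"
proof
  fix g show "op a g = op b g"
  proof (cases "g \<in> Hc")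
    case True
    then obtain x where x: "lims x g" by (auto simp: Hc_def)
    then have F: "x n \<in> F" for n by (auto simp: cau_F lims_cau)
    have "N (a * x n - b * x n) = 0" for n
      using N_eqv[of "a * x n - b * x n" 0] eqv_mult_right[OF assms(1) F, of n] assms F by (simp add: eqv_def)
    then show ?thesis
      using lims_unique_null[OF lims_op[OF x assms(2)] lims_op[OF x assms(3)]] by simp
  qed (simp add: op_def)
qed

lemma op_bounded:
  assumes a: "a \<in> F" shows "op a \<in> bounded_operators Hs"
  unfolding bounded_operators_def
proof (intro CollectI conjI ballI allI)
  show "op a \<in> carrier Hs \<rightarrow>\<^sub>E carrier Hs"
  proof (rule PiE_I)
    fix g assume "g \<in> carrier Hs"
    then obtain x where "lims x g" by (auto simp: Hc_def)
    then show "op a g \<in> carrier Hs" using lims_op[OF _ a] HcI by auto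
  qed (simp add: op_def)
  fix g assume "g \<in> carrier Hs"
  then obtain x where x: "lims x g" by (auto simp: Hc_def)
  then have xF: "x n \<in> F" for n by (auto simp: cau_F lims_cau)
  show "op a (g \<oplus>\<^bsub>Hs\<^esub> h) = op a g \<oplus>\<^bsub>Hs\<^esub> op a h" if k: "h \<in> carrier Hs" for h
  proof -
    obtain y where y: "lims y h" using k by (auto simp: Hc_def)
    show ?thesis
      using lims_add[OF lims_op[OF x a] lims_op[OF y a]] a
      by (simp add: op_eqI[OF lims_add[OF x y]] distrib_left)
  qed
  show "op a (c \<odot>\<^bsub>Hs\<^esub> g) = c \<odot>\<^bsub>Hs\<^esub> op a g" for c
    using lims_smult[OF lims_op[OF x a], of c] a
    by (simp add: op_eqI[OF lims_smult[OF x]] free_smult_eq mult_const_left)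
next
  have "hnorm Hs (op a g) \<le> coeff_norm a * hnorm Hs g" if k: "g \<in> carrier Hs" for g
  proof -
    obtain x where x: "lims x g" using k by (auto simp: Hc_def)
    show ?thesis
      by (rule LIMSEQ_le[OF hnorm_lim[OF lims_op[OF x a]] tendsto_mult_left[OF hnorm_lim[OF x]]])
         (use x a in \<open>auto intro!: N_mult simp: cau_F lims_cau\<close>)
  qed
  then show "\<exists>K. \<forall>g\<in>carrier Hs. hnorm Hs (op a g) \<le> K * hnorm Hs g" by blast
qed

lemma op_star: "a \<in> F \<Longrightarrow> star (bounded_ops Hs) (op a) = op (free_star a)"
proof (rule Hp.star_bounded_ops_eqI)
  assume a: "a \<in> F"
  then show "op (free_star a) \<in> bounded_operators Hs" by (intro op_bounded) auto
  fix g h assume "g \<in> carrier Hs" "h \<in> carrier Hs"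
  then obtain x y where x: "lims x g" and y: "lims y h" by (auto simp: Hc_def)
  have "(\<lambda>n. B (a * x n) (y n)) = (\<lambda>n. B (x n) (free_star a * y n))"
    using x y a by (intro ext B_adj) (auto simp: cau_F lims_cau)
  then have "(\<lambda>n. B (a * x n) (y n)) \<longlonglongrightarrow> ip g (op (free_star a) h)"
    using lims_ip[OF x lims_op[OF y F_star[OF a]]] by simp
  then show "cinner Hs (op a g) h = cinner Hs g (op (free_star a) h)"
    using ip_eqI[OF lims_op[OF x a] y] by simp
qed

definition Pi_rep :: "('v, 'e) lpa_free set \<Rightarrow> (nat \<Rightarrow> complex) \<Rightarrow> (nat \<Rightarrow> complex)" where
  "Pi_rep X = op (SOME x. x \<in> F \<and> cl x = X)"

lemma Pi_rep_cl: "a \<in> F \<Longrightarrow> Pi_rep (cl a) = op a"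
proof -
  assume a: "a \<in> F"
  define b where "b = (SOME x. x \<in> F \<and> cl x = cl a)"
  have "b \<in> F \<and> cl b = cl a" unfolding b_def by (rule someI[of _ a]) (use a in simp)
  then show ?thesis unfolding Pi_rep_def b_def[symmetric] using a by (intro op_eqv) (auto simp: cl_eq_iff)
qed

lemma op_outside: "g \<notin> Hc \<Longrightarrow> op a g = undefined"
  by (simp add: op_def)

lemma star_hom_Pi_rep: "star_hom L (bounded_ops Hs) Pi_rep"
  unfolding star_hom_def
proof (intro conjI ballI allI)
  fix X assume "X \<in> carrier L"
  then obtain x where X: "x \<in> F" "X = cl x" by blast
  show "Pi_rep X \<in> carrier (bounded_ops Hs)" using X by (simp add: Pi_rep_cl op_bounded)
  show "Pi_rep (star L X) = star (bounded_ops Hs) (Pi_rep X)"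
    using X by (simp add: L_star Pi_rep_cl op_star)
  show "Pi_rep (c \<odot>\<^bsub>L\<^esub> X) = c \<odot>\<^bsub>bounded_ops Hs\<^esub> Pi_rep X" for c
  proof
    fix g
    show "Pi_rep (c \<odot>\<^bsub>L\<^esub> X) g = (c \<odot>\<^bsub>bounded_ops Hs\<^esub> Pi_rep X) g"
    proof (cases "g \<in> Hc")
      case True
      then obtain y where y: "lims y g" by (auto simp: Hc_def)
      show ?thesis using X True lims_smult[OF lims_op[OF y X(1)], of c]
        by (simp add: L_smult Pi_rep_cl op_eqI[OF y] free_smult_eq mult.assoc)
    qed (use X in \<open>simp add: L_smult Pi_rep_cl op_outside\<close>)
  qed
  fix Y assume "Y \<in> carrier L"
  then obtain y where Y: "y \<in> F" "Y = cl y" by blast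
  show "Pi_rep (X \<oplus>\<^bsub>L\<^esub> Y) = Pi_rep X \<oplus>\<^bsub>bounded_ops Hs\<^esub> Pi_rep Y"
  proof
    fix g
    show "Pi_rep (X \<oplus>\<^bsub>L\<^esub> Y) g = (Pi_rep X \<oplus>\<^bsub>bounded_ops Hs\<^esub> Pi_rep Y) g"
    proof (cases "g \<in> Hc")
      case True
      then obtain z where z: "lims z g" by (auto simp: Hc_def)
      show ?thesis using X Y True lims_add[OF lims_op[OF z X(1)] lims_op[OF z Y(1)]]
        by (simp add: L_add Pi_rep_cl op_eqI[OF z] distrib_right)
    qed (use X Y in \<open>simp add: L_add Pi_rep_cl op_outside\<close>)
  qed
  show "Pi_rep (X \<otimes>\<^bsub>L\<^esub> Y) = Pi_rep X \<otimes>\<^bsub>bounded_ops Hs\<^esub> Pi_rep Y"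
  proof
    fix g
    show "Pi_rep (X \<otimes>\<^bsub>L\<^esub> Y) g = (Pi_rep X \<otimes>\<^bsub>bounded_ops Hs\<^esub> Pi_rep Y) g"
    proof (cases "g \<in> Hc")
      case True
      then obtain z where z: "lims z g" by (auto simp: Hc_def)
      show ?thesis using X Y True lims_op[OF lims_op[OF z Y(1)] X(1)]
        by (simp add: L_mult Pi_rep_cl op_eqI[OF z] compose_def mult.assoc)
    qed (use X Y in \<open>simp add: L_mult Pi_rep_cl op_outside compose_def\<close>)
  qed
qed

lemma op_J: "a \<in> F \<Longrightarrow> z \<in> F \<Longrightarrow> op a (J z) = J (a * z)"
  by (rule op_eqI[OF lims_J]) (auto intro: lims_J)

lemma J_eqv: "y \<asymp> z \<Longrightarrow> y \<in> F \<Longrightarrow> z \<in> F \<Longrightarrow> J y = J z"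
  unfolding J_def by (intro ext B_eqv) auto

text \<open>A left local unit \<open>unit S\<close> of \<open>z\<close> satisfies
  \<open>Pi_rep (cl (unit S)) (J z) = J z\<close>, so the vectors \<open>J z\<close>, which are
  dense, lie in the range of the representation.\<close>

lemma nondegenerate_Pi_rep: "nondegenerate_rep L Hs Pi_rep"
  unfolding nondegenerate_rep_def
proof (intro conjI hilbert_space_Hs star_hom_Pi_rep allI impI)
  fix K assume K: "submodule K complex_ring Hs \<and> closedin (norm_topology Hs (hnorm Hs)) K \<and>
      (\<forall>a\<in>carrier L. \<forall>x\<in>carrier Hs. Pi_rep a x \<in> K)"
  then have closed: "K \<subseteq> carrier Hs \<and> (\<forall>x l. (\<forall>n. x n \<in> K) \<and> Hp.hn.conv x l \<longrightarrow> l \<in> K)"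
    unfolding Hp.hn.closedin_iff by (elim conjE) (intro conjI)
  have JK: "J z \<in> K" if z: "z \<in> F" for z
  proof -
    obtain S where S: "finite S" "S \<subseteq> verts E" "unit S * z \<asymp> z" using local_unit[OF z] by blast
    then have "J z = Pi_rep (cl (unit S)) (J z)"
      using z unit_in_F[OF S(2)] by (simp add: Pi_rep_cl op_J J_eqv[OF S(3)])
    also have "\<dots> \<in> K" using K z unit_in_F[OF S(2)] by simp
    finally show ?thesis .
  qed
  have "g \<in> K" if k: "g \<in> carrier Hs" for g
  proof -
    obtain x where x: "lims x g" using k by (auto simp: Hc_def)
    have "J (x n) \<in> K" for n using x by (intro JK) (auto simp: cau_F lims_cau)
    then have "(\<forall>n. J (x n) \<in> K) \<and> Hp.hn.conv (\<lambda>n. J (x n)) g" using lims_conv_J[OF x] by simp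
    then show ?thesis by (rule closed[THEN conjunct2, rule_format])
  qed
  moreover have "K \<subseteq> carrier Hs" by (rule closed[THEN conjunct1])
  ultimately show "K = carrier Hs" by blast
qed

text \<open>In place of a cyclic vector, the operator of \<open>a\<close> is tested on
  \<open>J u\<close> for a right unit \<open>u\<close> of \<open>a\<close>: the result is
  \<open>J (a * u) = J a\<close>, of norm \<open>N a\<close>. The number \<open>r\<close> is the
  same for all such \<open>u\<close>.\<close>

theorem gns:
  assumes a: "a \<in> F"
  obtains r where "r \<in> rep_norms TYPE(nat \<Rightarrow> complex) E (cl a)" "0 \<le> r"
    "\<And>u. u \<in> F \<Longrightarrow> a * u \<asymp> a \<Longrightarrow> N a \<le> r * N u"
proof
  let ?r = "nrm (bounded_ops Hs) (Pi_rep (cl a))"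
  show "?r \<in> rep_norms TYPE(nat \<Rightarrow> complex) E (cl a)"
    unfolding rep_norms_def using nondegenerate_Pi_rep by blast
  show "0 \<le> ?r" using a by (simp add: Pi_rep_cl op_bounded)
  fix u assume u: "u \<in> F" "a * u \<asymp> a"
  have "N a = hnorm Hs (op a (J u))"
    using a u by (simp add: op_J hnorm_J N_eqv[OF u(2)])
  also have "\<dots> \<le> ?r * hnorm Hs (J u)"
    using a u by (simp add: Pi_rep_cl Hp.opn_bound op_bounded)
  finally show "N a \<le> ?r * N u" using u by (simp add: hnorm_J)
qed

end

section \<open>The C*-norm of a Leavitt path algebra\<close>

lemma star_homD:
  assumes "star_hom A B \<phi>"
  shows "x \<in> carrier A \<Longrightarrow> \<phi> x \<in> carrier B"
    "\<lbrakk>x \<in> carrier A; y \<in> carrier A\<rbrakk> \<Longrightarrow> \<phi> (x \<oplus>\<^bsub>A\<^esub> y) = \<phi> x \<oplus>\<^bsub>B\<^esub> \<phi> y"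
    "x \<in> carrier A \<Longrightarrow> \<phi> (c \<odot>\<^bsub>A\<^esub> x) = c \<odot>\<^bsub>B\<^esub> \<phi> x"
    "\<lbrakk>x \<in> carrier A; y \<in> carrier A\<rbrakk> \<Longrightarrow> \<phi> (x \<otimes>\<^bsub>A\<^esub> y) = \<phi> x \<otimes>\<^bsub>B\<^esub> \<phi> y"
    "x \<in> carrier A \<Longrightarrow> \<phi> (star A x) = star B (\<phi> x)"
  using assms by (auto simp: star_hom_def)

context countable_graph begin

lemma lpa_formI:
  assumes "\<And>x y z. \<lbrakk>x \<in> F; y \<in> F; z \<in> F\<rbrakk> \<Longrightarrow> B (x + y) z = B x z + B y z"
    and "\<And>c x y. \<lbrakk>x \<in> F; y \<in> F\<rbrakk> \<Longrightarrow> B (free_smult c x) y = c * B x y"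
    and "\<And>x y. \<lbrakk>x \<in> F; y \<in> F\<rbrakk> \<Longrightarrow> B y x = cnj (B x y)"
    and "\<And>x. x \<in> F \<Longrightarrow> 0 \<le> Re (B x x)"
    and "\<And>x y z. \<lbrakk>x \<in> F; y \<in> F; z \<in> F\<rbrakk> \<Longrightarrow> B (z * x) y = B x (free_star z * y)"
    and "\<And>x y. \<lbrakk>x \<in> I; y \<in> F\<rbrakk> \<Longrightarrow> B x y = 0"
  shows "lpa_form E B"
  by (intro lpa_form.intro lpa_form_axioms.intro countable_graph_axioms assms)

text \<open>The form \<open>0\<close> yields a representation on the zero space. A supremum of real
  numbers is meaningful only over a nonempty set, so one representation must be exhibited.\<close>

lemma rep_norms_ne:
  assumes "a \<in> F" shows "\<exists>r\<in>rep_norms TYPE(nat \<Rightarrow> complex) E (cl a). 0 \<le> r"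
proof -
  have "lpa_form E (\<lambda>x y. 0)" by (rule lpa_formI) auto
  from lpa_form.gns[OF this assms] show ?thesis by blast
qed

end

section \<open>Representations on Hilbert spaces of arbitrary element type\<close>

locale lpa_rep = countable_graph E + hilbert_space H
  for E :: "('v, 'e) pre_digraph" and H :: "'h hilbert_space" +
  fixes \<pi>
  assumes star_hom: "star_hom (leavitt_path_algebra E) (bounded_ops H) \<pi>"
begin

lemma rep_op [simp]: "a \<in> F \<Longrightarrow> \<pi> (cl a) \<in> bounded_operators H"
  using star_homD(1)[OF star_hom, of "cl a"] by simp

lemma rep_closed [simp]: "a \<in> F \<Longrightarrow> \<xi> \<in> carrier H \<Longrightarrow> \<pi> (cl a) \<xi> \<in> carrier H"
  by (rule bounded_opD(1)[OF rep_op])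

lemma rep_add: "\<lbrakk>a \<in> F; b \<in> F; \<xi> \<in> carrier H\<rbrakk> \<Longrightarrow> \<pi> (cl (a + b)) \<xi> = \<pi> (cl a) \<xi> \<oplus>\<^bsub>H\<^esub> \<pi> (cl b) \<xi>"
  using star_homD(2)[OF star_hom, of "cl a" "cl b"] by (simp add: L_add)

lemma rep_smult: "\<lbrakk>a \<in> F; \<xi> \<in> carrier H\<rbrakk> \<Longrightarrow> \<pi> (cl (free_smult c a)) \<xi> = c \<odot>\<^bsub>H\<^esub> \<pi> (cl a) \<xi>"
  using star_homD(3)[OF star_hom, of "cl a" c] by (simp add: L_smult)

lemma rep_mult: "\<lbrakk>a \<in> F; b \<in> F; \<xi> \<in> carrier H\<rbrakk> \<Longrightarrow> \<pi> (cl (a * b)) \<xi> = \<pi> (cl a) (\<pi> (cl b) \<xi>)"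
  using star_homD(4)[OF star_hom, of "cl a" "cl b"] by (simp add: L_mult compose_def)

lemma rep_star:
  "\<lbrakk>a \<in> F; \<xi> \<in> carrier H; \<eta> \<in> carrier H\<rbrakk> \<Longrightarrow> cinner H (\<pi> (cl a) \<xi>) \<eta> = cinner H \<xi> (\<pi> (cl (free_star a)) \<eta>)"
  using star_homD(5)[OF star_hom, of "cl a"] adjoint_exists[OF rep_op, of a] by (simp add: L_star)

lemma rep_form:
  assumes \<xi>: "\<xi> \<in> carrier H"
  shows "lpa_form E (\<lambda>x y. cinner H (\<pi> (cl x) \<xi>) (\<pi> (cl y) \<xi>))"
proof (rule lpa_formI)
  fix x y assume "x \<in> I" and y: "y \<in> F"
  then have x: "x \<in> F" by auto
  have "x \<asymp> free_smult 0 x" using \<open>x \<in> I\<close> by (simp add: free_smult_eq eqv_zero)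
  then have "cl x = cl (free_smult 0 x)" by (rule cl_eqI)
  then have "\<pi> (cl x) \<xi> = 0 \<odot>\<^bsub>H\<^esub> \<pi> (cl x) \<xi>" using x \<xi> rep_smult[of x \<xi> 0] by simp
  then have "\<pi> (cl x) \<xi> = \<zero>\<^bsub>H\<^esub>" using x \<xi> by simp
  then show "cinner H (\<pi> (cl x) \<xi>) (\<pi> (cl y) \<xi>) = 0" using y \<xi> by simp
next
  fix x y z assume "x \<in> F" "y \<in> F" "z \<in> F"
  then show "cinner H (\<pi> (cl (z * x)) \<xi>) (\<pi> (cl y) \<xi>) = cinner H (\<pi> (cl x) \<xi>) (\<pi> (cl (free_star z * y)) \<xi>)"
    using \<xi> by (simp add: rep_mult rep_star[of z])
next
  fix x y assume "x \<in> F" "y \<in> F"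
  then show "cinner H (\<pi> (cl y) \<xi>) (\<pi> (cl x) \<xi>) = cnj (cinner H (\<pi> (cl x) \<xi>) (\<pi> (cl y) \<xi>))"
    using \<xi> by (intro cinner_sym) auto
qed (use \<xi> in \<open>auto simp: rep_add rep_smult cinner_add_left cinner_smult_left cinner_pos\<close>)

lemma form_N:
  "\<xi> \<in> carrier H \<Longrightarrow> lpa_form.N (\<lambda>x y. cinner H (\<pi> (cl x) \<xi>) (\<pi> (cl y) \<xi>)) a = hn (\<pi> (cl a) \<xi>)"
  by (simp add: lpa_form.N_def[OF rep_form] hnorm_def)

text \<open>\<open>unit S\<close> acts as a self-adjoint idempotent, so the squared norm of the
  image \<open>\<eta>\<close> of \<open>\<xi>\<close> is \<open>cinner H \<xi> \<eta>\<close>, and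
  Cauchy--Schwarz applies.\<close>

lemma rep_unit_contraction:
  assumes S: "finite S" "S \<subseteq> verts E" and \<xi>: "\<xi> \<in> carrier H"
  shows "hn (\<pi> (cl (unit S)) \<xi>) \<le> hn \<xi>"
proof -
  let ?\<eta> = "\<pi> (cl (unit S)) \<xi>"
  have u: "unit S \<in> F" using S by (intro unit_in_F)
  have "cl (unit S * unit S) = cl (unit S)" by (rule cl_eqI[OF unit_idem[OF S]])
  then have "\<pi> (cl (unit S)) ?\<eta> = ?\<eta>" using rep_mult[OF u u \<xi>] by simp
  then have "cinner H ?\<eta> ?\<eta> = cinner H \<xi> ?\<eta>" using rep_star[OF u \<xi>, of ?\<eta>] u \<xi> by simp
  then have "(hn ?\<eta>)\<^sup>2 = cmod (cinner H \<xi> ?\<eta>)"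
    using cinner_self[of ?\<eta>] u \<xi> by (metis abs_of_nonneg norm_of_real rep_closed zero_le_power2)
  also have "\<dots> \<le> hn \<xi> * hn ?\<eta>" using u \<xi> by (intro cauchy_schwarz) auto
  finally have le: "hn ?\<eta> * hn ?\<eta> \<le> hn \<xi> * hn ?\<eta>" by (simp add: power2_eq_square)
  show ?thesis
  proof (cases "hn ?\<eta> = 0")
    case False
    then have "hn ?\<eta> > 0" using u \<xi> by (simp add: less_le)
    then show ?thesis using le by simp
  qed (use \<xi> in simp)
qed

text \<open>A local unit \<open>unit S\<close> serves as \<open>u\<close>. As it acts contractively,
  the vector \<open>\<pi> (cl u) \<xi>\<close> in the bound can be replaced by
  \<open>\<xi>\<close>.\<close>

lemma rep_bound_of_forms:
  assumes a: "a \<in> F" and \<xi>: "\<xi> \<in> carrier H" and K: "0 \<le> K"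
    and bound: "\<And>u. u \<in> F \<Longrightarrow> a * u \<asymp> a \<Longrightarrow> hn (\<pi> (cl a) \<xi>) \<le> K * hn (\<pi> (cl u) \<xi>)"
  shows "hn (\<pi> (cl a) \<xi>) \<le> K * hn \<xi>"
proof -
  obtain S where S: "finite S" "S \<subseteq> verts E" "a * unit S \<asymp> a" using local_unit[OF a] by blast
  have "hn (\<pi> (cl a) \<xi>) \<le> K * hn (\<pi> (cl (unit S)) \<xi>)"
    using S by (intro bound unit_in_F) auto
  also have "\<dots> \<le> K * hn \<xi>"
    using rep_unit_contraction[OF S(1,2) \<xi>] K by (rule mult_left_mono)
  finally show ?thesis .
qed

lemma rep_coeff_bound:
  assumes a: "a \<in> F" and \<xi>: "\<xi> \<in> carrier H"
  shows "hn (\<pi> (cl a) \<xi>) \<le> coeff_norm a * hn \<xi>"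
proof (rule rep_bound_of_forms[OF a \<xi>])
  fix u assume u: "u \<in> F" "a * u \<asymp> a"
  then show "hn (\<pi> (cl a) \<xi>) \<le> coeff_norm a * hn (\<pi> (cl u) \<xi>)"
    using lpa_form.N_mult[OF rep_form[OF \<xi>] a u(1)] cl_eqI[OF u(2)] by (simp add: form_N[OF \<xi>])
qed simp

end

context countable_graph begin

lemma lpa_repI:
  assumes "nondegenerate_rep L H \<pi>" shows "lpa_rep E H \<pi>"
  using assms unfolding nondegenerate_rep_def
  by (intro lpa_rep.intro lpa_rep_axioms.intro countable_graph_axioms) auto

lemma rep_norms_cases:
  assumes "r \<in> rep_norms TYPE('h) E X"
  obtains H :: "'h hilbert_space" and \<pi> where "lpa_rep E H \<pi>" "r = nrm (bounded_ops H) (\<pi> X)"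
  using assms lpa_repI unfolding rep_norms_def by blast

lemma bdd_above_rep_norms:
  assumes "a \<in> F" shows "bdd_above (rep_norms TYPE('h) E (cl a))"
proof (rule bdd_aboveI)
  fix r assume "r \<in> rep_norms TYPE('h) E (cl a)"
  then obtain H :: "'h hilbert_space" and \<pi> where rep: "lpa_rep E H \<pi>" "r = nrm (bounded_ops H) (\<pi> (cl a))"
    by (rule rep_norms_cases)
  interpret lpa_rep E H \<pi> by (rule rep)
  show "r \<le> coeff_norm a" unfolding rep(2) using assms by (intro opn_le rep_coeff_bound) auto
qed

abbreviation ln :: "('v, 'e) lpa_free \<Rightarrow> real" where "ln a \<equiv> leavitt_norm E (cl a)"

lemma rep_norm_le_ln:
  "a \<in> F \<Longrightarrow> r \<in> rep_norms TYPE(nat \<Rightarrow> complex) E (cl a) \<Longrightarrow> r \<le> ln a"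
  unfolding leavitt_norm_def by (rule cSup_upper[OF _ bdd_above_rep_norms])

lemma ln_nonneg [simp]: "a \<in> F \<Longrightarrow> 0 \<le> ln a"
  using rep_norms_ne rep_norm_le_ln by (meson order_trans)

text \<open>All comparisons with the supremum pass through this inequality: GNS turns the form,
  whatever its origin, into one of the representations counted by
  \<open>leavitt_norm\<close>.\<close>

lemma form_le_ln:
  assumes "lpa_form E B" "a \<in> F" "u \<in> F" "a * u \<asymp> a"
  shows "lpa_form.N B a \<le> ln a * lpa_form.N B u"
proof -
  obtain r where r: "r \<in> rep_norms TYPE(nat \<Rightarrow> complex) E (cl a)"
      "lpa_form.N B a \<le> r * lpa_form.N B u"
    using lpa_form.gns[OF assms(1,2)] assms(3,4) by metis
  have "r * lpa_form.N B u \<le> ln a * lpa_form.N B u"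
    using rep_norm_le_ln[OF assms(2) r(1)] lpa_form.N_nonneg[OF assms(1,3)] by (rule mult_right_mono)
  with r(2) show ?thesis by linarith
qed

lemma ln_le:
  assumes "a \<in> F" "\<And>(H :: (nat \<Rightarrow> complex) hilbert_space) \<pi>. lpa_rep E H \<pi> \<Longrightarrow> nrm (bounded_ops H) (\<pi> (cl a)) \<le> K"
  shows "ln a \<le> K"
  unfolding leavitt_norm_def
proof (rule cSup_least)
  show "rep_norms TYPE(nat \<Rightarrow> complex) E (cl a) \<noteq> {}" using rep_norms_ne[OF assms(1)] by blast
qed (use assms(2) in \<open>auto elim: rep_norms_cases\<close>)

end

context lpa_rep begin

text \<open>The form of the vector \<open>\<xi>\<close> is realised again on a space of sequences,
  so the supremum over the single type \<open>nat \<Rightarrow> complex\<close> bounds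
  representations on Hilbert spaces of any element type.\<close>

lemma rep_bound: "a \<in> F \<Longrightarrow> \<xi> \<in> carrier H \<Longrightarrow> hn (\<pi> (cl a) \<xi>) \<le> ln a * hn \<xi>"
proof (rule rep_bound_of_forms)
  fix u assume *: "a \<in> F" "\<xi> \<in> carrier H" "u \<in> F" "a * u \<asymp> a"
  then show "hn (\<pi> (cl a) \<xi>) \<le> ln a * hn (\<pi> (cl u) \<xi>)"
    using form_le_ln[OF rep_form[OF *(2)] *(1,3,4)] by (simp add: form_N[OF *(2)])
qed simp_all

lemma opn_rep_le: "a \<in> F \<Longrightarrow> opn (\<pi> (cl a)) \<le> ln a"
  by (rule opn_le) (simp_all add: rep_bound)

end

section \<open>The norm is a C*-seminorm\<close>

context countable_graph begin

lemma rep_norms_le_ln: "a \<in> F \<Longrightarrow> r \<in> rep_norms TYPE('h) E (cl a) \<Longrightarrow> r \<le> ln a"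
  by (auto elim!: rep_norms_cases intro: lpa_rep.opn_rep_le)

lemma ln_add:
  assumes "a \<in> F" "b \<in> F" shows "ln (a + b) \<le> ln a + ln b"
proof (rule ln_le)
  fix H :: "(nat \<Rightarrow> complex) hilbert_space" and \<pi> assume "lpa_rep E H \<pi>"
  then interpret lpa_rep E H \<pi> .
  show "opn (\<pi> (cl (a + b))) \<le> ln a + ln b"
  proof (rule opn_le)
    fix \<xi> assume \<xi>: "\<xi> \<in> carrier H"
    have "hn (\<pi> (cl (a + b)) \<xi>) \<le> hn (\<pi> (cl a) \<xi>) + hn (\<pi> (cl b) \<xi>)"
      using assms \<xi> by (simp add: rep_add hn.norm_add)
    then show "hn (\<pi> (cl (a + b)) \<xi>) \<le> (ln a + ln b) * hn \<xi>"
      using rep_bound[OF assms(1) \<xi>] rep_bound[OF assms(2) \<xi>] by (simp add: distrib_right)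
  qed (use assms in auto)
qed (use assms in auto)

lemma ln_smult:
  assumes "a \<in> F" shows "ln (free_smult c a) = cmod c * ln a"
proof -
  have le: "ln (free_smult c a) \<le> cmod c * ln a" if a: "a \<in> F" for c a
  proof (rule ln_le)
    fix H :: "(nat \<Rightarrow> complex) hilbert_space" and \<pi> assume "lpa_rep E H \<pi>"
    then interpret lpa_rep E H \<pi> .
    show "opn (\<pi> (cl (free_smult c a))) \<le> cmod c * ln a"
    proof (rule opn_le)
      fix \<xi> assume \<xi>: "\<xi> \<in> carrier H"
      show "hn (\<pi> (cl (free_smult c a)) \<xi>) \<le> cmod c * ln a * hn \<xi>"
        using rep_bound[OF a \<xi>] a \<xi> by (simp add: rep_smult hn.norm_smult mult.assoc mult_left_mono)
    qed (use a in auto)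
  qed (use a in auto)
  show ?thesis
  proof (cases "c = 0")
    case True
    have "0 \<le> ln (free_smult 0 a)" using assms by (intro ln_nonneg) auto
    then show ?thesis using le[OF assms, of 0] True by simp
  next
    case False
    then have "free_smult (1 / c) (free_smult c a) = a"
      by (simp add: free_smult_eq const_mult_const)
    then have "ln a \<le> cmod (1 / c) * ln (free_smult c a)"
      using le[of "free_smult c a" "1 / c"] assms by simp
    then have "cmod c * ln a \<le> ln (free_smult c a)"
      using False by (simp add: norm_divide field_simps)
    with le[OF assms, of c] show ?thesis by simp
  qed
qed

lemma ln_mult:
  assumes "a \<in> F" "b \<in> F" shows "ln (a * b) \<le> ln a * ln b"
proof (rule ln_le)
  fix H :: "(nat \<Rightarrow> complex) hilbert_space" and \<pi> assume "lpa_rep E H \<pi>"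
  then interpret lpa_rep E H \<pi> .
  show "opn (\<pi> (cl (a * b))) \<le> ln a * ln b"
  proof (rule opn_le)
    fix \<xi> assume \<xi>: "\<xi> \<in> carrier H"
    have "hn (\<pi> (cl (a * b)) \<xi>) \<le> ln a * hn (\<pi> (cl b) \<xi>)"
      using assms \<xi> by (simp add: rep_mult rep_bound)
    also have "\<dots> \<le> ln a * (ln b * hn \<xi>)"
      using assms \<xi> by (intro mult_left_mono rep_bound) auto
    finally show "hn (\<pi> (cl (a * b)) \<xi>) \<le> ln a * ln b * hn \<xi>" by (simp add: mult.assoc)
  qed (use assms in auto)
qed (use assms in auto)

lemma ln_sq_le:
  assumes "a \<in> F" shows "(ln a)\<^sup>2 \<le> ln (free_star a * a)"
proof -
  have n: "0 \<le> ln (free_star a * a)" using assms by simp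
  have "ln a \<le> sqrt (ln (free_star a * a))"
  proof (rule ln_le)
    fix H :: "(nat \<Rightarrow> complex) hilbert_space" and \<pi> assume "lpa_rep E H \<pi>"
    then interpret lpa_rep E H \<pi> .
    show "opn (\<pi> (cl a)) \<le> sqrt (ln (free_star a * a))"
    proof (rule opn_le)
      fix \<xi> assume \<xi>: "\<xi> \<in> carrier H"
      have "(hn (\<pi> (cl a) \<xi>))\<^sup>2 = cmod (cinner H (\<pi> (cl a) \<xi>) (\<pi> (cl a) \<xi>))"
        using cinner_self[of "\<pi> (cl a) \<xi>"] assms \<xi> by (simp add: norm_power)
      also have "\<dots> = cmod (cinner H \<xi> (\<pi> (cl (free_star a * a)) \<xi>))"
        using assms \<xi> by (simp add: rep_star rep_mult)
      also have "\<dots> \<le> hn \<xi> * hn (\<pi> (cl (free_star a * a)) \<xi>)"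
        using assms \<xi> by (intro cauchy_schwarz) auto
      also have "\<dots> \<le> hn \<xi> * (ln (free_star a * a) * hn \<xi>)"
        using assms \<xi> by (intro mult_left_mono rep_bound) auto
      also have "\<dots> = (sqrt (ln (free_star a * a)) * hn \<xi>)\<^sup>2"
        using n by (simp add: power_mult_distrib) (simp add: power2_eq_square)
      finally show "hn (\<pi> (cl a) \<xi>) \<le> sqrt (ln (free_star a * a)) * hn \<xi>"
        by (rule power2_le_imp_le) (use n \<xi> in auto)
    qed (use assms n in auto)
  qed (use assms in auto)
  then have "(ln a)\<^sup>2 \<le> (sqrt (ln (free_star a * a)))\<^sup>2"
    by (rule power_mono) (use assms in auto)
  then show ?thesis using n by simp
qed

lemma ln_star:
  assumes "a \<in> F" shows "ln (free_star a) = ln a"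
proof -
  have le: "ln a \<le> ln (free_star a)" if a: "a \<in> F" for a
  proof (cases "ln a = 0")
    case False
    then have "ln a > 0" using a by (simp add: less_le)
    moreover have "ln a * ln a \<le> ln (free_star a) * ln a"
      using ln_sq_le[OF a] ln_mult[of "free_star a" a] a by (simp add: power2_eq_square)
    ultimately show ?thesis by simp
  qed (use a in simp)
  show ?thesis using le[OF assms] le[of "free_star a"] assms by simp
qed

lemma ln_cstar:
  assumes "a \<in> F" shows "ln (free_star a * a) = (ln a)\<^sup>2"
  using ln_sq_le[OF assms] ln_mult[of "free_star a" a] ln_star[OF assms] assms
  by (simp add: power2_eq_square)

end

section \<open>A faithful representation\<close>

definition plin :: "('w \<Rightarrow> complex \<Rightarrow> 'm::ab_group_add) \<Rightarrow> ('w \<Rightarrow>\<^sub>0 complex) \<Rightarrow> 'm" where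
  "plin h z = (\<Sum>w\<in>Poly_Mapping.keys z. h w (Poly_Mapping.lookup z w))"

lemma plin_superset:
  assumes "\<And>w. h w 0 = 0" "finite S" "Poly_Mapping.keys z \<subseteq> S"
  shows "plin h z = (\<Sum>w\<in>S. h w (Poly_Mapping.lookup z w))"
  unfolding plin_def by (rule sum.mono_neutral_left) (use assms in \<open>auto simp: in_keys_iff\<close>)

lemma plin_add:
  assumes "\<And>w c d. h w (c + d) = h w c + h w d"
  shows "plin h (x + y) = plin h x + plin h y"
proof -
  have h0: "h w 0 = 0" for w using assms[of w 0 0] by simp
  define S where "S = Poly_Mapping.keys x \<union> Poly_Mapping.keys y"
  have S: "finite S" "Poly_Mapping.keys x \<subseteq> S" "Poly_Mapping.keys y \<subseteq> S" "Poly_Mapping.keys (x + y) \<subseteq> S"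
    using Poly_Mapping.keys_add[of x y] by (auto simp: S_def)
  show ?thesis
    unfolding plin_superset[of h, OF h0 S(1,2)] plin_superset[of h, OF h0 S(1,3)]
      plin_superset[of h, OF h0 S(1,4)]
    by (simp add: lookup_add assms sum.distrib)
qed

lemma plin_single: "h w 0 = 0 \<Longrightarrow> plin h (Poly_Mapping.single w c) = h w c"
  by (cases "c = 0") (simp_all add: plin_def)

lemma plin_zero_fun: "(\<And>w c. h w c = 0) \<Longrightarrow> plin h z = 0"
  by (simp add: plin_def)

definition inn :: "('p \<Rightarrow>\<^sub>0 complex) \<Rightarrow> ('p \<Rightarrow>\<^sub>0 complex) \<Rightarrow> complex" where
  "inn \<xi> \<eta> = plin (\<lambda>s c. c * cnj (Poly_Mapping.lookup \<eta> s)) \<xi>"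

lemma inn_add: "inn (x + y) z = inn x z + inn y z"
  unfolding inn_def by (rule plin_add) (simp add: distrib_right)

lemma inn_add_right: "inn x (y + z) = inn x y + inn x z"
  by (simp add: inn_def plin_def lookup_add distrib_left sum.distrib)

lemma inn_0 [simp]: "inn 0 z = 0" "inn z 0 = 0"
  by (simp_all add: inn_def plin_def)

lemma inn_single: "inn (Poly_Mapping.single s c) (Poly_Mapping.single t d) = (if s = t then c * cnj d else 0)"
  by (simp add: inn_def plin_single lookup_single when_def)

lemma inn_self: "inn x x = complex_of_real (\<Sum>s\<in>Poly_Mapping.keys x. (cmod (Poly_Mapping.lookup x s))\<^sup>2)"
  unfolding inn_def plin_def of_real_sum by (rule sum.cong[OF refl]) (simp only: complex_norm_square)

lemma inn_self_eq_0: "Re (inn x x) = 0 \<Longrightarrow> x = 0"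
proof -
  assume "Re (inn x x) = 0"
  then have "(\<Sum>s\<in>Poly_Mapping.keys x. (cmod (Poly_Mapping.lookup x s))\<^sup>2) = 0" by (simp add: inn_self)
  then have "\<forall>s\<in>Poly_Mapping.keys x. (cmod (Poly_Mapping.lookup x s))\<^sup>2 = 0"
    by (subst (asm) sum_nonneg_eq_0_iff) auto
  then show "x = 0" by (auto intro!: poly_mapping_eqI simp: in_keys_iff)
qed

lemma inn_sym: "inn y x = cnj (inn x y)"
proof (induction x rule: poly_mapping_single_induct)
  case (single s c)
  show ?case
    by (induction y rule: poly_mapping_single_induct) (auto simp: inn_add inn_add_right inn_single)
qed (simp_all add: inn_add inn_add_right)

text \<open>Whether a combination of basis vectors vanishes depends only on which indices coincide.
  Below, this carries a relation between moved points over to the paths that move them.\<close>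

lemma sum_single_zero_transfer:
  fixes c :: "'w \<Rightarrow> complex"
  assumes "finite K" "\<And>v w. v \<in> K \<Longrightarrow> w \<in> K \<Longrightarrow> h v = h w \<longleftrightarrow> k v = k w"
    "(\<Sum>w\<in>K. Poly_Mapping.single (h w) (c w)) = 0"
  shows "(\<Sum>w\<in>K. Poly_Mapping.single (k w) (c w)) = 0"
proof (rule poly_mapping_eqI)
  fix x
  show "Poly_Mapping.lookup (\<Sum>w\<in>K. Poly_Mapping.single (k w) (c w)) x = Poly_Mapping.lookup 0 x"
  proof (cases "x \<in> k ` K")
    case True
    then obtain v where v: "v \<in> K" "x = k v" by blast
    have "Poly_Mapping.lookup (\<Sum>w\<in>K. Poly_Mapping.single (k w) (c w)) x = (\<Sum>w\<in>K. c w when k w = k v)"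
      by (simp add: lookup_sum lookup_single v)
    also have "\<dots> = (\<Sum>w\<in>K. c w when h w = h v)"
      by (rule sum.cong[OF refl]) (use assms(2) v in \<open>auto simp: when_def\<close>)
    also have "\<dots> = Poly_Mapping.lookup (\<Sum>w\<in>K. Poly_Mapping.single (h w) (c w)) (h v)"
      by (simp add: lookup_sum lookup_single)
    finally show ?thesis by (simp add: assms(3))
  qed (auto simp: lookup_sum lookup_single when_def intro!: sum.neutral)
qed

type_synonym 'v point = "'v \<times> nat \<times> int"

section \<open>The branching system of the graph\<close>

context countable_graph begin

text \<open>Every vertex \<open>v\<close> carries the points \<open>(v, n, k)\<close>; an edge \<open>e\<close> embeds the points of its range
  into those of its source such that, at a vertex that emits edges, the ranges of the edges partition
  the points.  The last coordinate counts edges, so that distinct paths move a point to distinct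
  points.\<close>

definition idx :: "'e \<Rightarrow> nat \<Rightarrow> nat" where
  "idx e n = to_nat_on (emitted E (tail E e) \<times> (UNIV :: nat set)) (e, n)"

fun step :: "'e \<Rightarrow> 'v point \<Rightarrow> 'v point" where
  "step e (v, n, k) = (tail E e, idx e n, k + 1)"

lemma countable_emitted: "countable (emitted E v)"
  using countable_arcs by (rule countable_subset[rotated]) (auto simp: emitted_def)

lemma idx_eq_iff:
  assumes "e \<in> arcs E" "f \<in> arcs E" "tail E e = tail E f"
  shows "idx e m = idx f n \<longleftrightarrow> e = f \<and> m = n"
proof -
  have inj: "inj_on (to_nat_on (emitted E (tail E f) \<times> (UNIV :: nat set))) (emitted E (tail E f) \<times> UNIV)"
    by (rule inj_on_to_nat_on) (simp add: countable_emitted)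
  have "(e, m) \<in> emitted E (tail E f) \<times> UNIV" "(f, n) \<in> emitted E (tail E f) \<times> UNIV"
    using assms by (auto simp: emitted_def)
  from inj_on_eq_iff[OF inj this] show ?thesis
    unfolding idx_def assms(3) by simp
qed

text \<open>The factor of natural numbers makes the enumerated product infinite, so
  \<open>to_nat_on\<close> is onto even if \<open>v\<close> emits only finitely many edges.\<close>

lemma idx_surj:
  assumes "emitted E v \<noteq> {}" shows "\<exists>e\<in>emitted E v. \<exists>m. idx e m = n"
proof -
  have "bij_betw (to_nat_on (emitted E v \<times> (UNIV :: nat set))) (emitted E v \<times> UNIV) UNIV"
    using assms by (intro to_nat_on_infinite) (auto simp: countable_emitted dest: finite_cartesian_productD2)
  then obtain e m where "e \<in> emitted E v" "to_nat_on (emitted E v \<times> (UNIV :: nat set)) (e, m) = n"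
    by (metis (no_types, lifting) UNIV_I bij_betw_iff_bijections mem_Sigma_iff prod.exhaust)
  then show ?thesis by (auto simp: idx_def emitted_def)
qed

lemma step_inj:
  assumes "e \<in> arcs E" "f \<in> arcs E" "fst s = head E e" "fst t = head E f" "step e s = step f t"
  shows "e = f \<and> s = t"
  using assms by (cases s; cases t) (auto simp: idx_eq_iff)

definition act1_edge :: "'e \<Rightarrow> 'v point \<Rightarrow> 'v point \<Rightarrow> bool" where
  "act1_edge e s t \<longleftrightarrow> e \<in> arcs E \<and> fst s = head E e \<and> t = step e s"

lemma act1_edge_inj: "act1_edge e s t \<Longrightarrow> act1_edge f s' t \<Longrightarrow> e = f \<and> s = s'"
  using step_inj unfolding act1_edge_def by blast

text \<open>\<open>None\<close> stands for the vector \<open>0\<close>. A ghost edge acts as the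
  partial inverse of its edge; the description is unambiguous by
  \<open>act1_edge_inj\<close>.\<close>

fun act1 :: "('v, 'e) lpa_gen \<Rightarrow> 'v point \<Rightarrow> 'v point option" where
  "act1 (Vertex v) s = (if fst s = v then Some s else None)"
| "act1 (Edge e) s = (if e \<in> arcs E \<and> fst s = head E e then Some (step e s) else None)"
| "act1 (Ghost e) t = (if \<exists>s. act1_edge e s t then Some (THE s. act1_edge e s t) else None)"

lemma act1_Edge: "act1 (Edge e) s = Some t \<longleftrightarrow> act1_edge e s t"
  by (auto simp: act1_edge_def)

lemma act1_Ghost: "act1 (Ghost e) t = Some s \<longleftrightarrow> act1_edge e s t"
proof -
  have "(THE s. act1_edge e s t) = s" if "act1_edge e s t" for s
    using that act1_edge_inj by (intro the_equality) auto
  then show ?thesis unfolding act1.simps by (metis option.inject option.distinct(1))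
qed

declare act1.simps(2,3) [simp del]

lemma act1_star: "act1 (gen_star g) t = Some s \<longleftrightarrow> act1 g s = Some t"
  by (cases g) (auto simp: act1_Edge act1_Ghost split: if_splits)

fun wact :: "('v, 'e) lpa_gen list \<Rightarrow> 'v point \<Rightarrow> 'v point option" where
  "wact [] s = Some s"
| "wact (g # gs) s = Option.bind (wact gs s) (act1 g)"

lemma wact_append: "wact (gs @ hs) s = Option.bind (wact hs s) (wact gs)"
proof (induction gs)
  case (Cons g gs)
  then show ?case by (cases "wact hs s") auto
qed (cases "wact hs s"; simp)

lemma wact_star: "wact (rev (map gen_star gs)) t = Some s \<longleftrightarrow> wact gs s = Some t"
proof (induction gs arbitrary: t)
  case (Cons g gs)
  show ?case
    using Cons act1_star[of g]
    by (auto simp: wact_append bind_eq_Some_conv)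
qed auto

fun ptv :: "'p option \<Rightarrow> complex \<Rightarrow> ('p \<Rightarrow>\<^sub>0 complex)" where
  "ptv None c = 0"
| "ptv (Some t) c = Poly_Mapping.single t c"

lemma ptv_add: "ptv p (c + d) = ptv p c + ptv p d"
  by (cases p) (auto simp: single_add)

lemma ptv_0 [simp]: "ptv p 0 = 0"
  by (cases p) auto

section \<open>The action on finitely supported functions\<close>

definition act :: "('v, 'e) lpa_free \<Rightarrow> ('v point \<Rightarrow>\<^sub>0 complex) \<Rightarrow> ('v point \<Rightarrow>\<^sub>0 complex)" where
  "act z \<xi> = plin (\<lambda>w d. plin (\<lambda>s c. ptv (wact (letters w) s) (d * c)) \<xi>) z"

lemma act_add_right: "act z (\<xi> + \<eta>) = act z \<xi> + act z \<eta>"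
  unfolding act_def plin_def[of _ z]
  by (subst plin_add) (auto simp: distrib_left ptv_add sum.distrib)

lemma act_add: "act (y + z) \<xi> = act y \<xi> + act z \<xi>"
  unfolding act_def by (rule plin_add) (simp add: plin_def distrib_right ptv_add sum.distrib)

lemma act_0 [simp]: "act 0 \<xi> = 0" "act z 0 = 0"
  by (simp_all add: act_def plin_def)

lemma act_single [simp]:
  "act (Poly_Mapping.single w d) (Poly_Mapping.single s c) = ptv (wact (letters w) s) (d * c)"
  unfolding act_def by (subst plin_single) (simp_all add: plin_single plin_zero_fun)

lemma act_minus: "act (- z) \<xi> = - act z \<xi>"
  using act_add[of z "- z" \<xi>] by (simp add: eq_neg_iff_add_eq_0 add.commute)

lemma act_diff: "act (y - z) \<xi> = act y \<xi> - act z \<xi>"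
  using act_add[of y "- z" \<xi>] by (simp add: act_minus)

lemma act_sum: "act (\<Sum>i\<in>S. f i) \<xi> = (\<Sum>i\<in>S. act (f i) \<xi>)"
  by (induction S rule: infinite_finite_induct) (auto simp: act_add)

lemma act_mult: "act (y * z) \<xi> = act y (act z \<xi>)"
proof (induction \<xi> rule: poly_mapping_single_induct)
  case (single s c)
  show ?case
  proof (induction z rule: poly_mapping_single_induct)
    case (single w d)
    show ?case
    proof (induction y rule: poly_mapping_single_induct)
      case (single v b)
      then show ?case by (cases "wact (letters w) s") (simp_all add: mult_single wact_append mult.assoc)
    qed (simp_all add: distrib_right act_add)
  qed (simp_all add: distrib_left act_add act_add_right)
qed (simp_all add: act_add_right)

lemma inn_act: "inn (act z \<xi>) \<eta> = inn \<xi> (act (free_star z) \<eta>)"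
proof (induction \<xi> rule: poly_mapping_single_induct)
  case (single s c)
  show ?case
  proof (induction \<eta> rule: poly_mapping_single_induct)
    case (single t b)
    show ?case
    proof (induction z rule: poly_mapping_single_induct)
      case (single w d)
      show ?case
        using wact_star[of "letters w" t s]
        by (cases "wact (letters w) s"; cases "wact (rev (map gen_star (letters w))) t")
           (auto simp: free_star_single word_star_def inn_single)
    qed (simp_all add: act_add inn_add inn_add_right free_star_add)
  qed (simp_all add: act_add_right inn_add_right)
qed (simp_all add: act_add_right inn_add)

lemma inn_act_const: "inn (act (const c) \<xi>) \<eta> = c * inn \<xi> \<eta>"
proof (induction \<xi> rule: poly_mapping_single_induct)
  case (single s d)
  show ?case
    by (induction \<eta> rule: poly_mapping_single_induct) (auto simp: inn_add_right inn_single distrib_left)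
qed (simp_all add: act_add_right inn_add distrib_left)

lemma act_gen [simp]: "act (free_gen g) (Poly_Mapping.single s c) = ptv (act1 g s) c"
  by (simp add: free_gen_def)

lemma act_gen_gen: "act (free_gen g * free_gen h) (Poly_Mapping.single s c) =
    ptv (Option.bind (act1 h s) (act1 g)) c"
  by (cases "act1 h s") (simp_all add: act_mult)

lemma act1_edge_tail: "act1_edge e s t \<Longrightarrow> fst t = tail E e \<and> fst s = head E e \<and> e \<in> arcs E"
  by (cases s) (auto simp: act1_edge_def)

lemma act1_edge_surj:
  assumes "v \<in> verts E" "emitted E v \<noteq> {}" "fst t = v"
  shows "\<exists>e\<in>emitted E v. \<exists>s. act1_edge e s t"
proof -
  obtain n k where t: "t = (v, n, k)" using assms(3) by (cases t) auto
  obtain e m where e: "e \<in> emitted E v" "idx e m = n" using idx_surj[OF assms(2)] by blast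
  then have "act1_edge e (head E e, m, k - 1) t"
    using emittedD[OF e(1)] by (simp add: act1_edge_def t)
  then show ?thesis using e by blast
qed

lemma act_rel_single: "x \<in> lpa_rels E \<Longrightarrow> act x (Poly_Mapping.single s c) = 0"
proof (induction rule: lpa_rels.induct)
  case (source_edge e)
  have "Option.bind (act1 (Edge e) s) (act1 (Vertex (tail E e))) = act1 (Edge e) s"
  proof (cases "act1 (Edge e) s")
    case (Some t)
    then have "act1_edge e s t" by (simp add: act1_Edge)
    from act1_edge_tail[OF this] show ?thesis using Some by simp
  qed simp
  then show ?case by (simp add: act_diff act_gen_gen)
next
  case (edge_range e)
  have "Option.bind (act1 (Vertex (head E e)) s) (act1 (Edge e)) = act1 (Edge e) s"
  proof (cases "act1 (Edge e) s")
    case (Some t)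
    then have "act1_edge e s t" by (simp add: act1_Edge)
    from act1_edge_tail[OF this] show ?thesis using Some by simp
  qed simp
  then show ?case by (simp add: act_diff act_gen_gen)
next
  case (range_ghost e)
  have "Option.bind (act1 (Ghost e) s) (act1 (Vertex (head E e))) = act1 (Ghost e) s"
  proof (cases "act1 (Ghost e) s")
    case (Some t)
    then have "act1_edge e t s" by (simp add: act1_Ghost)
    from act1_edge_tail[OF this] show ?thesis using Some by simp
  qed simp
  then show ?case by (simp add: act_diff act_gen_gen)
next
  case (ghost_source e)
  have "Option.bind (act1 (Vertex (tail E e)) s) (act1 (Ghost e)) = act1 (Ghost e) s"
  proof (cases "act1 (Ghost e) s")
    case (Some t)
    then have "act1_edge e t s" by (simp add: act1_Ghost)
    from act1_edge_tail[OF this] show ?thesis using Some by simp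
  qed simp
  then show ?case by (simp add: act_diff act_gen_gen)
next
  case (ghost_edge_same e)
  have "Option.bind (act1 (Edge e) s) (act1 (Ghost e)) = act1 (Vertex (head E e)) s"
  proof (cases "act1 (Edge e) s")
    case None
    then show ?thesis using ghost_edge_same by (auto simp: act1.simps split: if_splits)
  next
    case (Some t)
    then have t: "act1_edge e s t" by (simp add: act1_Edge)
    then have "act1 (Ghost e) t = Some s" by (simp add: act1_Ghost)
    then show ?thesis using Some act1_edge_tail[OF t] by simp
  qed
  then show ?case by (simp add: act_diff act_gen_gen)
next
  case (ghost_edge_diff e f)
  have "Option.bind (act1 (Edge f) s) (act1 (Ghost e)) = None"
  proof (cases "act1 (Edge f) s")
    case (Some t)
    then have "act1_edge f s t" by (simp add: act1_Edge)
    then have "act1 (Ghost e) t \<noteq> Some s'" for s'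
      unfolding act1_Ghost using ghost_edge_diff act1_edge_inj by blast
    then show ?thesis using Some by (cases "act1 (Ghost e) t") auto
  qed simp
  then show ?case by (simp add: act_gen_gen)
next
  case (regular v)
  then have v: "v \<in> verts E" "emitted E v \<noteq> {}" "finite (emitted E v)"
    by (auto simp: regular_vertices_def)
  show ?case
  proof (cases "fst s = v")
    case True
    \<comment> \<open>The ranges of the edges at \<open>v\<close> partition its points, so exactly
      one summand of the Cuntz-Krieger relation fixes \<open>s\<close> and all others send it to
      \<open>0\<close>.\<close>
    then obtain e t where e: "e \<in> emitted E v" "act1_edge e t s" using act1_edge_surj[OF v(1,2)] by blast
    have "act (A f * G f) (Poly_Mapping.single s c) = (if f = e then Poly_Mapping.single s c else 0)" for f
    proof (cases "act1 (Ghost f) s")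
      case None
      then have "f \<noteq> e" using e act1_Ghost[of e s t] by auto
      then show ?thesis using None by (simp add: act_mult)
    next
      case (Some t')
      then have "f = e" "t' = t" "act1 (Edge e) t = Some s"
        using e act1_edge_inj[of f t' s e t] by (auto simp: act1_Ghost act1_Edge)
      then show ?thesis using Some by (simp add: act_mult)
    qed
    then show ?thesis using True e v by (simp add: act_diff act_sum)
  next
    case False
    have "act (A f * G f) (Poly_Mapping.single s c) = 0" if "f \<in> emitted E v" for f
    proof (cases "act1 (Ghost f) s")
      case (Some t')
      then have "fst s = v" using that by (auto simp: act1_Ghost emitted_def dest: act1_edge_tail)
      then show ?thesis using False by simp
    qed (simp add: act_mult)
    then show ?thesis using False by (simp add: act_diff act_sum)
  qed
qed (auto simp: act_diff act_mult)

lemma act_rel: "x \<in> lpa_rels E \<Longrightarrow> act x \<xi> = 0"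
  by (induction \<xi> rule: poly_mapping_single_induct) (auto simp: act_add_right act_rel_single)

lemma act_ideal: "x \<in> I \<Longrightarrow> act x \<xi> = 0"
  by (induction arbitrary: \<xi> rule: lpa_ideal.induct)
     (auto simp: act_rel act_add act_mult free_smult_eq)

lemma act_eqv: "x \<asymp> y \<Longrightarrow> act x \<xi> = act y \<xi>"
  using act_ideal[of "x - y" \<xi>] by (simp add: eqv_def act_diff)

lemma act_form: "lpa_form E (\<lambda>x y. inn (act x \<xi>) (act y \<xi>))"
proof (rule lpa_formI)
  fix x assume "x \<in> F"
  show "0 \<le> Re (inn (act x \<xi>) (act x \<xi>))" by (simp add: inn_self sum_nonneg)
next
  fix x y show "inn (act y \<xi>) (act x \<xi>) = cnj (inn (act x \<xi>) (act y \<xi>))" by (rule inn_sym)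
next
  fix x y z show "inn (act (z * x) \<xi>) (act y \<xi>) = inn (act x \<xi>) (act (free_star z * y) \<xi>)"
    unfolding act_mult by (rule inn_act)
qed (simp_all add: act_add inn_add free_smult_eq act_mult inn_act_const act_ideal)

text \<open>The functions of finite support are not a Hilbert space, so the action is compared with
  the norm through its vector forms: by \<open>form_le_ln\<close> the form of \<open>a\<close>
  vanishes, and the inner product is definite.\<close>

lemma act_zero_of_ln_zero:
  assumes "a \<in> F" "ln a = 0" shows "act a \<xi> = 0"
proof -
  obtain S where S: "finite S" "S \<subseteq> verts E" "a * unit S \<asymp> a" using local_unit[OF assms(1)] by blast
  have "lpa_form.N (\<lambda>x y. inn (act x \<xi>) (act y \<xi>)) a \<le> 0"
    using form_le_ln[OF act_form assms(1) unit_in_F[OF S(2)] S(3)] assms(2) by simp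
  then have "Re (inn (act a \<xi>) (act a \<xi>)) \<le> 0"
    by (simp add: lpa_form.N_def[OF act_form])
  moreover have "0 \<le> Re (inn (act a \<xi>) (act a \<xi>))" by (simp add: inn_self sum_nonneg)
  ultimately show ?thesis by (intro inn_self_eq_0) simp
qed

text \<open>The final vertex keeps the word nonempty for the path of length
  \<open>0\<close>.\<close>

abbreviation pathw :: "'e list \<Rightarrow> 'v \<Rightarrow> ('v, 'e) lpa_gen free_word" where
  "pathw \<alpha> v \<equiv> Free_Word (map Edge \<alpha> @ [Vertex v])"

section \<open>Ghost-free elements and paths\<close>

fun real_gen :: "('v, 'e) lpa_gen \<Rightarrow> bool" where
  "real_gen (Ghost e) = False" | "real_gen _ = True"

fun edges_of :: "('v, 'e) lpa_gen list \<Rightarrow> 'e list" where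
  "edges_of [] = []"
| "edges_of (Edge e # gs) = e # edges_of gs"
| "edges_of (_ # gs) = edges_of gs"

definition realF :: "('v, 'e) lpa_free set" where
  "realF = {x \<in> F. \<forall>w\<in>Poly_Mapping.keys x. \<forall>g\<in>set (letters w). real_gen g}"

lemma realF_F: "x \<in> realF \<Longrightarrow> x \<in> F"
  by (simp add: realF_def)

lemma realF_0 [simp]: "0 \<in> realF"
  by (simp add: realF_def)

lemma realF_add: "x \<in> realF \<Longrightarrow> y \<in> realF \<Longrightarrow> x + y \<in> realF"
  using Poly_Mapping.keys_add[of x y] by (auto simp: realF_def)

lemma realF_mult: "x \<in> realF \<Longrightarrow> y \<in> realF \<Longrightarrow> x * y \<in> realF"
  using Poly_Mapping.keys_mult[of x y] by (fastforce simp: realF_def)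

lemma realF_gen: "gen_in E g \<Longrightarrow> real_gen g \<Longrightarrow> free_gen g \<in> realF"
  by (simp add: realF_def) (simp add: free_gen_def)

lemma realF_sum: "(\<And>i. i \<in> S \<Longrightarrow> f i \<in> realF) \<Longrightarrow> (\<Sum>i\<in>S. f i) \<in> realF"
  by (induction S rule: infinite_finite_induct) (auto intro: realF_add)

lemma single_Cons: "Poly_Mapping.single (Free_Word (g # gs)) c * y =
    free_gen g * (Poly_Mapping.single (Free_Word gs) c * y)"
  by (simp add: free_gen_def mult_single plus_free_word_def flip: mult.assoc)

lemma single_pathw_F: "v \<in> verts E \<Longrightarrow> set \<alpha> \<subseteq> arcs E \<Longrightarrow> Poly_Mapping.single (pathw \<alpha> v) c \<in> F"
  by (rule F_single) (auto simp: valid_word_def free_word_zero_iff)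

text \<open>A ghost-free word followed by \<open>V v\<close> reduces to one path ending in
  \<open>v\<close>, or to \<open>0\<close> if two neighbouring letters do not fit. A point at
  \<open>v\<close> detects which case occurs, because it can be moved along exactly if the letters
  fit. The last conjunct, on the vertex at the left end, is what the induction needs for attaching
  the next letter.\<close>

lemma wact_real_word:
  assumes "\<forall>g\<in>set gs. gen_in E g \<and> real_gen g" "v \<in> verts E" "fst t = v"
  shows "(case wact gs t of
      None \<Rightarrow> Poly_Mapping.single (Free_Word gs) c * V v \<asymp> 0
    | Some s \<Rightarrow> Poly_Mapping.single (Free_Word gs) c * V v \<asymp> Poly_Mapping.single (pathw (edges_of gs) v) c
        \<and> wact (map Edge (edges_of gs)) t = Some s \<and> set (edges_of gs) \<subseteq> arcs E \<and> fst s \<in> verts E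
        \<and> V (fst s) * Poly_Mapping.single (pathw (edges_of gs) v) c \<asymp> Poly_Mapping.single (pathw (edges_of gs) v) c)"
  using assms(1)
proof (induction gs)
  case Nil
  have "V v * (const c * V v) \<asymp> const c * V v"
    using eqv_smult[OF eqv_rels(1)[OF assms(2)], of c] by (simp add: free_smult_eq mult_const_left)
  moreover have "const c * V v = Poly_Mapping.single (Free_Word [Vertex v]) c"
    by (simp add: free_gen_def)
  ultimately show ?case using assms by simp
next
  case (Cons g gs)
  then have g: "gen_in E g" "free_gen g \<in> F" by auto
  show ?case
  proof (cases "wact gs t")
    case None
    then have "Poly_Mapping.single (Free_Word gs) c * V v \<asymp> 0" using Cons by auto
    from eqv_mult_left[OF this g(2)] show ?thesis using None by (simp add: single_Cons)
  next
    case (Some s)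
    define p where "p = Poly_Mapping.single (pathw (edges_of gs) v) c"
    have s: "Poly_Mapping.single (Free_Word gs) c * V v \<asymp> p" "wact (map Edge (edges_of gs)) t = Some s"
      "set (edges_of gs) \<subseteq> arcs E" "fst s \<in> verts E" "V (fst s) * p \<asymp> p"
      using Cons Some by (auto simp: p_def)
    have pF: "p \<in> F" unfolding p_def by (rule single_pathw_F[OF assms(2) s(3)])
    have gp: "Poly_Mapping.single (Free_Word (g # gs)) c * V v \<asymp> free_gen g * p"
      unfolding single_Cons by (rule eqv_mult_left[OF s(1) g(2)])
    have zero: "free_gen g * p \<asymp> 0" if "fst s \<noteq> gen_range g"
    proof -
      have "free_gen g * p \<asymp> free_gen g * (V (fst s) * p)"
        by (rule eqv_mult_left[OF eqv_sym[OF s(5)] g(2)])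
      also have "\<dots> = (free_gen g * V (fst s)) * p" by (simp add: mult.assoc)
      also have "\<dots> \<asymp> 0 * p" by (rule eqv_mult_right[OF gen_mult_vertex[OF g(1) s(4) that] pF])
      finally show ?thesis by simp
    qed
    show ?thesis
    proof (cases g)
      case (Vertex u)
      show ?thesis
      proof (cases "fst s = u")
        case True
        then show ?thesis using Vertex Some s eqv_trans[OF gp] by (simp add: p_def)
      next
        case False
        then show ?thesis using Vertex Some eqv_trans[OF gp zero] by simp
      qed
    next
      case (Edge e)
      then have e: "e \<in> arcs E" using g by simp
      show ?thesis
      proof (cases "fst s = head E e")
        case True
        then obtain s' where s': "act1_edge e s s'" using e by (simp add: act1_edge_def)
        have q: "free_gen g * p = Poly_Mapping.single (pathw (edges_of (g # gs)) v) c"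
          by (simp add: Edge p_def free_gen_def mult_single plus_free_word_def)
        have "V (tail E e) * (A e * p) \<asymp> A e * p"
          using eqv_mult_right[OF eqv_rels(2)[OF e] pF] by (simp add: mult.assoc)
        then have "V (fst s') * Poly_Mapping.single (pathw (edges_of (g # gs)) v) c \<asymp>
            Poly_Mapping.single (pathw (edges_of (g # gs)) v) c"
          using act1_edge_tail[OF s'] Edge unfolding q[symmetric] by simp
        moreover have "act1 (Edge e) s = Some s'" using s' by (simp add: act1_Edge)
        ultimately show ?thesis
          using Some s gp act1_edge_tail[OF s'] e unfolding q by (simp add: Edge)
      next
        case False
        then have "act1 (Edge e) s = None" by (simp add: act1.simps)
        then show ?thesis using Edge Some False eqv_trans[OF gp zero] by simp
      qed
    next
      case (Ghost e)
      then show ?thesis using Cons.prems by simp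
    qed
  qed
qed

lemma wact_Cons_Edge:
  "wact (map Edge (e # \<alpha>)) t = Some s \<Longrightarrow> \<exists>r. wact (map Edge \<alpha>) t = Some r \<and> act1_edge e r s"
  by (cases "wact (map Edge \<alpha>) t") (auto simp: act1_Edge)

lemma wact_edges_length: "wact (map Edge \<alpha>) t = Some s \<Longrightarrow> snd (snd s) = snd (snd t) + int (length \<alpha>)"
proof (induction \<alpha> arbitrary: s)
  case (Cons e \<alpha>)
  then obtain r where r: "wact (map Edge \<alpha>) t = Some r" "act1_edge e r s"
    using wact_Cons_Edge by blast
  then show ?case using Cons.IH[OF r(1)] by (cases r) (auto simp: act1_edge_def)
qed simp

text \<open>The degree coordinate forces equal lengths. Then the final point determines the leftmost
  edge, since ranges of distinct edges are disjoint, and also the point before it.\<close>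

lemma wact_edges_inj:
  "wact (map Edge \<alpha>) t = Some s \<Longrightarrow> wact (map Edge \<beta>) t = Some s \<Longrightarrow> \<alpha> = \<beta>"
proof (induction \<alpha> arbitrary: \<beta> s)
  case Nil
  have "int (length ([] :: 'e list)) = int (length \<beta>)"
    using wact_edges_length[OF Nil(1)] wact_edges_length[OF Nil(2)] by linarith
  then show ?case by simp
next
  case (Cons e \<alpha>)
  have "int (length (e # \<alpha>)) = int (length \<beta>)"
    using wact_edges_length[OF Cons.prems(1)] wact_edges_length[OF Cons.prems(2)] by linarith
  then obtain f \<gamma> where \<beta>: "\<beta> = f # \<gamma>" by (cases \<beta>) auto
  obtain r r' where r: "wact (map Edge \<alpha>) t = Some r" "act1_edge e r s"
    "wact (map Edge \<gamma>) t = Some r'" "act1_edge f r' s"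
    using wact_Cons_Edge[OF Cons.prems(1)] wact_Cons_Edge[OF Cons.prems(2)[unfolded \<beta>]] by blast
  have "e = f" "r = r'" using act1_edge_inj[OF r(2,4)] by auto
  then show ?case using Cons.IH[OF r(1)] r(3) \<beta> by simp
qed

text \<open>Distinct paths that end in \<open>v\<close> move a point at \<open>v\<close> to distinct points.\<close>

lemma realF_faithful:
  assumes y: "y \<in> realF" and v: "v \<in> verts E" "fst t = v" and 0: "act y (Poly_Mapping.single t 1) = 0"
  shows "y * V v \<asymp> 0"
proof -
  let ?c = "Poly_Mapping.lookup y"
  define K where "K = {w \<in> Poly_Mapping.keys y. wact (letters w) t \<noteq> None}"
  define \<tau> where "\<tau> w = the (wact (letters w) t)" for w
  have K: "finite K" "K \<subseteq> Poly_Mapping.keys y" by (auto simp: K_def)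
  have word: "\<forall>g\<in>set (letters w). gen_in E g \<and> real_gen g" if "w \<in> Poly_Mapping.keys y" for w
    using y that by (auto simp: realF_def F_iff valid_word_def)
  have some: "wact (letters w) t = Some (\<tau> w)" if "w \<in> K" for w using that by (auto simp: K_def \<tau>_def)
  have nf: "Poly_Mapping.single w (?c w) * V v \<asymp>
      (if w \<in> K then Poly_Mapping.single (pathw (edges_of (letters w)) v) (?c w) else 0)"
    if "w \<in> Poly_Mapping.keys y" for w
    using wact_real_word[OF word[OF that] v, of "?c w"] that
    by (cases "wact (letters w) t") (auto simp: K_def)
  have path: "wact (map Edge (edges_of (letters w))) t = Some (\<tau> w)" if "w \<in> K" for w
    using wact_real_word[OF word v, of w 1] some[OF that] that K by auto
  have "y * V v = (\<Sum>w\<in>Poly_Mapping.keys y. Poly_Mapping.single w (?c w) * V v)"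
    by (simp only: sum_distrib_right[symmetric] sum_single_lookup)
  also have "\<dots> \<asymp> (\<Sum>w\<in>Poly_Mapping.keys y.
      if w \<in> K then Poly_Mapping.single (pathw (edges_of (letters w)) v) (?c w) else 0)"
    by (rule eqv_sum[OF nf])
  also have "\<dots> = (\<Sum>w\<in>K. Poly_Mapping.single (pathw (edges_of (letters w)) v) (?c w))"
    using K by (simp add: sum.If_cases Int_absorb1)
  also have "\<dots> = 0"
  \<comment> \<open>The relation supplied by the hypothesis is between the points
    \<open>\<tau> w\<close>; by injectivity they coincide exactly when the paths do.\<close>
  proof (rule sum_single_zero_transfer[OF K(1)])
    show "\<tau> w = \<tau> w' \<longleftrightarrow> pathw (edges_of (letters w)) v = pathw (edges_of (letters w')) v"
      if "w \<in> K" "w' \<in> K" for w w'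
    proof -
      have "edges_of (letters w) = edges_of (letters w') \<longleftrightarrow> \<tau> w = \<tau> w'"
        using path[OF that(1)] path[OF that(2)] wact_edges_inj by (metis option.inject)
      moreover have "(map Edge xs :: ('v, 'e) lpa_gen list) = map Edge ys \<longleftrightarrow> xs = ys" for xs ys :: "'e list"
        by (rule inj_map_eq_map) (simp add: inj_def)
      ultimately show ?thesis by simp
    qed
    have "0 = (\<Sum>w\<in>Poly_Mapping.keys y. act (Poly_Mapping.single w (?c w)) (Poly_Mapping.single t 1))"
      by (simp only: act_sum[symmetric] sum_single_lookup 0)
    also have "\<dots> = (\<Sum>w\<in>Poly_Mapping.keys y. if w \<in> K then Poly_Mapping.single (\<tau> w) (?c w) else 0)"
    proof (rule sum.cong[OF refl])
      fix w assume w: "w \<in> Poly_Mapping.keys y"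
      show "act (Poly_Mapping.single w (?c w)) (Poly_Mapping.single t 1) =
          (if w \<in> K then Poly_Mapping.single (\<tau> w) (?c w) else 0)"
      proof (cases "w \<in> K")
        case False
        then have "wact (letters w) t = None" using w unfolding K_def by blast
        then show ?thesis using False by simp
      qed (simp add: some)
    qed
    also have "\<dots> = (\<Sum>w\<in>K. Poly_Mapping.single (\<tau> w) (?c w))"
      using K by (simp add: sum.If_cases Int_absorb1)
    finally show "(\<Sum>w\<in>K. Poly_Mapping.single (\<tau> w) (?c w)) = 0" ..
  qed
  finally show ?thesis .
qed

text \<open>The filtration of the Leavitt path algebra by the number of ghost edges at the right end.\<close>

primrec filt :: "nat \<Rightarrow> ('v, 'e) lpa_free \<Rightarrow> bool" where
  "filt 0 x \<longleftrightarrow> (\<exists>y\<in>realF. x \<asymp> y)"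
| "filt (Suc m) x \<longleftrightarrow> (\<exists>y\<in>realF. \<exists>S b. finite S \<and> S \<subseteq> arcs E \<and> (\<forall>e\<in>S. b e \<in> F \<and> filt m (b e)) \<and>
     x \<asymp> y + (\<Sum>e\<in>S. b e * G e))"

declare filt.simps(2) [simp del]

lemma filt_SucI:
  assumes "y \<in> realF" "finite S" "S \<subseteq> arcs E" "\<And>e. e \<in> S \<Longrightarrow> b e \<in> F \<and> filt m (b e)"
    "x \<asymp> y + (\<Sum>e\<in>S. b e * G e)"
  shows "filt (Suc m) x"
  unfolding filt.simps using assms by blast

lemma filt_SucE:
  assumes "filt (Suc m) x"
  obtains y S b where "y \<in> realF" "finite S" "S \<subseteq> arcs E" "\<forall>e\<in>S. b e \<in> F \<and> filt m (b e)"
    "x \<asymp> y + (\<Sum>e\<in>S. b e * G e)"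
proof -
  from assms obtain y S b where "y \<in> realF \<and> finite S \<and> S \<subseteq> arcs E \<and>
      (\<forall>e\<in>S. b e \<in> F \<and> filt m (b e)) \<and> x \<asymp> y + (\<Sum>e\<in>S. b e * G e)"
    unfolding filt.simps by blast
  then show ?thesis using that[of y S b] by blast
qed

lemma filt_eqv: "filt m y \<Longrightarrow> x \<asymp> y \<Longrightarrow> filt m x"
proof (cases m)
  case (Suc n)
  assume "filt m y" "x \<asymp> y"
  then show ?thesis unfolding Suc by (elim filt_SucE) (rule filt_SucI, assumption+, blast, rule eqv_trans)
qed (auto intro: eqv_trans)

lemma filt_real: "y \<in> realF \<Longrightarrow> filt m y"
proof (cases m)
  case (Suc n)
  assume "y \<in> realF"
  then show ?thesis unfolding Suc by (intro filt_SucI[of y "{}" "\<lambda>_. 0"]) auto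
qed (auto intro: bexI[of _ y])

lemma filt_0: "filt m 0"
  by (rule filt_real) simp

lemma filt_Suc: "filt m x \<Longrightarrow> filt (Suc m) x"
proof (induction m arbitrary: x)
  case 0
  then show ?case using filt_real filt_eqv by fastforce
next
  case (Suc m)
  from Suc.prems obtain y S b where "y \<in> realF" "finite S" "S \<subseteq> arcs E"
    "\<forall>e\<in>S. b e \<in> F \<and> filt m (b e)" "x \<asymp> y + (\<Sum>e\<in>S. b e * G e)" by (rule filt_SucE)
  then show ?case using Suc.IH by (intro filt_SucI[of y S b]) auto
qed

lemma filt_add: "filt m x \<Longrightarrow> filt m x' \<Longrightarrow> filt m (x + x')"
proof (induction m arbitrary: x x')
  case 0
  then show ?case using realF_add eqv_add by (simp, blast)
next
  case (Suc m)
  obtain y S b where y: "y \<in> realF" "finite S" "S \<subseteq> arcs E" "\<forall>e\<in>S. b e \<in> F \<and> filt m (b e)"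
      "x \<asymp> y + (\<Sum>e\<in>S. b e * G e)" using Suc.prems(1) by (rule filt_SucE)
  obtain y' S' b' where y': "y' \<in> realF" "finite S'" "S' \<subseteq> arcs E" "\<forall>e\<in>S'. b' e \<in> F \<and> filt m (b' e)"
      "x' \<asymp> y' + (\<Sum>e\<in>S'. b' e * G e)" using Suc.prems(2) by (rule filt_SucE)
  define c where "c e = (if e \<in> S then b e else 0) + (if e \<in> S' then b' e else 0)" for e
  have "(\<Sum>e\<in>S \<union> S'. c e * G e) =
      (\<Sum>e\<in>S \<union> S'. if e \<in> S then b e * G e else 0) + (\<Sum>e\<in>S \<union> S'. if e \<in> S' then b' e * G e else 0)"
    by (simp add: c_def distrib_right if_distrib[of "\<lambda>z. z * _"] sum.distrib cong: if_cong)
  also have "\<dots> = (\<Sum>e\<in>S. b e * G e) + (\<Sum>e\<in>S'. b' e * G e)"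
    using y(2) y'(2) by (simp add: sum.If_cases Int_absorb1)
  finally have "x + x' \<asymp> (y + y') + (\<Sum>e\<in>S \<union> S'. c e * G e)"
    using eqv_add[OF y(5) y'(5)] by (simp add: add_ac)
  moreover have "c e \<in> F \<and> filt m (c e)" if "e \<in> S \<union> S'" for e
    using y(4) y'(4) Suc.IH filt_0 by (auto simp: c_def)
  ultimately show ?case
    using y y' realF_add by (intro filt_SucI[of "y + y'" "S \<union> S'" c]) auto
qed

lemma filt_vertex: "filt m x \<Longrightarrow> v \<in> verts E \<Longrightarrow> filt m (x * V v)"
proof (cases m)
  case 0
  assume "filt m x" "v \<in> verts E"
  then obtain y where "y \<in> realF" "x \<asymp> y" using 0 by auto
  then show ?thesis using \<open>v \<in> verts E\<close> 0
    by (auto intro!: bexI[of _ "y * V v"] eqv_mult_right realF_mult realF_gen)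
next
  case (Suc n)
  assume fx: "filt m x" and v: "v \<in> verts E"
  obtain y S b where y: "y \<in> realF" "finite S" "S \<subseteq> arcs E" "\<forall>e\<in>S. b e \<in> F \<and> filt n (b e)"
      "x \<asymp> y + (\<Sum>e\<in>S. b e * G e)" using fx[unfolded Suc] by (rule filt_SucE)
  have "x * V v \<asymp> y * V v + (\<Sum>e\<in>S. b e * (G e * V v))"
    using eqv_mult_right[OF y(5), of "V v"] v by (simp add: distrib_right sum_distrib_right mult.assoc)
  also have "\<dots> \<asymp> y * V v + (\<Sum>e\<in>S. b e * (if tail E e = v then G e else 0))"
  proof (intro eqv_add eqv_refl eqv_sum eqv_mult_left)
    show "G e * V v \<asymp> (if tail E e = v then G e else 0)" if "e \<in> S" for e
      using that y(3) v gen_mult_vertex[of "Ghost e" v] eqv_rels(5)[of e] by auto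
  qed (use y in auto)
  also have "(\<Sum>e\<in>S. b e * (if tail E e = v then G e else 0)) = (\<Sum>e\<in>{e\<in>S. tail E e = v}. b e * G e)"
    using y(2) by (simp add: sum.inter_filter if_distrib[of "\<lambda>z. _ * z"] cong: if_cong)
  finally have *: "x * V v \<asymp> y * V v + (\<Sum>e\<in>{e\<in>S. tail E e = v}. b e * G e)" .
  show ?thesis unfolding Suc
    by (rule filt_SucI[of "y * V v" "{e\<in>S. tail E e = v}" b])
       (use * y v in \<open>auto intro!: realF_mult realF_gen\<close>)
qed

text \<open>\<open>G e * A f\<close> is \<open>V (head E f)\<close> if \<open>e = f\<close> and
  \<open>0\<close> otherwise, so right multiplication by \<open>A f\<close> singles out the
  coefficient of \<open>G f\<close>.\<close>

lemma filt_edge_coeff: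
  assumes "finite S" "S \<subseteq> arcs E" "\<And>e. e \<in> S \<Longrightarrow> b e \<in> F" "x \<asymp> y + (\<Sum>e\<in>S. b e * G e)" "f \<in> arcs E"
  shows "x * A f \<asymp> y * A f + (if f \<in> S then b f * V (head E f) else 0)"
proof -
  have "x * A f \<asymp> y * A f + (\<Sum>e\<in>S. b e * (G e * A f))"
    using eqv_mult_right[OF assms(4), of "A f"] assms(5) by (simp add: distrib_right sum_distrib_right mult.assoc)
  also have "\<dots> \<asymp> y * A f + (\<Sum>e\<in>S. b e * (if e = f then V (head E f) else 0))"
  proof (intro eqv_add eqv_refl eqv_sum eqv_mult_left)
    show "G e * A f \<asymp> (if e = f then V (head E f) else 0)" if "e \<in> S" for e
      using that assms(2,5) eqv_rels(6)[of e] eqv_rels(9)[of e f] by auto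
  qed (use assms in auto)
  also have "(\<Sum>e\<in>S. b e * (if e = f then V (head E f) else 0)) = (if f \<in> S then b f * V (head E f) else 0)"
    using assms(1) by (simp add: if_distrib[of "\<lambda>z. _ * z"] cong: if_cong)
  finally show ?thesis .
qed

text \<open>An edge on the right turns the last ghost edge into a vertex or \<open>0\<close>. The
  resulting drop of the level drives the induction for faithfulness.\<close>

lemma filt_edge: "filt (Suc m) x \<Longrightarrow> f \<in> arcs E \<Longrightarrow> filt m (x * A f)"
proof -
  assume fx: "filt (Suc m) x" and f: "f \<in> arcs E"
  obtain y S b where y: "y \<in> realF" "finite S" "S \<subseteq> arcs E" "\<forall>e\<in>S. b e \<in> F \<and> filt m (b e)"
      "x \<asymp> y + (\<Sum>e\<in>S. b e * G e)" using fx by (rule filt_SucE)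
  have "x * A f \<asymp> y * A f + (if f \<in> S then b f * V (head E f) else 0)"
    using y f by (intro filt_edge_coeff) auto
  moreover have "filt m (y * A f)" using y f by (intro filt_real realF_mult realF_gen) auto
  then have "filt m (y * A f + (if f \<in> S then b f * V (head E f) else 0))"
    using y f by (intro filt_add) (auto intro: filt_vertex filt_0)
  ultimately show ?thesis using filt_eqv by blast
qed

lemma filt_ghost: "filt m x \<Longrightarrow> x \<in> F \<Longrightarrow> e \<in> arcs E \<Longrightarrow> filt (Suc m) (x * G e)"
  by (rule filt_SucI[of 0 "{e}" "\<lambda>_. x"]) auto

lemma filt_word:
  assumes "\<forall>g\<in>set gs. gen_in E g" "filt m x" "x \<in> F"
  shows "\<exists>m'. filt m' (x * Poly_Mapping.single (Free_Word gs) 1)"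
  using assms
proof (induction gs arbitrary: x m)
  case (Cons g gs)
  have "\<exists>m'. filt m' (x * free_gen g)"
  proof (cases g)
    case (Vertex v) then show ?thesis using Cons.prems filt_vertex by auto
  next
    case (Edge e) then show ?thesis using Cons.prems filt_edge[OF filt_Suc, of m x e] by auto
  next
    case (Ghost e) then show ?thesis using Cons.prems filt_ghost[of m x e] by auto
  qed
  then obtain m' where "filt m' (x * free_gen g)" by blast
  moreover have "x * Poly_Mapping.single (Free_Word (g # gs)) 1 = (x * free_gen g) * Poly_Mapping.single (Free_Word gs) 1"
    by (simp add: free_gen_def mult_single plus_free_word_def mult.assoc)
  ultimately show ?case using Cons by simp
qed auto

lemma filt_smult_right: "filt m x \<Longrightarrow> filt m (free_smult c x)"
proof (induction m arbitrary: x)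
  case 0
  then obtain y where y: "y \<in> realF" "x \<asymp> y" by auto
  have "free_smult c y \<in> realF"
    using y(1) Poly_Mapping.keys_mult[of "const c" y] by (fastforce simp: realF_def free_smult_eq split: if_splits)
  then show ?case using eqv_smult[OF y(2)] by auto
next
  case (Suc m)
  from Suc.prems obtain y S b where y: "y \<in> realF" "finite S" "S \<subseteq> arcs E" "\<forall>e\<in>S. b e \<in> F \<and> filt m (b e)"
      "x \<asymp> y + (\<Sum>e\<in>S. b e * G e)" by (rule filt_SucE)
  have "free_smult c y \<in> realF"
    using y(1) Poly_Mapping.keys_mult[of "const c" y] by (fastforce simp: realF_def free_smult_eq split: if_splits)
  moreover have "free_smult c x \<asymp> free_smult c y + (\<Sum>e\<in>S. free_smult c (b e) * G e)"
    using eqv_smult[OF y(5), of c] by (simp add: free_smult_eq distrib_left sum_distrib_left mult.assoc)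
  ultimately show ?case using y Suc.IH
    by (intro filt_SucI[of "free_smult c y" S "\<lambda>e. free_smult c (b e)"]) auto
qed

text \<open>A local unit has level \<open>0\<close>, and the letters of a word are multiplied to it
  from the right: a ghost edge raises the level by one, the other letters do not raise it.\<close>

lemma filt_exhausts: "a \<in> F \<Longrightarrow> \<exists>m. filt m a"
proof (induction rule: F_induct)
  case zero then show ?case using filt_0 by blast
next
  case (single w c)
  then have z: "Poly_Mapping.single w 1 \<in> F" by auto
  obtain S where S: "finite S" "S \<subseteq> verts E" "unit S * Poly_Mapping.single w 1 \<asymp> Poly_Mapping.single w 1"
    using local_unit[OF z] by blast
  have "filt 0 (unit S)" unfolding unit_def using S by (intro filt_real realF_sum realF_gen) auto
  then obtain m where "filt m (unit S * Poly_Mapping.single w 1)"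
    using filt_word[of "letters w" 0 "unit S"] single unit_in_F[OF S(2)] by (auto simp: valid_word_def)
  then have "filt m (Poly_Mapping.single w 1)" using eqv_sym[OF S(3)] filt_eqv by blast
  then have "filt m (free_smult c (Poly_Mapping.single w 1))" by (rule filt_smult_right)
  then show ?case by (auto simp: free_smult_eq)
next
  case (add x y)
  then obtain m n where mn: "filt m x" "filt n y" by blast
  have up: "filt (m + k) x" if "filt m x" for m k x using that by (induction k) (auto intro: filt_Suc )
  have "filt (m + n) x" "filt (m + n) y" using up[OF mn(1), of n] up[OF mn(2), of m] by (simp_all add: add.commute)
  then show ?case using filt_add by blast
qed

lemma eqv_zero_of_vertices:
  assumes "a \<in> F" "\<And>v. v \<in> verts E \<Longrightarrow> a * V v \<asymp> 0" shows "a \<asymp> 0"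
proof -
  obtain S where S: "finite S" "S \<subseteq> verts E" "a * unit S \<asymp> a" using local_unit[OF assms(1)] by blast
  have "a * unit S \<asymp> (\<Sum>v\<in>S. 0)"
    unfolding unit_def sum_distrib_left by (rule eqv_sum) (use assms S in auto)
  then show ?thesis using eqv_trans[OF eqv_sym[OF S(3)]] by simp
qed

text \<open>By induction \<open>a * A e\<close> is \<open>0\<close> for every edge. At a regular
  vertex the Cuntz-Krieger relation then gives \<open>a * V v = 0\<close>. At any other vertex there
  is no such relation, but the ranges of the finitely many edges in \<open>S\<close> do not cover
  its points, and a point outside them isolates the ghost-free part \<open>y\<close>.\<close>

lemma filt_faithful:
  "filt m a \<Longrightarrow> a \<in> F \<Longrightarrow> (\<And>\<xi>. act a \<xi> = 0) \<Longrightarrow> a \<asymp> 0"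
proof (induction m arbitrary: a)
  case 0
  then obtain y where y: "y \<in> realF" "a \<asymp> y" by auto
  show ?case
  proof (rule eqv_zero_of_vertices[OF 0(2)])
    fix v assume v: "v \<in> verts E"
    have "y * V v \<asymp> 0"
      using 0(3) act_eqv[OF y(2)] v by (intro realF_faithful[OF y(1), of v "(v, 0, 0)"]) auto
    then show "a * V v \<asymp> 0" using eqv_mult_right[OF y(2), of "V v"] v eqv_trans by auto
  qed
next
  case (Suc m)
  obtain y S b where y: "y \<in> realF" "finite S" "S \<subseteq> arcs E" "\<forall>e\<in>S. b e \<in> F \<and> filt m (b e)"
      "a \<asymp> y + (\<Sum>e\<in>S. b e * G e)" using Suc.prems(1) by (rule filt_SucE)
  have yF: "y \<in> F" using y(1) by (rule realF_F)
  have aA: "a * A e \<asymp> 0" if "e \<in> arcs E" for e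
    using that Suc.prems filt_edge by (intro Suc.IH) (auto simp: act_mult )
  show ?case
  proof (rule eqv_zero_of_vertices[OF Suc.prems(2)])
    fix v assume v: "v \<in> verts E"
    show "a * V v \<asymp> 0"
    proof (cases "v \<in> regular_vertices E")
      case True
      have "a * V v \<asymp> a * (\<Sum>e\<in>emitted E v. A e * G e)"
        using eqv_rels(7)[OF True] Suc.prems(2) by (rule eqv_mult_left)
      also have "\<dots> = (\<Sum>e\<in>emitted E v. a * A e * G e)" by (simp add: sum_distrib_left mult.assoc)
      also have "\<dots> \<asymp> (\<Sum>e\<in>emitted E v. 0 * G e)"
        using aA by (intro eqv_sum eqv_mult_right) (auto dest: emittedD)
      finally show ?thesis by simp
    next
      case False
      \<comment> \<open>A vertex that is not regular is a sink or an infinite emitter. No edge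
        reaches a point of a sink; at an infinite emitter, a point in the range of an edge outside
        the finite set \<open>S\<close> is suitable.\<close>
      have "\<exists>t. fst t = v \<and> (\<forall>e\<in>S. \<forall>s. \<not> act1_edge e s t)"
      proof (cases "emitted E v = {}")
        case True
        have "\<not> act1_edge e s (v, 0, 0)" for e s
          using True act1_edge_tail[of e s "(v, 0, 0)"] by (auto simp: emitted_def)
        then show ?thesis by (intro exI[of _ "(v, 0, 0)"]) auto
      next
        case nonempty: False
        then have "infinite (emitted E v)" using False v by (simp add: regular_vertices_def)
        then obtain f where f: "f \<in> emitted E v" "f \<notin> S" using y(2) by (meson finite_subset subsetI)
        define t where "t = step f (head E f, 0, 0)"
        have "act1_edge f (head E f, 0, 0) t" using emittedD[OF f(1)] by (simp add: act1_edge_def t_def)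
        then have "\<not> act1_edge e s t" if "e \<in> S" for e s using that f act1_edge_inj by blast
        moreover have "fst t = v" using emittedD[OF f(1)] by (simp add: t_def)
        ultimately show ?thesis by blast
      qed
      then obtain t where t: "fst t = v" "\<And>e s. e \<in> S \<Longrightarrow> \<not> act1_edge e s t" by blast
      have "act (G e) (Poly_Mapping.single t 1) = 0" if "e \<in> S" for e
        using t(2)[OF that] by (simp add: act1.simps)
      then have "act a (Poly_Mapping.single t 1) = act y (Poly_Mapping.single t 1)"
        unfolding act_eqv[OF y(5)] by (simp add: act_add act_sum act_mult)
      then have yv: "y * V v \<asymp> 0" using Suc.prems(3) by (intro realF_faithful[OF y(1) v t(1)]) simp
      \<comment> \<open>Since \<open>y * V v\<close> is already \<open>0\<close>, multiplying
        \<open>a\<close> by an edge \<open>e\<close> of \<open>S\<close> that leaves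
        \<open>v\<close> keeps only the coefficient \<open>b e\<close>; but \<open>a * A e\<close>
        is \<open>0\<close> by \<open>aA\<close>.\<close>
      have b0: "b e * (G e * V v) \<asymp> 0" if e: "e \<in> S" for e
      proof (cases "tail E e = v")
        case True
        have eE: "e \<in> arcs E" using e y by blast
        have "y * A e \<asymp> y * (V v * A e)"
          using eqv_mult_left[OF eqv_sym[OF eqv_rels(2)[OF eE]] yF] True by simp
        also have "\<dots> = (y * V v) * A e" by (simp add: mult.assoc)
        also have "\<dots> \<asymp> 0 * A e" using eE by (intro eqv_mult_right[OF yv]) auto
        finally have yA: "y * A e \<asymp> 0" by simp
        have "a * A e \<asymp> y * A e + b e * V (head E e)"
          using filt_edge_coeff[of S b a y e] y e eE by auto
        then have "0 \<asymp> y * A e + b e * V (head E e)" using eqv_trans[OF eqv_sym[OF aA[OF eE]]] by blast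
        also have "\<dots> \<asymp> 0 + b e * V (head E e)" by (intro eqv_add yA eqv_refl)
        finally have bV: "b e * V (head E e) \<asymp> 0" using eqv_sym by simp
        have "b e * (G e * V v) \<asymp> b e * G e"
          using eqv_rels(5)[OF eE] True y(4)[rule_format, OF e] by (intro eqv_mult_left) auto
        also have "\<dots> \<asymp> b e * (V (head E e) * G e)"
          using y(4)[rule_format, OF e] by (intro eqv_mult_left[OF eqv_sym[OF eqv_rels(4)[OF eE]]]) auto
        also have "\<dots> = (b e * V (head E e)) * G e" by (simp add: mult.assoc)
        also have "\<dots> \<asymp> 0 * G e" using eE by (intro eqv_mult_right[OF bV]) auto
        finally show ?thesis by simp
      next
        case False
        have "b e * (G e * V v) \<asymp> b e * 0"
          using gen_mult_vertex[of "Ghost e" v] False e y v by (intro eqv_mult_left) auto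
        then show ?thesis by simp
      qed
      have "a * V v \<asymp> y * V v + (\<Sum>e\<in>S. b e * (G e * V v))"
        using eqv_mult_right[OF y(5), of "V v"] v by (simp add: distrib_right sum_distrib_right mult.assoc)
      also have "\<dots> \<asymp> 0 + (\<Sum>e\<in>S. 0)" by (intro eqv_add yv eqv_sum b0)
      finally show ?thesis by simp
    qed
  qed
qed

theorem ln_eq_0_iff:
  assumes "a \<in> F" shows "ln a = 0 \<longleftrightarrow> cl a = \<zero>\<^bsub>L\<^esub>"
proof
  assume "ln a = 0"
  obtain m where "filt m a" using filt_exhausts[OF assms] by blast
  then have "a \<asymp> 0" using assms act_zero_of_ln_zero[OF assms \<open>ln a = 0\<close>] by (rule filt_faithful)
  then show "cl a = \<zero>\<^bsub>L\<^esub>" by (simp add: L_zero cl_eqI)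
next
  assume "cl a = \<zero>\<^bsub>L\<^esub>"
  then have "cl a = cl (free_smult 0 a)" by (simp add: L_zero free_smult_eq)
  then have "ln a = ln (free_smult 0 a)" by simp
  then show "ln a = 0" using ln_smult[OF assms, of 0] by simp
qed

theorem norm_on_leavitt: "norm_on L (leavitt_norm E)"
  unfolding norm_on_def
proof (intro conjI ballI allI)
  fix X assume "X \<in> carrier L"
  then obtain x where x: "x \<in> F" "X = cl x" by blast
  show "leavitt_norm E X = 0 \<longleftrightarrow> X = \<zero>\<^bsub>L\<^esub>" unfolding x(2) by (rule ln_eq_0_iff[OF x(1)])
qed (auto elim!: L_cases simp: L_add L_smult ln_add ln_smult)

end

section \<open>Completions of pre-C*-algebras\<close>

sublocale star_algebra \<subseteq> complex_module A
  by (intro complex_module.intro module_axioms)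

text \<open>The axioms of a C*-algebra except completeness. One development thus serves the normed
  Leavitt path algebra and, through \<open>cstar_imp_pre_cstar\<close>, every C*-algebra.\<close>

locale pre_cstar = star_algebra A for A :: "'a normed_star_algebra" (structure) +
  assumes pre_norm: "norm_on A (nrm A)"
    and pre_mult: "\<lbrakk>x \<in> carrier A; y \<in> carrier A\<rbrakk> \<Longrightarrow> nrm A (x \<otimes> y) \<le> nrm A x * nrm A y"
    and pre_cstar: "x \<in> carrier A \<Longrightarrow> nrm A (star A x \<otimes> x) = (nrm A x)\<^sup>2"
begin

sublocale nm: normed_module A "nrm A"
  by unfold_locales (rule pre_norm)

lemma mult_diff_left: "\<lbrakk>x \<in> carrier A; y \<in> carrier A; z \<in> carrier A\<rbrakk> \<Longrightarrow> (x \<ominus> y) \<otimes> z = x \<otimes> z \<ominus> y \<otimes> z"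
  by (simp add: diff_eq_smult mult_distrib_right smult_mult_left mult_closed)

lemma mult_diff_right: "\<lbrakk>x \<in> carrier A; y \<in> carrier A; z \<in> carrier A\<rbrakk> \<Longrightarrow> z \<otimes> (x \<ominus> y) = z \<otimes> x \<ominus> z \<otimes> y"
  by (simp add: diff_eq_smult mult_distrib_left smult_mult_right mult_closed)

lemma star_diff: "\<lbrakk>x \<in> carrier A; y \<in> carrier A\<rbrakk> \<Longrightarrow> star A (x \<ominus> y) = star A x \<ominus> star A y"
  by (simp add: diff_eq_smult star_add star_smult star_closed)

lemma nrm_star: "x \<in> carrier A \<Longrightarrow> nrm A (star A x) = nrm A x"
proof -
  have le: "nrm A x \<le> nrm A (star A x)" if x: "x \<in> carrier A" for x
  proof (cases "nrm A x = 0")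
    case False
    then have "nrm A x > 0" using nm.norm_nonneg[OF x] by linarith
    moreover have "nrm A x * nrm A x \<le> nrm A (star A x) * nrm A x"
      using pre_mult[OF star_closed[OF x] x] by (simp add: pre_cstar[OF x] power2_eq_square)
    ultimately show ?thesis by simp
  qed (use x star_closed in simp)
  assume x: "x \<in> carrier A"
  show ?thesis using le[OF x] le[OF star_closed[OF x]] by (simp add: star_star x)
qed

lemma nrm_mult_diff:
  assumes "x \<in> carrier A" "y \<in> carrier A" "x' \<in> carrier A" "y' \<in> carrier A" "nrm A y \<le> K" "nrm A x' \<le> K"
  shows "nrm A (x \<otimes> y \<ominus> x' \<otimes> y') \<le> K * (nrm A (x \<ominus> x') + nrm A (y \<ominus> y'))"
proof -
  have "nrm A (x \<otimes> y \<ominus> x' \<otimes> y') \<le> nrm A ((x \<ominus> x') \<otimes> y) + nrm A (x' \<otimes> (y \<ominus> y'))"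
    using assms nm.norm_triangle_diff[of "x \<otimes> y" "x' \<otimes> y" "x' \<otimes> y'"]
    by (simp add: mult_diff_left mult_diff_right mult_closed)
  also have "\<dots> \<le> nrm A (x \<ominus> x') * nrm A y + nrm A x' * nrm A (y \<ominus> y')"
    using assms by (intro add_mono pre_mult) auto
  also have "\<dots> \<le> nrm A (x \<ominus> x') * K + K * nrm A (y \<ominus> y')"
    using assms by (intro add_mono mult_left_mono mult_right_mono) auto
  finally show ?thesis by (simp add: algebra_simps)
qed

section \<open>Cauchy sequences and null differences\<close>

abbreviation Cy :: "(nat \<Rightarrow> 'a) \<Rightarrow> bool" where "Cy \<equiv> norm_Cauchy A (nrm A)"

definition null_diff :: "(nat \<Rightarrow> 'a) \<Rightarrow> (nat \<Rightarrow> 'a) \<Rightarrow> bool" where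
  "null_diff x y \<longleftrightarrow> (\<lambda>n. nrm A (x n \<ominus> y n)) \<longlonglongrightarrow> 0"

lemma Cy_carrier: "Cy x \<Longrightarrow> x n \<in> carrier A"
  by (simp add: nm.norm_Cauchy_iff)

lemma Cy_const: "a \<in> carrier A \<Longrightarrow> Cy (\<lambda>n. a)"
  by (simp add: nm.norm_Cauchy_iff)

text \<open>One pattern for all operations: the increments of \<open>z\<close> are bounded by
  \<open>K\<close> times the sum of those of \<open>x\<close> and \<open>y\<close>. Unary operations
  use it with \<open>x\<close> in both places, and \<open>null_dominated\<close> is the counterpart
  for independence of representatives.\<close>

lemma Cy_dominated:
  assumes x: "Cy x" and y: "Cy y" and z: "\<And>n. z n \<in> carrier A" and K: "0 \<le> K"
    and le: "\<And>m n. nrm A (z m \<ominus> z n) \<le> K * (nrm A (x m \<ominus> x n) + nrm A (y m \<ominus> y n))"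
  shows "Cy z"
  unfolding nm.norm_Cauchy_iff
proof (intro conjI allI impI z)
  fix \<epsilon> :: real assume e: "0 < \<epsilon>"
  define \<delta> where "\<delta> = \<epsilon> / (2 * (K + 1))"
  have "(K + 1) * (\<delta> + \<delta>) = (2 * (K + 1)) * \<delta>" by (simp add: algebra_simps)
  then have \<delta>: "0 < \<delta>" "(K + 1) * (\<delta> + \<delta>) = \<epsilon>" using e K by (simp_all add: \<delta>_def)
  obtain M1 M2 where M: "\<And>m n. m \<ge> M1 \<Longrightarrow> n \<ge> M1 \<Longrightarrow> nrm A (x m \<ominus> x n) < \<delta>"
      "\<And>m n. m \<ge> M2 \<Longrightarrow> n \<ge> M2 \<Longrightarrow> nrm A (y m \<ominus> y n) < \<delta>"
    using x y \<delta>(1) unfolding nm.norm_Cauchy_iff by metis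
  have "nrm A (z m \<ominus> z n) < \<epsilon>" if "m \<ge> max M1 M2" "n \<ge> max M1 M2" for m n
  proof -
    let ?s = "nrm A (x m \<ominus> x n) + nrm A (y m \<ominus> y n)"
    have s: "0 \<le> ?s" using Cy_carrier[OF x] Cy_carrier[OF y] by (intro add_nonneg_nonneg nm.norm_nonneg) auto
    have "nrm A (z m \<ominus> z n) \<le> (K + 1) * ?s"
      using le[of m n] s by (simp add: distrib_right)
    also have "\<dots> < (K + 1) * (\<delta> + \<delta>)"
      using that K by (intro mult_strict_left_mono add_strict_mono M) auto
    finally show ?thesis unfolding \<delta>(2) .
  qed
  then show "\<exists>M. \<forall>m\<ge>M. \<forall>n\<ge>M. nrm A (z m \<ominus> z n) < \<epsilon>" by blast
qed

lemma null_dominated: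
  assumes "null_diff x x'" "null_diff y y'" "\<And>n. z n \<in> carrier A" "\<And>n. z' n \<in> carrier A"
    "\<And>n. nrm A (z n \<ominus> z' n) \<le> K * (nrm A (x n \<ominus> x' n) + nrm A (y n \<ominus> y' n))"
  shows "null_diff z z'"
  unfolding null_diff_def
  by (rule nm.norm_tendsto_bound[OF tendsto_mult_right_zero[OF
        tendsto_add_zero[OF assms(1,2)[unfolded null_diff_def]], of K]])
     (use assms in auto)

lemma Cy_bounded:
  assumes x: "Cy x" shows "\<exists>K>0. \<forall>n. nrm A (x n) \<le> K"
proof -
  have "Cauchy (\<lambda>n. nrm A (x n))"
    unfolding Cauchy_def
  proof (intro allI impI)
    fix e :: real assume "0 < e"
    then obtain M where "\<forall>m\<ge>M. \<forall>n\<ge>M. nrm A (x m \<ominus> x n) < e" using x unfolding nm.norm_Cauchy_iff by blast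
    then show "\<exists>M. \<forall>m\<ge>M. \<forall>n\<ge>M. dist (nrm A (x m)) (nrm A (x n)) < e"
      using nm.norm_diff_norm Cy_carrier[OF x] unfolding dist_real_def by (meson le_less_trans)
  qed
  then have "Bseq (\<lambda>n. nrm A (x n))" by (rule Cauchy_Bseq)
  then obtain K where "K > 0" "\<And>n. norm (nrm A (x n)) \<le> K" by (auto elim: BseqE)
  then show ?thesis using Cy_carrier[OF x] by (intro exI[of _ K]) auto
qed

lemma Cy_norm_convergent:
  assumes x: "Cy x" shows "\<exists>l. (\<lambda>n. nrm A (x n)) \<longlonglongrightarrow> l"
proof -
  have "Cauchy (\<lambda>n. nrm A (x n))"
    unfolding Cauchy_def
  proof (intro allI impI)
    fix e :: real assume "0 < e"
    then obtain M where "\<forall>m\<ge>M. \<forall>n\<ge>M. nrm A (x m \<ominus> x n) < e" using x unfolding nm.norm_Cauchy_iff by blast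
    then show "\<exists>M. \<forall>m\<ge>M. \<forall>n\<ge>M. dist (nrm A (x m)) (nrm A (x n)) < e"
      using nm.norm_diff_norm Cy_carrier[OF x] unfolding dist_real_def by (meson le_less_trans)
  qed
  then show ?thesis using real_Cauchy_convergent convergent_def by blast
qed

lemma nrm_add_diff:
  assumes "x \<in> carrier A" "y \<in> carrier A" "x' \<in> carrier A" "y' \<in> carrier A"
  shows "nrm A ((x \<oplus> y) \<ominus> (x' \<oplus> y')) \<le> 1 * (nrm A (x \<ominus> x') + nrm A (y \<ominus> y'))"
  using assms by (simp add: add_diff_add nm.norm_add)

lemma nrm_smult_diff:
  assumes "x \<in> carrier A" "x' \<in> carrier A"
  shows "nrm A (c \<odot> x \<ominus> c \<odot> x') \<le> cmod c * (nrm A (x \<ominus> x') + nrm A (x \<ominus> x'))"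
  using assms by (simp add: smult_diff[symmetric] nm.norm_smult mult_left_mono)

lemma nrm_star_diff:
  assumes "x \<in> carrier A" "x' \<in> carrier A"
  shows "nrm A (star A x \<ominus> star A x') \<le> 1 * (nrm A (x \<ominus> x') + nrm A (x \<ominus> x'))"
  using assms by (simp add: star_diff[symmetric] nrm_star)

lemma Cy_add: "Cy x \<Longrightarrow> Cy y \<Longrightarrow> Cy (\<lambda>n. x n \<oplus> y n)"
  by (rule Cy_dominated[where K = 1, of x y]) (auto simp: Cy_carrier intro: nrm_add_diff[simplified])

lemma Cy_smult: "Cy x \<Longrightarrow> Cy (\<lambda>n. c \<odot> x n)"
  by (rule Cy_dominated[where K = "cmod c", of x x]) (auto simp: Cy_carrier intro: nrm_smult_diff[simplified])

lemma Cy_star: "Cy x \<Longrightarrow> Cy (\<lambda>n. star A (x n))"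
  by (rule Cy_dominated[where K = 1, of x x]) (auto simp: Cy_carrier star_closed intro: nrm_star_diff[simplified])

lemma Cy_common_bound:
  assumes "Cy x" "Cy y" obtains K where "0 < K" "\<And>n. nrm A (x n) \<le> K" "\<And>n. nrm A (y n) \<le> K"
proof -
  obtain K1 where K1: "K1 > 0" "\<forall>n. nrm A (x n) \<le> K1" using Cy_bounded[OF assms(1)] by blast
  obtain K2 where K2: "K2 > 0" "\<forall>n. nrm A (y n) \<le> K2" using Cy_bounded[OF assms(2)] by blast
  show ?thesis
    by (rule that[of "max K1 K2"]) (use K1 K2 in \<open>auto simp: less_max_iff_disj le_max_iff_disj\<close>)
qed

lemma Cy_mult: "Cy x \<Longrightarrow> Cy y \<Longrightarrow> Cy (\<lambda>n. x n \<otimes> y n)"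
proof -
  assume x: "Cy x" and y: "Cy y"
  obtain K where K: "0 < K" "\<And>n. nrm A (x n) \<le> K" "\<And>n. nrm A (y n) \<le> K"
    using Cy_common_bound[OF x y] by blast
  show ?thesis
  proof (rule Cy_dominated[OF x y, where K = K])
    show "nrm A (x m \<otimes> y m \<ominus> x n \<otimes> y n) \<le> K * (nrm A (x m \<ominus> x n) + nrm A (y m \<ominus> y n))" for m n
      by (rule nrm_mult_diff) (fact Cy_carrier[OF x] Cy_carrier[OF y] K)+
  qed (use K(1) x y in \<open>auto simp: mult_closed Cy_carrier\<close>)
qed

lemma null_add: "\<lbrakk>null_diff x x'; null_diff y y'; Cy x; Cy x'; Cy y; Cy y'\<rbrakk> \<Longrightarrow>
    null_diff (\<lambda>n. x n \<oplus> y n) (\<lambda>n. x' n \<oplus> y' n)"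
  by (rule null_dominated[where K = 1, of x x' y y']) (auto simp: Cy_carrier intro: nrm_add_diff[simplified])

lemma null_smult: "\<lbrakk>null_diff x x'; Cy x; Cy x'\<rbrakk> \<Longrightarrow> null_diff (\<lambda>n. c \<odot> x n) (\<lambda>n. c \<odot> x' n)"
  by (rule null_dominated[where K = "cmod c", of x x' x x']) (auto simp: Cy_carrier intro: nrm_smult_diff[simplified])

lemma null_star: "\<lbrakk>null_diff x x'; Cy x; Cy x'\<rbrakk> \<Longrightarrow> null_diff (\<lambda>n. star A (x n)) (\<lambda>n. star A (x' n))"
  by (rule null_dominated[where K = 1, of x x' x x'])
     (auto simp: Cy_carrier star_closed intro: nrm_star_diff[simplified])

lemma null_mult: "\<lbrakk>null_diff x x'; null_diff y y'; Cy x; Cy x'; Cy y; Cy y'\<rbrakk> \<Longrightarrow>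
    null_diff (\<lambda>n. x n \<otimes> y n) (\<lambda>n. x' n \<otimes> y' n)"
proof -
  assume n: "null_diff x x'" "null_diff y y'" and c: "Cy x" "Cy x'" "Cy y" "Cy y'"
  obtain K where K: "0 < K" "\<And>n. nrm A (x' n) \<le> K" "\<And>n. nrm A (y n) \<le> K"
    using Cy_common_bound[OF c(2,3)] by blast
  show ?thesis
  proof (rule null_dominated[OF n, where K = K])
    show "nrm A (x i \<otimes> y i \<ominus> x' i \<otimes> y' i) \<le> K * (nrm A (x i \<ominus> x' i) + nrm A (y i \<ominus> y' i))" for i
      by (rule nrm_mult_diff) (fact Cy_carrier[OF c(1)] Cy_carrier[OF c(2)] Cy_carrier[OF c(3)] Cy_carrier[OF c(4)] K)+
  qed (use c in \<open>auto simp: mult_closed Cy_carrier\<close>)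
qed

lemma null_refl: "Cy x \<Longrightarrow> null_diff x x"
  by (simp add: null_diff_def Cy_carrier)

lemma null_sym: "Cy x \<Longrightarrow> Cy y \<Longrightarrow> null_diff x y \<Longrightarrow> null_diff y x"
  by (simp add: null_diff_def nm.norm_diff_commute[OF Cy_carrier Cy_carrier])

lemma null_trans:
  assumes "Cy x" "Cy y" "Cy z" "null_diff x y" "null_diff y z" shows "null_diff x z"
  unfolding null_diff_def
  by (rule nm.norm_tendsto_bound[OF tendsto_add_zero[OF assms(4,5)[unfolded null_diff_def]]])
     (use assms in \<open>auto simp: Cy_carrier intro: nm.norm_triangle_diff\<close>)

section \<open>The completion as a C*-algebra\<close>

abbreviation cc :: "(nat \<Rightarrow> 'a) \<Rightarrow> (nat \<Rightarrow> 'a) set" where "cc \<equiv> completion_class A"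
abbreviation C :: "(nat \<Rightarrow> 'a) set normed_star_algebra" where "C \<equiv> norm_completion A"
abbreviation emb :: "'a \<Rightarrow> (nat \<Rightarrow> 'a) set" where "emb \<equiv> completion_embed A"

lemma cc_mem: "Cy x \<Longrightarrow> y \<in> cc x \<longleftrightarrow> Cy y \<and> null_diff x y"
  unfolding completion_class_def null_diff_def
  by (auto simp: norm_dist_def Cy_carrier cong: conj_cong)

lemma cc_self: "Cy x \<Longrightarrow> x \<in> cc x"
  by (simp add: cc_mem null_refl)

lemma cc_eq:
  assumes "Cy x" "Cy y" "null_diff x y" shows "cc x = cc y"
proof -
  have "null_diff y x" by (rule null_sym[OF assms])
  then have "Cy z \<and> null_diff x z \<longleftrightarrow> Cy z \<and> null_diff y z" for z
    using null_trans[OF assms(1,2) _ assms(3), of z] null_trans[OF assms(2,1), of z] by blast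
  then show ?thesis unfolding set_eq_iff cc_mem[OF assms(1)] cc_mem[OF assms(2)] by blast
qed

lemma C_carrier: "carrier C = cc ` Collect Cy"
  by (simp add: norm_completion_def)

lemma cc_in_C [simp]: "Cy x \<Longrightarrow> cc x \<in> carrier C"
  by (simp add: C_carrier)

lemma C_cases [elim]: assumes "X \<in> carrier C" obtains x where "Cy x" "X = cc x"
  using assms by (auto simp: C_carrier)

lemma C_zero: "\<zero>\<^bsub>C\<^esub> = cc (\<lambda>n. \<zero>)"
  by (simp add: norm_completion_def)

lemma C_add: "Cy x \<Longrightarrow> Cy y \<Longrightarrow> cc x \<oplus>\<^bsub>C\<^esub> cc y = cc (\<lambda>n. x n \<oplus> y n)"
  by (simp add: norm_completion_def, rule UN_UN_const[OF cc_self cc_self], assumption+, rule cc_eq)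
     (auto simp: cc_mem intro: Cy_add null_add null_sym)

lemma C_mult: "Cy x \<Longrightarrow> Cy y \<Longrightarrow> cc x \<otimes>\<^bsub>C\<^esub> cc y = cc (\<lambda>n. x n \<otimes> y n)"
  by (simp add: norm_completion_def, rule UN_UN_const[OF cc_self cc_self], assumption+, rule cc_eq)
     (auto simp: cc_mem intro: Cy_mult null_mult null_sym)

lemma C_smult: "Cy x \<Longrightarrow> c \<odot>\<^bsub>C\<^esub> cc x = cc (\<lambda>n. c \<odot> x n)"
  by (simp add: norm_completion_def, rule UN_const[OF cc_self], assumption, rule cc_eq)
     (auto simp: cc_mem intro: Cy_smult null_smult null_sym)

lemma C_star: "Cy x \<Longrightarrow> star C (cc x) = cc (\<lambda>n. star A (x n))"
  by (simp add: norm_completion_def, rule UN_const[OF cc_self], assumption, rule cc_eq)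
     (auto simp: cc_mem intro: Cy_star null_star null_sym)

lemma null_norm:
  assumes "Cy x" "Cy y" "null_diff x y" "(\<lambda>n. nrm A (x n)) \<longlonglongrightarrow> l"
  shows "(\<lambda>n. nrm A (y n)) \<longlonglongrightarrow> l"
proof -
  have "(\<lambda>n. \<bar>nrm A (y n) - nrm A (x n)\<bar>) \<longlonglongrightarrow> 0"
    by (rule nm.norm_tendsto_bound[OF null_sym[OF assms(1-3), unfolded null_diff_def]])
       (use assms in \<open>auto simp: Cy_carrier intro: nm.norm_diff_norm\<close>)
  then have "(\<lambda>n. nrm A (y n) - nrm A (x n)) \<longlonglongrightarrow> 0" by (rule tendsto_rabs_zero_cancel)
  from tendsto_add[OF this assms(4)] show ?thesis by simp
qed

lemma C_nrm:
  assumes x: "Cy x" shows "(\<lambda>n. nrm A (x n)) \<longlonglongrightarrow> nrm C (cc x)"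
proof -
  obtain l where l: "(\<lambda>n. nrm A (x n)) \<longlonglongrightarrow> l" using Cy_norm_convergent[OF x] by blast
  have "(THE l. \<forall>y\<in>cc x. (\<lambda>n. nrm A (y n)) \<longlonglongrightarrow> l) = l"
  proof (rule the_equality)
    show "\<forall>y\<in>cc x. (\<lambda>n. nrm A (y n)) \<longlonglongrightarrow> l"
      using null_norm[OF x _ _ l] by (auto simp: cc_mem[OF x])
    show "l' = l" if "\<forall>y\<in>cc x. (\<lambda>n. nrm A (y n)) \<longlonglongrightarrow> l'" for l'
      using that cc_self[OF x] l LIMSEQ_unique by blast
  qed
  then show ?thesis using l by (simp add: norm_completion_def)
qed

lemma C_nrm_eqI: "Cy x \<Longrightarrow> (\<lambda>n. nrm A (x n)) \<longlonglongrightarrow> l \<Longrightarrow> nrm C (cc x) = l"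
  using C_nrm LIMSEQ_unique by blast

lemmas C_ops = C_zero C_add C_mult C_smult C_star
lemmas Cy_ops = Cy_add Cy_mult Cy_smult Cy_star Cy_const

lemma Cy_zero [simp]: "Cy (\<lambda>n. \<zero>)"
  by (simp add: Cy_const)

lemma module_C: "Module.module complex_ring C"
proof (rule moduleI)
  show "abelian_group C"
  proof (rule abelian_groupI)
    fix X assume "X \<in> carrier C"
    then obtain x where x: "Cy x" "X = cc x" by blast
    have "(\<lambda>n. (- 1) \<odot> x n \<oplus> x n) = (\<lambda>n. \<zero>)"
      using Cy_carrier[OF x(1)] by (intro ext) (simp flip: minus_eq_smult add: M.l_neg)
    then show "\<exists>Y\<in>carrier C. Y \<oplus>\<^bsub>C\<^esub> X = \<zero>\<^bsub>C\<^esub>"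
      using x by (intro bexI[of _ "cc (\<lambda>n. (- 1) \<odot> x n)"]) (auto simp: C_ops Cy_ops)
  qed (auto simp: C_ops Cy_ops Cy_carrier M.a_ac elim!: C_cases)
qed (auto simp: cring_complex_ring C_ops Cy_ops Cy_carrier smult_add_left smult_add_right smult_smult elim!: C_cases)

lemma star_algebra_C: "star_algebra C"
  by (intro star_algebra.intro star_algebra_axioms.intro module_C)
     (auto simp: C_ops Cy_ops Cy_carrier mult_assoc mult_distrib_left mult_distrib_right smult_mult_left
       smult_mult_right star_closed star_star star_add star_smult star_mult elim!: C_cases)

lemma norm_on_C: "norm_on C (nrm C)"
  unfolding norm_on_def
proof (intro conjI ballI allI)
  fix X assume "X \<in> carrier C"
  then obtain x where x: "Cy x" "X = cc x" by blast
  show "0 \<le> nrm C X"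
    unfolding x(2) by (rule LIMSEQ_le_const[OF C_nrm[OF x(1)]]) (use x in \<open>auto simp: Cy_carrier\<close>)
  show "nrm C X = 0 \<longleftrightarrow> X = \<zero>\<^bsub>C\<^esub>"
  proof
    assume "nrm C X = 0"
    then have "null_diff x (\<lambda>n. \<zero>)" using C_nrm[OF x(1)] x by (simp add: null_diff_def Cy_carrier)
    then show "X = \<zero>\<^bsub>C\<^esub>" using x by (simp add: C_zero cc_eq)
  next
    assume "X = \<zero>\<^bsub>C\<^esub>"
    then show "nrm C X = 0" using C_nrm_eqI[OF Cy_zero, of 0] by (simp add: C_zero)
  qed
  show "nrm C (c \<odot>\<^bsub>C\<^esub> X) = cmod c * nrm C X" for c
    using x tendsto_mult_left[OF C_nrm[OF x(1)], of "cmod c"]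
    by (simp add: C_ops) (rule C_nrm_eqI, auto simp: Cy_ops Cy_carrier nm.norm_smult)
  fix Y assume "Y \<in> carrier C"
  then obtain y where y: "Cy y" "Y = cc y" by blast
  show "nrm C (X \<oplus>\<^bsub>C\<^esub> Y) \<le> nrm C X + nrm C Y"
    unfolding x(2) y(2) C_add[OF x(1) y(1)]
    by (rule LIMSEQ_le[OF C_nrm[OF Cy_add[OF x(1) y(1)]] tendsto_add[OF C_nrm[OF x(1)] C_nrm[OF y(1)]]])
       (use x y in \<open>auto simp: Cy_carrier nm.norm_add\<close>)
qed

sublocale Cn: normed_module C "nrm C"
  by (intro normed_module.intro complex_module.intro normed_module_axioms.intro module_C norm_on_C)

lemma C_diff: "Cy x \<Longrightarrow> Cy y \<Longrightarrow> cc x \<ominus>\<^bsub>C\<^esub> cc y = cc (\<lambda>n. x n \<ominus> y n)"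
  by (simp add: Cn.diff_eq_smult C_ops Cy_ops diff_eq_smult Cy_carrier)

lemma emb_def: "emb a = cc (\<lambda>n. a)"
  by (simp add: completion_embed_def)

lemma emb_in_C [simp]: "a \<in> carrier A \<Longrightarrow> emb a \<in> carrier C"
  by (simp add: emb_def Cy_const)

lemma nrm_emb: "a \<in> carrier A \<Longrightarrow> nrm C (emb a) = nrm A a"
  unfolding emb_def by (rule C_nrm_eqI) (auto simp: Cy_const)

lemma emb_star_hom: "star_hom A C emb"
  unfolding star_hom_def emb_def by (auto simp: C_ops Cy_const)

lemma emb_diff: "a \<in> carrier A \<Longrightarrow> b \<in> carrier A \<Longrightarrow> emb a \<ominus>\<^bsub>C\<^esub> emb b = emb (a \<ominus> b)"
  by (simp add: emb_def C_diff Cy_const)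

lemma conv_emb:
  assumes x: "Cy x" shows "Cn.conv (\<lambda>n. emb (x n)) (cc x)"
proof -
  have "(\<lambda>n. nrm C (emb (x n) \<ominus>\<^bsub>C\<^esub> cc x)) \<longlonglongrightarrow> 0"
  proof (rule LIMSEQ_I)
    fix e :: real assume e: "0 < e"
    then obtain M where M: "\<And>m n. m \<ge> M \<Longrightarrow> n \<ge> M \<Longrightarrow> nrm A (x m \<ominus> x n) < e/2"
      using x unfolding nm.norm_Cauchy_iff by (meson half_gt_zero)
    have "norm (nrm C (emb (x m) \<ominus>\<^bsub>C\<^esub> cc x) - 0) < e" if m: "m \<ge> M" for m
    proof -
      have xm: "Cy (\<lambda>n. x m)" using x by (simp add: Cy_const Cy_carrier)
      have "Cy (\<lambda>n. x m \<oplus> (- 1) \<odot> x n)" using x xm by (intro Cy_add Cy_smult)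
      then have "Cy (\<lambda>n. x m \<ominus> x n)" using x by (simp add: diff_eq_smult Cy_carrier)
      from C_nrm[OF this] have "(\<lambda>n. nrm A (x m \<ominus> x n)) \<longlonglongrightarrow> nrm C (emb (x m) \<ominus>\<^bsub>C\<^esub> cc x)"
        using x xm by (simp add: emb_def C_diff)
      then have "nrm C (emb (x m) \<ominus>\<^bsub>C\<^esub> cc x) \<le> e/2"
        by (rule LIMSEQ_le_const2) (use M m in \<open>auto intro!: exI[of _ M] less_imp_le\<close>)
      moreover have "0 \<le> nrm C (emb (x m) \<ominus>\<^bsub>C\<^esub> cc x)"
        using x by (intro Cn.norm_nonneg Cn.M.minus_closed) (auto simp: Cy_carrier)
      ultimately show ?thesis using e by simp
    qed
    then show "\<exists>M. \<forall>n\<ge>M. norm (nrm C (emb (x n) \<ominus>\<^bsub>C\<^esub> cc x) - 0) < e" by blast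
  qed
  then show ?thesis using x by (simp add: Cn.conv_def Cy_carrier)
qed

lemma complete_C: "norm_complete C (nrm C)"
proof (rule Cn.complete_via_dense[of "emb ` carrier A"])
  fix X and \<epsilon> :: real assume X: "X \<in> carrier C" and e: "0 < \<epsilon>"
  then obtain x where x: "Cy x" "X = cc x" by blast
  have "(\<lambda>n. nrm C (emb (x n) \<ominus>\<^bsub>C\<^esub> X)) \<longlonglongrightarrow> 0"
    using conv_emb[OF x(1)] by (simp add: Cn.conv_def x(2))
  then have "\<forall>\<^sub>F n in sequentially. nrm C (emb (x n) \<ominus>\<^bsub>C\<^esub> X) < \<epsilon>"
    using e by (rule order_tendstoD(2))
  then obtain n where "nrm C (emb (x n) \<ominus>\<^bsub>C\<^esub> X) < \<epsilon>"
    by (auto simp: eventually_sequentially)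
  then show "\<exists>D\<in>emb ` carrier A. nrm C (X \<ominus>\<^bsub>C\<^esub> D) < \<epsilon>"
    using X x Cn.norm_diff_commute[of X "emb (x n)"]
    by (intro bexI[of _ "emb (x n)"]) (auto simp: Cy_carrier)
next
  fix Y assume Y: "norm_Cauchy C (nrm C) Y" "\<And>n. Y n \<in> emb ` carrier A"
  have "\<forall>n. \<exists>a. a \<in> carrier A \<and> Y n = emb a" using Y(2) by (auto simp: image_iff)
  from choice[OF this] obtain x where x: "\<And>n. x n \<in> carrier A" "\<And>n. Y n = emb (x n)" by blast
  have "nrm C (Y m \<ominus>\<^bsub>C\<^esub> Y n) = nrm A (x m \<ominus> x n)" for m n
    by (simp only: x(2) emb_diff x(1) nrm_emb M.minus_closed)
  then have "Cy x" using Y(1) x(1) unfolding nm.norm_Cauchy_iff Cn.norm_Cauchy_iff by simp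
  from conv_emb[OF this] have "Cn.conv Y (cc x)" by (simp flip: x(2))
  then show "\<exists>l. Cn.conv Y l" by blast
qed auto

theorem cstar_algebra_C: "cstar_algebra C"
proof (intro cstar_algebra.intro cstar_algebra_axioms.intro star_algebra_C norm_on_C complete_C)
  fix X assume "X \<in> carrier C"
  then obtain x where x: "Cy x" "X = cc x" by blast
  show "nrm C (star C X \<otimes>\<^bsub>C\<^esub> X) = (nrm C X)\<^sup>2"
    using x tendsto_power[OF C_nrm[OF x(1)], of 2]
    by (simp add: C_ops Cy_ops) (rule C_nrm_eqI, auto simp: Cy_ops Cy_carrier pre_cstar)
  fix Y assume "Y \<in> carrier C"
  then obtain y where y: "Cy y" "Y = cc y" by blast
  show "nrm C (X \<otimes>\<^bsub>C\<^esub> Y) \<le> nrm C X * nrm C Y"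
    unfolding x(2) y(2) C_mult[OF x(1) y(1)]
    by (rule LIMSEQ_le[OF C_nrm[OF Cy_mult[OF x(1) y(1)]] tendsto_mult[OF C_nrm[OF x(1)] C_nrm[OF y(1)]]])
       (use x y in \<open>auto simp: Cy_carrier pre_mult\<close>)
qed

lemma conv_imp_Cy_null: "nm.conv x l \<Longrightarrow> Cy x \<and> null_diff x (\<lambda>n. l)"
  using nm.conv_Cauchy by (simp add: null_diff_def nm.conv_def)

lemma conv_iff_null: "nm.conv x l \<longleftrightarrow> (\<forall>n. x n \<in> carrier A) \<and> l \<in> carrier A \<and> null_diff x (\<lambda>n. l)"
  by (simp add: nm.conv_def null_diff_def)

lemma conv_mult: "nm.conv x l \<Longrightarrow> nm.conv y k \<Longrightarrow> nm.conv (\<lambda>n. x n \<otimes> y n) (l \<otimes> k)"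
  using conv_imp_Cy_null[of x l] conv_imp_Cy_null[of y k] null_mult[of x "\<lambda>n. l" y "\<lambda>n. k"]
  unfolding conv_iff_null by (auto simp: Cy_const mult_closed)

lemma conv_star: "nm.conv x l \<Longrightarrow> nm.conv (\<lambda>n. star A (x n)) (star A l)"
  using conv_imp_Cy_null[of x l] null_star[of x "\<lambda>n. l"]
  unfolding conv_iff_null by (auto simp: Cy_const star_closed)

end

lemma cstar_imp_pre_cstar: "cstar_algebra (A :: 'a normed_star_algebra) \<Longrightarrow> pre_cstar A"
  unfolding cstar_algebra_def cstar_algebra_axioms_def
  by (intro pre_cstar.intro pre_cstar_axioms.intro) auto

text \<open>A contraction maps Cauchy sequences to Cauchy sequences and preserves null differences,
  so the limit in \<open>B\<close> along a representative does not depend on its choice. The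
  algebraic identities pass to the limit by continuity of the operations.\<close>

lemma (in pre_cstar) completion_extension:
  assumes B: "cstar_algebra (B :: 'b normed_star_algebra)" and \<psi>: "star_hom A B \<psi>"
    and contr: "\<And>a. a \<in> carrier A \<Longrightarrow> nrm B (\<psi> a) \<le> nrm A a"
  shows "\<exists>\<Phi>. star_hom (norm_completion A) B \<Phi> \<and> (\<forall>a\<in>carrier A. \<Phi> (completion_embed A a) = \<psi> a)"
proof -
  interpret B: pre_cstar B by (rule cstar_imp_pre_cstar[OF B])
  have B_complete: "norm_complete B (nrm B)" using B by (rule cstar_algebra.complete)
  have \<psi>_diff: "\<psi> (a \<ominus> b) = \<psi> a \<ominus>\<^bsub>B\<^esub> \<psi> b" if "a \<in> carrier A" "b \<in> carrier A" for a b
    using that star_homD[OF \<psi>] by (simp add: diff_eq_smult B.diff_eq_smult)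
  have contr2: "nrm B (\<psi> a \<ominus>\<^bsub>B\<^esub> \<psi> b) \<le> nrm A (a \<ominus> b)" if "a \<in> carrier A" "b \<in> carrier A" for a b
    using that contr[of "a \<ominus> b"] by (simp add: \<psi>_diff)
  have lim: "\<exists>l. B.nm.conv (\<lambda>n. \<psi> (x n)) l" if x: "Cy x" for x
  proof -
    have "norm_Cauchy B (nrm B) (\<lambda>n. \<psi> (x n))"
      using x contr2 star_homD(1)[OF \<psi>] unfolding nm.norm_Cauchy_iff B.nm.norm_Cauchy_iff
      by (meson le_less_trans)
    then show ?thesis using B_complete B.nm.norm_complete_iff by blast
  qed
  define \<Phi> where "\<Phi> X = (SOME l. \<exists>x. Cy x \<and> X = cc x \<and> B.nm.conv (\<lambda>n. \<psi> (x n)) l)" for X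
  have \<Phi>: "B.nm.conv (\<lambda>n. \<psi> (x n)) (\<Phi> (cc x))" if x: "Cy x" for x
  proof -
    obtain l where "B.nm.conv (\<lambda>n. \<psi> (x n)) l" using lim[OF x] by blast
    then have "\<exists>y. Cy y \<and> cc x = cc y \<and> B.nm.conv (\<lambda>n. \<psi> (y n)) (\<Phi> (cc x))"
      unfolding \<Phi>_def using x
      by (intro someI_ex[of "\<lambda>l. \<exists>y. Cy y \<and> cc x = cc y \<and> B.nm.conv (\<lambda>n. \<psi> (y n)) l"]) blast
    then obtain y where y: "Cy y" "cc x = cc y" "B.nm.conv (\<lambda>n. \<psi> (y n)) (\<Phi> (cc x))" by blast
    have "x \<in> cc y" using cc_self[OF x] y(2) by simp
    then have "null_diff x y" using x y(1) by (simp add: cc_mem null_sym)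
    then have "(\<lambda>n. nrm A (x n \<ominus> y n)) \<longlonglongrightarrow> 0" by (simp add: null_diff_def)
    then have *: "(\<lambda>n. nrm B (\<psi> (x n) \<ominus>\<^bsub>B\<^esub> \<psi> (y n))) \<longlonglongrightarrow> 0"
      by (rule B.nm.norm_tendsto_bound) (use x y star_homD(1)[OF \<psi>] contr2 in \<open>auto simp: Cy_carrier\<close>)
    show ?thesis
      by (rule B.nm.conv_of_close[OF y(3) _ *]) (use x star_homD(1)[OF \<psi>] in \<open>auto simp: Cy_carrier\<close>)
  qed
  have \<Phi>_eqI: "\<Phi> (cc x) = l" if "Cy x" "B.nm.conv (\<lambda>n. \<psi> (x n)) l" for x l
    using \<Phi>[OF that(1)] that(2) by (rule B.nm.conv_unique)
  have "star_hom C B \<Phi>"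
    unfolding star_hom_def
  proof (intro conjI ballI allI)
    fix X assume "X \<in> carrier C"
    then obtain x where x: "Cy x" "X = cc x" by blast
    show "\<Phi> X \<in> carrier B" using B.nm.conv_carrier(1)[OF \<Phi>[OF x(1)]] x by simp
    show "\<Phi> (c \<odot>\<^bsub>C\<^esub> X) = c \<odot>\<^bsub>B\<^esub> \<Phi> X" for c
      using x B.nm.conv_smult[OF \<Phi>[OF x(1)], of c] star_homD[OF \<psi>]
      by (simp add: C_ops) (rule \<Phi>_eqI, auto simp: Cy_ops Cy_carrier)
    show "\<Phi> (star C X) = star B (\<Phi> X)"
      using x B.conv_star[OF \<Phi>[OF x(1)]] star_homD[OF \<psi>]
      by (simp add: C_ops) (rule \<Phi>_eqI, auto simp: Cy_ops Cy_carrier)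
    fix Y assume "Y \<in> carrier C"
    then obtain y where y: "Cy y" "Y = cc y" by blast
    show "\<Phi> (X \<oplus>\<^bsub>C\<^esub> Y) = \<Phi> X \<oplus>\<^bsub>B\<^esub> \<Phi> Y"
      using x y B.nm.conv_add[OF \<Phi>[OF x(1)] \<Phi>[OF y(1)]] star_homD[OF \<psi>]
      by (simp add: C_ops) (rule \<Phi>_eqI, auto simp: Cy_ops Cy_carrier)
    show "\<Phi> (X \<otimes>\<^bsub>C\<^esub> Y) = \<Phi> X \<otimes>\<^bsub>B\<^esub> \<Phi> Y"
      using x y B.conv_mult[OF \<Phi>[OF x(1)] \<Phi>[OF y(1)]] star_homD[OF \<psi>]
      by (simp add: C_ops) (rule \<Phi>_eqI, auto simp: Cy_ops Cy_carrier)
  qed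
  moreover have "\<Phi> (emb a) = \<psi> a" if "a \<in> carrier A" for a
    unfolding emb_def using that star_homD(1)[OF \<psi> that]
    by (intro \<Phi>_eqI Cy_const B.nm.conv_const)
  ultimately show ?thesis by blast
qed

section \<open>States of C*-algebras\<close>

text \<open>The words over the elements of \<open>A\<close> generate a free unital algebra, which acts on \<open>A\<close> by left
  multiplication; the operator norm of this action is a C*-seminorm that extends the norm of \<open>A\<close>.\<close>

context pre_cstar begin

definition istar :: "'a \<Rightarrow> 'a" where "istar g = (if g \<in> carrier A then star A g else g)"

lemma istar_istar [simp]: "istar (istar g) = g"
  by (simp add: istar_def star_closed star_star)

text \<open>Letters range over the whole type. Those outside the carrier act as \<open>0\<close>,
  and \<open>istar\<close> fixes them, so that it is an involution on all letters.\<close>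

definition lact :: "'a \<Rightarrow> 'a \<Rightarrow> 'a" where "lact g a = (if g \<in> carrier A then g \<otimes> a else \<zero>)"

abbreviation wl :: "'a list \<Rightarrow> 'a \<Rightarrow> 'a" where "wl gs a \<equiv> foldr lact gs a"

text \<open>The empty word acts as the identity, which supplies the unit that \<open>A\<close>
  itself may lack.\<close>

definition ac :: "('a free_word \<Rightarrow>\<^sub>0 complex) \<Rightarrow> 'a \<Rightarrow> 'a" where
  "ac z a = lext (\<lambda>w. wl (letters w) a) z"

lemma zero_mult [simp]: "a \<in> carrier A \<Longrightarrow> \<zero> \<otimes> a = \<zero>"
  using smult_mult_left[of \<zero> a 0] by (simp add: mult_closed)

lemma mult_zero [simp]: "a \<in> carrier A \<Longrightarrow> a \<otimes> \<zero> = \<zero>"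
  using smult_mult_right[of a \<zero> 0] by (simp add: mult_closed)

lemma star_zero [simp]: "star A \<zero> = \<zero>"
  using star_smult[of \<zero> 0] star_closed[of \<zero>] by simp

lemma lact_closed [simp]: "a \<in> carrier A \<Longrightarrow> lact g a \<in> carrier A"
  by (simp add: lact_def mult_closed)

lemma wl_closed [simp]: "a \<in> carrier A \<Longrightarrow> wl gs a \<in> carrier A"
  by (induction gs) auto

lemma wl_add: "\<lbrakk>a \<in> carrier A; b \<in> carrier A\<rbrakk> \<Longrightarrow> wl gs (a \<oplus> b) = wl gs a \<oplus> wl gs b"
  by (induction gs) (auto simp: lact_def mult_distrib_left)

lemma wl_smult: "a \<in> carrier A \<Longrightarrow> wl gs (c \<odot> a) = c \<odot> wl gs a"
  by (induction gs) (auto simp: lact_def smult_mult_right)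

lemma ac_closed [simp]: "a \<in> carrier A \<Longrightarrow> ac z a \<in> carrier A"
  by (simp add: ac_def)

lemma ac_zero [simp]: "ac 0 a = \<zero>"
  by (simp add: ac_def)

lemma ac_add: "a \<in> carrier A \<Longrightarrow> ac (y + z) a = ac y a \<oplus> ac z a"
  by (simp add: ac_def lext_add)

lemma ac_single [simp]: "a \<in> carrier A \<Longrightarrow> ac (Poly_Mapping.single w c) a = c \<odot> wl (letters w) a"
  by (simp add: ac_def lext_single)

lemma ac_add_right: "\<lbrakk>a \<in> carrier A; b \<in> carrier A\<rbrakk> \<Longrightarrow> ac z (a \<oplus> b) = ac z a \<oplus> ac z b"
  by (induction z rule: poly_mapping_single_induct)
     (simp_all add: wl_add smult_add_right ac_add M.a_ac)

lemma ac_smult_right: "a \<in> carrier A \<Longrightarrow> ac z (c \<odot> a) = c \<odot> ac z a"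
  by (induction z rule: poly_mapping_single_induct)
     (simp_all add: wl_smult smult_smult mult.commute smult_add_right ac_add)

lemma ac_mult: "a \<in> carrier A \<Longrightarrow> ac (y * z) a = ac y (ac z a)"
proof (induction z rule: poly_mapping_single_induct)
  case (single w d)
  then show ?case
  proof (induction y rule: poly_mapping_single_induct)
    case (single v c)
    then show ?case by (simp add: mult_single wl_smult smult_smult)
  qed (simp_all add: distrib_right ac_add)
next
  case zero
  have "ac y \<zero> = \<zero>" using ac_smult_right[of \<zero> y 0] by simp
  then show ?case by simp
qed (simp_all add: distrib_left ac_add ac_add_right)

lemma lact_star: "\<lbrakk>a \<in> carrier A; b \<in> carrier A\<rbrakk> \<Longrightarrow> star A (lact g a) \<otimes> b = star A a \<otimes> lact (istar g) b"
  by (auto simp: lact_def istar_def star_mult star_closed mult_assoc)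

lemma wl_star: "\<lbrakk>a \<in> carrier A; b \<in> carrier A\<rbrakk> \<Longrightarrow>
    star A (wl gs a) \<otimes> b = star A a \<otimes> wl (rev (map istar gs)) b"
  by (induction gs arbitrary: b) (auto simp: lact_star)

text \<open>\<open>A\<close> is a Hilbert module over itself with inner product
  \<open>star A a \<otimes> b\<close>, and \<open>pm_star istar z\<close> acts as the adjoint of
  \<open>z\<close>. The C*-identity of \<open>op_norm\<close> comes from this.\<close>

lemma ac_star: "\<lbrakk>a \<in> carrier A; b \<in> carrier A\<rbrakk> \<Longrightarrow> star A (ac z a) \<otimes> b = star A a \<otimes> ac (pm_star istar z) b"
proof (induction z rule: poly_mapping_single_induct)
  case (single w c)
  then show ?case
    by (simp add: star_smult smult_mult_left smult_mult_right star_closed wl_star)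
next
  case (add x y)
  then show ?case
    by (simp add: ac_add star_add mult_distrib_right mult_distrib_left star_closed pm_star_add)
qed (simp add: star_closed)

lemma wl_bounded: "\<exists>K\<ge>0. \<forall>a\<in>carrier A. nrm A (wl gs a) \<le> K * nrm A a"
proof (induction gs)
  case Nil
  show ?case by (auto intro: exI[of _ 1])
next
  case (Cons g gs)
  then obtain K where K: "K \<ge> 0" "\<And>a. a \<in> carrier A \<Longrightarrow> nrm A (wl gs a) \<le> K * nrm A a" by blast
  define k where "k = (if g \<in> carrier A then nrm A g else 0)"
  have k: "0 \<le> k" by (simp add: k_def)
  have "nrm A (wl (g # gs) a) \<le> k * K * nrm A a" if a: "a \<in> carrier A" for a
  proof -
    have "nrm A (lact g (wl gs a)) \<le> k * nrm A (wl gs a)"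
      using a pre_mult[of g "wl gs a"] by (auto simp: lact_def k_def)
    also have "\<dots> \<le> k * (K * nrm A a)" by (rule mult_left_mono[OF K(2)[OF a] k])
    finally show ?thesis by (simp add: mult.assoc)
  qed
  then show ?case using K k by (intro exI[of _ "k * K"]) auto
qed

lemma ac_bounded: "\<exists>K\<ge>0. \<forall>a\<in>carrier A. nrm A (ac z a) \<le> K * nrm A a"
proof (induction z rule: poly_mapping_single_induct)
  case zero
  show ?case by (auto intro: exI[of _ 0])
next
  case (single w c)
  obtain K where K: "K \<ge> 0" "\<And>a. a \<in> carrier A \<Longrightarrow> nrm A (wl (letters w) a) \<le> K * nrm A a"
    using wl_bounded by blast
  have "nrm A (ac (Poly_Mapping.single w c) a) \<le> (cmod c * K) * nrm A a" if "a \<in> carrier A" for a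
    using mult_left_mono[OF K(2)[OF that], of "cmod c"] that by (simp add: nm.norm_smult mult.assoc)
  then show ?case using K by (intro exI[of _ "cmod c * K"]) auto
next
  case (add x y)
  then obtain K K' where K: "K \<ge> 0" "\<And>a. a \<in> carrier A \<Longrightarrow> nrm A (ac x a) \<le> K * nrm A a"
    "K' \<ge> 0" "\<And>a. a \<in> carrier A \<Longrightarrow> nrm A (ac y a) \<le> K' * nrm A a" by blast
  have "nrm A (ac (x + y) a) \<le> (K + K') * nrm A a" if a: "a \<in> carrier A" for a
    using nm.norm_add[of "ac x a" "ac y a"] K(2)[OF a] K(4)[OF a] a by (simp add: ac_add distrib_right)
  then show ?case using K by (intro exI[of _ "K + K'"]) auto
qed

definition op_norm :: "('a free_word \<Rightarrow>\<^sub>0 complex) \<Rightarrow> real" where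
  "op_norm z = Sup {nrm A (ac z a) | a. a \<in> carrier A \<and> nrm A a \<le> 1}"

lemma op_norm_le:
  assumes "0 \<le> K" "\<And>a. a \<in> carrier A \<Longrightarrow> nrm A (ac z a) \<le> K * nrm A a" shows "op_norm z \<le> K"
  unfolding op_norm_def
proof (rule cSup_least)
  show "{nrm A (ac z a) | a. a \<in> carrier A \<and> nrm A a \<le> 1} \<noteq> {}" by (auto intro!: exI[of _ \<zero>])
  fix r assume "r \<in> {nrm A (ac z a) | a. a \<in> carrier A \<and> nrm A a \<le> 1}"
  then obtain a where a: "a \<in> carrier A" "nrm A a \<le> 1" "r = nrm A (ac z a)" by auto
  show "r \<le> K" using assms(2)[OF a(1)] mult_left_mono[OF a(2) assms(1)] a(3) by simp
qed

lemma op_norm_upper: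
  assumes "a \<in> carrier A" "nrm A a \<le> 1" shows "nrm A (ac z a) \<le> op_norm z"
  unfolding op_norm_def
proof (rule cSup_upper)
  obtain K where K: "K \<ge> 0" "\<And>a. a \<in> carrier A \<Longrightarrow> nrm A (ac z a) \<le> K * nrm A a"
    using ac_bounded by blast
  show "bdd_above {nrm A (ac z a) | a. a \<in> carrier A \<and> nrm A a \<le> 1}"
    unfolding bdd_above_def
  proof (intro exI[of _ K] ballI)
    fix r assume "r \<in> {nrm A (ac z a) | a. a \<in> carrier A \<and> nrm A a \<le> 1}"
    then obtain a where a: "a \<in> carrier A" "nrm A a \<le> 1" "r = nrm A (ac z a)" by auto
    show "r \<le> K" using K(2)[OF a(1)] mult_left_mono[OF a(2) K(1)] a(3) by simp
  qed
qed (use assms in blast)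

lemma op_norm_nonneg [simp]: "0 \<le> op_norm z"
  by (rule order_trans[OF nm.norm_nonneg op_norm_upper[of \<zero> z]]) auto

lemma op_norm_bound:
  assumes "a \<in> carrier A" shows "nrm A (ac z a) \<le> op_norm z * nrm A a"
proof (cases "nrm A a = 0")
  case True
  obtain K where K: "\<And>a. a \<in> carrier A \<Longrightarrow> nrm A (ac z a) \<le> K * nrm A a" using ac_bounded by blast
  show ?thesis using K[OF assms] True by simp
next
  case False
  then have p: "nrm A a > 0" using nm.norm_nonneg[OF assms] by linarith
  have "nrm A (ac z (complex_of_real (1 / nrm A a) \<odot> a)) \<le> op_norm z"
    using assms p by (intro op_norm_upper) (auto simp: nm.norm_smult norm_divide)
  then show ?thesis
    using assms p by (simp add: ac_smult_right nm.norm_smult norm_divide field_simps)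
qed

lemma op_norm_mult: "op_norm (y * z) \<le> op_norm y * op_norm z"
proof (rule op_norm_le)
  fix a assume a: "a \<in> carrier A"
  have "nrm A (ac y (ac z a)) \<le> op_norm y * nrm A (ac z a)" using a by (intro op_norm_bound) simp
  also have "\<dots> \<le> op_norm y * (op_norm z * nrm A a)" by (intro mult_left_mono op_norm_bound a) simp
  finally show "nrm A (ac (y * z) a) \<le> op_norm y * op_norm z * nrm A a"
    using a by (simp add: ac_mult mult.assoc)
qed simp

lemma op_norm_sq_le: "(op_norm z)\<^sup>2 \<le> op_norm (pm_star istar z * z)"
proof -
  let ?q = "op_norm (pm_star istar z * z)"
  have "op_norm z \<le> sqrt ?q"
  proof (rule op_norm_le)
    fix a assume a: "a \<in> carrier A"
    have "(nrm A (ac z a))\<^sup>2 = nrm A (star A a \<otimes> ac (pm_star istar z * z) a)"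
      using a by (simp add: pre_cstar[symmetric] ac_star ac_mult)
    also have "\<dots> \<le> nrm A (star A a) * nrm A (ac (pm_star istar z * z) a)"
      using a by (intro pre_mult) (auto simp: star_closed)
    also have "\<dots> \<le> nrm A a * (?q * nrm A a)"
      using a by (simp add: nrm_star mult_left_mono op_norm_bound)
    also have "\<dots> = (sqrt ?q * nrm A a)\<^sup>2"
      by (simp add: power_mult_distrib) (simp add: power2_eq_square)
    finally show "nrm A (ac z a) \<le> sqrt ?q * nrm A a"
      by (rule power2_le_imp_le) (use a in simp)
  qed simp
  then have "(op_norm z)\<^sup>2 \<le> (sqrt ?q)\<^sup>2" by (rule power_mono) simp
  then show ?thesis by simp
qed

lemma op_norm_star_ge: "op_norm z \<le> op_norm (pm_star istar z)"
proof (cases "op_norm z = 0")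
  case False
  then have "op_norm z > 0" using op_norm_nonneg[of z] by linarith
  moreover have "op_norm z * op_norm z \<le> op_norm (pm_star istar z) * op_norm z"
    using op_norm_sq_le[of z] op_norm_mult[of "pm_star istar z" z] by (simp add: power2_eq_square)
  ultimately show ?thesis by simp
qed simp

lemma op_norm_cstar: "op_norm (pm_star istar z * z) = (op_norm z)\<^sup>2"
proof (rule antisym[OF _ op_norm_sq_le])
  have "op_norm (pm_star istar z) \<le> op_norm z"
    using op_norm_star_ge[of "pm_star istar z"] by (simp add: pm_star_star)
  then have "op_norm (pm_star istar z) * op_norm z \<le> op_norm z * op_norm z"
    by (rule mult_right_mono) simp
  then show "op_norm (pm_star istar z * z) \<le> (op_norm z)\<^sup>2"
    using op_norm_mult[of "pm_star istar z" z] by (simp add: power2_eq_square)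
qed

lemma op_norm_add: "op_norm (y + z) \<le> op_norm y + op_norm z"
proof (rule op_norm_le)
  fix a assume a: "a \<in> carrier A"
  show "nrm A (ac (y + z) a) \<le> (op_norm y + op_norm z) * nrm A a"
    using nm.norm_add[of "ac y a" "ac z a"] op_norm_bound[OF a, of y] op_norm_bound[OF a, of z] a
    by (simp add: ac_add distrib_right)
qed simp

lemma ac_const: "a \<in> carrier A \<Longrightarrow> ac (const c * z) a = c \<odot> ac z a"
  by (simp add: ac_mult)

lemma op_norm_const: "op_norm (const c * z) = cmod c * op_norm z"
proof -
  have le: "op_norm (const c * z) \<le> cmod c * op_norm z" for c z
    by (rule op_norm_le)
       (auto simp: ac_const nm.norm_smult mult.assoc intro!: mult_left_mono op_norm_bound)
  show ?thesis
  proof (cases "c = 0")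
    case True
    then show ?thesis using le[of 0 z] op_norm_nonneg[of 0] by simp
  next
    case False
    then have "const (1/c) * (const c * z) = z" by (simp add: const_mult_const)
    then have "op_norm z \<le> cmod (1/c) * op_norm (const c * z)" using le[of "1/c" "const c * z"] by simp
    then have "cmod c * op_norm z \<le> op_norm (const c * z)"
      using False by (simp add: norm_divide field_simps)
    with le[of c z] show ?thesis by simp
  qed
qed

lemma op_norm_one:
  assumes "a \<in> carrier A" "a \<noteq> \<zero>" shows "op_norm 1 = 1"
proof (rule antisym)
  have one: "ac 1 b = b" if "b \<in> carrier A" for b
    using ac_single[OF that, of 0 1] that by simp
  show "op_norm 1 \<le> 1" by (rule op_norm_le) (auto simp: one)
  have "nrm A a > 0" using assms nm.norm_nonneg[OF assms(1)] nm.norm_eq_0[OF assms(1)] by linarith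
  then show "1 \<le> op_norm 1" using op_norm_bound[OF assms(1), of 1] by (simp add: one assms)
qed

text \<open>The nonzero element ensures \<open>op_norm 1 = 1\<close>; on the zero algebra
  \<open>op_norm\<close> vanishes.\<close>

lemma cstar_seminorm_op_norm:
  assumes "a \<in> carrier A" "a \<noteq> \<zero>" shows "cstar_seminorm const (pm_star istar) op_norm"
proof (rule cstar_seminorm.intro)
  show "pm_star istar (pm_star istar x) = x" for x by (rule pm_star_star) simp
  show "op_norm 1 = 1" by (rule op_norm_one[OF assms])
  show "const (c * d) = const c * const d" for c d :: complex by simp
  show "const 1 = 1" by simp
qed (rule single_add mult_const pm_star_add pm_star_mult pm_star_const op_norm_add op_norm_mult
    op_norm_const op_norm_cstar)+

definition el :: "'a \<Rightarrow> ('a free_word \<Rightarrow>\<^sub>0 complex)" where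
  "el x = Poly_Mapping.single (Free_Word [x]) 1"

lemma ac_el [simp]: "\<lbrakk>x \<in> carrier A; a \<in> carrier A\<rbrakk> \<Longrightarrow> ac (el x) a = x \<otimes> a"
  by (simp add: el_def lact_def mult_closed)

text \<open>The upper bound is submultiplicativity of the norm; the C*-identity shows that it is
  attained at \<open>star A x\<close>.\<close>

lemma op_norm_el: "x \<in> carrier A \<Longrightarrow> op_norm (el x) = nrm A x"
proof (rule antisym)
  assume x: "x \<in> carrier A"
  show "op_norm (el x) \<le> nrm A x" by (rule op_norm_le) (use x in \<open>auto intro: pre_mult\<close>)
  show "nrm A x \<le> op_norm (el x)"
  proof (cases "nrm A x = 0")
    case False
    then have "nrm A x > 0" using nm.norm_nonneg[OF x] by linarith
    moreover have "nrm A x * nrm A x \<le> op_norm (el x) * nrm A x"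
      using op_norm_bound[of "star A x" "el x"] pre_cstar[of "star A x"] x
      by (simp add: star_closed star_star nrm_star power2_eq_square)
    ultimately show ?thesis by simp
  qed simp
qed

lemma pm_star_el: "x \<in> carrier A \<Longrightarrow> pm_star istar (el x) = el (star A x)"
  by (simp add: el_def istar_def)

text \<open>Two elements of the free algebra that act equally on \<open>A\<close> differ by an
  element of seminorm \<open>0\<close>, which the state kills. Hence the state descends to
  \<open>A\<close>: for instance, \<open>el (x \<oplus> y)\<close> and \<open>el x + el y\<close>
  act alike.\<close>

theorem state_on_cstar:
  assumes x0: "x0 \<in> carrier A"
  obtains g :: "'a \<Rightarrow> complex" where
    "\<And>x y. \<lbrakk>x \<in> carrier A; y \<in> carrier A\<rbrakk> \<Longrightarrow> g (x \<oplus> y) = g x + g y"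
    "\<And>c x. x \<in> carrier A \<Longrightarrow> g (c \<odot> x) = c * g x"
    "\<And>x. x \<in> carrier A \<Longrightarrow> g (star A x) = cnj (g x)"
    "\<And>x. x \<in> carrier A \<Longrightarrow> 0 \<le> Re (g (star A x \<otimes> x))"
    "\<And>x. x \<in> carrier A \<Longrightarrow> Re (g x) \<le> nrm A x"
    "Re (g (star A x0 \<otimes> x0)) = (nrm A x0)\<^sup>2"
proof (cases "x0 = \<zero>")
  case True
  show ?thesis by (rule that[of "\<lambda>_. 0"]) (auto simp: True)
next
  case False
  interpret cstar_seminorm const "pm_star istar" op_norm
    by (rule cstar_seminorm_op_norm[OF x0 False])
  show ?thesis
  proof (rule state_exists[of "el x0"])
    fix f assume f: "\<And>x y. f (x + y) = f x + f y" "\<And>c x. f (const c * x) = c * f x"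
      "\<And>x. f (pm_star istar x) = cnj (f x)" "\<And>x. Im (f (pm_star istar x * x)) = 0"
      "\<And>x. 0 \<le> Re (f (pm_star istar x * x))" "\<And>x. Re (f x) \<le> op_norm x"
      "\<And>x. op_norm x = 0 \<Longrightarrow> f x = 0"
      "Re (f (pm_star istar (el x0) * el x0)) = (op_norm (el x0))\<^sup>2"
    have f_eq: "f y = f z" if "\<And>a. a \<in> carrier A \<Longrightarrow> ac y a = ac z a" for y z
    proof -
      have "ac (y - z) a = \<zero>" if a: "a \<in> carrier A" for a
      proof -
        have "y - z = y + const (- 1) * z" by (simp add: single_uminus)
        then have "ac (y - z) a = ac y a \<ominus> ac z a"
          using a by (simp only: ac_add ac_const diff_eq_smult ac_closed)
        then show ?thesis using a \<open>\<And>a. a \<in> carrier A \<Longrightarrow> ac y a = ac z a\<close> by simp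
      qed
      then have "op_norm (y - z) \<le> 0" by (intro op_norm_le) auto
      then have "f (y - z) = 0" using f(7) by (simp add: antisym)
      then show ?thesis using f(1)[of "y - z" z] by simp
    qed
    define g where "g x = f (el x)" for x
    have g_mult: "g (star A x \<otimes> x) = f (pm_star istar (el x) * el x)" if "x \<in> carrier A" for x
      unfolding g_def using that
      by (intro f_eq) (simp add: pm_star_el ac_mult mult_assoc mult_closed star_closed)
    show ?thesis
    proof
      show "g (x \<oplus> y) = g x + g y" if "x \<in> carrier A" "y \<in> carrier A" for x y
        unfolding g_def f(1)[symmetric] using that by (intro f_eq) (simp add: ac_add mult_distrib_right)
      show "g (c \<odot> x) = c * g x" if "x \<in> carrier A" for c x
        unfolding g_def f(2)[symmetric] using that by (intro f_eq) (simp add: ac_const smult_mult_left)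
      show "g (star A x) = cnj (g x)" if "x \<in> carrier A" for x
        unfolding g_def using f(3)[of "el x"] that by (simp add: pm_star_el)
      show "0 \<le> Re (g (star A x \<otimes> x))" if "x \<in> carrier A" for x
        using f(5) that by (simp add: g_mult)
      show "Re (g x) \<le> nrm A x" if "x \<in> carrier A" for x
        using f(6)[of "el x"] that by (simp add: g_def op_norm_el)
      show "Re (g (star A x0 \<otimes> x0)) = (nrm A x0)\<^sup>2"
        using f(8) x0 by (simp add: g_mult op_norm_el)
    qed
  qed
qed

end

section \<open>The graph C*-algebra\<close>

context pre_cstar begin

text \<open>Formally, compressing \<open>q - p = star A z \<otimes> z\<close> by
  \<open>1 - q\<close> makes \<open>star A w \<otimes> w\<close> the negative of
  \<open>star A r \<otimes> r\<close>, where \<open>w = z (1 - q)\<close> and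
  \<open>r = p (1 - q)\<close>. A state that attains the norm of \<open>r\<close> is nonnegative on
  the former, which forces \<open>r = 0\<close>.\<close>

lemma projection_le:
  assumes p: "projection A p" and q: "projection A q" and le: "cstar_le A p q"
  shows "q \<otimes> p = p"
proof -
  obtain z where z: "z \<in> carrier A" "q \<ominus> p = star A z \<otimes> z"
    using le by (auto simp: cstar_le_def)
  have P: "p \<in> carrier A" "p \<otimes> p = p" "star A p = p" and Q: "q \<in> carrier A" "q \<otimes> q = q" "star A q = q"
    using p q by (auto simp: projection_def)
  define w where "w = z \<ominus> z \<otimes> q"
  define r where "r = p \<ominus> p \<otimes> q"
  have cl: "w \<in> carrier A" "r \<in> carrier A" using z P Q by (auto simp: w_def r_def mult_closed)
  obtain g where g: "\<And>x y. \<lbrakk>x \<in> carrier A; y \<in> carrier A\<rbrakk> \<Longrightarrow> g (x \<oplus> y) = g x + g y"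
    "\<And>c x. x \<in> carrier A \<Longrightarrow> g (c \<odot> x) = c * g x"
    "\<And>x. x \<in> carrier A \<Longrightarrow> 0 \<le> Re (g (star A x \<otimes> x))"
    "Re (g (star A r \<otimes> r)) = (nrm A r)\<^sup>2"
    using state_on_cstar[OF cl(2)] by metis
  have g_diff: "g (x \<ominus> y) = g x - g y" if "x \<in> carrier A" "y \<in> carrier A" for x y
    using that by (simp add: diff_eq_smult g(1,2))
  have ss: "star A z \<in> carrier A" using z by (simp add: star_closed)
  have "star A w \<otimes> w = (star A z \<ominus> q \<otimes> star A z) \<otimes> (z \<ominus> z \<otimes> q)"
    using z Q by (simp add: w_def star_diff star_mult mult_closed)
  also have "\<dots> = (star A z \<otimes> z \<ominus> q \<otimes> (star A z \<otimes> z)) \<ominus> (star A z \<otimes> z \<otimes> q \<ominus> q \<otimes> (star A z \<otimes> z) \<otimes> q)"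
    using z(1) Q(1) ss by (simp add: mult_diff_left mult_diff_right mult_closed mult_assoc)
  also have "\<dots> = ((q \<ominus> p) \<ominus> q \<otimes> (q \<ominus> p)) \<ominus> ((q \<ominus> p) \<otimes> q \<ominus> q \<otimes> (q \<ominus> p) \<otimes> q)"
    by (simp only: z(2))
  finally have "g (star A w \<otimes> w) = - (g p - g (p \<otimes> q) - g (q \<otimes> p) + g (q \<otimes> p \<otimes> q))"
    using P Q by (simp add: mult_diff_left mult_diff_right mult_closed g_diff)
  moreover have "star A r \<otimes> r = (p \<ominus> q \<otimes> p) \<otimes> (p \<ominus> p \<otimes> q)"
    using P Q by (simp add: r_def star_diff star_mult mult_closed)
  then have "g (star A r \<otimes> r) = g p - g (p \<otimes> q) - g (q \<otimes> p) + g (q \<otimes> p \<otimes> q)"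
    using P Q by (simp add: mult_diff_left mult_diff_right mult_closed g_diff)
       (simp add: P Q mult_closed mult_assoc flip: mult_assoc[of p p])
  ultimately have "Re (g (star A w \<otimes> w)) = - (nrm A r)\<^sup>2"
    using g(4) by simp
  then have "nrm A r = 0" using g(3)[OF cl(1)] by (simp add: power2_less_eq_zero_iff)
  then have "p = p \<otimes> q" using P Q cl(2) by (simp add: nm.norm_eq_0 r_def diff_eq_zero_iff mult_closed)
  then have "star A p = star A (p \<otimes> q)" by simp
  then show ?thesis using P Q by (simp add: star_mult)
qed

lemma norm_projection_le: "projection A p \<Longrightarrow> nrm A p \<le> 1"
proof -
  assume p: "projection A p"
  then have "nrm A p * nrm A p = nrm A p"
    using pre_cstar[of p] by (simp add: projection_def power2_eq_square)
  then show ?thesis by (cases "nrm A p = 0") auto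
qed

end

locale ck_family = countable_graph E + B: pre_cstar B
  for E :: "('v, 'e) pre_digraph" and B :: "'b normed_star_algebra" +
  fixes q :: "'v \<Rightarrow> 'b" and t :: "'e \<Rightarrow> 'b"
  assumes ck: "cuntz_krieger_family E B q t"
begin

lemma q_proj: "v \<in> verts E \<Longrightarrow> projection B (q v)"
  and q_orth: "v \<in> verts E \<Longrightarrow> w \<in> verts E \<Longrightarrow> v \<noteq> w \<Longrightarrow> q v \<otimes>\<^bsub>B\<^esub> q w = \<zero>\<^bsub>B\<^esub>"
  and t_iso: "e \<in> arcs E \<Longrightarrow> partial_isometry B (t e)"
  and t_ranges: "e \<in> arcs E \<Longrightarrow> f \<in> arcs E \<Longrightarrow> e \<noteq> f \<Longrightarrow>
    (t e \<otimes>\<^bsub>B\<^esub> star B (t e)) \<otimes>\<^bsub>B\<^esub> (t f \<otimes>\<^bsub>B\<^esub> star B (t f)) = \<zero>\<^bsub>B\<^esub>"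
  and t_star_t: "e \<in> arcs E \<Longrightarrow> star B (t e) \<otimes>\<^bsub>B\<^esub> t e = q (head E e)"
  and t_le: "e \<in> arcs E \<Longrightarrow> cstar_le B (t e \<otimes>\<^bsub>B\<^esub> star B (t e)) (q (tail E e))"
  and q_regular: "v \<in> regular_vertices E \<Longrightarrow> q v = (\<Oplus>\<^bsub>B\<^esub>e\<in>emitted E v. t e \<otimes>\<^bsub>B\<^esub> star B (t e))"
  using ck by (simp_all add: cuntz_krieger_family_def)

lemma q_closed: "v \<in> verts E \<Longrightarrow> q v \<in> carrier B"
  using q_proj by (simp add: projection_def)

lemma t_closed: "e \<in> arcs E \<Longrightarrow> t e \<in> carrier B"
  using t_iso by (simp add: partial_isometry_def)

lemma t_t_star_t: "e \<in> arcs E \<Longrightarrow> t e \<otimes>\<^bsub>B\<^esub> star B (t e) \<otimes>\<^bsub>B\<^esub> t e = t e"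
  using t_iso by (simp add: partial_isometry_def)

lemma t_head: "e \<in> arcs E \<Longrightarrow> t e \<otimes>\<^bsub>B\<^esub> q (head E e) = t e"
  using t_t_star_t[of e] t_closed[of e] by (simp add: t_star_t[symmetric] B.mult_assoc B.star_closed)

text \<open>The definition relates the range projection of \<open>t e\<close> to
  \<open>q (tail E e)\<close> only by the order of \<open>B\<close>; \<open>projection_le\<close>
  converts this into an algebraic identity.\<close>

lemma tail_t: "e \<in> arcs E \<Longrightarrow> q (tail E e) \<otimes>\<^bsub>B\<^esub> t e = t e"
proof -
  assume e: "e \<in> arcs E"
  have c: "t e \<in> carrier B" "star B (t e) \<in> carrier B" "q (tail E e) \<in> carrier B"
    using e by (auto simp: t_closed B.star_closed q_closed)
  have "projection B (t e \<otimes>\<^bsub>B\<^esub> star B (t e))"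
    using c t_t_star_t[OF e]
    by (simp add: projection_def B.mult_closed B.star_mult B.star_star flip: B.mult_assoc)
  then have "q (tail E e) \<otimes>\<^bsub>B\<^esub> (t e \<otimes>\<^bsub>B\<^esub> star B (t e)) = t e \<otimes>\<^bsub>B\<^esub> star B (t e)"
    using e by (intro B.projection_le q_proj t_le) auto
  then have "q (tail E e) \<otimes>\<^bsub>B\<^esub> (t e \<otimes>\<^bsub>B\<^esub> star B (t e)) \<otimes>\<^bsub>B\<^esub> t e = t e"
    using t_t_star_t[OF e] by simp
  then show ?thesis using c t_t_star_t[OF e] by (simp add: B.mult_assoc B.mult_closed)
qed

text \<open>Each partial isometry absorbs its own range projection, so the product of two orthogonal
  range projections can be inserted in the middle.\<close>

lemma t_star_t_diff:
  assumes "e \<in> arcs E" "f \<in> arcs E" "e \<noteq> f" shows "star B (t e) \<otimes>\<^bsub>B\<^esub> t f = \<zero>\<^bsub>B\<^esub>"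
proof -
  let ?a = "t e" and ?a' = "star B (t e)" and ?b = "t f" and ?b' = "star B (t f)"
  have c: "?a \<in> carrier B" "?a' \<in> carrier B" "?b \<in> carrier B" "?b' \<in> carrier B"
    using assms by (auto simp: t_closed B.star_closed)
  have "star B (?a \<otimes>\<^bsub>B\<^esub> ?a' \<otimes>\<^bsub>B\<^esub> ?a) = ?a'" using t_t_star_t[OF assms(1)] by simp
  then have a': "?a' \<otimes>\<^bsub>B\<^esub> (?a \<otimes>\<^bsub>B\<^esub> ?a') = ?a'"
    using c by (simp add: B.star_mult B.star_star B.mult_closed)
  have "?a' \<otimes>\<^bsub>B\<^esub> ?b = (?a' \<otimes>\<^bsub>B\<^esub> (?a \<otimes>\<^bsub>B\<^esub> ?a')) \<otimes>\<^bsub>B\<^esub> (?b \<otimes>\<^bsub>B\<^esub> ?b' \<otimes>\<^bsub>B\<^esub> ?b)"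
    by (simp only: a' t_t_star_t[OF assms(2)])
  also have "\<dots> = ?a' \<otimes>\<^bsub>B\<^esub> ((?a \<otimes>\<^bsub>B\<^esub> ?a') \<otimes>\<^bsub>B\<^esub> (?b \<otimes>\<^bsub>B\<^esub> ?b')) \<otimes>\<^bsub>B\<^esub> ?b"
    using c by (simp add: B.mult_assoc B.mult_closed)
  finally show ?thesis using c by (simp add: t_ranges[OF assms])
qed

fun hg :: "('v, 'e) lpa_gen \<Rightarrow> 'b" where
  "hg (Vertex v) = (if v \<in> verts E then q v else \<zero>\<^bsub>B\<^esub>)"
| "hg (Edge e) = (if e \<in> arcs E then t e else \<zero>\<^bsub>B\<^esub>)"
| "hg (Ghost e) = (if e \<in> arcs E then star B (t e) else \<zero>\<^bsub>B\<^esub>)"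

lemma hg_closed [simp]: "hg g \<in> carrier B"
  by (cases g) (auto simp: q_closed t_closed B.star_closed)

lemma hg_star: "hg (gen_star g) = star B (hg g)"
  using q_proj by (cases g) (auto simp: projection_def B.star_star t_closed)

text \<open>\<open>B\<close> may have no unit, so the product starts from the last letter and the
  empty word gets the default \<open>0\<close>; multiplicativity is stated for nonempty
  words.\<close>

fun wp :: "('v, 'e) lpa_gen list \<Rightarrow> 'b" where
  "wp [] = \<zero>\<^bsub>B\<^esub>"
| "wp [g] = hg g"
| "wp (g # h # gs) = hg g \<otimes>\<^bsub>B\<^esub> wp (h # gs)"

lemma wp_Cons: "gs \<noteq> [] \<Longrightarrow> wp (g # gs) = hg g \<otimes>\<^bsub>B\<^esub> wp gs"
  by (cases gs) auto

lemma wp_closed [simp]: "wp gs \<in> carrier B"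
  by (induction gs rule: wp.induct) (auto simp: B.mult_closed)

lemma wp_append: "gs \<noteq> [] \<Longrightarrow> hs \<noteq> [] \<Longrightarrow> wp (gs @ hs) = wp gs \<otimes>\<^bsub>B\<^esub> wp hs"
proof (induction gs)
  case (Cons g gs)
  then show ?case by (cases "gs = []") (auto simp: wp_Cons B.mult_assoc)
qed simp

lemma wp_star: "gs \<noteq> [] \<Longrightarrow> wp (rev (map gen_star gs)) = star B (wp gs)"
proof (induction gs)
  case (Cons g gs)
  then show ?case by (cases "gs = []") (auto simp: wp_Cons wp_append hg_star B.star_mult)
qed simp

definition ev :: "('v, 'e) lpa_free \<Rightarrow> 'b" where "ev = B.lext (\<lambda>w. wp (letters w))"

lemma ev_closed [simp]: "ev a \<in> carrier B"
  by (simp add: ev_def)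

lemma ev_0 [simp]: "ev 0 = \<zero>\<^bsub>B\<^esub>"
  by (simp add: ev_def)

lemma ev_add: "ev (a + b) = ev a \<oplus>\<^bsub>B\<^esub> ev b"
  by (simp add: ev_def B.lext_add)

lemma ev_single: "ev (Poly_Mapping.single w c) = c \<odot>\<^bsub>B\<^esub> wp (letters w)"
  by (simp add: ev_def B.lext_single)

lemma ev_gen [simp]: "ev (free_gen g) = hg g"
  by (simp add: free_gen_def ev_single)

lemma ev_smult: "ev (free_smult c a) = c \<odot>\<^bsub>B\<^esub> ev a"
  unfolding free_smult_eq
  by (induction a rule: poly_mapping_single_induct)
     (simp_all add: ev_single B.smult_smult distrib_left ev_add B.smult_add_right)

lemma ev_diff: "ev (a - b) = ev a \<ominus>\<^bsub>B\<^esub> ev b"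
proof -
  have "a - b = a + free_smult (- 1) b" by (simp add: free_smult_minus_one)
  then show ?thesis by (simp only: ev_add ev_smult B.diff_eq_smult ev_closed)
qed

lemma ev_mult: "a \<in> F \<Longrightarrow> b \<in> F \<Longrightarrow> ev (a * b) = ev a \<otimes>\<^bsub>B\<^esub> ev b"
proof (induction a rule: F_induct)
  case (single v c)
  show ?case using single(2)
  proof (induction b rule: F_induct)
    case (single w d)
    then show ?case using \<open>valid_word v\<close>
      by (simp add: mult_single ev_single valid_word_def free_word_zero_iff wp_append
          B.smult_mult_left B.smult_mult_right B.smult_smult B.mult_closed mult.commute[of d c])
  qed (simp_all add: distrib_left ev_add B.mult_distrib_left)
qed (simp_all add: distrib_right ev_add B.mult_distrib_right)

lemma ev_star: "a \<in> F \<Longrightarrow> ev (free_star a) = star B (ev a)"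
proof (induction a rule: F_induct)
  case (single w c)
  then show ?case
    by (simp add: free_star_single ev_single word_star_def valid_word_def free_word_zero_iff wp_star B.star_smult)
qed (simp_all add: free_star_add ev_add B.star_add)

lemma ev_sum: "finite S \<Longrightarrow> ev (\<Sum>i\<in>S. f i) = (\<Oplus>\<^bsub>B\<^esub>i\<in>S. ev (f i))"
  by (induction S rule: finite_induct) (auto simp: ev_add B.M.finsum_insert)

lemma ev_rel: "x \<in> lpa_rels E \<Longrightarrow> ev x = \<zero>\<^bsub>B\<^esub>"
proof (induction rule: lpa_rels.induct)
  case (range_ghost e)
  have "star B (t e \<otimes>\<^bsub>B\<^esub> q (head E e)) = star B (t e)" using range_ghost by (simp add: t_head)
  then show ?case using range_ghost q_proj[of "head E e"]
    by (simp add: ev_diff ev_mult B.star_mult t_closed q_closed projection_def B.star_closed)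
next
  case (ghost_source e)
  have "star B (q (tail E e) \<otimes>\<^bsub>B\<^esub> t e) = star B (t e)" using ghost_source by (simp add: tail_t)
  then show ?case using ghost_source q_proj[of "tail E e"]
    by (simp add: ev_diff ev_mult B.star_mult t_closed q_closed projection_def B.star_closed)
next
  case (regular v)
  then have v: "v \<in> verts E" "finite (emitted E v)" by (auto dest: regular_verticesD)
  have "ev (\<Sum>e\<in>emitted E v. A e * G e) = (\<Oplus>\<^bsub>B\<^esub>e\<in>emitted E v. t e \<otimes>\<^bsub>B\<^esub> star B (t e))"
    unfolding ev_sum[OF v(2)]
    by (rule B.M.finsum_cong') (auto simp: ev_mult t_closed B.star_closed B.mult_closed dest: emittedD)
  then have "ev (\<Sum>e\<in>emitted E v. A e * G e) = q v" by (simp only: q_regular[OF regular])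
  then show ?case using v q_closed[of v] by (simp add: ev_diff B.diff_eq_zero_iff)
qed (use q_proj in \<open>auto simp: ev_diff ev_mult q_orth tail_t t_head t_star_t t_star_t_diff t_closed q_closed projection_def\<close>)

lemma ev_ideal: "x \<in> I \<Longrightarrow> ev x = \<zero>\<^bsub>B\<^esub>"
  by (induction rule: lpa_ideal.induct) (auto simp: ev_rel ev_add ev_smult ev_mult I_in_F)

lemma ev_eqv: "x \<asymp> y \<Longrightarrow> ev x = ev y"
  using ev_ideal[of "x - y"] by (simp add: eqv_def ev_diff B.diff_eq_zero_iff)

text \<open>No Hilbert space is attached to \<open>B\<close>. A state attaining the norm at
  \<open>ev a\<close>, composed with \<open>ev\<close>, is an invariant form on L(E) whose seminorm
  of \<open>a\<close> is the norm of \<open>ev a\<close>; it is bounded by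
  \<open>form_le_ln\<close>. The local unit contributes a factor at most \<open>1\<close> because
  its image is a projection.\<close>

lemma norm_ev_le:
  assumes a: "a \<in> F" shows "nrm B (ev a) \<le> ln a"
proof -
  obtain g where g: "\<And>x y. \<lbrakk>x \<in> carrier B; y \<in> carrier B\<rbrakk> \<Longrightarrow> g (x \<oplus>\<^bsub>B\<^esub> y) = g x + g y"
    "\<And>c x. x \<in> carrier B \<Longrightarrow> g (c \<odot>\<^bsub>B\<^esub> x) = c * g x"
    "\<And>x. x \<in> carrier B \<Longrightarrow> g (star B x) = cnj (g x)"
    "\<And>x. x \<in> carrier B \<Longrightarrow> 0 \<le> Re (g (star B x \<otimes>\<^bsub>B\<^esub> x))"
    "\<And>x. x \<in> carrier B \<Longrightarrow> Re (g x) \<le> nrm B x"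
    "Re (g (star B (ev a) \<otimes>\<^bsub>B\<^esub> ev a)) = (nrm B (ev a))\<^sup>2"
    by (rule B.state_on_cstar[OF ev_closed[of a]], rule that; simp)
  define Q where "Q x y = g (star B (ev y) \<otimes>\<^bsub>B\<^esub> ev x)" for x y
  have g0: "g \<zero>\<^bsub>B\<^esub> = 0" using g(2)[of "\<zero>\<^bsub>B\<^esub>" 0] by simp
  have form: "lpa_form E Q"
  proof (rule lpa_formI)
    fix x y z assume F: "x \<in> F" "y \<in> F" "z \<in> F"
    show "Q (z * x) y = Q x (free_star z * y)"
      using F by (simp add: Q_def ev_mult ev_star B.star_mult B.star_star B.star_closed B.mult_assoc)
  next
    fix x y
    have "g (star B (star B (ev y) \<otimes>\<^bsub>B\<^esub> ev x)) = cnj (g (star B (ev y) \<otimes>\<^bsub>B\<^esub> ev x))"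
      by (intro g(3)) (simp add: B.mult_closed B.star_closed)
    then show "Q y x = cnj (Q x y)" by (simp add: Q_def B.star_mult B.star_star B.star_closed)
  qed (auto simp: Q_def ev_add ev_smult ev_ideal B.mult_distrib_left B.smult_mult_right g(1,2,4) g0
      B.mult_closed B.star_closed)
  obtain S where S: "finite S" "S \<subseteq> verts E" "a * unit S \<asymp> a" using local_unit[OF a] by blast
  define e where "e = ev (unit S)"
  have u: "unit S \<in> F" using S by (intro unit_in_F)
  have e: "projection B e"
    using ev_eqv[OF unit_idem[OF S(1,2)]] ev_star[OF u] u by (simp add: e_def projection_def ev_mult)
  have "Re (Q (unit S) (unit S)) \<le> 1"
    using e g(5)[of e] B.norm_projection_le[OF e] by (simp add: Q_def projection_def flip: e_def)
  then have Nu: "lpa_form.N Q (unit S) \<le> 1"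
    by (simp add: lpa_form.N_def[OF form])
  have "nrm B (ev a) = lpa_form.N Q a"
    using g(6) by (simp add: lpa_form.N_def[OF form] Q_def)
  also have "\<dots> \<le> ln a * lpa_form.N Q (unit S)" by (rule form_le_ln[OF form a u S(3)])
  also have "\<dots> \<le> ln a * 1" using Nu a by (intro mult_left_mono) auto
  finally show ?thesis by simp
qed

end

section \<open>The completion of L(E) has the universal property\<close>

context countable_graph begin

abbreviation nL :: "('v, 'e) lpa_free set normed_star_algebra" where "nL \<equiv> normed_leavitt_path_algebra E"

lemma nL_simps [simp]:
  "carrier nL = carrier L" "monoid.mult nL = monoid.mult L" "\<zero>\<^bsub>nL\<^esub> = \<zero>\<^bsub>L\<^esub>" "add nL = add L"
  "smult nL = smult L" "star nL = star L" "nrm nL = leavitt_norm E"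
  by (simp_all add: normed_leavitt_path_algebra_def star_algebra.defs normed_star_algebra.defs)

lemma module_nL: "Module.module complex_ring nL"
proof (rule moduleI)
  show "abelian_group nL"
  proof (rule abelian_groupI)
    fix X assume "X \<in> carrier nL"
    then obtain x where "x \<in> F" "X = cl x" by auto
    then show "\<exists>Y\<in>carrier nL. Y \<oplus>\<^bsub>nL\<^esub> X = \<zero>\<^bsub>nL\<^esub>"
      by (intro bexI[of _ "cl (- x)"]) (auto simp: L_ops)
  qed (auto simp: L_ops add_ac elim!: L_cases)
qed (auto simp: cring_complex_ring L_ops free_smult_eq algebra_simps single_add const_mult_const
    elim!: L_cases)

lemma star_algebra_nL: "star_algebra nL"
  by (intro star_algebra.intro star_algebra_axioms.intro module_nL)
     (auto simp: L_ops free_smult_eq mult.assoc distrib_left distrib_right mult_const_left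
       free_star_add free_star_mult free_star_const mult_const elim!: L_cases)

lemma pre_cstar_nL: "pre_cstar nL"
proof (intro pre_cstar.intro pre_cstar_axioms.intro star_algebra_nL)
  show "norm_on nL (nrm nL)" using norm_on_leavitt by (simp add: norm_on_def)
qed (auto simp: L_ops ln_mult ln_cstar elim!: L_cases)

sublocale nL: pre_cstar nL
  by (rule pre_cstar_nL)

definition h :: "('v, 'e) lpa_free \<Rightarrow> (nat \<Rightarrow> ('v, 'e) lpa_free set) set" where
  "h a = completion_embed nL (cl a)"

abbreviation CE where "CE \<equiv> norm_completion nL"

lemma h_closed [simp]: "a \<in> F \<Longrightarrow> h a \<in> carrier CE"
  by (simp add: h_def)

lemma h_eqv: "a \<asymp> b \<Longrightarrow> h a = h b"
  by (simp add: h_def cl_eqI)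

lemma h_add: "a \<in> F \<Longrightarrow> b \<in> F \<Longrightarrow> h (a + b) = h a \<oplus>\<^bsub>CE\<^esub> h b"
  using star_homD(2)[OF nL.emb_star_hom, of "cl a" "cl b"] by (simp add: h_def L_add)

lemma h_mult: "a \<in> F \<Longrightarrow> b \<in> F \<Longrightarrow> h (a * b) = h a \<otimes>\<^bsub>CE\<^esub> h b"
  using star_homD(4)[OF nL.emb_star_hom, of "cl a" "cl b"] by (simp add: h_def L_mult)

lemma h_smult: "a \<in> F \<Longrightarrow> h (free_smult c a) = c \<odot>\<^bsub>CE\<^esub> h a"
  using star_homD(3)[OF nL.emb_star_hom, of "cl a" c] by (simp add: h_def L_smult)

lemma h_star: "a \<in> F \<Longrightarrow> h (free_star a) = star CE (h a)"
  using star_homD(5)[OF nL.emb_star_hom, of "cl a"] by (simp add: h_def L_star)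

lemma h_0: "h 0 = \<zero>\<^bsub>CE\<^esub>"
  by (simp add: h_def nL.emb_def nL.C_zero L_zero)

lemma h_diff: "a \<in> F \<Longrightarrow> b \<in> F \<Longrightarrow> h (a - b) = h a \<ominus>\<^bsub>CE\<^esub> h b"
proof -
  assume F: "a \<in> F" "b \<in> F"
  have "a - b = a + free_smult (- 1) b" by (simp add: free_smult_minus_one)
  then show ?thesis using F by (simp only: h_add h_smult nL.Cn.diff_eq_smult h_closed F_smult)
qed

lemma h_sum: "finite S \<Longrightarrow> (\<And>i. i \<in> S \<Longrightarrow> f i \<in> F) \<Longrightarrow> h (\<Sum>i\<in>S. f i) = (\<Oplus>\<^bsub>CE\<^esub>i\<in>S. h (f i))"
proof (induction S rule: finite_induct)
  case (insert i S)
  then show ?case using F_sum[of S f] by (simp add: h_add nL.Cn.M.finsum_insert Pi_def)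
qed (simp add: h_0)

lemma ck_family_CE: "cuntz_krieger_family E CE (\<lambda>v. h (V v)) (\<lambda>e. h (A e))"
  unfolding cuntz_krieger_family_def
proof (intro conjI ballI impI)
  fix v assume v: "v \<in> verts E"
  show "projection CE (h (V v))"
    using v h_eqv[OF eqv_rels(1)[OF v]] h_star[of "V v"] by (simp add: projection_def h_mult)
  show "h (V v) \<otimes>\<^bsub>CE\<^esub> h (V w) = \<zero>\<^bsub>CE\<^esub>" if "w \<in> verts E" "v \<noteq> w" for w
    using v that h_eqv[OF eqv_rels(8)[of v w]] by (simp add: h_mult h_0)
next
  fix e assume e: "e \<in> arcs E"
  have s: "star CE (h (A e)) = h (G e)" using h_star[of "A e"] e by simp
  have AGA: "A e * G e * A e \<asymp> A e" using gen_partial_isometry[of "Edge e"] e by simp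
  show "partial_isometry CE (h (A e))"
    using e h_eqv[OF AGA] by (simp add: partial_isometry_def s h_mult)
  show "star CE (h (A e)) \<otimes>\<^bsub>CE\<^esub> h (A e) = h (V (head E e))"
    using e h_eqv[OF eqv_rels(6)[OF e]] by (simp add: s h_mult)
  show "(h (A e) \<otimes>\<^bsub>CE\<^esub> star CE (h (A e))) \<otimes>\<^bsub>CE\<^esub> (h (A f) \<otimes>\<^bsub>CE\<^esub> star CE (h (A f))) = \<zero>\<^bsub>CE\<^esub>"
    if f: "f \<in> arcs E" "e \<noteq> f" for f
  proof -
    have sf: "star CE (h (A f)) = h (G f)" using h_star[of "A f"] f by simp
    have "A e * (G e * A f * G f) \<asymp> A e * (0 * G f)"
      using e f by (intro eqv_mult_left eqv_mult_right eqv_rels(9)) auto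
    then have "A e * G e * (A f * G f) \<asymp> 0" by (simp add: mult.assoc)
    from h_eqv[OF this] show ?thesis using e f by (simp add: s sf h_mult h_0)
  qed
  show "cstar_le CE (h (A e) \<otimes>\<^bsub>CE\<^esub> star CE (h (A e))) (h (V (tail E e)))"
  proof -
    \<comment> \<open>The difference of the two projections is itself a projection, so it serves as
      its own witness for \<open>cstar_le\<close>.\<close>
    define z where "z = V (tail E e) - A e * G e"
    have zF: "z \<in> F" using e by (simp add: z_def)
    have AG: "A e * G e * (A e * G e) \<asymp> A e * G e"
      using eqv_mult_right[OF AGA, of "G e"] e by (simp add: mult.assoc)
    have VA: "V (tail E e) * (A e * G e) \<asymp> A e * G e"
      using eqv_mult_right[OF eqv_rels(2)[OF e], of "G e"] e by (simp add: mult.assoc)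
    have AV: "A e * G e * V (tail E e) \<asymp> A e * G e"
      using eqv_mult_left[OF eqv_rels(5)[OF e], of "A e"] e by (simp add: mult.assoc)
    have "z * z = V (tail E e) * V (tail E e) - V (tail E e) * (A e * G e) - (A e * G e * V (tail E e) - A e * G e * (A e * G e))"
      by (simp add: z_def algebra_simps)
    also have "\<dots> \<asymp> V (tail E e) - A e * G e - (A e * G e - A e * G e)"
      using AG VA AV eqv_rels(1)[of "tail E e"] e by (intro eqv_diff) auto
    also have "\<dots> = z" by (simp add: z_def)
    finally have zz: "z * z \<asymp> z" .
    have "free_star z = z" by (simp add: z_def free_star_diff free_star_mult)
    then have sz: "star CE (h z) \<otimes>\<^bsub>CE\<^esub> h z = h z"
      using zF h_star[OF zF] h_eqv[OF zz] by (simp add: h_mult)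
    have hz: "h z = h (V (tail E e)) \<ominus>\<^bsub>CE\<^esub> h (A e) \<otimes>\<^bsub>CE\<^esub> star CE (h (A e))"
      using e by (simp add: z_def h_diff h_mult s)
    show ?thesis unfolding cstar_le_def by (rule bexI[OF _ h_closed[OF zF]]) (simp only: sz hz[symmetric])
  qed
next
  fix v assume reg: "v \<in> regular_vertices E"
  then have v: "v \<in> verts E" "finite (emitted E v)" by (auto dest: regular_verticesD)
  have "h (V v) = h (\<Sum>e\<in>emitted E v. A e * G e)" by (rule h_eqv[OF eqv_rels(7)[OF reg]])
  also have "\<dots> = (\<Oplus>\<^bsub>CE\<^esub>e\<in>emitted E v. h (A e * G e))"
    by (rule h_sum[OF v(2)]) (auto dest: emittedD)
  also have "\<dots> = (\<Oplus>\<^bsub>CE\<^esub>e\<in>emitted E v. h (A e) \<otimes>\<^bsub>CE\<^esub> star CE (h (A e)))"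
  proof (rule nL.Cn.M.finsum_cong'[OF refl])
    have "h (A e * G e) = h (A e) \<otimes>\<^bsub>CE\<^esub> star CE (h (A e))" if "e \<in> arcs E" for e
      using that h_star[of "A e"] by (simp add: h_mult)
    moreover have "h (A e * G e) \<in> carrier CE" if "e \<in> arcs E" for e
      using that by (intro h_closed) auto
    ultimately have "h (A e * G e) = h (A e) \<otimes>\<^bsub>CE\<^esub> star CE (h (A e))"
      "h (A e) \<otimes>\<^bsub>CE\<^esub> star CE (h (A e)) \<in> carrier CE" if "e \<in> emitted E v" for e
      using that by (metis emittedD(1))+
    then show "(\<lambda>e. h (A e) \<otimes>\<^bsub>CE\<^esub> star CE (h (A e))) \<in> emitted E v \<rightarrow> carrier CE"
      "e \<in> emitted E v \<Longrightarrow> h (A e * G e) = h (A e) \<otimes>\<^bsub>CE\<^esub> star CE (h (A e))" for e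
      by auto
  qed
  finally show "h (V v) = (\<Oplus>\<^bsub>CE\<^esub>e\<in>emitted E v. h (A e) \<otimes>\<^bsub>CE\<^esub> star CE (h (A e)))" .
qed

text \<open>Stability under the involution brings in the ghost edges, products and sums give the
  whole image of L(E), and this image is dense.\<close>

lemma generated_CE: "cstar_generated_by CE ((\<lambda>v. h (V v)) ` verts E \<union> (\<lambda>e. h (A e)) ` arcs E)"
  unfolding cstar_generated_by_def
proof (intro conjI allI impI)
  show "(\<lambda>v. h (V v)) ` verts E \<union> (\<lambda>e. h (A e)) ` arcs E \<subseteq> carrier CE" by auto
  fix K assume K: "star_subalgebra K CE \<and> closedin (norm_topology CE (nrm CE)) K \<and>
    (\<lambda>v. h (V v)) ` verts E \<union> (\<lambda>e. h (A e)) ` arcs E \<subseteq> K"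
  then have sub: "submodule K complex_ring CE" "\<And>x y. x \<in> K \<Longrightarrow> y \<in> K \<Longrightarrow> x \<otimes>\<^bsub>CE\<^esub> y \<in> K"
    "\<And>x. x \<in> K \<Longrightarrow> star CE x \<in> K" and closed: "closedin (norm_topology CE (nrm CE)) K"
    by (auto simp: star_subalgebra_def)
  note sm = nL.Cn.submoduleE[OF sub(1)]
  have zero: "\<zero>\<^bsub>CE\<^esub> \<in> K"
  proof -
    obtain k where "k \<in> K" using sm(2) by blast
    then show ?thesis using sm(1) sm(4)[of 0 k] by (simp add: subset_iff)
  qed
  have gen: "h (free_gen g) \<in> K" if "gen_in E g" for g
  proof (cases g)
    case (Ghost e)
    then have "h (G e) = star CE (h (A e))" using h_star[of "A e"] that by simp
    then show ?thesis using Ghost that K sub(3) by auto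
  qed (use that K in auto)
  have word: "h (Poly_Mapping.single (Free_Word gs) 1) \<in> K" if "gs \<noteq> []" "\<forall>g\<in>set gs. gen_in E g" for gs
    using that
  proof (induction gs rule: list_nonempty_induct)
    case (single g)
    then show ?case using gen[of g] by (simp add: free_gen_def)
  next
    case (cons g gs)
    have "Poly_Mapping.single (Free_Word (g # gs)) 1 = free_gen g * Poly_Mapping.single (Free_Word gs) (1 :: complex)"
      by (simp add: free_gen_def mult_single plus_free_word_def)
    moreover have "Poly_Mapping.single (Free_Word gs) 1 \<in> F"
      using cons by (intro F_single) (auto simp: valid_word_def free_word_zero_iff)
    ultimately show ?case using cons gen[of g] sub(2) by (simp add: h_mult)
  qed
  have hK: "h a \<in> K" if "a \<in> F" for a
    using that
  proof (induction rule: F_induct)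
    case (single w c)
    then have "h (Poly_Mapping.single w 1) \<in> K"
      using word[of "letters w"] by (auto simp: valid_word_def free_word_zero_iff)
    moreover have "Poly_Mapping.single w c = free_smult c (Poly_Mapping.single w 1)" by (simp add: free_smult_eq)
    ultimately show ?case using single sm(4)[of c] by (simp add: h_smult)
  qed (use zero sm(5) in \<open>auto simp: h_0 h_add\<close>)
  have embK: "completion_embed nL X \<in> K" if "X \<in> carrier nL" for X
    using that hK by (auto simp: h_def elim!: L_cases)
  show "K = carrier CE"
  proof (rule subset_antisym[OF sm(1)], rule subsetI)
    fix X assume "X \<in> carrier CE"
    then obtain x where x: "nL.Cy x" "X = completion_class nL x" by (rule nL.C_cases)
    have "(\<forall>n. completion_embed nL (x n) \<in> K) \<and> nL.Cn.conv (\<lambda>n. completion_embed nL (x n)) X"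
      using x nL.conv_emb[OF x(1)] embK nL.Cy_carrier[OF x(1)] by simp
    then show "X \<in> K" using closed[unfolded nL.Cn.closedin_iff, THEN conjunct2, rule_format, of "\<lambda>n. completion_embed nL (x n)" X] by simp
  qed
qed

text \<open>Evaluation at the family is defined on L(E) because the relations hold in
  \<open>B\<close>, and \<open>norm_ev_le\<close> makes it contractive, so it extends to the
  completion.\<close>

lemma universal_CE:
  fixes B :: "'b normed_star_algebra"
  assumes B: "cstar_algebra B" and ck: "cuntz_krieger_family E B q t"
  shows "\<exists>\<phi>. star_hom CE B \<phi> \<and> (\<forall>v\<in>verts E. \<phi> (h (V v)) = q v) \<and> (\<forall>e\<in>arcs E. \<phi> (h (A e)) = t e)"
proof -
  interpret ck_family E B q t
    by (intro ck_family.intro ck_family_axioms.intro countable_graph_axioms cstar_imp_pre_cstar B ck)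
  define \<psi> where "\<psi> X = ev (SOME x. x \<in> F \<and> cl x = X)" for X
  have \<psi>: "\<psi> (cl a) = ev a" if a: "a \<in> F" for a
  proof -
    define b where "b = (SOME x. x \<in> F \<and> cl x = cl a)"
    have "b \<in> F \<and> cl b = cl a" unfolding b_def by (rule someI[of _ a]) (use a in simp)
    then show ?thesis unfolding \<psi>_def b_def[symmetric] by (intro ev_eqv) (auto simp: cl_eq_iff)
  qed
  have "star_hom nL B \<psi>"
    unfolding star_hom_def by (auto simp: L_ops \<psi> ev_add ev_smult ev_mult ev_star elim!: L_cases)
  moreover have "nrm B (\<psi> X) \<le> nrm nL X" if "X \<in> carrier nL" for X
    using that by (auto simp: \<psi> norm_ev_le elim!: L_cases)
  ultimately obtain \<Phi> where "star_hom CE B \<Phi>" "\<And>X. X \<in> carrier nL \<Longrightarrow> \<Phi> (completion_embed nL X) = \<psi> X"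
    using nL.completion_extension[OF B, of \<psi>] by blast
  then show ?thesis by (intro exI[of _ \<Phi>]) (simp add: h_def \<psi>)
qed

theorem graph_cstar_algebra_CE:
  "graph_cstar_algebra TYPE('b) E CE (\<lambda>v. completion_embed nL (lpa_vertex E v))
     (\<lambda>e. completion_embed nL (lpa_edge E e))"
  unfolding graph_cstar_algebra_def lpa_vertex_def lpa_edge_def h_def[symmetric]
  by (intro conjI nL.cstar_algebra_C ck_family_CE generated_CE allI impI universal_CE) auto

end

text \<open>\<open>leavitt_norm\<close> takes its supremum over one element type. Boundedness makes
  it a genuine supremum, and the bound for the type variable \<open>'h\<close> identifies it with
  the supremum over all Hilbert spaces. The type variable \<open>'b\<close> serves likewise for the
  C*-algebras in the universal property.\<close>

theorem corollary7p6:
  fixes E :: "('v, 'e) pre_digraph"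
  assumes "wf_digraph E" and "countable (verts E)" and "countable (arcs E)"
  shows
    "(\<forall>a\<in>carrier (leavitt_path_algebra E).
        bdd_above (rep_norms TYPE(nat \<Rightarrow> complex) E a) \<and>
        (\<forall>r\<in>rep_norms TYPE('h) E a. r \<le> leavitt_norm E a)) \<and>
     norm_on (leavitt_path_algebra E) (leavitt_norm E) \<and>
     graph_cstar_algebra TYPE('b) E
       (norm_completion (normed_leavitt_path_algebra E))
       (\<lambda>v. completion_embed (normed_leavitt_path_algebra E) (lpa_vertex E v))
       (\<lambda>e. completion_embed (normed_leavitt_path_algebra E) (lpa_edge E e))"
proof -
  interpret countable_graph E
    by (intro countable_graph.intro countable_graph_axioms.intro assms)
  show ?thesis
  proof (intro conjI ballI norm_on_leavitt graph_cstar_algebra_CE)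
    fix a assume "a \<in> carrier (leavitt_path_algebra E)"
    then obtain x where x: "x \<in> free_carrier E" "a = lpa_class E x" by (rule L_cases)
    show "bdd_above (rep_norms TYPE(nat \<Rightarrow> complex) E a)"
      unfolding x(2) by (rule bdd_above_rep_norms[OF x(1)])
    show "r \<le> leavitt_norm E a" if "r \<in> rep_norms TYPE('h) E a" for r
      using that x by (simp add: rep_norms_le_ln)
  qed
qed

end
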